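(* Let $m$ be a natural number ($m\ge1$) or $m=\infty$, and let $X$ be a graded $\mathbf k$-vector space. The free $A(m)$-algebra on $X$ (the value at $X$ of the left adjoint of the forgetful functor from $A(m)$-algebras and strict homomorphisms to graded vector spaces) can be described as $\mathfrak A_m(X)=\bigoplus_{n\ge1}\mathfrak A_m^n(X)$ with $$\mathfrak A_m^n(X):=\underline{A}_m(n)\otimes X^{\otimes n},\qquad \underline{A}_m(n)\cong\mathrm{Span}_{\mathbf k}(\mathrm{Adm}_m(n)),$$ where the structure operations $\mu_k$, $1\le k\le m$, $k<\infty$, are defined as follows. Let $\vec v_j\in X^{\otimes k_j}$ be homogeneous and $T_j\in\mathrm{Adm}_m(k_j)$, $1\le j\le k$. Then $$\mu_k(T_1\otimes\vec v_1,\dots,T_k\otimes\vec v_k):=(-1)^{\varepsilon}\,\Omega(\xi_k(T_1,\dots,T_k))\otimes(\vec v_1\otimes\cdots\otimes\vec v_k),$$ where $\varepsilon=\sum_{1\le i<j\le k}|\vec v_i|\deg(T_j)$ is the Koszul sign exponent.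
   Context: $\mathbf k$ is a field of characteristic zero. $A(m)$-algebras. An $A(m)$-algebra is a graded $\mathbf k$-vector space $A$ with linear maps $\mu_k:A^{\otimes k}\to A$ of degree $k-2$, $1\le k\le m$, $k<\infty$, such that for every $n\le m$, $n<\infty$, and homogeneous $a_1,\dots,a_n\in A$ $$\sum_{\lambda=0}^{n-1}\sum_{k=1}^{n-\lambda}(-1)^{\omega}\mu_{n-k+1}(a_1,\dots,a_\lambda,\mu_k(a_{\lambda+1},\dots,a_{\lambda+k}),a_{\lambda+k+1},\dots,a_n)=0,$$ $\omega=k+\lambda+k\lambda+k(|a_1|+\dots+|a_\lambda|)$. Strict homomorphisms are degree $0$ linear maps commuting with all $\mu_k$. Trees. An $n$-tree is a finite connected acyclic rooted tree with one output leg (the root) and $n$ input legs; legs are half-edges attached to only one vertex. $\mathrm{val}(v)\ge1$ is the number of input edges of a vertex $v$; $v$ is unary if $\mathrm{val}(v)=1$. The trivial $1$-tree (one edge, no vertices) is allowed. A planar tree has a linear order on the input edges of each vertex. $T_m(n)$ is the set of planar $n$-trees all of whose vertices have at most $m$ input edges (unary vertices allowed); $\deg(T)=\sum_v(\mathrm{val}(v)-2)$. An input vertex is a vertex all of whose input edges are input legs of the tree. $T\in T_m(n)$ is admissible if all its unary vertices are input vertices; $\mathrm{Adm}_m(n)$ is the set of admissible trees. Operad. $\underline{F}_m$ is the free graded non-$\Sigma$ operad (with Koszul signs) on generators $\xi_i$ of arity $i$ and degree $i-2$, $1\le i\le m$, $i<\infty$. One has $\underline F_m(n)=\mathrm{Span}_{\mathbf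 k}(T_m(n))$, where $\xi_j$ is the $j$-corolla (one vertex, $j$ inputs), the trivial tree is the unit, and $\xi_k(T_1,\dots,T_k)$, the tree obtained by grafting $T_i$ to the $i$-th input of $\xi_k$, corresponds to the operadic composite. Let $\underline I_m$ be the operadic ideal generated by $\Phi_n=\sum_{\lambda=0}^{n-1}\sum_{k=1}^{n-\lambda}(-1)^{\lambda(k+1)+k}\xi_{n-k+1}\circ_{\lambda+1}\xi_k$, $1\le n\le m$, $n<\infty$, where $f\circ_i g$ is insertion of $g$ in the $i$-th input of $f$. Put $\underline A_m=\underline F_m/\underline I_m$. The classes of admissible $n$-trees form a basis of $\underline A_m(n)$, and $\Omega:T_m(n)\to\mathrm{Span}_{\mathbf k}(\mathrm{Adm}_m(n))$ is the unique map with $\Omega(T)\equiv T$ modulo $\underline I_m(n)$ for each $T$. The space $X$ is included in $\mathfrak A_m(X)$ as $x\mapsto(\text{trivial tree})\otimes x$. *)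

theory Defs
  imports "HOL-Algebra.Algebra" "HOL-Algebra.Algebraic_Closure_Type"
    "HOL-Library.Poly_Mapping" "HOL-Library.Extended_Nat"
begin

section \<open>Graded vector spaces\<close>

text \<open>
  The ground field is a type \<open>'k\<close> of class \<^class>\<open>field_char_0\<close>; a vector space over it is a
  \<open>module\<close> over \<^const>\<open>ring_of_type_algebra\<close>. The record \<open>module\<close> extends \<open>ring\<close>, and the fields
  \<open>mult\<close> and \<open>one\<close> have no meaning for vector spaces. The \<open>int\<close>-indexed field \<open>grade\<close>
  gives the homogeneous components as subspaces of the total space.
\<close>

record ('k, 'v) gr_module = "('k, 'v) module" +
  grade :: "int \<Rightarrow> 'v set"

abbreviation subspace_of :: "('k::field_char_0, 'v, 'e) module_scheme \<Rightarrow> 'v set \<Rightarrow> bool"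
  where "subspace_of V H \<equiv> submodule H (ring_of_type_algebra :: 'k ring) V"

definition graded_space :: "('k::field_char_0, 'v) gr_module \<Rightarrow> bool"
  where "graded_space V \<longleftrightarrow>
    module (ring_of_type_algebra :: 'k ring) V \<and>
    (\<forall>d. subspace_of V (grade V d)) \<and>
    (\<forall>v\<in>carrier V. \<exists>!c. (\<forall>d. c d \<in> grade V d) \<and> finite {d. c d \<noteq> \<zero>\<^bsub>V\<^esub>} \<and>
       v = finsum V c {d. c d \<noteq> \<zero>\<^bsub>V\<^esub>})"

text \<open>Linear maps of degree \<open>0\<close>, as functions that are \<open>undefined\<close> outside the carrier.\<close>

definition gr_hom :: "('k::field_char_0, 'v) gr_module \<Rightarrow> ('k, 'w) gr_module \<Rightarrow> ('v \<Rightarrow> 'w) set"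
  where "gr_hom V W = {h \<in> carrier V \<rightarrow>\<^sub>E carrier W.
    (\<forall>x\<in>carrier V. \<forall>y\<in>carrier V. h (x \<oplus>\<^bsub>V\<^esub> y) = h x \<oplus>\<^bsub>W\<^esub> h y) \<and>
    (\<forall>c. \<forall>x\<in>carrier V. h (c \<odot>\<^bsub>V\<^esub> x) = c \<odot>\<^bsub>W\<^esub> h x) \<and>
    (\<forall>d. h ` grade V d \<subseteq> grade W d)}"

text \<open>A linear map on \<open>V\<^sup>\<otimes>\<^sup>k\<close> is given as a \<open>k\<close>-linear map on \<open>V\<close>, its arguments forming a list.\<close>

definition multilinear ::
    "nat \<Rightarrow> ('k::field_char_0, 'v) gr_module \<Rightarrow> ('k, 'w) gr_module \<Rightarrow> ('v list \<Rightarrow> 'w) \<Rightarrow> bool"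
  where "multilinear k V W f \<longleftrightarrow>
    (\<forall>as. length as = k \<and> set as \<subseteq> carrier V \<longrightarrow>
       f as \<in> carrier W \<and>
       (\<forall>i<k. \<forall>x\<in>carrier V. \<forall>y\<in>carrier V.
          f (as[i := x \<oplus>\<^bsub>V\<^esub> y]) = f (as[i := x]) \<oplus>\<^bsub>W\<^esub> f (as[i := y])) \<and>
       (\<forall>i<k. \<forall>c. \<forall>x\<in>carrier V. f (as[i := c \<odot>\<^bsub>V\<^esub> x]) = c \<odot>\<^bsub>W\<^esub> f (as[i := x])))"


section \<open>\<open>A(m)\<close>-algebras\<close>

text \<open>
  \<open>\<mu> k [a\<^sub>1, \<dots>, a\<^sub>k]\<close> is the \<open>k\<close>-ary operation. Only the values for \<open>1 \<le> k \<le> m\<close> and arguments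
  in the carrier are meaningful. The list \<open>ds\<close> contains the degrees of the homogeneous elements \<open>as\<close>.
\<close>

definition Am_algebra ::
    "enat \<Rightarrow> ('k::field_char_0, 'v) gr_module \<Rightarrow> (nat \<Rightarrow> 'v list \<Rightarrow> 'v) \<Rightarrow> bool"
  where "Am_algebra m V \<mu> \<longleftrightarrow>
    graded_space V \<and>
    (\<forall>k. 1 \<le> k \<and> enat k \<le> m \<longrightarrow> multilinear k V V (\<mu> k)) \<and>
    (\<forall>k as ds. 1 \<le> k \<and> enat k \<le> m \<and> length as = k \<and> length ds = k \<and>
       (\<forall>i<k. as ! i \<in> grade V (ds ! i)) \<longrightarrow>
       \<mu> k as \<in> grade V (sum_list ds + int k - 2)) \<and>
    (\<forall>n as ds. 1 \<le> n \<and> enat n \<le> m \<and> length as = n \<and> length ds = n \<and>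
       (\<forall>i<n. as ! i \<in> grade V (ds ! i)) \<longrightarrow>
       (\<Oplus>\<^bsub>V\<^esub> l \<in> {0..<n}. \<Oplus>\<^bsub>V\<^esub> k \<in> {1..n - l}.
          ((-1 :: 'k) powi (int k + int l + int k * int l + int k * sum_list (take l ds))) \<odot>\<^bsub>V\<^esub>
            \<mu> (n - k + 1) (take l as @ [\<mu> k (take k (drop l as))] @ drop (l + k) as))
       = \<zero>\<^bsub>V\<^esub>)"

definition strict_hom ::
    "enat \<Rightarrow> ('k::field_char_0, 'v) gr_module \<Rightarrow> (nat \<Rightarrow> 'v list \<Rightarrow> 'v) \<Rightarrow>
      ('k, 'w) gr_module \<Rightarrow> (nat \<Rightarrow> 'w list \<Rightarrow> 'w) \<Rightarrow> ('v \<Rightarrow> 'w) set"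
  where "strict_hom m V \<mu> W \<nu> = {h \<in> gr_hom V W.
    \<forall>k as. 1 \<le> k \<and> enat k \<le> m \<and> length as = k \<and> set as \<subseteq> carrier V \<longrightarrow>
      h (\<mu> k as) = \<nu> k (map h as)}"


section \<open>Constructions with vector spaces\<close>

definition mk_module ::
    "'v set \<Rightarrow> 'v \<Rightarrow> ('v \<Rightarrow> 'v \<Rightarrow> 'v) \<Rightarrow> ('k \<Rightarrow> 'v \<Rightarrow> 'v) \<Rightarrow> ('k, 'v) module"
  where "mk_module C z a s =
    \<lparr>carrier = C, monoid.mult = undefined, one = undefined, ring.zero = z, add = a, module.smult = s\<rparr>"

definition with_grading :: "('k, 'v) module \<Rightarrow> (int \<Rightarrow> 'v set) \<Rightarrow> ('k, 'v) gr_module"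
  where "with_grading V g = module.extend V (gr_module.fields g)"

definition span_in :: "('k::field_char_0, 'v, 'e) module_scheme \<Rightarrow> 'v set \<Rightarrow> 'v set"
  where "span_in V S = (subspace_of V) hull S"

abbreviation scalar :: "'k::field_char_0 \<Rightarrow> ('a \<Rightarrow>\<^sub>0 'k) \<Rightarrow> ('a \<Rightarrow>\<^sub>0 'k)"
  where "scalar c \<equiv> Poly_Mapping.map ((*) c)"

definition free_space :: "'a set \<Rightarrow> ('k::field_char_0, 'a \<Rightarrow>\<^sub>0 'k) module"
  where "free_space S = mk_module {f. Poly_Mapping.keys f \<subseteq> S} 0 (+) scalar"

definition free_gr_space :: "('a \<Rightarrow> int) \<Rightarrow> 'a set \<Rightarrow> ('k::field_char_0, 'a \<Rightarrow>\<^sub>0 'k) gr_module"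
  where "free_gr_space dg S =
    with_grading (free_space S) (\<lambda>d. {f. Poly_Mapping.keys f \<subseteq> {s \<in> S. dg s = d}})"

text \<open>
  The quotient by a subspace \<open>N\<close>, consisting of cosets. The union in the scalar multiplication is over
  all representatives, which yield the same coset.
\<close>

definition quot_space :: "('k::field_char_0, 'v, 'e) module_scheme \<Rightarrow> 'v set \<Rightarrow> ('k, 'v set) module"
  where "quot_space V N = mk_module (a_rcosets\<^bsub>V\<^esub> N) N (\<lambda>A B. A <+>\<^bsub>V\<^esub> B)
    (\<lambda>c A. \<Union>a\<in>A. N +>\<^bsub>V\<^esub> (c \<odot>\<^bsub>V\<^esub> a))"

definition quot_gr_space :: "('k::field_char_0, 'v) gr_module \<Rightarrow> 'v set \<Rightarrow> ('k, 'v set) gr_module"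
  where "quot_gr_space V N = with_grading (quot_space V N) (\<lambda>d. (\<lambda>v. N +>\<^bsub>V\<^esub> v) ` grade V d)"

definition direct_sum :: "'i set \<Rightarrow> ('i \<Rightarrow> ('k::field_char_0, 'v) gr_module) \<Rightarrow> ('k, 'i \<Rightarrow> 'v) gr_module"
  where "direct_sum I V =
    (let C = {f \<in> \<Pi>\<^sub>E i\<in>I. carrier (V i). finite {i \<in> I. f i \<noteq> \<zero>\<^bsub>V i\<^esub>}} in
     with_grading
       (mk_module C (\<lambda>i\<in>I. \<zero>\<^bsub>V i\<^esub>) (\<lambda>f g. \<lambda>i\<in>I. f i \<oplus>\<^bsub>V i\<^esub> g i) (\<lambda>c f. \<lambda>i\<in>I. c \<odot>\<^bsub>V i\<^esub> f i))
       (\<lambda>d. {f \<in> C. \<forall>i\<in>I. f i \<in> grade (V i) d}))"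

definition sum_inj :: "'i set \<Rightarrow> ('i \<Rightarrow> ('k::field_char_0, 'v) gr_module) \<Rightarrow> 'i \<Rightarrow> 'v \<Rightarrow> ('i \<Rightarrow> 'v)"
  where "sum_inj I V i v = (\<lambda>j\<in>I. if j = i then v else \<zero>\<^bsub>V j\<^esub>)"


subsection \<open>Tensor products\<close>

definition tensor_rels ::
    "('k::field_char_0, 'v) gr_module \<Rightarrow> ('k, 'w) gr_module \<Rightarrow> ('v \<times> 'w \<Rightarrow>\<^sub>0 'k) set"
  where "tensor_rels V W = span_in (free_space (carrier V \<times> carrier W))
   ({Poly_Mapping.single (x \<oplus>\<^bsub>V\<^esub> x', y) 1 - Poly_Mapping.single (x, y) 1 - Poly_Mapping.single (x', y) 1
       | x x' y. x \<in> carrier V \<and> x' \<in> carrier V \<and> y \<in> carrier W} \<union>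
    {Poly_Mapping.single (x, y \<oplus>\<^bsub>W\<^esub> y') 1 - Poly_Mapping.single (x, y) 1 - Poly_Mapping.single (x, y') 1
       | x y y'. x \<in> carrier V \<and> y \<in> carrier W \<and> y' \<in> carrier W} \<union>
    {Poly_Mapping.single (c \<odot>\<^bsub>V\<^esub> x, y) 1 - Poly_Mapping.single (x, y) c
       | c x y. x \<in> carrier V \<and> y \<in> carrier W} \<union>
    {Poly_Mapping.single (x, c \<odot>\<^bsub>W\<^esub> y) 1 - Poly_Mapping.single (x, y) c
       | c x y. x \<in> carrier V \<and> y \<in> carrier W})"

definition tens ::
    "('k::field_char_0, 'v) gr_module \<Rightarrow> ('k, 'w) gr_module \<Rightarrow> 'v \<Rightarrow> 'w \<Rightarrow> ('v \<times> 'w \<Rightarrow>\<^sub>0 'k) set"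
  where "tens V W v w =
    tensor_rels V W +>\<^bsub>(free_space (carrier V \<times> carrier W) :: ('k, _) module)\<^esub> Poly_Mapping.single (v, w) 1"

definition tensor ::
    "('k::field_char_0, 'v) gr_module \<Rightarrow> ('k, 'w) gr_module \<Rightarrow> ('k, ('v \<times> 'w \<Rightarrow>\<^sub>0 'k) set) gr_module"
  where "tensor V W =
    (let Q = quot_space (free_space (carrier V \<times> carrier W)) (tensor_rels V W) in
     with_grading Q
       (\<lambda>d. span_in Q {tens V W v w | v w. \<exists>i j. v \<in> grade V i \<and> w \<in> grade W j \<and> i + j = d}))"

text \<open>The tensor power \<open>V\<^sup>\<otimes>\<^sup>n\<close>, a quotient of the free vector space on \<open>V\<^sup>n\<close> (lists of length \<open>n\<close>).\<close>

definition tuples :: "('k::field_char_0, 'v) gr_module \<Rightarrow> nat \<Rightarrow> 'v list set"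
  where "tuples V n = {vs. length vs = n \<and> set vs \<subseteq> carrier V}"

definition power_rels :: "('k::field_char_0, 'v) gr_module \<Rightarrow> nat \<Rightarrow> ('v list \<Rightarrow>\<^sub>0 'k) set"
  where "power_rels V n = span_in (free_space (tuples V n))
   ({Poly_Mapping.single (vs[i := x \<oplus>\<^bsub>V\<^esub> y]) 1 - Poly_Mapping.single (vs[i := x]) 1
       - Poly_Mapping.single (vs[i := y]) 1
       | vs i x y. vs \<in> tuples V n \<and> i < n \<and> x \<in> carrier V \<and> y \<in> carrier V} \<union>
    {Poly_Mapping.single (vs[i := c \<odot>\<^bsub>V\<^esub> x]) 1 - Poly_Mapping.single (vs[i := x]) c
       | vs i c x. vs \<in> tuples V n \<and> i < n \<and> x \<in> carrier V})"

definition power_class ::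
    "('k::field_char_0, 'v) gr_module \<Rightarrow> nat \<Rightarrow> ('v list \<Rightarrow>\<^sub>0 'k) \<Rightarrow> ('v list \<Rightarrow>\<^sub>0 'k) set"
  where "power_class V n f = power_rels V n +>\<^bsub>(free_space (tuples V n) :: ('k, _) module)\<^esub> f"

definition tensor_power ::
    "('k::field_char_0, 'v) gr_module \<Rightarrow> nat \<Rightarrow> ('k, ('v list \<Rightarrow>\<^sub>0 'k) set) gr_module"
  where "tensor_power V n =
    (let Q = quot_space (free_space (tuples V n)) (power_rels V n) in
     with_grading Q
       (\<lambda>d. span_in Q {power_class V n (Poly_Mapping.single vs 1) | vs.
          \<exists>ds. length vs = n \<and> length ds = n \<and> (\<forall>i<n. vs ! i \<in> grade V (ds ! i)) \<and> sum_list ds = d}))"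

definition bilinear_ext ::
    "('a \<Rightarrow> 'b \<Rightarrow> 'c \<Rightarrow>\<^sub>0 'k::field_char_0) \<Rightarrow> ('a \<Rightarrow>\<^sub>0 'k) \<Rightarrow> ('b \<Rightarrow>\<^sub>0 'k) \<Rightarrow> ('c \<Rightarrow>\<^sub>0 'k)"
  where "bilinear_ext h f g = (\<Sum>s\<in>Poly_Mapping.keys f. \<Sum>t\<in>Poly_Mapping.keys g.
     scalar (Poly_Mapping.lookup f s * Poly_Mapping.lookup g t) (h s t))"

text \<open>
  The product \<open>V\<^sup>\<otimes>\<^sup>p \<times> V\<^sup>\<otimes>\<^sup>q \<rightarrow> V\<^sup>\<otimes>\<^sup>(\<^sup>p\<^sup>+\<^sup>q\<^sup>)\<close> induced by concatenation, and its iteration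
  \<open>v\<^sub>1 \<otimes> \<dots> \<otimes> v\<^sub>k\<close> for \<open>v\<^sub>j \<in> V\<close> to the tensor power \<open>n\<^sub>j\<close>. As in the quotient space, the union runs over
  representatives of the two cosets.
\<close>

definition concat_tensor ::
    "('k::field_char_0, 'v) gr_module \<Rightarrow> nat \<Rightarrow> nat \<Rightarrow>
      ('v list \<Rightarrow>\<^sub>0 'k) set \<Rightarrow> ('v list \<Rightarrow>\<^sub>0 'k) set \<Rightarrow> ('v list \<Rightarrow>\<^sub>0 'k) set"
  where "concat_tensor V p q A B = (\<Union>f\<in>A. \<Union>g\<in>B.
     power_class V (p + q) (bilinear_ext (\<lambda>vs ws. Poly_Mapping.single (vs @ ws) 1) f g))"

fun concat_tensors ::
    "('k::field_char_0, 'v) gr_module \<Rightarrow> nat list \<Rightarrow> ('v list \<Rightarrow>\<^sub>0 'k) set list \<Rightarrow> ('v list \<Rightarrow>\<^sub>0 'k) set"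
  where
    "concat_tensors V (n # ns) (A # As) = concat_tensor V n (sum_list ns) A (concat_tensors V ns As)"
  | "concat_tensors V _ _ = power_class V 0 (Poly_Mapping.single [] 1)"


section \<open>Planar trees\<close>

text \<open>
  \<open>Triv\<close> is a leg without a vertex; \<open>Vertex [T\<^sub>1, \<dots>, T\<^sub>k]\<close> is the grafting \<open>\<xi>\<^sub>k(T\<^sub>1, \<dots>, T\<^sub>k)\<close>.
  A vertex of a tree is represented by the list of the subtrees above its input edges, so its
  valence is the length of the list, and it is an input vertex iff all these subtrees are \<open>Triv\<close>.
  The datatype contains vertices without inputs; they are excluded in \<open>trees\<close>.
\<close>

datatype ptree = Triv | Vertex "ptree list"

fun vertices :: "ptree \<Rightarrow> ptree list list"
  where
    "vertices Triv = []"
  | "vertices (Vertex ts) = ts # concat (map vertices ts)"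

fun legs :: "ptree \<Rightarrow> nat"
  where
    "legs Triv = 1"
  | "legs (Vertex ts) = sum_list (map legs ts)"

definition tdeg :: "ptree \<Rightarrow> int"
  where "tdeg T = (\<Sum>v\<leftarrow>vertices T. int (length v) - 2)"

definition trees :: "enat \<Rightarrow> nat \<Rightarrow> ptree set"
  where "trees m n =
    {T. legs T = n \<and> (\<forall>v\<in>set (vertices T). 1 \<le> length v \<and> enat (length v) \<le> m)}"

definition Adm :: "enat \<Rightarrow> nat \<Rightarrow> ptree set"
  where "Adm m n = {T \<in> trees m n. \<forall>v\<in>set (vertices T). length v = 1 \<longrightarrow> set v \<subseteq> {Triv}}"

definition corolla :: "nat \<Rightarrow> ptree"
  where "corolla j = Vertex (replicate j Triv)"


section \<open>The operads\<close>

text \<open>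
  \<open>graft i T S\<close> inserts \<open>S\<close> into the \<open>i\<close>-th leg of \<open>T\<close>, counting from \<open>1\<close>. The partial composite
  \<open>T \<circ>\<^sub>i S\<close> in the free operad is this tree up to the Koszul sign: if the leg belongs
  to \<open>T\<^sub>j\<close> in \<open>T = \<xi>\<^sub>k(T\<^sub>1, \<dots>, T\<^sub>k)\<close>, then
  \<open>T \<circ>\<^sub>i S = (-1)\<^sup>e \<xi>\<^sub>k(T\<^sub>1, \<dots>, T\<^sub>j \<circ> S, \<dots>, T\<^sub>k)\<close> with \<open>e = |S| (|T\<^sub>j\<^sub>+\<^sub>1| + \<dots> + |T\<^sub>k|)\<close>,
  because \<open>S\<close> is moved past \<open>T\<^sub>j\<^sub>+\<^sub>1, \<dots>, T\<^sub>k\<close>. In particular \<open>\<xi>\<^sub>k(T\<^sub>1, \<dots>, T\<^sub>k)\<close>, as a total composite,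
  carries no sign. \<open>graft_sgn i T d\<close> is the total exponent for \<open>|S| = d\<close>.
\<close>

fun graft :: "nat \<Rightarrow> ptree \<Rightarrow> ptree \<Rightarrow> ptree"
  and graft_list :: "nat \<Rightarrow> ptree list \<Rightarrow> ptree \<Rightarrow> ptree list"
  where
    "graft i Triv S = S"
  | "graft i (Vertex ts) S = Vertex (graft_list i ts S)"
  | "graft_list i [] S = []"
  | "graft_list i (t # ts) S =
      (if i \<le> legs t then graft i t S # ts else t # graft_list (i - legs t) ts S)"

fun graft_sgn :: "nat \<Rightarrow> ptree \<Rightarrow> int \<Rightarrow> int"
  and graft_sgn_list :: "nat \<Rightarrow> ptree list \<Rightarrow> int \<Rightarrow> int"
  where
    "graft_sgn i Triv d = 0"
  | "graft_sgn i (Vertex ts) d = graft_sgn_list i ts d"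
  | "graft_sgn_list i [] d = 0"
  | "graft_sgn_list i (t # ts) d =
      (if i \<le> legs t then graft_sgn i t d + d * (\<Sum>t'\<leftarrow>ts. tdeg t')
       else graft_sgn_list (i - legs t) ts d)"

definition pcomp :: "nat \<Rightarrow> (ptree \<Rightarrow>\<^sub>0 'k::field_char_0) \<Rightarrow> (ptree \<Rightarrow>\<^sub>0 'k) \<Rightarrow> (ptree \<Rightarrow>\<^sub>0 'k)"
  where "pcomp i = bilinear_ext
    (\<lambda>T S. Poly_Mapping.single (graft i T S) ((-1) powi graft_sgn i T (tdeg S)))"

definition opF :: "enat \<Rightarrow> nat \<Rightarrow> ('k::field_char_0, ptree \<Rightarrow>\<^sub>0 'k) gr_module"
  where "opF m n = free_gr_space tdeg (trees m n)"

definition xi :: "nat \<Rightarrow> (ptree \<Rightarrow>\<^sub>0 'k::field_char_0)"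
  where "xi j = Poly_Mapping.single (corolla j) 1"

definition Phi :: "nat \<Rightarrow> (ptree \<Rightarrow>\<^sub>0 'k::field_char_0)"
  where "Phi n = (\<Sum>l\<in>{0..<n}. \<Sum>k\<in>{1..n - l}.
     scalar ((-1) ^ (l * (k + 1) + k)) (pcomp (l + 1) (xi (n - k + 1)) (xi k)))"

inductive_set op_ideal :: "enat \<Rightarrow> (nat \<times> (ptree \<Rightarrow>\<^sub>0 'k::field_char_0)) set"
  for m :: enat
  where
    generator: "1 \<le> n \<Longrightarrow> enat n \<le> m \<Longrightarrow> (n, Phi n) \<in> op_ideal m"
  | zero: "(n, 0) \<in> op_ideal m"
  | add: "(n, f) \<in> op_ideal m \<Longrightarrow> (n, g) \<in> op_ideal m \<Longrightarrow> (n, f + g) \<in> op_ideal m"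
  | scalar: "(n, f) \<in> op_ideal m \<Longrightarrow> (n, scalar c f) \<in> op_ideal m"
  | comp_left: "(n, f) \<in> op_ideal m \<Longrightarrow> g \<in> carrier (opF m p) \<Longrightarrow> 1 \<le> i \<Longrightarrow> i \<le> n \<Longrightarrow> 1 \<le> p \<Longrightarrow>
      (n + p - 1, pcomp i f g) \<in> op_ideal m"
  | comp_right: "f \<in> carrier (opF m n) \<Longrightarrow> (p, g) \<in> op_ideal m \<Longrightarrow> 1 \<le> i \<Longrightarrow> i \<le> n \<Longrightarrow> 1 \<le> p \<Longrightarrow>
      (n + p - 1, pcomp i f g) \<in> op_ideal m"

definition opI :: "enat \<Rightarrow> nat \<Rightarrow> (ptree \<Rightarrow>\<^sub>0 'k::field_char_0) set"
  where "opI m n = {f. (n, f) \<in> op_ideal m}"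

definition opA :: "enat \<Rightarrow> nat \<Rightarrow> ('k::field_char_0, (ptree \<Rightarrow>\<^sub>0 'k) set) gr_module"
  where "opA m n = quot_gr_space (opF m n) (opI m n)"

definition op_class :: "enat \<Rightarrow> nat \<Rightarrow> (ptree \<Rightarrow>\<^sub>0 'k::field_char_0) \<Rightarrow> (ptree \<Rightarrow>\<^sub>0 'k) set"
  where "op_class m n f = opI m n +>\<^bsub>(opF m n :: ('k, _) gr_module)\<^esub> f"

definition span_Adm :: "enat \<Rightarrow> nat \<Rightarrow> ('k::field_char_0, ptree \<Rightarrow>\<^sub>0 'k) gr_module"
  where "span_Adm m n = free_gr_space tdeg (Adm m n)"

definition Omega :: "enat \<Rightarrow> ptree \<Rightarrow> (ptree \<Rightarrow>\<^sub>0 'k::field_char_0)"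
  where "Omega m T = (THE w. w \<in> carrier (span_Adm m (legs T) :: ('k, _) gr_module) \<and>
     w - Poly_Mapping.single T 1 \<in> opI m (legs T))"


section \<open>The free algebra\<close>

definition free_Am_part ::
    "enat \<Rightarrow> ('k::field_char_0, 'x) gr_module \<Rightarrow> nat \<Rightarrow>
      ('k, ((ptree \<Rightarrow>\<^sub>0 'k) set \<times> ('x list \<Rightarrow>\<^sub>0 'k) set \<Rightarrow>\<^sub>0 'k) set) gr_module"
  where "free_Am_part m U n = tensor (opA m n) (tensor_power U n)"

definition free_Am ::
    "enat \<Rightarrow> ('k::field_char_0, 'x) gr_module \<Rightarrow>
      ('k, nat \<Rightarrow> ((ptree \<Rightarrow>\<^sub>0 'k) set \<times> ('x list \<Rightarrow>\<^sub>0 'k) set \<Rightarrow>\<^sub>0 'k) set) gr_module"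
  where "free_Am m U = direct_sum {1..} (free_Am_part m U)"

text \<open>The element \<open>w \<otimes> v\<close> for \<open>w\<close> in the span of the \<open>n\<close>-trees and \<open>v \<in> U\<^sup>\<otimes>\<^sup>n\<close>.\<close>

definition free_elem ::
    "enat \<Rightarrow> ('k::field_char_0, 'x) gr_module \<Rightarrow> nat \<Rightarrow> (ptree \<Rightarrow>\<^sub>0 'k) \<Rightarrow> ('x list \<Rightarrow>\<^sub>0 'k) set \<Rightarrow>
      (nat \<Rightarrow> ((ptree \<Rightarrow>\<^sub>0 'k) set \<times> ('x list \<Rightarrow>\<^sub>0 'k) set \<Rightarrow>\<^sub>0 'k) set)"
  where "free_elem m U n w v = sum_inj {1..} (free_Am_part m U) n
     (tens (opA m n) (tensor_power U n) (op_class m n w) v)"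

definition free_incl ::
    "enat \<Rightarrow> ('k::field_char_0, 'x) gr_module \<Rightarrow> 'x \<Rightarrow>
      (nat \<Rightarrow> ((ptree \<Rightarrow>\<^sub>0 'k) set \<times> ('x list \<Rightarrow>\<^sub>0 'k) set \<Rightarrow>\<^sub>0 'k) set)"
  where "free_incl m U = (\<lambda>x\<in>carrier U. free_elem m U 1 (Poly_Mapping.single Triv 1)
     (power_class U 1 (Poly_Mapping.single [x] 1)))"

text \<open>
  The multilinear operations with the prescribed values on the elements \<open>T\<^sub>j \<otimes> v\<^sub>j\<close>, where \<open>v\<^sub>j\<close> is
  homogeneous of degree \<open>d\<^sub>j\<close>.
\<close>

definition free_structure ::
    "enat \<Rightarrow> ('k::field_char_0, 'x) gr_module \<Rightarrow>
      (nat \<Rightarrow> (nat \<Rightarrow> ((ptree \<Rightarrow>\<^sub>0 'k) set \<times> ('x list \<Rightarrow>\<^sub>0 'k) set \<Rightarrow>\<^sub>0 'k) set) list \<Rightarrow>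
        (nat \<Rightarrow> ((ptree \<Rightarrow>\<^sub>0 'k) set \<times> ('x list \<Rightarrow>\<^sub>0 'k) set \<Rightarrow>\<^sub>0 'k) set)) \<Rightarrow> bool"
  where "free_structure m U \<mu> \<longleftrightarrow> (\<forall>k. 1 \<le> k \<and> enat k \<le> m \<longrightarrow>
     multilinear k (free_Am m U) (free_Am m U) (\<mu> k) \<and>
     (\<forall>Ts vs ds. length Ts = k \<and> length vs = k \<and> length ds = k \<and>
        (\<forall>j<k. Ts ! j \<in> Adm m (legs (Ts ! j)) \<and>
           vs ! j \<in> grade (tensor_power U (legs (Ts ! j))) (ds ! j)) \<longrightarrow>
        \<mu> k (map2 (\<lambda>T v. free_elem m U (legs T) (Poly_Mapping.single T 1) v) Ts vs) =
          ((-1 :: 'k) powi (\<Sum>j<k. \<Sum>i<j. ds ! i * tdeg (Ts ! j))) \<odot>\<^bsub>free_Am m U\<^esub>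
            free_elem m U (legs (Vertex Ts)) (Omega m (Vertex Ts))
              (concat_tensors U (map legs Ts) vs)))"

end

theory Submission
  imports Defs
begin

text \<open>
  The heart of the proof is a normal form for trees modulo the ideal. In the relation of arity \<open>n \<ge> 2\<close> the
  unary operation occurs outside once, as \<open>\<mu>\<^sub>1 \<mu>\<^sub>n\<close>, and otherwise on the arguments of \<open>\<mu>\<^sub>n\<close>, the remaining terms being
  free of unary operations. So the relation can be read as a rule that moves a unary vertex towards the
  inputs; the relation \<open>\<mu>\<^sub>1 \<mu>\<^sub>1 = 0\<close> removes it when it meets another one. Hence the admissible trees span.

  That they are independent is shown by a bar construction. After a suspension,
  the operations on admissible trees become a family \<open>treeop\<close> of maps of degree \<open>-1\<close>: on at least two trees
  it grafts them to a corolla, on one tree it is \<open>tdiff\<close>, the normal form of the tree with a unary vertex put below it,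
  which is defined by recursion such that the relations of arity \<open>\<ge> 2\<close> hold. The one relation that is not built in
  is \<open>tdiff\<^sup>2 = 0\<close>. It follows by induction, because the square of the coderivation defined by \<open>treeop\<close> is a
  coderivation, which vanishes once it vanishes on the proper segments of a word (\<open>coder_square\<close>,
  \<open>tdiff_square\<close>). The truncation at \<open>m\<close> does no harm since none of these steps increases a valence.
  Applying \<open>treeop\<close> from the inputs of a tree to its root, and removing the suspension, gives a normal form \<open>nf\<close> that satisfies
  the relations (\<open>nf_relation\<close>), fixes admissible trees, and is congruent to the identity (\<open>nf_cong\<close>).

  Now trees are decorated by words in a homogeneous basis of \<open>U\<close>. On the span of the decorated admissible trees,
  \<open>nf\<close> and the Koszul sign define an \<open>A(m)\<close>-algebra (\<open>Am_algebra_freeP\<close>). Every tree with valences at most \<open>m\<close> can be evaluated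
  in every \<open>A(m)\<close>-algebra, and the evaluation kills the ideal (\<open>ev_ideal\<close>). In the algebra of decorated trees,
  a tree evaluates on the generators to its own normal form (\<open>ev_gens\<close>). This has two
  consequences. First, \<open>nf\<close> vanishes on the ideal (\<open>nf_op_ideal\<close>), so the classes of admissible trees form a basis and \<open>\<Omega>\<close>
  is \<open>nf\<close>. Second, the algebra is free: a homomorphism is
  determined by the generators, and conversely the evaluation of decorated trees is a strict homomorphism because it is
  compatible with normal forms.

  What remains is to identify the quotients, tensor products and direct sum in the definition of
  \<open>free_Am\<close> with spaces of finitely supported functions. For this, \<open>coords\<close> expresses
  that a graded space has a given homogeneous basis; coordinates are found for each of the constructions,
  and the structure is transported along them.
\<close>

abbreviation keys where "keys \<equiv> Poly_Mapping.keys"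
abbreviation lookup where "lookup \<equiv> Poly_Mapping.lookup"
abbreviation single where "single \<equiv> Poly_Mapping.single"


section \<open>Signs\<close>

definition sg :: "int \<Rightarrow> 'k::field_char_0"
  where "sg i = (if even i then 1 else -1)"

lemma sg_0 [simp]: "sg 0 = 1"
  by (simp add: sg_def)

lemma sg_add: "sg (i + j) = sg i * sg j"
  by (simp add: sg_def)

lemma sg_square [simp]: "sg i * sg i = 1" "sg i * (sg i * c) = c"
  by (simp_all add: sg_def)

lemma sg_cong: "even (i - j) \<Longrightarrow> sg i = sg j"
  by (simp add: sg_def)

lemma powi_eq_sg: "(-1) powi i = sg i"
  by (cases "even i") (auto simp: sg_def power_int_minus_left)

lemma power_eq_sg: "(-1) ^ n = sg (int n)"
  by (simp add: sg_def)


section \<open>Linear extension\<close>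

lemma lookup_scalar: "lookup (scalar c f) s = c * lookup f s"
  by (simp add: Poly_Mapping.map.rep_eq when_def)

lemma scalar_add: "scalar c (f + g) = scalar c f + scalar c g"
  by (rule poly_mapping_eqI) (simp add: lookup_scalar lookup_add algebra_simps)

lemma scalar_add_left: "scalar (c + d) f = scalar c f + scalar d f"
  by (rule poly_mapping_eqI) (simp add: lookup_scalar lookup_add algebra_simps)

lemma scalar_scalar [simp]: "scalar c (scalar d f) = scalar (c * d) f"
  by (rule poly_mapping_eqI) (simp add: lookup_scalar algebra_simps)

lemma scalar_1 [simp]: "scalar 1 f = f"
  by (rule poly_mapping_eqI) (simp add: lookup_scalar)

lemma scalar_0 [simp]: "scalar 0 f = 0" "scalar c 0 = 0"
  by (rule poly_mapping_eqI, simp add: lookup_scalar)+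

lemma scalar_uminus: "scalar (- c) f = - scalar c f" "scalar c (- f) = - scalar c f"
  by (rule poly_mapping_eqI, simp add: lookup_scalar)+

lemma scalar_minus: "scalar c (f - g) = scalar c f - scalar c g"
  by (rule poly_mapping_eqI) (simp add: lookup_scalar lookup_minus algebra_simps)

lemma scalar_sum: "scalar c (sum f A) = (\<Sum>a\<in>A. scalar c (f a))"
  by (induction A rule: infinite_finite_induct) (simp_all add: scalar_add)

lemma scalar_single [simp]: "scalar c (single a d) = single a (c * d)"
  by (rule poly_mapping_eqI) (simp add: lookup_scalar lookup_single when_def)

lemma keys_scalar_subset: "keys (scalar c f) \<subseteq> keys f"
  by (auto simp: in_keys_iff lookup_scalar)

lemma poly_mapping_expansion:
  "f = (\<Sum>a\<in>keys f. single a (lookup f a))"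
  by (rule poly_mapping_eqI) (auto simp: lookup_sum lookup_single when_def in_keys_iff)

definition lin :: "(('a \<Rightarrow>\<^sub>0 'k::field_char_0) \<Rightarrow> ('b \<Rightarrow>\<^sub>0 'k)) \<Rightarrow> bool"
  where "lin f \<longleftrightarrow> (\<forall>x y. f (x + y) = f x + f y) \<and> (\<forall>c x. f (scalar c x) = scalar c (f x))"

definition linext :: "('a \<Rightarrow> 'b \<Rightarrow>\<^sub>0 'k::field_char_0) \<Rightarrow> ('a \<Rightarrow>\<^sub>0 'k) \<Rightarrow> ('b \<Rightarrow>\<^sub>0 'k)"
  where "linext \<phi> f = (\<Sum>a\<in>keys f. scalar (lookup f a) (\<phi> a))"

lemma linext_superset:
  assumes "finite A" "keys f \<subseteq> A"
  shows "linext \<phi> f = (\<Sum>a\<in>A. scalar (lookup f a) (\<phi> a))"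
  unfolding linext_def using assms
  by (intro sum.mono_neutral_left) (auto simp: in_keys_iff)

lemma linext_add [simp]: "linext \<phi> (f + g) = linext \<phi> f + linext \<phi> g"
proof -
  let ?A = "keys f \<union> keys g"
  have "linext \<phi> (f + g) = (\<Sum>a\<in>?A. scalar (lookup (f + g) a) (\<phi> a))"
    by (rule linext_superset) (use Poly_Mapping.keys_add[of f g] in auto)
  moreover have "linext \<phi> f = (\<Sum>a\<in>?A. scalar (lookup f a) (\<phi> a))"
    by (rule linext_superset) auto
  moreover have "linext \<phi> g = (\<Sum>a\<in>?A. scalar (lookup g a) (\<phi> a))"
    by (rule linext_superset) auto
  ultimately show ?thesis
    by (simp add: lookup_add scalar_add_left sum.distrib)
qed

lemma linext_scalar [simp]: "linext \<phi> (scalar c f) = scalar c (linext \<phi> f)"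
proof -
  have "linext \<phi> (scalar c f)
      = (\<Sum>a\<in>keys f. scalar (lookup (scalar c f) a) (\<phi> a))"
    by (rule linext_superset) (use keys_scalar_subset[of c f] in auto)
  also have "\<dots> = scalar c (linext \<phi> f)"
    unfolding linext_def scalar_sum by (simp add: lookup_scalar)
  finally show ?thesis .
qed

lemma linext_single [simp]: "linext \<phi> (single a c) = scalar c (\<phi> a)"
  by (cases "c = 0") (simp_all add: linext_def)

lemma linext_0 [simp]: "linext \<phi> 0 = 0"
  by (simp add: linext_def)

lemma lin_linext [simp]: "lin (linext \<phi>)"
  by (simp add: lin_def)

lemma lin_addD: "lin f \<Longrightarrow> f (x + y) = f x + f y"
  and lin_scalarD: "lin f \<Longrightarrow> f (scalar c x) = scalar c (f x)"
  unfolding lin_def by blast+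

lemma lin_0: assumes "lin f" shows "f 0 = 0"
  using lin_scalarD[OF assms, of 0 0] by simp

lemma lin_uminus: assumes "lin f" shows "f (- x) = - f x"
  using lin_scalarD[OF assms, of "-1" x] by (simp add: scalar_uminus)

lemma lin_diff: assumes "lin f" shows "f (x - y) = f x - f y"
  using lin_addD[OF assms, of x "- y"] lin_uminus[OF assms, of y] by simp

lemmas linext_uminus [simp] = lin_uminus[OF lin_linext] and linext_diff [simp] = lin_diff[OF lin_linext]

lemma lin_sum: "lin f \<Longrightarrow> f (sum g A) = (\<Sum>a\<in>A. f (g a))"
  by (induction A rule: infinite_finite_induct) (simp_all add: lin_0[of f] lin_addD[of f])


lemma lin_eq_linext:
  assumes "lin f" shows "f p = linext (\<lambda>a. f (single a 1)) p"
proof -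
  have "f p = (\<Sum>a\<in>keys p. f (single a (lookup p a)))"
    by (subst poly_mapping_expansion[of p], subst lin_sum[OF assms], rule refl)
  also have "\<dots> = (\<Sum>a\<in>keys p. scalar (lookup p a) (f (single a 1)))"
  proof (rule sum.cong[OF refl])
    fix a
    have "f (scalar (lookup p a) (single a 1))
        = scalar (lookup p a) (f (single a 1))"
      using assms unfolding lin_def by blast
    then show "f (single a (lookup p a))
        = scalar (lookup p a) (f (single a 1))" by simp
  qed
  finally show ?thesis by (simp add: linext_def)
qed

lemma linext_cong:
  "p = q \<Longrightarrow> (\<And>a. a \<in> keys q \<Longrightarrow> \<phi> a = \<psi> a) \<Longrightarrow> linext \<phi> p = linext \<psi> q"
  by (simp add: linext_def)

lemma lin_eqI:
  assumes "lin f" "lin g"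
    "\<And>a. a \<in> keys p \<Longrightarrow> f (single a 1) = g (single a 1)"
  shows "f p = g p"
  unfolding lin_eq_linext[OF assms(1), of p] lin_eq_linext[OF assms(2), of p]
  by (rule linext_cong) (use assms in auto)

lemma lin_comp: "lin f \<Longrightarrow> lin g \<Longrightarrow> lin (\<lambda>x. f (g x))"
  by (simp add: lin_def)

lemma lin_ident: "lin (\<lambda>x. x)"
  by (simp add: lin_def)

lemma linext_id [simp]: "linext (\<lambda>a. single a 1) p = p"
  using lin_eq_linext[OF lin_ident, of p] by simp

lemma lin_linext_apply: "lin f \<Longrightarrow> f (linext \<phi> p) = linext (\<lambda>a. f (\<phi> a)) p"
  using lin_eq_linext[OF lin_comp[OF _ lin_linext], of f \<phi> p] by simp

lemma linext_linext: "linext \<phi> (linext \<psi> p) = linext (\<lambda>a. linext \<phi> (\<psi> a)) p"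
  by (rule lin_linext_apply) simp

lemma linext_plus_fun: "linext (\<lambda>a. \<phi> a + \<psi> a) p = linext \<phi> p + linext \<psi> p"
  by (simp add: linext_def scalar_add sum.distrib)

lemma linext_0_fun [simp]: "linext (\<lambda>a. 0) p = 0"
  by (simp add: linext_def)

lemma linext_scalar_fun: "linext (\<lambda>a. scalar c (\<phi> a)) p = scalar c (linext \<phi> p)"
  by (simp add: linext_def scalar_sum mult.commute)

lemma linext_sum_fun: "linext (\<lambda>a. \<Sum>i\<in>I. \<phi> i a) p = (\<Sum>i\<in>I. linext (\<phi> i) p)"
  unfolding linext_def scalar_sum by (rule sum.swap)

lemma lin_linext_fun: "(\<And>a. lin (\<phi> a)) \<Longrightarrow> lin (\<lambda>x. linext (\<lambda>a. \<phi> a x) p)"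
  unfolding lin_def by (simp only: linext_plus_fun linext_scalar_fun simp_thms)

lemma linext_swap: "linext (\<lambda>a. linext (\<lambda>b. F a b) q) p = linext (\<lambda>b. linext (\<lambda>a. F a b) p) q"
  unfolding linext_def scalar_sum
  by (subst sum.swap) (simp add: mult.commute)

lemma keys_linext: "keys (linext \<phi> p) \<subseteq> (\<Union>a\<in>keys p. keys (\<phi> a))"
proof -
  have "keys (linext \<phi> p)
      \<subseteq> (\<Union>a\<in>keys p. keys (scalar (lookup p a) (\<phi> a)))"
    unfolding linext_def by (rule keys_sum)
  also have "\<dots> \<subseteq> (\<Union>a\<in>keys p. keys (\<phi> a))"
    by (intro UN_mono keys_scalar_subset subset_refl)
  finally show ?thesis .
qed

lemma keys_linext_subset:
  "(\<And>a. a \<in> keys p \<Longrightarrow> keys (\<phi> a) \<subseteq> S) \<Longrightarrow> keys (linext \<phi> p) \<subseteq> S"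
  using keys_linext[of \<phi> p] by blast

lemma keys_add_subset: "keys f \<subseteq> S \<Longrightarrow> keys g \<subseteq> S \<Longrightarrow> keys (f + g) \<subseteq> S"
  using Poly_Mapping.keys_add[of f g] by blast

lemma keys_diff_subset: "keys f \<subseteq> S \<Longrightarrow> keys g \<subseteq> S \<Longrightarrow> keys (f - g) \<subseteq> S"
  for f g :: "'a \<Rightarrow>\<^sub>0 'k::ring_1"
proof
  fix x
  assume *: "keys f \<subseteq> S" "keys g \<subseteq> S" "x \<in> keys (f - g)"
  then have "lookup f x \<noteq> 0 \<or> lookup g x \<noteq> 0"
    by (auto simp: in_keys_iff lookup_minus)
  with * show "x \<in> S" by (auto simp: in_keys_iff)
qed

lemma keys_sum_subset:
  "(\<And>i. i \<in> I \<Longrightarrow> keys (f i) \<subseteq> S) \<Longrightarrow> keys (sum f I) \<subseteq> S"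
  using keys_sum[of f I] by blast

lemma keys_scalar_le: "keys f \<subseteq> S \<Longrightarrow> keys (scalar c f) \<subseteq> S"
  using keys_scalar_subset[of c f] by blast

lemmas keys_le = keys_add_subset keys_diff_subset keys_sum_subset keys_scalar_le


section \<open>The tensor algebra\<close>

text \<open>
  Words form a monoid under concatenation, so the library's convolution product makes
  \<open>'a word \<Rightarrow>\<^sub>0 'k\<close> the tensor algebra on the vector space with basis \<open>'a\<close>. It serves to handle
  multilinear maps as linear ones.
\<close>

datatype 'a word = Word (letters: "'a list")

instantiation word :: (type) monoid_add
begin
definition zero_word :: "'a word" where "zero_word = Word []"
definition plus_word :: "'a word \<Rightarrow> 'a word \<Rightarrow> 'a word"
  where "plus_word v w = Word (letters v @ letters w)"
instance
  by standard (simp_all add: zero_word_def plus_word_def)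
end

definition wd :: "'a list \<Rightarrow> ('a word \<Rightarrow>\<^sub>0 'k::field_char_0)"
  where "wd xs = single (Word xs) 1"

definition emb :: "('a \<Rightarrow>\<^sub>0 'k::field_char_0) \<Rightarrow> ('a word \<Rightarrow>\<^sub>0 'k)"
  where "emb = linext (\<lambda>a. wd [a])"

lemma wd_Nil [simp]: "wd [] = 1"
  unfolding wd_def zero_word_def[symmetric] by (rule single_one)

lemma wd_append: "wd (xs @ ys) = wd xs * wd ys"
  by (simp add: wd_def mult_single plus_word_def)

lemma wd_Cons: "wd (x # xs) = wd [x] * wd xs"
  using wd_append[of "[x]" xs] by simp

lemma keys_wd [simp]: "keys (wd xs :: _ \<Rightarrow>\<^sub>0 'k::field_char_0) = {Word xs}"
  by (simp add: wd_def)

lemma emb_single [simp]: "emb (single a c) = scalar c (wd [a])"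
  by (simp add: emb_def)

lemma lin_emb [simp]: "lin emb"
  by (simp add: emb_def)

lemma linext_wd [simp]: "linext \<phi> (wd xs) = \<phi> (Word xs)"
  by (simp add: wd_def)

lemma scalar_mult_left: "scalar c (f * g) = scalar c f * g"
  for f g :: "'a::monoid_add \<Rightarrow>\<^sub>0 'k::field_char_0"
  by (simp add: mult_map_scale_conv_mult mult.assoc)

lemma scalar_mult_right: "f * scalar c g = scalar c (f * g)"
  for f g :: "'a::monoid_add \<Rightarrow>\<^sub>0 'k::field_char_0"
proof -
  have "(\<Sum>a\<in>keys f. single a (lookup f a)) * single 0 c
      = single 0 c * (\<Sum>a\<in>keys f. single a (lookup f a))"
    by (simp add: sum_distrib_left sum_distrib_right mult_single mult.commute)
  then have "f * single 0 c = single 0 c * f"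
    by (simp flip: poly_mapping_expansion)
  then show ?thesis
    by (metis mult_map_scale_conv_mult mult.assoc)
qed

lemmas scalar_mult = scalar_mult_left[symmetric] scalar_mult_right

lemma lin_mult:
  fixes c :: "'a::monoid_add \<Rightarrow>\<^sub>0 'k::field_char_0"
  assumes "lin f" shows "lin (\<lambda>x. c * f x)" "lin (\<lambda>x. f x * c)"
  using assms unfolding lin_def by (simp_all add: distrib_left distrib_right scalar_mult)

lemma keys_mult_words:
  assumes "w \<in> keys (f * g :: 'a word \<Rightarrow>\<^sub>0 'k::field_char_0)"
  obtains u v where "u \<in> keys f" "v \<in> keys g" "letters w = letters u @ letters v"
proof -
  have "w \<in> {a + b | a b. a \<in> keys f \<and> b \<in> keys g}"
    using assms Poly_Mapping.keys_mult[of f g] by blast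
  then show ?thesis
    using that by (auto simp: plus_word_def)
qed

lemma keys_emb: "w \<in> keys (emb f) \<Longrightarrow> \<exists>a\<in>keys f. letters w = [a]"
  unfolding emb_def using keys_linext[of "\<lambda>a. wd [a]" f] by auto


section \<open>Sums over the splittings of a list\<close>

text \<open>
  Sums over all ways to write a list as a concatenation. The recursion makes the (co)associativity
  identities below direct inductions, without index arithmetic.
\<close>

fun ssum :: "('a list \<Rightarrow> 'a list \<Rightarrow> 'c::comm_monoid_add) \<Rightarrow> 'a list \<Rightarrow> 'c"
  where
    "ssum f [] = f [] []"
  | "ssum f (t # w) = f [] (t # w) + ssum (\<lambda>x y. f (t # x) y) w"

lemma ssum_eq_sum: "ssum f w = (\<Sum>l\<le>length w. f (take l w) (drop l w))"
proof (induction w arbitrary: f)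
  case (Cons t w)
  show ?case
    by (simp add: Cons sum.atMost_Suc_shift del: sum.atMost_Suc)
qed simp

lemma ssum_cong:
  "(\<And>x y. w = x @ y \<Longrightarrow> f x y = g x y) \<Longrightarrow> ssum f w = ssum g w"
  by (simp add: ssum_eq_sum)

lemma ssum_plus: "ssum (\<lambda>x y. f x y + g x y) w = ssum f w + ssum g w"
  by (simp add: ssum_eq_sum sum.distrib)

lemma ssum_minus: "ssum (\<lambda>x y. f x y - g x y) w = ssum f w - ssum g w"
  for f :: "_ \<Rightarrow> _ \<Rightarrow> 'c::ab_group_add"
  by (simp add: ssum_eq_sum sum_subtractf)

lemma ssum_swap: "ssum (\<lambda>x y. ssum (\<lambda>x' y'. f x y x' y') w') w
    = ssum (\<lambda>x' y'. ssum (\<lambda>x y. f x y x' y') w) w'"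
  unfolding ssum_eq_sum by (rule sum.swap)

lemma ssum_assoc: "ssum (\<lambda>x r. ssum (\<lambda>x1 x2. f x1 x2 r) x) w = ssum (\<lambda>x1 r. ssum (\<lambda>x2 r'. f x1 x2 r') r) w"
proof (induction w arbitrary: f)
  case (Cons t w)
  show ?case
    using Cons[of "\<lambda>x1 x2 r. f (t # x1) x2 r"] by (simp add: ssum_plus add.assoc)
qed simp

lemma ssum_middle: "ssum f (x @ y # z)
    = ssum (\<lambda>x1 x2. f x1 (x2 @ y # z)) x + ssum (\<lambda>z1 z2. f (x @ y # z1) z2) z"
  by (induction x arbitrary: f) (simp_all add: add.assoc)

lemma ssum_scalar: "scalar c (ssum f w) = ssum (\<lambda>x y. scalar c (f x y)) w"
  by (simp add: ssum_eq_sum scalar_sum)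

lemma ssum_mult: "c * ssum f w = ssum (\<lambda>x y. c * f x y) w" "ssum f w * c = ssum (\<lambda>x y. f x y * c) w"
  for c :: "'c::semiring_0"
  by (simp_all add: ssum_eq_sum sum_distrib_left sum_distrib_right)

lemma lin_ssum: "lin h \<Longrightarrow> h (ssum f w) = ssum (\<lambda>x y. h (f x y)) w"
  by (simp add: ssum_eq_sum lin_sum)

lemma linext_ssum: "linext (\<lambda>a. ssum (f a) w) p = ssum (\<lambda>x y. linext (\<lambda>a. f a x y) p) w"
  by (simp add: ssum_eq_sum linext_sum_fun)

lemma ssum_0 [simp]: "ssum (\<lambda>x y. 0) w = 0"
  by (simp add: ssum_eq_sum)


section \<open>The coderivation of the tensor coalgebra defined by a family of operations\<close>

definition pw :: "('a \<Rightarrow> int) \<Rightarrow> 'a list \<Rightarrow> int"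
  where "pw p w = sum_list (map p w)"

lemma pw_simps [simp]: "pw p [] = 0" "pw p (x # w) = p x + pw p w" "pw p (v @ w) = pw p v + pw p w"
  by (simp_all add: pw_def)

text \<open>
  The sum over all segments \<open>y\<close> of the word, each replaced by the value of the operation on it. The sign is the one for
  moving an operation of odd degree past \<open>x\<close>, where \<open>p\<close> gives the degrees of the letters.
\<close>

definition coder :: "('a \<Rightarrow> int) \<Rightarrow> ('a list \<Rightarrow> 'a \<Rightarrow>\<^sub>0 'k::field_char_0) \<Rightarrow> 'a list \<Rightarrow> ('a word \<Rightarrow>\<^sub>0 'k)"
  where "coder p op w = ssum (\<lambda>x r. ssum (\<lambda>y z. scalar (sg (pw p x)) (wd x * emb (op y) * wd z)) r) w"

lemma ssum_word_mult:
  fixes u :: "'a \<Rightarrow>\<^sub>0 'k::field_char_0"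
  shows "linext (\<lambda>v. ssum f (letters v)) (wd x * emb u * wd z)
    = ssum (\<lambda>x1 x2. linext (\<lambda>b. f x1 (letters b)) (wd x2 * emb u * wd z)) x
    + ssum (\<lambda>z1 z2. linext (\<lambda>a. f (letters a) z2) (wd x * emb u * wd z1)) z"
proof (rule lin_eqI[where p = u])
  have l: "lin (\<lambda>u. wd x * emb u * wd z)" for x z
    by (intro lin_mult lin_emb)
  show "lin (\<lambda>u. linext (\<lambda>v. ssum f (letters v)) (wd x * emb u * wd z))"
    by (intro lin_comp[OF lin_linext] l)
  have "lin (\<lambda>u. linext (\<lambda>b. f x1 (letters b)) (wd x2 * emb u * wd z))" for x1 x2
    by (intro lin_comp[OF lin_linext] l)
  moreover have "lin (\<lambda>u. linext (\<lambda>a. f (letters a) z2) (wd x * emb u * wd z1))" for z1 z2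
    by (intro lin_comp[OF lin_linext] l)
  ultimately show "lin (\<lambda>u. ssum (\<lambda>x1 x2. linext (\<lambda>b. f x1 (letters b)) (wd x2 * emb u * wd z)) x
    + ssum (\<lambda>z1 z2. linext (\<lambda>a. f (letters a) z2) (wd x * emb u * wd z1)) z)"
    unfolding lin_def by (simp add: ssum_plus ssum_scalar scalar_add algebra_simps)
next
  fix a :: 'a
  have *: "wd x * emb (single a 1) * wd z = (wd (x @ a # z) :: _ \<Rightarrow>\<^sub>0 'k)" for x z
    by (simp add: wd_append wd_Cons[of _ z] mult.assoc)
  show "linext (\<lambda>v. ssum f (letters v)) (wd x * emb (single a 1) * wd z)
    = ssum (\<lambda>x1 x2. linext (\<lambda>b. f x1 (letters b)) (wd x2 * emb (single a 1) * wd z)) x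
    + ssum (\<lambda>z1 z2. linext (\<lambda>b. f (letters b) z2) (wd x * emb (single a 1) * wd z1)) z"
    unfolding * by (simp add: ssum_middle)
qed

text \<open>
  The co-Leibniz rule. In the threefold splitting \<open>x, y, z\<close> that defines the coderivation, a further
  cut of the resulting word falls into \<open>x\<close> or into \<open>z\<close>, since the value of the operation is a letter.
\<close>

lemma coder_split:
  "linext (\<lambda>v. ssum f (letters v)) (coder p op w)
    = ssum (\<lambda>a c. linext (\<lambda>a'. f (letters a') c) (coder p op a)
        + scalar (sg (pw p a)) (linext (\<lambda>c'. f a (letters c')) (coder p op c))) w"
proof -
  define A where "A = (\<lambda>x1 x2 y z. scalar (sg (pw p x1)) (scalar (sg (pw p x2))
      (linext (\<lambda>b. f x1 (letters b)) (wd x2 * emb (op y) * wd z))))"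
  define C where "C = (\<lambda>x y z1 z2. scalar (sg (pw p x))
      (linext (\<lambda>a. f (letters a) z2) (wd x * emb (op y) * wd z1)))"
  have "linext (\<lambda>v. ssum f (letters v)) (coder p op w)
    = ssum (\<lambda>x r. ssum (\<lambda>y z. ssum (\<lambda>x1 x2. A x1 x2 y z) x + ssum (\<lambda>z1 z2. C x y z1 z2) z) r) w"
    unfolding coder_def lin_ssum[OF lin_linext] linext_scalar ssum_word_mult scalar_add
    unfolding A_def C_def ssum_scalar
    by (intro ssum_cong arg_cong2[where f = "(+)"] refl) (auto simp: sg_add)
  also have "\<dots> = ssum (\<lambda>x r. ssum (\<lambda>y z. ssum (\<lambda>x1 x2. A x1 x2 y z) x) r) w
      + ssum (\<lambda>x r. ssum (\<lambda>y z. ssum (\<lambda>z1 z2. C x y z1 z2) z) r) w"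
    by (simp only: ssum_plus)
  also have "ssum (\<lambda>x r. ssum (\<lambda>y z. ssum (\<lambda>x1 x2. A x1 x2 y z) x) r) w
      = ssum (\<lambda>x r. ssum (\<lambda>x1 x2. ssum (\<lambda>y z. A x1 x2 y z) r) x) w"
    by (rule ssum_cong) (rule ssum_swap)
  also have "\<dots> = ssum (\<lambda>x1 c. ssum (\<lambda>x2 r. ssum (\<lambda>y z. A x1 x2 y z) r) c) w"
    by (rule ssum_assoc)
  also have "\<dots> = ssum (\<lambda>a c. scalar (sg (pw p a)) (linext (\<lambda>c'. f a (letters c')) (coder p op c))) w"
    unfolding coder_def lin_ssum[OF lin_linext] linext_scalar ssum_scalar A_def by (rule refl)
  also have "ssum (\<lambda>x r. ssum (\<lambda>y z. ssum (\<lambda>z1 z2. C x y z1 z2) z) r) w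
     = ssum (\<lambda>x r. ssum (\<lambda>r1 z2. ssum (\<lambda>y z1. C x y z1 z2) r1) r) w"
    by (rule ssum_cong) (rule ssum_assoc[symmetric])
  also have "\<dots> = ssum (\<lambda>a z2. ssum (\<lambda>x r1. ssum (\<lambda>y z1. C x y z1 z2) r1) a) w"
    by (rule ssum_assoc[symmetric])
  also have "\<dots> = ssum (\<lambda>a c. linext (\<lambda>a'. f (letters a') c) (coder p op a)) w"
    unfolding coder_def lin_ssum[OF lin_linext] linext_scalar ssum_scalar C_def by (rule refl)
  finally show ?thesis
    by (simp only: ssum_plus add.commute)
qed

lemma parity_coder:
  fixes op :: "'a list \<Rightarrow> 'a \<Rightarrow>\<^sub>0 'k::field_char_0"
  assumes deg: "\<And>y a. a \<in> keys (op y) \<Longrightarrow> p a = pw p y - 1"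
    and "v \<in> keys (coder p op w)"
  shows "pw p (letters v) = pw p w - 1"
proof -
  have "keys (coder p op w) \<subseteq> {v. pw p (letters v) = pw p w - 1}"
    unfolding coder_def ssum_eq_sum
  proof (intro keys_le subsetI, goal_cases)
    case (1 i j v)
    from 1(3) obtain u z where v: "u \<in> keys (wd (take i w) * emb (op (take j (drop i w))))"
      "z \<in> keys (wd (drop j (drop i w)) :: _ \<Rightarrow>\<^sub>0 'k)" "letters v = letters u @ letters z"
      by (rule keys_mult_words)
    from v(1) obtain x y where u: "x \<in> keys (wd (take i w) :: _ \<Rightarrow>\<^sub>0 'k)"
       "y \<in> keys (emb (op (take j (drop i w))))" "letters u = letters x @ letters y"
      by (rule keys_mult_words)
    from keys_emb[OF u(2)] obtain a where a: "a \<in> keys (op (take j (drop i w)))" "letters y = [a]"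
      by blast
    have "pw p (letters v) = pw p (take i w) + (pw p (take j (drop i w)) - 1) + pw p (drop j (drop i w))"
      using v u a deg[OF a(1)] by simp
    also have "\<dots> = pw p (take i w @ take j (drop i w) @ drop j (drop i w)) - 1"
      by (simp only: pw_simps)
    also have "\<dots> = pw p w - 1"
      by (simp only: append_take_drop_id)
    finally show ?case by simp
  qed
  with assms(2) show ?thesis by blast
qed

text \<open>
  The square of a coderivation of odd degree is again a coderivation, so it vanishes as soon as
  its component on every segment does.
\<close>

lemma coder_square:
  fixes op :: "'a list \<Rightarrow> 'a \<Rightarrow>\<^sub>0 'k::field_char_0"
  assumes deg: "\<And>y a. a \<in> keys (op y) \<Longrightarrow> p a = pw p y - 1"
    and seg: "\<And>x y z. w = x @ y @ z \<Longrightarrow> linext (\<lambda>v. op (letters v)) (coder p op y) = 0"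
  shows "linext (\<lambda>v. coder p op (letters v)) (coder p op w) = 0"
proof -
  define G where "G = (\<lambda>x y z. scalar (sg (pw p x)) (wd x * emb (op y) * wd z))"
  define K where "K = (\<lambda>a d e y z. scalar (sg (pw p d) * sg (pw p e))
     (wd a * emb (op d) * wd e * emb (op y) * wd z))"
  have G1: "linext (\<lambda>a'. G (letters a') y z) (coder p op a)
      = - scalar (sg (pw p a)) (coder p op a * emb (op y) * wd z)" for a y z
  proof -
    have "linext (\<lambda>a'. G (letters a') y z) (coder p op a)
       = linext (\<lambda>a'. scalar (- sg (pw p a)) (wd (letters a') * emb (op y) * wd z)) (coder p op a)"
      unfolding G_def
      by (rule linext_cong[OF refl]) (simp add: parity_coder[OF deg] sg_def)
    also have "\<dots> = - scalar (sg (pw p a)) (linext (\<lambda>a'. wd (letters a') * emb (op y) * wd z) (coder p op a))"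
      by (subst linext_scalar_fun) (rule scalar_uminus)
    also have "linext (\<lambda>a'. wd (letters a') * emb (op y) * wd z) (coder p op a) = coder p op a * emb (op y) * wd z"
      using lin_eq_linext[of "\<lambda>v. v * emb (op y) * wd z" "coder p op a"]
      by (simp add: lin_mult lin_ident wd_def)
    finally show ?thesis .
  qed
  have G2: "linext (\<lambda>b'. G a (letters b') z) (coder p op y)
     = scalar (sg (pw p a)) (wd a * emb (linext (\<lambda>v. op (letters v)) (coder p op y)) * wd z)" for a y z
    unfolding G_def linext_scalar_fun
    by (subst lin_linext_apply[of "\<lambda>u. wd a * emb u * wd z"]) (simp_all add: lin_mult)
  have G3: "linext (\<lambda>c'. G a y (letters c')) (coder p op z)
     = scalar (sg (pw p a)) (wd a * emb (op y) * coder p op z)" for a y z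
    unfolding G_def linext_scalar_fun
    using lin_eq_linext[of "\<lambda>v. wd a * emb (op y) * v" "coder p op z"]
    by (simp add: lin_mult lin_ident wd_def)
  have "linext (\<lambda>v. coder p op (letters v)) (coder p op w)
      = linext (\<lambda>v. ssum (\<lambda>x. ssum (G x)) (letters v)) (coder p op w)"
    unfolding coder_def[of p op "letters _"] G_def by (rule refl)
  also have "\<dots> = ssum (\<lambda>a c. ssum (\<lambda>y z. linext (\<lambda>a'. G (letters a') y z) (coder p op a)) c
        + scalar (sg (pw p a)) (ssum (\<lambda>y z. linext (\<lambda>b'. G a (letters b') z) (coder p op y)
           + scalar (sg (pw p y)) (linext (\<lambda>c'. G a y (letters c')) (coder p op z))) c)) w"
    unfolding coder_split linext_ssum by (rule refl)
  also have "\<dots> = ssum (\<lambda>a c. ssum (\<lambda>y z. scalar (sg (pw p y)) (wd a * emb (op y) * coder p op z)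
         - scalar (sg (pw p a)) (coder p op a * emb (op y) * wd z)) c) w"
  proof (rule ssum_cong, unfold ssum_scalar ssum_plus[symmetric], rule ssum_cong)
    fix a c y z assume w: "w = a @ c" "c = y @ z"
    show "linext (\<lambda>a'. G (letters a') y z) (coder p op a)
        + scalar (sg (pw p a)) (linext (\<lambda>b'. G a (letters b') z) (coder p op y)
           + scalar (sg (pw p y)) (linext (\<lambda>c'. G a y (letters c')) (coder p op z)))
       = scalar (sg (pw p y)) (wd a * emb (op y) * coder p op z)
         - scalar (sg (pw p a)) (coder p op a * emb (op y) * wd z)"
      unfolding G1 G2 G3 using seg[of a y z] w
      by (simp add: lin_0[OF lin_emb] mult.left_commute mult.commute)
  qed
  also have "\<dots> = ssum (\<lambda>a c. ssum (\<lambda>y z. scalar (sg (pw p y)) (wd a * emb (op y) * coder p op z)) c) w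
      - ssum (\<lambda>a c. ssum (\<lambda>y z. scalar (sg (pw p a)) (coder p op a * emb (op y) * wd z)) c) w"
    by (simp only: ssum_minus)
  also have "ssum (\<lambda>a c. ssum (\<lambda>y z. scalar (sg (pw p y)) (wd a * emb (op y) * coder p op z)) c) w
    = ssum (\<lambda>a c. ssum (\<lambda>d r. ssum (\<lambda>e r'. ssum (\<lambda>y z. K a d e y z) r') r) c) w"
    unfolding coder_def ssum_mult ssum_scalar K_def
    by (intro ssum_cong) (simp add: scalar_mult mult.assoc)
  also have "ssum (\<lambda>a c. ssum (\<lambda>y z. scalar (sg (pw p a)) (coder p op a * emb (op y) * wd z)) c) w
    = ssum (\<lambda>x r. ssum (\<lambda>y z. ssum (\<lambda>a r1. ssum (\<lambda>d e. K a d e y z) r1) x) r) w"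
    unfolding coder_def ssum_mult ssum_scalar K_def
    by (intro ssum_cong) (simp add: scalar_mult mult.assoc sg_add mult.left_commute mult.commute)
  also have "\<dots> = ssum (\<lambda>x r. ssum (\<lambda>a r1. ssum (\<lambda>y z. ssum (\<lambda>d e. K a d e y z) r1) r) x) w"
    by (intro ssum_cong) (rule ssum_swap)
  also have "\<dots> = ssum (\<lambda>a c. ssum (\<lambda>r1 r. ssum (\<lambda>y z. ssum (\<lambda>d e. K a d e y z) r1) r) c) w"
    by (rule ssum_assoc)
  also have "\<dots> = ssum (\<lambda>a c. ssum (\<lambda>r1 r. ssum (\<lambda>d e. ssum (\<lambda>y z. K a d e y z) r) r1) c) w"
    by (intro ssum_cong) (rule ssum_swap)
  also have "\<dots> = ssum (\<lambda>a c. ssum (\<lambda>d r. ssum (\<lambda>e r'. ssum (\<lambda>y z. K a d e y z) r') r) c) w"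
    by (rule ssum_cong) (rule ssum_assoc)
  finally show ?thesis by simp
qed


section \<open>The differential on trees\<close>

definition valid :: "enat \<Rightarrow> ptree \<Rightarrow> bool"
  where "valid m T \<longleftrightarrow> (\<forall>v\<in>set (vertices T). 1 \<le> length v \<and> enat (length v) \<le> m)"

definition adm :: "ptree \<Rightarrow> bool"
  where "adm T \<longleftrightarrow> (\<forall>v\<in>set (vertices T). length v = 1 \<longrightarrow> set v \<subseteq> {Triv})"

lemma valid_simps [simp]:
  "valid m Triv"
  "valid m (Vertex ts) \<longleftrightarrow> 1 \<le> length ts \<and> enat (length ts) \<le> m \<and> (\<forall>t\<in>set ts. valid m t)"
  by (auto simp: valid_def)

lemma adm_simps [simp]:
  "adm Triv"
  "adm (Vertex ts) \<longleftrightarrow> (length ts = 1 \<longrightarrow> set ts \<subseteq> {Triv}) \<and> (\<forall>t\<in>set ts. adm t)"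
  by (auto simp: adm_def)

lemma trees_iff: "T \<in> trees m n \<longleftrightarrow> legs T = n \<and> valid m T"
  by (auto simp: trees_def valid_def)

lemma Adm_iff: "T \<in> Adm m n \<longleftrightarrow> legs T = n \<and> valid m T \<and> adm T"
  by (auto simp: Adm_def trees_iff adm_def)

lemma tdeg_simps [simp]:
  "tdeg Triv = 0" "tdeg (Vertex ts) = int (length ts) - 2 + sum_list (map tdeg ts)"
proof -
  have "(\<Sum>v\<leftarrow>concat (map vertices ts). int (length v) - 2) = sum_list (map tdeg ts)"
    by (induction ts) (simp_all add: tdeg_def)
  then show "tdeg (Vertex ts) = int (length ts) - 2 + sum_list (map tdeg ts)"
    by (simp add: tdeg_def)
qed (simp add: tdeg_def)

text \<open>
  The degree after a suspension. With it, all operations have degree \<open>-1\<close> and the signs in the relations become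
  those of a coderivation.
\<close>

definition susp :: "ptree \<Rightarrow> int"
  where "susp T = tdeg T + 1"

lemma pw_susp: "pw susp ts = sum_list (map tdeg ts) + int (length ts)"
  by (induction ts) (simp_all add: susp_def)

lemma susp_Vertex [simp]: "susp (Vertex ts) = pw susp ts - 1"
  by (simp add: susp_def pw_susp)

definition vert :: "(ptree word \<Rightarrow>\<^sub>0 'k::field_char_0) \<Rightarrow> (ptree \<Rightarrow>\<^sub>0 'k)"
  where "vert = linext (\<lambda>w. single (Vertex (letters w)) 1)"

definition brk :: "ptree list \<Rightarrow> (ptree word \<Rightarrow>\<^sub>0 'k::field_char_0)"
  where "brk ts = ssum (\<lambda>x r. ssum (\<lambda>y z.
    if 2 \<le> length y then scalar (sg (pw susp x)) (wd (x @ Vertex y # z)) else 0) r) ts"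

text \<open>
  On an admissible tree, \<open>tdiff\<close> is, after suspension, the normal form of the tree with a unary vertex put below its root. The
  relation for \<open>ts\<close> is solved for this term: \<open>tdiffs ts + brk ts\<close> contains all other terms, and \<open>wd [Vertex ts]\<close> is taken out because
  it is the term that is being defined. The value \<open>0\<close> at a unary vertex is the relation of arity one.
\<close>

fun tdiff :: "ptree \<Rightarrow> (ptree \<Rightarrow>\<^sub>0 'k::field_char_0)"
  and tdiffs :: "ptree list \<Rightarrow> (ptree word \<Rightarrow>\<^sub>0 'k)"
  where
    "tdiff Triv = single (Vertex [Triv]) 1"
  | "tdiff (Vertex ts) = (if length ts \<le> 1 then 0 else - vert (tdiffs ts + brk ts - wd [Vertex ts]))"
  | "tdiffs [] = 0"
  | "tdiffs (t # ts) = emb (tdiff t) * wd ts + scalar (sg (susp t)) (wd [t] * tdiffs ts)"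

text \<open>
  There is no operation without inputs, hence the value \<open>0\<close> at the empty list.
\<close>

definition treeop :: "ptree list \<Rightarrow> (ptree \<Rightarrow>\<^sub>0 'k::field_char_0)"
  where "treeop y = (if length y = 1 then tdiff (hd y) else if 2 \<le> length y then single (Vertex y) 1 else 0)"

lemma treeop_simps: "treeop [] = 0" "treeop [t] = tdiff t" "2 \<le> length y \<Longrightarrow> treeop y = single (Vertex y) 1"
  by (auto simp: treeop_def)

lemma ssum_Nil_left: "ssum (\<lambda>x y. if x = [] then g y else 0) w = g w"
  by (cases w) simp_all

lemma ssum_Nil_right: "ssum (\<lambda>x y. if y = [] then g x else 0) w = g w"
  by (induction w arbitrary: g) simp_all

lemma coder_treeop: "coder susp treeop ts = (tdiffs ts + brk ts :: _ \<Rightarrow>\<^sub>0 'k::field_char_0)"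
proof -
  have *: "ssum (\<lambda>x r. ssum (\<lambda>y z. if length y = 1 then scalar (sg (pw susp x)) (wd x * emb (tdiff (hd y)) * wd z) else 0) r) ts
      = (tdiffs ts :: _ \<Rightarrow>\<^sub>0 'k)"
  proof (induction ts)
    case (Cons t ts)
    have "ssum (\<lambda>y z. if length y = 1 then scalar (sg (pw susp [])) (wd [] * emb (tdiff (hd y)) * wd z) else 0) (t # ts)
       = ssum (\<lambda>y z. if y = [] then emb (tdiff t) * wd z else (0 :: _ \<Rightarrow>\<^sub>0 'k)) ts"
      by (simp, rule ssum_cong) auto
    also have "\<dots> = emb (tdiff t) * wd ts"
      by (rule ssum_Nil_left)
    finally have 1: "ssum (\<lambda>y z. if length y = 1 then scalar (sg (pw susp [])) (wd [] * emb (tdiff (hd y)) * wd z) else 0) (t # ts)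
       = (emb (tdiff t) * wd ts :: _ \<Rightarrow>\<^sub>0 'k)" .
    have "ssum (\<lambda>x r. ssum (\<lambda>y z. if length y = 1 then scalar (sg (pw susp (t # x))) (wd (t # x) * emb (tdiff (hd y)) * wd z) else 0) r) ts
      = scalar (sg (susp t)) (wd [t] * tdiffs ts :: _ \<Rightarrow>\<^sub>0 'k)"
      unfolding Cons[symmetric] ssum_mult ssum_scalar
      by (intro ssum_cong, subst wd_Cons[of t]) (simp add: sg_add scalar_mult mult.assoc)
    with 1 show ?case by (simp only: ssum.simps tdiffs.simps)
  qed simp
  have "coder susp treeop ts = (ssum (\<lambda>x r. ssum (\<lambda>y z.
      (if length y = 1 then scalar (sg (pw susp x)) (wd x * emb (tdiff (hd y)) * wd z) else 0)
      + (if 2 \<le> length y then scalar (sg (pw susp x)) (wd (x @ Vertex y # z)) else 0)) r) ts :: _ \<Rightarrow>\<^sub>0 'k)"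
    unfolding coder_def
    by (intro ssum_cong) (auto simp: treeop_def lin_0[OF lin_emb] simp flip: wd_append)
  then show ?thesis
    by (simp only: ssum_plus * brk_def)
qed

lemma brk_proper:
  assumes "2 \<le> length ts"
  shows "brk ts - wd [Vertex ts] = (ssum (\<lambda>x r. ssum (\<lambda>y z.
    if 2 \<le> length y \<and> \<not> (x = [] \<and> z = []) then scalar (sg (pw susp x)) (wd (x @ Vertex y # z)) else 0) r) ts :: _ \<Rightarrow>\<^sub>0 'k::field_char_0)"
proof -
  have "wd [Vertex ts] = (ssum (\<lambda>x r. if x = [] then
      ssum (\<lambda>y z. if z = [] then (if 2 \<le> length y then wd [Vertex y] else 0) else 0) r else 0) ts :: _ \<Rightarrow>\<^sub>0 'k)"
    using assms by (simp only: ssum_Nil_left ssum_Nil_right if_True)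
  then have "brk ts - wd [Vertex ts] = (ssum (\<lambda>x r.
      ssum (\<lambda>y z. if 2 \<le> length y then scalar (sg (pw susp x)) (wd (x @ Vertex y # z)) else 0) r
      - (if x = [] then ssum (\<lambda>y z. if z = [] then (if 2 \<le> length y then wd [Vertex y] else 0) else 0) r else 0)) ts :: _ \<Rightarrow>\<^sub>0 'k)"
    by (simp only: brk_def ssum_minus)
  also have "\<dots> = ssum (\<lambda>x r. ssum (\<lambda>y z.
    if 2 \<le> length y \<and> \<not> (x = [] \<and> z = []) then scalar (sg (pw susp x)) (wd (x @ Vertex y # z)) else 0) r) ts"
  proof (rule ssum_cong)
    fix x r
    show "ssum (\<lambda>y z. if 2 \<le> length y then scalar (sg (pw susp x)) (wd (x @ Vertex y # z)) else 0) r
      - (if x = [] then ssum (\<lambda>y z. if z = [] then (if 2 \<le> length y then wd [Vertex y] else 0) else 0) r else 0)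
      = ssum (\<lambda>y z. if 2 \<le> length y \<and> \<not> (x = [] \<and> z = [])
          then scalar (sg (pw susp x)) (wd (x @ Vertex y # z)) else 0) r"
    proof (cases "x = []")
      case True
      then show ?thesis
        unfolding if_P[OF True] ssum_minus[symmetric] by (intro ssum_cong) auto
    qed simp
  qed
  finally show ?thesis .
qed

text \<open>
  The invariants of the words that arise when the coderivation is applied to a list of trees. Words never become
  longer, so valences stay at most \<open>m\<close>. A vertex that is put below a segment has at least two inputs, so it keeps
  trees admissible.
\<close>

definition good :: "enat \<Rightarrow> ptree list \<Rightarrow> ptree list \<Rightarrow> bool"
  where "good m ts w \<longleftrightarrow> w \<noteq> [] \<and> length w \<le> length ts \<and> pw susp w = pw susp ts - 1 \<and>
    sum_list (map legs w) = sum_list (map legs ts) \<and>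
    (enat (length ts) \<le> m \<and> (\<forall>t\<in>set ts. valid m t) \<longrightarrow> (\<forall>t\<in>set w. valid m t)) \<and>
    (2 \<le> length w \<and> (\<forall>t\<in>set ts. adm t) \<longrightarrow> (\<forall>t\<in>set w. adm t))"

definition goodD :: "enat \<Rightarrow> ptree \<Rightarrow> ptree \<Rightarrow> bool"
  where "goodD m T T' \<longleftrightarrow> tdeg T' = tdeg T - 1 \<and> legs T' = legs T \<and> (valid m T \<longrightarrow> valid m T') \<and>
    (adm T \<longrightarrow> adm T')"

lemma keys_tdiffs:
  assumes "\<And>t. t \<in> set ts \<Longrightarrow> keys (tdiff t :: _ \<Rightarrow>\<^sub>0 'k::field_char_0) \<subseteq> Collect (goodD m t)"
  shows "keys (tdiffs ts :: _ \<Rightarrow>\<^sub>0 'k)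
    \<subseteq> {w. length (letters w) = length ts \<and> pw susp (letters w) = pw susp ts - 1 \<and>
      sum_list (map legs (letters w)) = sum_list (map legs ts) \<and>
      ((\<forall>t\<in>set ts. valid m t) \<longrightarrow> (\<forall>t\<in>set (letters w). valid m t)) \<and>
      ((\<forall>t\<in>set ts. adm t) \<longrightarrow> (\<forall>t\<in>set (letters w). adm t))}"
  using assms
proof (induction ts)
  case (Cons t ts)
  let ?K = "{w. length (letters w) = length (t # ts) \<and> pw susp (letters w) = pw susp (t # ts) - 1 \<and>
      sum_list (map legs (letters w)) = sum_list (map legs (t # ts)) \<and>
      ((\<forall>t\<in>set (t # ts). valid m t) \<longrightarrow> (\<forall>t\<in>set (letters w). valid m t)) \<and>
      ((\<forall>t\<in>set (t # ts). adm t) \<longrightarrow> (\<forall>t\<in>set (letters w). adm t))}"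
  have 1: "keys (emb (tdiff t) * wd ts :: _ \<Rightarrow>\<^sub>0 'k) \<subseteq> ?K"
  proof
    fix w assume "w \<in> keys (emb (tdiff t) * wd ts :: _ \<Rightarrow>\<^sub>0 'k)"
    then obtain u v where "u \<in> keys (emb (tdiff t) :: _ \<Rightarrow>\<^sub>0 'k)"
      "v \<in> keys (wd ts :: _ \<Rightarrow>\<^sub>0 'k)" "letters w = letters u @ letters v"
      by (rule keys_mult_words)
    moreover obtain a where "a \<in> keys (tdiff t :: _ \<Rightarrow>\<^sub>0 'k)" "letters u = [a]"
      using keys_emb calculation(1) by blast
    moreover have "goodD m t a" using Cons.prems[of t] calculation by auto
    ultimately show "w \<in> ?K"
      by (simp add: goodD_def susp_def)
  qed
  have 2: "keys (wd [t] * tdiffs ts :: _ \<Rightarrow>\<^sub>0 'k) \<subseteq> ?K"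
  proof
    fix w assume "w \<in> keys (wd [t] * tdiffs ts :: _ \<Rightarrow>\<^sub>0 'k)"
    then obtain u v where *: "u \<in> keys (wd [t] :: _ \<Rightarrow>\<^sub>0 'k)"
      "v \<in> keys (tdiffs ts :: _ \<Rightarrow>\<^sub>0 'k)" "letters w = letters u @ letters v"
      by (rule keys_mult_words)
    show "w \<in> ?K"
      using Cons.IH Cons.prems * by (auto simp: subset_iff)
  qed
  show ?case
    unfolding tdiffs.simps using 1 2 by (intro keys_le)
qed simp

lemma keys_proper:
  assumes "2 \<le> length ts"
    and "\<And>t. t \<in> set ts \<Longrightarrow> keys (tdiff t :: _ \<Rightarrow>\<^sub>0 'k::field_char_0) \<subseteq> Collect (goodD m t)"
  shows "keys (tdiffs ts + brk ts - wd [Vertex ts] :: _ \<Rightarrow>\<^sub>0 'k)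
     \<subseteq> {w. 2 \<le> length (letters w) \<and> good m ts (letters w)}"
proof -
  have "keys (tdiffs ts :: _ \<Rightarrow>\<^sub>0 'k) \<subseteq> {w. 2 \<le> length (letters w) \<and> good m ts (letters w)}"
    using keys_tdiffs[OF assms(2)] assms(1) by (fastforce simp: good_def)
  moreover have "keys (brk ts - wd [Vertex ts] :: _ \<Rightarrow>\<^sub>0 'k)
      \<subseteq> {w. 2 \<le> length (letters w) \<and> good m ts (letters w)}"
    unfolding brk_proper[OF assms(1)] ssum_eq_sum
  proof (intro keys_le, goal_cases)
    case (1 i j)
    define x y z where xyz: "x = take i ts" "y = take j (drop i ts)" "z = drop j (drop i ts)"
    have ts: "ts = x @ y @ z" by (simp add: xyz del: drop_drop)
    show ?case
    proof (cases "2 \<le> length y \<and> \<not> (x = [] \<and> z = [])")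
      case True
      then have len: "length x + length z \<ge> 1" by (cases x; cases z) auto
      have "enat (length y) \<le> m" if "enat (length ts) \<le> m"
        using that unfolding ts by (simp add: order_trans[rotated])
      then have "good m ts (x @ Vertex y # z)"
        using True len unfolding good_def ts by auto
      moreover have "2 \<le> length (x @ Vertex y # z)" using len by simp
      ultimately show ?thesis
        unfolding xyz(1,2,3)[symmetric] using keys_scalar_subset[of "sg (pw susp x) :: 'k" "wd (x @ Vertex y # z)"]
        by auto
    qed (simp add: xyz[symmetric] del: drop_drop)
  qed
  ultimately show ?thesis
    by (metis (no_types, lifting) add_diff_eq keys_add_subset)
qed

lemma keys_tdiff:
  assumes "1 \<le> m"
  shows "keys (tdiff T :: _ \<Rightarrow>\<^sub>0 'k::field_char_0) \<subseteq> Collect (goodD m T)"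
proof (induction T)
  case Triv
  show ?case using assms by (auto simp: goodD_def one_enat_def)
next
  case (Vertex ts)
  show ?case
  proof (cases "length ts \<le> 1")
    case False
    then have 2: "2 \<le> length ts" by simp
    have "keys (vert (tdiffs ts + brk ts - wd [Vertex ts]) :: _ \<Rightarrow>\<^sub>0 'k) \<subseteq> Collect (goodD m (Vertex ts))"
      unfolding vert_def
    proof (rule keys_linext_subset)
      fix w assume "w \<in> keys (tdiffs ts + brk ts - wd [Vertex ts] :: _ \<Rightarrow>\<^sub>0 'k)"
      then have w: "2 \<le> length (letters w)" "good m ts (letters w)"
        using keys_proper[OF 2 Vertex] by auto
      have "enat (length (letters w)) \<le> enat (length ts)" using w by (simp add: good_def)
      then have "enat (length (letters w)) \<le> m" if "enat (length ts) \<le> m"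
        using that order_trans by blast
      moreover have "tdeg (Vertex ts) = pw susp ts - 2" "tdeg (Vertex (letters w)) = pw susp (letters w) - 2"
        by (simp_all add: pw_susp)
      ultimately have "goodD m (Vertex ts) (Vertex (letters w))"
        using w 2 unfolding goodD_def good_def by (simp del: tdeg_simps)
      then show "keys (single (Vertex (letters w)) (1::'k)) \<subseteq> Collect (goodD m (Vertex ts))"
        by simp
    qed
    then show ?thesis using False by simp
  qed simp
qed

lemma susp_treeop: "a \<in> keys (treeop y) \<Longrightarrow> susp a = pw susp y - 1"
proof (cases "length y = 1")
  case True
  then obtain t where "y = [t]" by (cases y) auto
  moreover assume "a \<in> keys (treeop y)"
  ultimately show ?thesis
    using keys_tdiff[of "\<infinity>" t] by (auto simp: treeop_simps goodD_def susp_def)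
qed (auto simp: treeop_def split: if_splits)

definition tops :: "(ptree word \<Rightarrow>\<^sub>0 'k::field_char_0) \<Rightarrow> (ptree \<Rightarrow>\<^sub>0 'k)"
  where "tops = linext (\<lambda>v. treeop (letters v))"

lemma tops_emb: "tops (emb u) = linext tdiff u"
  unfolding tops_def emb_def linext_linext by (simp add: treeop_simps)

text \<open>
  The relations of arity at least two hold by the definition of \<open>tdiff\<close>.
\<close>

lemma tops_coder:
  assumes "2 \<le> length ts"
  shows "tops (coder susp treeop ts) = (0 :: _ \<Rightarrow>\<^sub>0 'k::field_char_0)"
proof -
  let ?X = "tdiffs ts + brk ts - wd [Vertex ts] :: _ \<Rightarrow>\<^sub>0 'k"
  have "tops ?X = vert ?X"
    unfolding tops_def vert_def
    by (rule linext_cong[OF refl])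
      (use keys_proper[OF assms keys_tdiff[of "\<infinity>"]] in \<open>auto simp: treeop_simps\<close>)
  moreover have "tops (wd [Vertex ts]) = - vert ?X"
    using assms by (simp add: tops_def treeop_simps)
  moreover have "coder susp treeop ts = ?X + wd [Vertex ts]"
    by (simp add: coder_treeop)
  ultimately show ?thesis
    by (simp only: tops_def linext_add add.right_inverse)
qed

lemma coder_singleton: "coder susp treeop [t] = emb (tdiff t)"
  unfolding coder_treeop by (simp add: brk_def)

text \<open>
  By induction, the relations hold on all proper segments of \<open>ts\<close>, and on \<open>ts\<close> itself by the definition of \<open>tdiff\<close>. So
  the square of the coderivation vanishes on \<open>ts\<close>. After the operation is applied to it once more, all terms but \<open>tdiff\<^sup>2\<close> are
  zero by the relations on words of at least two letters.
\<close>

theorem tdiff_square: "linext tdiff (tdiff T) = (0 :: _ \<Rightarrow>\<^sub>0 'k::field_char_0)"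
proof (induction T)
  case (Vertex ts)
  show ?case
  proof (cases "length ts \<le> 1")
    case False
    then have 2: "2 \<le> length ts" by simp
    let ?X = "tdiffs ts + brk ts - wd [Vertex ts] :: _ \<Rightarrow>\<^sub>0 'k"
    let ?B = "linext (\<lambda>v. coder susp treeop (letters v)) :: _ \<Rightarrow> ptree word \<Rightarrow>\<^sub>0 'k"
    have "tops (coder susp treeop y) = (0 :: _ \<Rightarrow>\<^sub>0 'k)" if "ts = x @ y @ z" for x y z
    proof -
      consider "y = []" | t where "y = [t]" "t \<in> set ts" | "2 \<le> length y"
        using \<open>ts = x @ y @ z\<close> by (cases y rule: remdups_adj.cases) auto
      then show ?thesis
      proof cases
        case 1
        then show ?thesis by (simp add: coder_treeop brk_def tops_def)
      next
        case 2
        then show ?thesis using Vertex[of t] by (simp add: coder_singleton tops_emb)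
      qed (rule tops_coder)
    qed
    then have "?B (coder susp treeop ts) = 0"
      by (intro coder_square susp_treeop) (simp_all add: tops_def)
    \<comment> \<open>\<open>?X\<close> consists of words with at least two letters, on which \<open>tops\<close> after the coderivation vanishes;
      the word \<open>[Vertex ts]\<close> contributes \<open>tdiff\<^sup>2\<close>.\<close>
    then have "0 = tops (?B (coder susp treeop ts))"
      by (simp add: tops_def)
    also have "\<dots> = tops (?B ?X) + tops (?B (wd [Vertex ts]))"
      unfolding coder_treeop tops_def by (simp flip: linext_add)
    also have "tops (?B ?X) = linext (\<lambda>v. 0) ?X"
      unfolding tops_def linext_linext
      by (rule linext_cong[OF refl])
        (use keys_proper[OF 2 keys_tdiff[of "\<infinity>"]] tops_coder in \<open>auto simp: tops_def\<close>)
    also have "tops (?B (wd [Vertex ts])) = linext tdiff (tdiff (Vertex ts))"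
      by (simp only: linext_wd word.sel coder_singleton tops_emb)
    finally show ?thesis by simp
  qed simp
qed simp

lemma tops_coder_eq_0: "tops (coder susp treeop y) = (0 :: _ \<Rightarrow>\<^sub>0 'k::field_char_0)"
proof -
  consider "y = []" | t where "y = [t]" | "2 \<le> length y"
    by (cases y rule: remdups_adj.cases) auto
  then show ?thesis
  proof cases
    case 1
    then show ?thesis by (simp add: coder_treeop brk_def tops_def)
  next
    case 2
    then show ?thesis by (simp add: coder_singleton tops_emb tdiff_square)
  qed (rule tops_coder)
qed


section \<open>Normal forms of trees\<close>

text \<open>
  The normal form up to the suspension signs: the operations on admissible trees are applied from the inputs to the root. Forests are
  elements of the tensor algebra, which makes \<open>snfs\<close> multiplicative.
\<close>

fun snf :: "ptree \<Rightarrow> (ptree \<Rightarrow>\<^sub>0 'k::field_char_0)"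
  and snfs :: "ptree list \<Rightarrow> (ptree word \<Rightarrow>\<^sub>0 'k)"
  where
    "snf Triv = single Triv 1"
  | "snf (Vertex ts) = tops (snfs ts)"
  | "snfs [] = 1"
  | "snfs (t # ts) = emb (snf t) * snfs ts"

lemma snfs_append: "snfs (xs @ ys) = snfs xs * snfs ys"
  by (induction xs) (simp_all add: mult.assoc)

definition goodN :: "enat \<Rightarrow> ptree \<Rightarrow> ptree \<Rightarrow> bool"
  where "goodN m T T' \<longleftrightarrow> tdeg T' = tdeg T \<and> legs T' = legs T \<and> (valid m T \<longrightarrow> valid m T' \<and> adm T')"

lemma keys_snfs:
  assumes "\<And>t. t \<in> set ts \<Longrightarrow> keys (snf t :: _ \<Rightarrow>\<^sub>0 'k::field_char_0) \<subseteq> Collect (goodN m t)"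
  shows "keys (snfs ts :: _ \<Rightarrow>\<^sub>0 'k) \<subseteq> {w. list_all2 (goodN m) ts (letters w)}"
  using assms
proof (induction ts)
  case Nil
  show ?case by (simp add: zero_word_def)
next
  case (Cons t ts)
  show ?case
  proof
    fix w assume "w \<in> keys (snfs (t # ts) :: _ \<Rightarrow>\<^sub>0 'k)"
    then have "w \<in> keys (emb (snf t) * snfs ts :: _ \<Rightarrow>\<^sub>0 'k)" by simp
    then obtain u v where *: "u \<in> keys (emb (snf t) :: _ \<Rightarrow>\<^sub>0 'k)"
      "v \<in> keys (snfs ts :: _ \<Rightarrow>\<^sub>0 'k)" "letters w = letters u @ letters v"
      by (rule keys_mult_words)
    obtain a where a: "a \<in> keys (snf t :: _ \<Rightarrow>\<^sub>0 'k)" "letters u = [a]"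
      using keys_emb[OF *(1)] by blast
    have "goodN m t a" using Cons.prems[of t] a(1) by auto
    moreover have "list_all2 (goodN m) ts (letters v)" using Cons.IH Cons.prems *(2) by auto
    ultimately show "w \<in> {w. list_all2 (goodN m) (t # ts) (letters w)}"
      using * a by simp
  qed
qed

lemma list_all2_goodN:
  assumes "list_all2 (goodN m) ts w"
  shows "length w = length ts" "map tdeg w = map tdeg ts" "map legs w = map legs ts"
    "(\<forall>t\<in>set ts. valid m t) \<Longrightarrow> (\<forall>t\<in>set w. valid m t \<and> adm t)" "pw susp w = pw susp ts"
proof -
  from assms have "length w = length ts \<and> map tdeg w = map tdeg ts \<and> map legs w = map legs ts \<and>
    ((\<forall>t\<in>set ts. valid m t) \<longrightarrow> (\<forall>t\<in>set w. valid m t \<and> adm t))"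
    by (induction rule: list_all2_induct) (auto simp: goodN_def)
  then show "length w = length ts" "map tdeg w = map tdeg ts" "map legs w = map legs ts"
    "(\<forall>t\<in>set ts. valid m t) \<Longrightarrow> (\<forall>t\<in>set w. valid m t \<and> adm t)" "pw susp w = pw susp ts"
    by (auto simp: pw_susp)
qed

lemma keys_snf:
  assumes "1 \<le> m"
  shows "keys (snf T :: _ \<Rightarrow>\<^sub>0 'k::field_char_0) \<subseteq> Collect (goodN m T)"
proof (induction T)
  case (Vertex ts)
  show ?case
    unfolding snf.simps tops_def
  proof (rule keys_linext_subset)
    fix w assume "w \<in> keys (snfs ts :: _ \<Rightarrow>\<^sub>0 'k)"
    then have "list_all2 (goodN m) ts (letters w)" using keys_snfs[OF Vertex] by auto
    note w = list_all2_goodN[OF this]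
    consider "letters w = []" | t where "letters w = [t]" | "2 \<le> length (letters w)"
      by (cases "letters w" rule: remdups_adj.cases) auto
    then show "keys (treeop (letters w) :: _ \<Rightarrow>\<^sub>0 'k) \<subseteq> Collect (goodN m (Vertex ts))"
    proof cases
      case (2 t)
      then obtain t' where "ts = [t']" using w(1) by (cases ts) auto
      then show ?thesis
        using keys_tdiff[OF assms, of t, where ?'k = 'k] w 2
        by (auto simp: treeop_simps goodN_def goodD_def)
    next
      case 3
      then have "goodN m (Vertex ts) (Vertex (letters w))"
        using w(1,4) unfolding goodN_def by (simp add: w(2,3))
      with 3 show ?thesis by (simp add: treeop_simps)
    qed (simp add: treeop_simps)
  qed
qed (simp add: goodN_def)

lemma snf_adm:
  assumes "valid m T" "adm T"
  shows "snf T = single T (1::'k::field_char_0)"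
  using assms
proof (induction T)
  case (Vertex ts)
  have "(\<forall>t\<in>set us. snf t = single t (1::'k)) \<Longrightarrow> snfs us = (wd us :: _ \<Rightarrow>\<^sub>0 'k)" for us
    by (induction us) (simp_all flip: wd_append)
  then have *: "snfs ts = (wd ts :: _ \<Rightarrow>\<^sub>0 'k)" using Vertex by auto
  show ?case
  proof (cases "length ts = 1")
    case True
    then have "ts = [Triv]" using Vertex.prems by (cases ts) auto
    then show ?thesis by (simp add: * tops_def treeop_simps)
  next
    case False
    then have "2 \<le> length ts" using Vertex.prems by auto
    then show ?thesis by (simp add: * tops_def treeop_simps)
  qed
qed simp

lemma linext_emb_mult:
  "linext \<phi> (emb u * g) = linext (\<lambda>a. linext (\<lambda>v. \<phi> (Word (a # letters v))) g) u"
proof (rule lin_eqI[where p = u])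
  show "lin (\<lambda>u. linext \<phi> (emb u * g))"
    by (intro lin_comp[OF lin_linext] lin_mult lin_emb)
next
  fix a
  have "linext \<phi> (wd [a] * g) = linext (\<lambda>v. \<phi> (Word (a # letters v))) g"
    by (rule lin_eqI[where p = g])
      (simp_all add: lin_comp[OF lin_linext] lin_mult lin_ident wd_def mult_single plus_word_def)
  then show "linext \<phi> (emb (single a 1) * g)
      = linext (\<lambda>a. linext (\<lambda>v. \<phi> (Word (a # letters v))) g) (single a 1)"
    by simp
qed simp

lemma linext_ssum_snfs:
  "linext (\<lambda>w. ssum f (letters w)) (snfs ts)
    = ssum (\<lambda>a c. linext (\<lambda>u. linext (\<lambda>v. f (letters u) (letters v)) (snfs c)) (snfs a)) ts"
proof (induction ts arbitrary: f)
  case Nil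
  then show ?case by (simp flip: wd_Nil)
next
  case (Cons t ts)
  have "linext (\<lambda>w. ssum f (letters w)) (snfs (t # ts))
    = linext (\<lambda>a. linext (\<lambda>v. f [] (a # letters v)) (snfs ts)) (snf t)
    + linext (\<lambda>a. linext (\<lambda>v. ssum (\<lambda>x. f (a # x)) (letters v)) (snfs ts)) (snf t)"
    by (simp add: linext_emb_mult linext_plus_fun)
  also have "linext (\<lambda>a. linext (\<lambda>v. f [] (a # letters v)) (snfs ts)) (snf t)
    = linext (\<lambda>v. f [] (letters v)) (snfs (t # ts))"
    by (simp add: linext_emb_mult)
  also have "linext (\<lambda>a. linext (\<lambda>v. ssum (\<lambda>x. f (a # x)) (letters v)) (snfs ts)) (snf t)
    = ssum (\<lambda>x c. linext (\<lambda>u. linext (\<lambda>v. f (letters u) (letters v)) (snfs c)) (snfs (t # x))) ts"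
    unfolding Cons linext_ssum by (simp add: linext_emb_mult)
  finally show ?case by (simp flip: wd_Nil)
qed

lemma linext_wd_mult:
  "linext (\<lambda>v. c * wd (letters v)) g = c * g" "linext (\<lambda>v. wd (letters v) * c) g = g * c"
  using lin_eq_linext[of "\<lambda>g. c * g" g] lin_eq_linext[of "\<lambda>g. g * c" g]
  by (simp_all add: lin_mult lin_ident wd_def)

text \<open>
  The relations for \<open>treeop\<close>, applied to the normal forms of \<open>ts\<close>.
\<close>

lemma snf_relation:
  "ssum (\<lambda>x r. ssum (\<lambda>y z. scalar (sg (pw susp x)) (snf (Vertex (x @ Vertex y # z)))) r) ts
    = (0 :: _ \<Rightarrow>\<^sub>0 'k::field_char_0)"
proof -
  have N1: "snf (Vertex (x @ Vertex y # z)) = (tops (snfs x * emb (tops (snfs y)) * snfs z) :: _ \<Rightarrow>\<^sub>0 'k)" for x y z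
    by (simp add: snfs_append mult.assoc)
  have lin1: "lin (\<lambda>g. f * emb (tops g) * h)" "lin (\<lambda>g. f * emb g * h)" for f h :: "_ \<Rightarrow>\<^sub>0 'k"
    by (intro lin_mult lin_comp[OF lin_emb] lin_linext lin_emb | simp add: tops_def)+
  have inner: "linext (\<lambda>u. linext (\<lambda>v. linext (\<lambda>v'. scalar (sg (pw susp (letters u)))
        (wd (letters u) * emb (treeop (letters v)) * wd (letters v'))) (snfs z)) (snfs y)) (snfs x)
      = scalar (sg (pw susp x)) (snfs x * emb (tops (snfs y)) * (snfs z :: _ \<Rightarrow>\<^sub>0 'k))" for x y z
  proof -
    have "linext (\<lambda>u. linext (\<lambda>v. linext (\<lambda>v'. scalar (sg (pw susp (letters u)))
        (wd (letters u) * emb (treeop (letters v)) * wd (letters v'))) (snfs z)) (snfs y)) (snfs x)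
      = linext (\<lambda>u. linext (\<lambda>v. linext (\<lambda>v'. scalar (sg (pw susp x))
        (wd (letters u) * emb (treeop (letters v)) * wd (letters v'))) (snfs z)) (snfs y)) (snfs x :: _ \<Rightarrow>\<^sub>0 'k)"
    proof (rule linext_cong[OF refl])
      fix u assume "u \<in> keys (snfs x :: _ \<Rightarrow>\<^sub>0 'k)"
      then have "list_all2 (goodN \<infinity>) x (letters u)" using keys_snfs[OF keys_snf[of "\<infinity>"]] by auto
      from list_all2_goodN(5)[OF this] show "linext (\<lambda>v. linext (\<lambda>v'. scalar (sg (pw susp (letters u)))
          (wd (letters u) * emb (treeop (letters v)) * wd (letters v'))) (snfs z)) (snfs y)
        = linext (\<lambda>v. linext (\<lambda>v'. scalar (sg (pw susp x))
          (wd (letters u) * emb (treeop (letters v)) * wd (letters v'))) (snfs z)) (snfs y)" by simp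
    qed
    also have "\<dots> = scalar (sg (pw susp x)) (linext (\<lambda>u. linext (\<lambda>v. linext (\<lambda>v'.
        wd (letters u) * emb (treeop (letters v)) * wd (letters v')) (snfs z)) (snfs y)) (snfs x))"
      by (simp add: linext_scalar_fun)
    also have "linext (\<lambda>u. linext (\<lambda>v. linext (\<lambda>v'.
        wd (letters u) * emb (treeop (letters v)) * wd (letters v')) (snfs z)) (snfs y)) (snfs x)
      = linext (\<lambda>u. linext (\<lambda>v. wd (letters u) * emb (treeop (letters v)) * (snfs z :: _ \<Rightarrow>\<^sub>0 'k)) (snfs y)) (snfs x)"
      by (simp only: linext_wd_mult)
    also have "\<dots> = linext (\<lambda>u. wd (letters u) * (emb (tops (snfs y)) * snfs z)) (snfs x)"
      unfolding tops_def by (subst lin_linext_apply[OF lin1(2), symmetric]) (simp add: mult.assoc)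
    also have "\<dots> = snfs x * emb (tops (snfs y)) * snfs z"
      by (simp only: linext_wd_mult mult.assoc)
    finally show ?thesis .
  qed
  have "0 = linext (\<lambda>v. tops (coder susp treeop (letters v))) (snfs ts :: _ \<Rightarrow>\<^sub>0 'k)"
    by (simp add: tops_coder_eq_0)
  also have "\<dots> = tops (linext (\<lambda>v. coder susp treeop (letters v)) (snfs ts))"
    unfolding tops_def linext_linext by (rule refl)
  also have "linext (\<lambda>v. coder susp treeop (letters v)) (snfs ts :: _ \<Rightarrow>\<^sub>0 'k)
    = ssum (\<lambda>x r. linext (\<lambda>u. linext (\<lambda>v. ssum (\<lambda>y z. scalar (sg (pw susp (letters u)))
        (wd (letters u) * emb (treeop y) * wd z)) (letters v)) (snfs r)) (snfs x)) ts"
    unfolding coder_def by (rule linext_ssum_snfs)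
  also have "\<dots> = ssum (\<lambda>x r. ssum (\<lambda>y z. scalar (sg (pw susp x)) (snfs x * emb (tops (snfs y)) * snfs z)) r) ts"
    unfolding linext_ssum_snfs linext_ssum inner by (rule refl)
  also have "tops \<dots> = ssum (\<lambda>x r. ssum (\<lambda>y z. scalar (sg (pw susp x)) (tops (snfs x * emb (tops (snfs y)) * snfs z))) r) ts"
    unfolding tops_def lin_ssum[OF lin_linext] linext_scalar by (rule refl)
  finally show ?thesis unfolding N1 by (rule sym)
qed


subsection \<open>Removing the suspension\<close>

text \<open>
  The exponent of the sign by which a tree of suspended operations differs from the tree of the original
  ones: every subtree is passed by the suspensions of its siblings to the right.
\<close>

fun sx :: "ptree \<Rightarrow> int" and sxl :: "ptree list \<Rightarrow> int"
  where
    "sx Triv = 0"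
  | "sx (Vertex ts) = sxl ts"
  | "sxl [] = 0"
  | "sxl (t # ts) = sx t + int (length ts) * susp t + sxl ts"

lemma sxl_append: "sxl (v @ w) = sxl v + int (length w) * pw susp v + sxl w"
  by (induction v) (simp_all add: algebra_simps)

text \<open>
  The exponent \<open>\<omega>\<close> of the \<open>A(m)\<close>-relations, for arguments \<open>x\<close> before the inner operation of arity \<open>k\<close>.
\<close>

definition om :: "ptree list \<Rightarrow> nat \<Rightarrow> int"
  where "om x k = int k + int (length x) + int k * int (length x) + int k * sum_list (map tdeg x)"

text \<open>
  The suspension turns the sign \<open>\<omega>\<close> into the sign of the coderivation, up to a sign that depends only on the whole list of
  arguments and thus factors out of the relation.
\<close>

lemma om_sign:
  "sg (om x (length y)) * sg (sx (Vertex (x @ Vertex y # z)))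
    = sg (pw susp x) * sg (int (length (x @ y @ z)) + sxl (x @ y @ z))"
proof -
  define P L K R Q where "P = pw susp x" and "L = int (length x)" and "K = int (length y)"
    and "R = int (length z)" and "Q = pw susp y"
  have s: "sum_list (map tdeg x) = P - L" by (simp add: P_def L_def pw_susp)
  have 1: "sx (Vertex (x @ Vertex y # z)) = sxl x + (1 + R) * P + sxl y + R * (Q - 1) + sxl z"
    by (simp add: sxl_append P_def R_def Q_def algebra_simps)
  have 2: "sxl (x @ y @ z) = sxl x + (K + R) * P + sxl y + R * Q + sxl z"
    by (simp add: sxl_append P_def R_def Q_def K_def algebra_simps)
  have 3: "int (length (x @ y @ z)) = L + K + R" by (simp add: L_def K_def R_def)
  have "(om x (length y) + sx (Vertex (x @ Vertex y # z)))
     - (pw susp x + (int (length (x @ y @ z)) + sxl (x @ y @ z))) = - 2 * R"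
    unfolding om_def s 1 2 3 L_def[symmetric] K_def[symmetric] P_def[symmetric] by (simp add: algebra_simps)
  then show ?thesis
    unfolding sg_add[symmetric] by (intro sg_cong) simp
qed

definition rho :: "(ptree \<Rightarrow>\<^sub>0 'k::field_char_0) \<Rightarrow> (ptree \<Rightarrow>\<^sub>0 'k)"
  where "rho = linext (\<lambda>T. single T (sg (sx T)))"

definition nf :: "ptree \<Rightarrow> (ptree \<Rightarrow>\<^sub>0 'k::field_char_0)"
  where "nf T = scalar (sg (sx T)) (rho (snf T))"

lemma linext_rho: "linext \<phi> (rho f) = linext (\<lambda>T. scalar (sg (sx T)) (\<phi> T)) f"
  by (simp add: rho_def linext_linext)

lemma keys_nf:
  assumes "1 \<le> m" "T' \<in> keys (nf T :: _ \<Rightarrow>\<^sub>0 'k::field_char_0)"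
  shows "goodN m T T'"
proof -
  have "keys (nf T :: _ \<Rightarrow>\<^sub>0 'k) \<subseteq> Collect (goodN m T)"
    unfolding nf_def rho_def
    by (intro keys_le keys_linext_subset) (use keys_snf[OF assms(1), of T, where ?'k = 'k] in auto)
  with assms(2) show ?thesis by blast
qed

lemma nf_adm: "valid m T \<Longrightarrow> adm T \<Longrightarrow> nf T = single T 1"
  by (simp add: nf_def snf_adm rho_def)

lemma nf_relation:
  "ssum (\<lambda>x r. ssum (\<lambda>y z. scalar (sg (om x (length y))) (nf (Vertex (x @ Vertex y # z)))) r) ts
    = (0 :: _ \<Rightarrow>\<^sub>0 'k::field_char_0)"
proof -
  have "ssum (\<lambda>x r. ssum (\<lambda>y z. scalar (sg (om x (length y))) (nf (Vertex (x @ Vertex y # z)) :: _ \<Rightarrow>\<^sub>0 'k)) r) ts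
    = ssum (\<lambda>x r. ssum (\<lambda>y z. scalar (sg (int (length ts) + sxl ts))
        (rho (scalar (sg (pw susp x)) (snf (Vertex (x @ Vertex y # z)))))) r) ts"
    by (intro ssum_cong) (simp add: nf_def om_sign[simplified] rho_def mult.commute)
  also have "\<dots> = scalar (sg (int (length ts) + sxl ts)) (rho 0)"
    unfolding snf_relation[of ts, symmetric] ssum_scalar rho_def lin_ssum[OF lin_linext] by (rule refl)
  finally show ?thesis by (simp add: rho_def)
qed

text \<open>
  Normal forms can be computed in stages, since admissible trees are their own normal forms.
\<close>

lemma nf_slot:
  assumes "1 \<le> m" "valid m T"
  shows "linext (\<lambda>T'. nf (Vertex (x @ T' # z))) (nf T) = (nf (Vertex (x @ T # z)) :: _ \<Rightarrow>\<^sub>0 'k::field_char_0)"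
proof -
  let ?F = "\<lambda>u. snfs x * emb u * (snfs z :: _ \<Rightarrow>\<^sub>0 'k)"
  let ?s = "\<lambda>T. sx (Vertex (x @ T # z))"
  have lin: "lin (\<lambda>u. rho (tops (?F u)))"
    unfolding rho_def tops_def by (intro lin_comp[OF lin_linext] lin_mult lin_emb)
  have "linext (\<lambda>T'. nf (Vertex (x @ T' # z))) (nf T :: _ \<Rightarrow>\<^sub>0 'k)
    = linext (\<lambda>T'. scalar (sg (?s T + sx T + sx T')) (rho (tops (?F (single T' 1))))) (nf T)"
  proof (rule linext_cong[OF refl])
    fix T' assume "T' \<in> keys (nf T :: _ \<Rightarrow>\<^sub>0 'k)"
    then have g: "goodN m T T'" by (rule keys_nf[OF assms(1)])
    then have snf: "snf T' = single T' (1::'k)" using assms(2) by (intro snf_adm) (auto simp: goodN_def)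
    have "sg (?s T') = (sg (?s T + sx T + sx T') :: 'k)"
      using g by (intro sg_cong) (simp add: sxl_append goodN_def susp_def)
    then show "nf (Vertex (x @ T' # z)) = scalar (sg (?s T + sx T + sx T')) (rho (tops (?F (single T' 1))))"
      unfolding nf_def by (simp add: snfs_append snf mult.assoc)
  qed
  also have "\<dots> = scalar (sg (?s T)) (linext (\<lambda>T'. rho (tops (?F (single T' 1)))) (snf T))"
  proof -
    have "sg (sx T') * sg (?s T + sx T + sx T') = sg (?s T) * (sg (sx T) :: 'k)" for T'
      by (simp add: sg_def)
    then show ?thesis
      unfolding nf_def linext_scalar linext_rho scalar_scalar
      by (simp only: linext_scalar_fun scalar_scalar) (simp add: mult.commute)
  qed
  also have "linext (\<lambda>T'. rho (tops (?F (single T' 1)))) (snf T) = rho (tops (?F (snf T)))"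
    by (rule lin_eq_linext[OF lin, symmetric])
  also have "scalar (sg (?s T)) (rho (tops (?F (snf T)))) = nf (Vertex (x @ T # z))"
    by (simp add: nf_def snfs_append mult.assoc)
  finally show ?thesis .
qed


section \<open>Grafting and the operadic ideal\<close>

lemma legs_pos: "valid m T \<Longrightarrow> 1 \<le> legs T"
proof (induction T)
  case (Vertex ts)
  then obtain t ts' where ts: "ts = t # ts'" by (cases ts) auto
  with Vertex have "1 \<le> legs t" by auto
  with ts show ?case by simp
qed simp

lemma length_graft_list [simp]: "length (graft_list i ts S) = length ts"
  by (induction ts arbitrary: i) auto

lemma graft_props:
  "1 \<le> i \<Longrightarrow> i \<le> legs T \<Longrightarrow> legs (graft i T S) + 1 = legs T + legs S \<and> tdeg (graft i T S) = tdeg T + tdeg S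
    \<and> (valid m T \<longrightarrow> valid m S \<longrightarrow> valid m (graft i T S))"
  "1 \<le> i \<Longrightarrow> i \<le> sum_list (map legs ts) \<Longrightarrow>
    sum_list (map legs (graft_list i ts S)) + 1 = sum_list (map legs ts) + legs S \<and>
    sum_list (map tdeg (graft_list i ts S)) = sum_list (map tdeg ts) + tdeg S \<and>
    ((\<forall>t\<in>set ts. valid m t) \<longrightarrow> valid m S \<longrightarrow> (\<forall>t\<in>set (graft_list i ts S). valid m t))"
proof (induction i T S and i ts S rule: graft_graft_list.induct)
  case (1 i S)
  then show ?case by simp
next
  case (2 i ts S)
  have "1 \<le> i" "i \<le> sum_list (map legs ts)" using 2(2,3) by simp_all
  note IH = 2(1)[OF this]
  show ?case
    unfolding graft.simps legs.simps tdeg_simps valid_simps length_graft_list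
    using conjunct1[OF IH] conjunct1[OF conjunct2[OF IH]] conjunct2[OF conjunct2[OF IH]] by (intro conjI) linarith+
next
  case (3 i S)
  then show ?case by simp
next
  case (4 i t ts S)
  show ?case
  proof (cases "i \<le> legs t")
    case True
    then show ?thesis using 4(1)[OF True 4(3) True] by auto
  next
    case False
    then have "1 \<le> i - legs t" "i - legs t \<le> sum_list (map legs ts)" using 4(4) by auto
    note IH = 4(2)[OF False this]
    have gl: "graft_list i (t # ts) S = t # graft_list (i - legs t) ts S" using False by simp
    have a: "sum_list (map legs (graft_list (i - legs t) ts S)) + 1 = sum_list (map legs ts) + legs S"
      and b: "sum_list (map tdeg (graft_list (i - legs t) ts S)) = sum_list (map tdeg ts) + tdeg S"
      and c: "(\<forall>t\<in>set ts. valid m t) \<longrightarrow> valid m S \<longrightarrow> (\<forall>t\<in>set (graft_list (i - legs t) ts S). valid m t)"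
      by (rule conjunct1[OF IH], rule conjunct1[OF conjunct2[OF IH]], rule conjunct2[OF conjunct2[OF IH]])
    show ?thesis
      unfolding gl list.map sum_list.Cons
    proof (intro conjI impI)
      show "legs t + sum_list (map legs (graft_list (i - legs t) ts S)) + 1 = legs t + sum_list (map legs ts) + legs S"
        using a by linarith
      show "tdeg t + sum_list (map tdeg (graft_list (i - legs t) ts S)) = tdeg t + sum_list (map tdeg ts) + tdeg S"
        using b by linarith
      assume "\<forall>t\<in>set (t # ts). valid m t" "valid m S"
      then show "\<forall>t\<in>set (t # graft_list (i - legs t) ts S). valid m t"
        using c by (metis list.set_intros set_ConsD)
    qed
  qed
qed

lemma graft_list_at: "graft_list (Suc (sum_list (map legs xs))) (xs @ Triv # zs) S = xs @ S # zs"
  by (induction xs) auto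

lemma graft_sgn_list_at:
  "graft_sgn_list (Suc (sum_list (map legs xs))) (xs @ Triv # zs) d = d * sum_list (map tdeg zs)"
  by (induction xs) auto

lemma bilinear_ext_eq: "bilinear_ext h f g = linext (\<lambda>s. linext (h s) g) f"
  by (simp add: bilinear_ext_def linext_def scalar_sum)

lemma pcomp_eq: "pcomp i f g
    = linext (\<lambda>T. linext (\<lambda>S. single (graft i T S) (sg (graft_sgn i T (tdeg S)))) g) f"
  unfolding pcomp_def bilinear_ext_eq powi_eq_sg by (rule refl)

lemma sum_list_legs_replicate [simp]: "sum_list (map legs (replicate j Triv)) = j"
  "sum_list (map tdeg (replicate j Triv)) = 0"
  by (induction j) auto

declare sum_list_replicate [simp]

lemma Phi_eq:
  "Phi n = (\<Sum>l\<in>{0..<n}. \<Sum>k\<in>{1..n - l}. single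
     (Vertex (replicate l Triv @ corolla k # replicate (n - k - l) Triv)) (sg (int (l * (k + 1) + k))))"
  unfolding Phi_def
proof (intro sum.cong refl)
  fix l k assume lk: "l \<in> {0..<n}" "k \<in> {1..n - l}"
  then have "n - k + 1 = l + Suc (n - k - l)" by auto
  then have c: "corolla (n - k + 1) = Vertex (replicate l Triv @ Triv # replicate (n - k - l) Triv)"
    by (simp only: corolla_def replicate_add replicate_Suc)
  have "graft (l + 1) (corolla (n - k + 1)) (corolla k)
    = Vertex (replicate l Triv @ corolla k # replicate (n - k - l) Triv)"
    unfolding c using graft_list_at[of "replicate l Triv", unfolded sum_list_legs_replicate] by simp
  moreover have "graft_sgn (l + 1) (corolla (n - k + 1)) d = 0" for d
    unfolding c
    using graft_sgn_list_at[of "replicate l Triv" "replicate (n - k - l) Triv" d, unfolded sum_list_legs_replicate]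
    by simp
  ultimately show "scalar ((-1) ^ (l * (k + 1) + k)) (pcomp (l + 1) (xi (n - k + 1)) (xi k))
    = single (Vertex (replicate l Triv @ corolla k # replicate (n - k - l) Triv)) (sg (int (l * (k + 1) + k)))"
    unfolding pcomp_eq xi_def power_eq_sg by simp
qed

lemma carrier_opF: "f \<in> carrier (opF m n) \<longleftrightarrow> keys f \<subseteq> trees m n"
  by (simp add: opF_def free_gr_space_def with_grading_def free_space_def mk_module_def
     gr_module.defs module.defs)

lemma Phi_keys:
  assumes "1 \<le> n" "enat n \<le> m"
  shows "keys (Phi n) \<subseteq> {T \<in> trees m n. tdeg T = int n - 3}"
  unfolding Phi_eq
proof (intro keys_le)
  fix l k assume lk: "l \<in> {0..<n}" "k \<in> {1..n - l}"
  have "enat (Suc (l + (n - k - l))) \<le> enat n" "enat k \<le> enat n" using lk by auto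
  then have "enat (Suc (l + (n - k - l))) \<le> m" "enat k \<le> m" using assms(2) order_trans by blast+
  then show "keys (single (Vertex (replicate l Triv @ corolla k # replicate (n - k - l) Triv))
     (sg (int (l * (k + 1) + k)))) \<subseteq> {T \<in> trees m n. tdeg T = int n - 3}"
    using lk by (auto simp: trees_iff corolla_def)
qed

lemma keys_pcomp:
  assumes "keys f \<subseteq> trees m n" "keys g \<subseteq> trees m p" "1 \<le> i" "i \<le> n"
  shows "keys (pcomp i f g) \<subseteq> trees m (n + p - 1)"
  unfolding pcomp_eq
proof (intro keys_linext_subset)
  fix T S assume "T \<in> keys f" "S \<in> keys g"
  then have "T \<in> trees m n" "S \<in> trees m p" using assms by auto
  then have "graft i T S \<in> trees m (n + p - 1)"
    using graft_props(1)[of i T S m] assms(3,4) by (auto simp: trees_iff)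
  then show "keys (single (graft i T S) (sg (graft_sgn i T (tdeg S)))) \<subseteq> trees m (n + p - 1)"
    by auto
qed

lemma op_ideal_keys: "(n, f) \<in> op_ideal m \<Longrightarrow> keys f \<subseteq> trees m n"
proof (induction rule: op_ideal.induct)
  case (generator n)
  then show ?case using Phi_keys[of n m] by blast
next
  case (comp_left n f g p i)
  then show ?case by (intro keys_pcomp) (simp_all add: carrier_opF)
next
  case (comp_right f n p g i)
  then show ?case by (intro keys_pcomp) (simp_all add: carrier_opF)
qed (simp_all add: keys_add_subset keys_scalar_le)

text \<open>
  Moving an element past factors of total degree \<open>c\<close> multiplies its odd part by \<open>(-1) ^ c\<close>. The ideal is
  stable under this twist because its generators are homogeneous.
\<close>

definition tw :: "int \<Rightarrow> (ptree \<Rightarrow>\<^sub>0 'k::field_char_0) \<Rightarrow> (ptree \<Rightarrow>\<^sub>0 'k)"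
  where "tw c = linext (\<lambda>T. single T (sg (c * tdeg T)))"

lemma linext_tw: "linext \<phi> (tw c f) = linext (\<lambda>T. scalar (sg (c * tdeg T)) (\<phi> T)) f"
  by (simp add: tw_def linext_linext)

lemma tw_tw: "tw c (tw d f) = tw (c + d) f"
  unfolding tw_def[of c] linext_tw by (simp add: tw_def distrib_right sg_add) (simp add: mult.commute)

lemma keys_tw: "keys f \<subseteq> S \<Longrightarrow> keys (tw c f) \<subseteq> S"
  unfolding tw_def by (intro keys_linext_subset) auto

lemma tw_pcomp:
  assumes "keys f \<subseteq> trees m n" "1 \<le> i" "i \<le> n"
  shows "tw c (pcomp i f g) = pcomp i (tw c f) (tw c g)"
  unfolding pcomp_eq linext_tw
  unfolding tw_def linext_linext
proof (rule linext_cong[OF refl], unfold linext_scalar_fun[symmetric], rule linext_cong[OF refl])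
  fix T S assume "T \<in> keys f"
  then have "tdeg (graft i T S) = tdeg T + tdeg S"
    using assms graft_props(1)[of i T S] by (auto simp: trees_iff)
  then show "linext (\<lambda>T. single T (sg (c * tdeg T)))
          (single (graft i T S) (sg (graft_sgn i T (tdeg S)))) =
         scalar (sg (c * tdeg T)) (scalar (sg (c * tdeg S))
           (single (graft i T S) (sg (graft_sgn i T (tdeg S)))))"
    by (simp add: distrib_left distrib_right sg_add mult.commute mult.left_commute)
qed

lemma tw_Phi:
  assumes "1 \<le> n" "enat n \<le> m"
  shows "tw c (Phi n) = scalar (sg (c * (int n - 3))) (Phi n)"
proof -
  have "tw c (Phi n) = linext (\<lambda>T. scalar (sg (c * (int n - 3))) (single T 1)) (Phi n)"
    unfolding tw_def
    by (rule linext_cong[OF refl]) (use Phi_keys[OF assms] in auto)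
  then show ?thesis by (simp only: linext_scalar_fun linext_id)
qed

lemma op_ideal_tw: "(n, f) \<in> op_ideal m \<Longrightarrow> (n, tw c f) \<in> op_ideal m"
proof (induction rule: op_ideal.induct)
  case (generator n)
  then show ?case
    by (simp add: tw_Phi op_ideal.generator op_ideal.scalar)
next
  case (comp_left n f g p i)
  have "tw c (pcomp i f g) = pcomp i (tw c f) (tw c g)"
    by (rule tw_pcomp[OF op_ideal_keys[OF comp_left.hyps(1)] comp_left.hyps(3,4)])
  then show ?case
    using op_ideal.comp_left[OF comp_left.IH _ comp_left.hyps(3-5), of "tw c g"] comp_left.hyps(2)
    by (simp only: carrier_opF keys_tw)
next
  case (comp_right f n p g i)
  have "tw c (pcomp i f g) = pcomp i (tw c f) (tw c g)"
    by (rule tw_pcomp[OF _ comp_right.hyps(3,4)]) (use comp_right.hyps(1) in \<open>simp only: carrier_opF\<close>)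
  then show ?case
    using op_ideal.comp_right[OF _ comp_right.IH comp_right.hyps(3-5), of "tw c f"] comp_right.hyps(1)
    by (simp only: carrier_opF keys_tw)
qed (auto simp: tw_def intro: op_ideal.intros)

lemma op_ideal_uminus: "(n, f) \<in> op_ideal m \<Longrightarrow> (n, - f) \<in> op_ideal m"
  using op_ideal.scalar[of n f m "-1"] by (simp add: scalar_uminus)

lemma op_ideal_sum: "(\<And>i. i \<in> I \<Longrightarrow> (n, f i) \<in> op_ideal m) \<Longrightarrow> (n, sum f I) \<in> op_ideal m"
  by (induction I rule: infinite_finite_induct) (auto intro: op_ideal.zero op_ideal.add)

lemma op_ideal_ssum:
  "(\<And>x y. w = x @ y \<Longrightarrow> (n, f x y) \<in> op_ideal m) \<Longrightarrow> (n, ssum f w) \<in> op_ideal m"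
  unfolding ssum_eq_sum by (rule op_ideal_sum) simp

lemma op_ideal_linext:
  "(\<And>a. a \<in> keys p \<Longrightarrow> (n, \<psi> a) \<in> op_ideal m) \<Longrightarrow> (n, linext \<psi> p) \<in> op_ideal m"
  unfolding linext_def by (intro op_ideal_sum op_ideal.scalar)

text \<open>
  The element of the ideal is inserted into a tree in which \<open>xs\<close> and \<open>zs\<close> are already in place. It is
  moved past \<open>zs\<close>, and twisting it beforehand cancels that sign.
\<close>

lemma op_ideal_slot:
  assumes "(p, g) \<in> op_ideal m" "1 \<le> p" "enat (length xs + 1 + length zs) \<le> m" "\<forall>t\<in>set xs \<union> set zs. valid m t"
  shows "(sum_list (map legs xs) + p + sum_list (map legs zs),
    linext (\<lambda>T. single (Vertex (xs @ T # zs)) 1) g) \<in> op_ideal m"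
proof -
  define n where "n = sum_list (map legs xs) + 1 + sum_list (map legs zs)"
  let ?f = "single (Vertex (xs @ Triv # zs)) (1 :: 'a)"
  let ?i = "Suc (sum_list (map legs xs))"
  let ?c = "sum_list (map tdeg zs)"
  have f: "?f \<in> carrier (opF m n)"
    using assms by (auto simp: carrier_opF trees_iff n_def)
  have "(n + p - 1, pcomp ?i ?f (tw ?c g)) \<in> op_ideal m"
    by (rule op_ideal.comp_right[OF f op_ideal_tw]) (use assms in \<open>auto simp: n_def\<close>)
  moreover have "pcomp ?i ?f (tw ?c g) = linext (\<lambda>T. single (Vertex (xs @ T # zs)) 1) g"
    unfolding pcomp_eq linext_tw by (simp add: graft_list_at graft_sgn_list_at mult.commute)
  moreover have "n + p - 1 = sum_list (map legs xs) + p + sum_list (map legs zs)"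
    using assms(2) by (simp add: n_def)
  ultimately show ?thesis by simp
qed

lemma linext_minus_fun: "linext (\<lambda>a. \<phi> a - \<psi> a) p = linext \<phi> p - linext \<psi> p"
  by (simp add: linext_def scalar_minus sum_subtractf)

text \<open>
  The relation \<open>Phi n\<close>, with trees grafted into its inputs. The case \<open>y = []\<close> is excluded since operations have at
  least one input.
\<close>

definition PhiT :: "ptree list \<Rightarrow> (ptree \<Rightarrow>\<^sub>0 'k::field_char_0)"
  where "PhiT ts = ssum (\<lambda>x r. ssum (\<lambda>y z. if y = [] then 0
    else single (Vertex (x @ Vertex y # z)) (sg (om x (length y)))) r) ts"

lemma ssum_ssum_middle:
  "ssum (\<lambda>x r. ssum (F x) r) (us @ t # w)
    = ssum (\<lambda>x x'. ssum (\<lambda>y z. F x y (z @ t # w)) x') us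
    + ssum (\<lambda>x x'. ssum (\<lambda>y z. F x (x' @ t # y) z) w) us
    + ssum (\<lambda>x r. ssum (\<lambda>y z. F (us @ t # x) y z) r) w"
proof -
  have "ssum (\<lambda>x r. ssum (F x) r) (us @ t # w)
    = ssum (\<lambda>x x'. ssum (F x) (x' @ t # w)) us + ssum (\<lambda>x r. ssum (F (us @ t # x)) r) w"
    by (rule ssum_middle)
  then show ?thesis
    by (simp only: ssum_middle[of _ _ t w] ssum_plus)
qed

lemma PhiT_replicate: "PhiT (replicate n Triv) = Phi n"
proof -
  have "PhiT (replicate n Triv) = (\<Sum>l\<le>n. \<Sum>k\<le>n - l. if k = 0 \<or> l = n then 0 else single
     (Vertex (replicate l Triv @ corolla k # replicate (n - k - l) Triv)) (sg (int (l * (k + 1) + k))))"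
    unfolding PhiT_def ssum_eq_sum
    by (intro sum.cong refl) (auto simp: om_def corolla_def min_def algebra_simps intro!: sg_cong)
  also have "\<dots> = (\<Sum>l\<in>{0..<n}. \<Sum>k\<le>n - l. if k = 0 \<or> l = n then 0 else single
     (Vertex (replicate l Triv @ corolla k # replicate (n - k - l) Triv)) (sg (int (l * (k + 1) + k))))"
    by (rule sum.mono_neutral_right) auto
  also have "\<dots> = Phi n"
    unfolding Phi_eq
    by (intro sum.cong[OF refl] sum.mono_neutral_cong_right) auto
  finally show ?thesis .
qed

text \<open>
  The trees are grafted from left to right, so that \<open>w\<close>, to the right of the current input, still consists of legs.
  Then the Koszul sign of the composition accounts for the terms in which the inner operation
  comes after the position of \<open>t\<close>, so that \<open>t\<close> has to be moved past it.
\<close>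

lemma PhiT_graft:
  assumes "set w \<subseteq> {Triv}"
  shows "pcomp (Suc (sum_list (map legs us))) (PhiT (us @ Triv # w)) (single t 1)
    = (PhiT (us @ t # w) :: _ \<Rightarrow>\<^sub>0 'k::field_char_0)"
proof -
  define \<psi> where "\<psi> = (\<lambda>T. single (graft (Suc (sum_list (map legs us))) T t)
    (sg (graft_sgn (Suc (sum_list (map legs us))) T (tdeg t))) :: _ \<Rightarrow>\<^sub>0 'k)"
  define F :: "_ \<Rightarrow> _ \<Rightarrow> _ \<Rightarrow> _ \<Rightarrow>\<^sub>0 'k" where "F = (\<lambda>x y z. if y = [] then 0
    else single (Vertex (x @ Vertex y # z)) (sg (om x (length y))))"
  have Triv_list: "sum_list (map tdeg v) = 0" if "w = v1 @ v @ v2" for v v1 v2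
  proof -
    have "set v \<subseteq> {Triv}" using assms that by auto
    then show ?thesis by (induction v) auto
  qed
  have lin: "linext \<psi> (ssum (\<lambda>x r. ssum (F x) r) v) = ssum (\<lambda>x r. ssum (\<lambda>y z. linext \<psi> (F x y z)) r) v" for v
    by (simp only: lin_ssum[OF lin_linext])
  have A: "linext \<psi> (F x y (z @ Triv # w)) = F x y (z @ t # w)" if "us = x @ y @ z" for x y z
    using graft_list_at[of "x @ Vertex y # z" w t] graft_sgn_list_at[of "x @ Vertex y # z" w "tdeg t"]
      Triv_list[of "[]" w "[]"] that
    by (simp add: F_def \<psi>_def add.assoc)
  have B: "linext \<psi> (F x (x' @ Triv # y) z) = F x (x' @ t # y) z" if "us = x @ x'" "w = y @ z" for x x' y z
  proof -
    have "graft (Suc (sum_list (map legs us))) (Vertex (x @ Vertex (x' @ Triv # y) # z)) t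
      = Vertex (x @ Vertex (x' @ t # y) # z)" for z
      using that(1)
    proof (induction x arbitrary: us)
      case Nil
      then show ?case using graft_list_at[of x' y t] by simp
    next
      case (Cons a x)
      then show ?case using Cons.IH[of "x @ x'"] by simp
    qed
    moreover have "graft_sgn (Suc (sum_list (map legs us))) (Vertex (x @ Vertex (x' @ Triv # y) # z)) d
      = d * (sum_list (map tdeg y) + sum_list (map tdeg z))" for d
      using that(1)
    proof (induction x arbitrary: us)
      case Nil
      then show ?case using graft_sgn_list_at[of x' y d] by (simp add: algebra_simps)
    next
      case (Cons a x)
      then show ?case using Cons.IH[of "x @ x'"] by simp
    qed
    ultimately show ?thesis
      using Triv_list[of "[]" y z] Triv_list[of y z "[]"] that by (simp add: F_def \<psi>_def)
  qed
  have C: "linext \<psi> (F (us @ Triv # x) y z) = F (us @ t # x) y z" if "w = x @ y @ z" for x y z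
  proof -
    have ty: "tdeg (Vertex y) = int (length y) - 2"
      using Triv_list[of x y z] that by simp
    have "sg (om (us @ t # x) (length y)) = sg (om (us @ Triv # x) (length y)) * (sg (tdeg t * tdeg (Vertex y)) :: 'k)"
      unfolding ty sg_add[symmetric] by (intro sg_cong) (simp add: om_def algebra_simps)
    then show ?thesis
      using graft_list_at[of us "x @ Vertex y # z" t] graft_sgn_list_at[of us "x @ Vertex y # z" "tdeg t"]
        Triv_list[of "[]" x "y @ z"] Triv_list[of "x @ y" z "[]"] that
      by (simp add: F_def \<psi>_def del: tdeg_simps(2))
  qed
  have "pcomp (Suc (sum_list (map legs us))) (PhiT (us @ Triv # w)) (single t 1)
    = linext \<psi> (ssum (\<lambda>x r. ssum (F x) r) (us @ Triv # w))"
    unfolding pcomp_eq PhiT_def F_def \<psi>_def by simp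
  also have "\<dots> = ssum (\<lambda>x r. ssum (\<lambda>y z. linext \<psi> (F x y z)) r) (us @ Triv # w)"
    by (rule lin)
  also have "\<dots> = ssum (\<lambda>x r. ssum (F x) r) (us @ t # w)"
    unfolding ssum_ssum_middle
    by (intro arg_cong2[where f = "(+)"] ssum_cong) (simp_all add: A B C)
  finally show ?thesis unfolding PhiT_def F_def .
qed

lemma PhiT_ideal:
  assumes "ts \<noteq> []" "enat (length ts) \<le> m" "\<forall>t\<in>set ts. valid m t"
  shows "(sum_list (map legs ts), PhiT ts :: _ \<Rightarrow>\<^sub>0 'k::field_char_0) \<in> op_ideal m"
proof -
  have "\<lbrakk>us @ replicate j Triv \<noteq> []; enat (length us + j) \<le> m; \<forall>t\<in>set us. valid m t\<rbrakk> \<Longrightarrow>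
    (sum_list (map legs us) + j, PhiT (us @ replicate j Triv) :: _ \<Rightarrow>\<^sub>0 'k) \<in> op_ideal m" for us j
  proof (induction us arbitrary: j rule: rev_induct)
    case Nil
    then show ?case by (simp add: PhiT_replicate op_ideal.generator)
  next
    case (snoc t us)
    have t: "valid m t" using snoc.prems by simp
    have "(sum_list (map legs us) + Suc j, PhiT (us @ replicate (Suc j) Triv) :: _ \<Rightarrow>\<^sub>0 'k) \<in> op_ideal m"
      using snoc.prems by (intro snoc.IH) auto
    then have "(sum_list (map legs us) + Suc j + legs t - 1,
      pcomp (Suc (sum_list (map legs us))) (PhiT (us @ replicate (Suc j) Triv)) (single t 1) :: _ \<Rightarrow>\<^sub>0 'k) \<in> op_ideal m"
      using t legs_pos[OF t] by (intro op_ideal.comp_left) (auto simp: carrier_opF trees_iff)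
    moreover have "pcomp (Suc (sum_list (map legs us))) (PhiT (us @ Triv # replicate j Triv)) (single t 1)
      = (PhiT (us @ t # replicate j Triv) :: _ \<Rightarrow>\<^sub>0 'k)"
      by (rule PhiT_graft) auto
    ultimately show ?case using legs_pos[OF t] by (simp add: add.commute add.left_commute)
  qed
  from this[of ts 0] assms show ?thesis by simp
qed


subsection \<open>Trees are congruent to their normal forms\<close>

text \<open>
  Being congruent to zero modulo the ideal, after the suspension. On this side the coderivation and \<open>tdiff\<close> can be used without
  further signs.
\<close>

definition ci :: "enat \<Rightarrow> nat \<Rightarrow> (ptree \<Rightarrow>\<^sub>0 'k::field_char_0) \<Rightarrow> bool"
  where "ci m n f \<longleftrightarrow> (n, rho f) \<in> op_ideal m"

lemma lin_rho [simp]: "lin rho"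
  by (simp add: rho_def)

lemma ci_add: "ci m n f \<Longrightarrow> ci m n g \<Longrightarrow> ci m n (f + g)"
  by (simp add: ci_def lin_addD[OF lin_rho] op_ideal.add)

lemma ci_uminus: "ci m n f \<Longrightarrow> ci m n (- f)"
  by (simp add: ci_def lin_uminus[OF lin_rho] op_ideal_uminus)

lemma ci_scalar: "ci m n f \<Longrightarrow> ci m n (scalar c f)"
  by (simp add: ci_def lin_scalarD[OF lin_rho] op_ideal.scalar)

lemma ci_0: "ci m n 0"
  by (simp add: ci_def lin_0[OF lin_rho] op_ideal.zero)

lemma ci_linext: "(\<And>a. a \<in> keys p \<Longrightarrow> ci m n (\<psi> a)) \<Longrightarrow> ci m n (linext \<psi> p)"
  unfolding ci_def lin_linext_apply[OF lin_rho] by (rule op_ideal_linext)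

lemma ci_ssum: "(\<And>x y. w = x @ y \<Longrightarrow> ci m n (f x y)) \<Longrightarrow> ci m n (ssum f w)"
  unfolding ci_def lin_ssum[OF lin_rho] by (rule op_ideal_ssum)

definition slot :: "ptree list \<Rightarrow> ptree list \<Rightarrow> (ptree \<Rightarrow>\<^sub>0 'k::field_char_0) \<Rightarrow> (ptree \<Rightarrow>\<^sub>0 'k)"
  where "slot xs zs = linext (\<lambda>T. single (Vertex (xs @ T # zs)) 1)"

lemma ci_slot:
  assumes "ci m p g" "1 \<le> p" "enat (length xs + 1 + length zs) \<le> m" "\<forall>t\<in>set xs \<union> set zs. valid m t"
  shows "ci m (sum_list (map legs xs) + p + sum_list (map legs zs)) (slot xs zs g)"
proof -
  define c where "c = sxl xs + (1 + int (length zs)) * pw susp xs + sxl zs + int (length zs)"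
  have "sxl (xs @ T # zs) = c + int (length zs) * tdeg T + sx T" for T
    by (simp add: sxl_append c_def susp_def algebra_simps)
  then have "rho (slot xs zs g) = scalar (sg c) (slot xs zs (tw (int (length zs)) (rho g)))"
    unfolding slot_def linext_tw linext_rho
    by (simp add: rho_def linext_linext sg_add mult.commute mult.left_commute flip: linext_scalar_fun)
  then show ?thesis
    using op_ideal_slot[OF op_ideal_tw[of p "rho g" m "int (length zs)"] assms(2-4)] assms(1)
    by (simp add: ci_def slot_def op_ideal.scalar)
qed

lemma ci_PhiT:
  assumes "ts \<noteq> []" "enat (length ts) \<le> m" "\<forall>t\<in>set ts. valid m t"
  shows "ci m (sum_list (map legs ts)) (ssum (\<lambda>x r. ssum (\<lambda>y z. if y = [] then 0
    else single (Vertex (x @ Vertex y # z)) (sg (pw susp x) :: 'k::field_char_0)) r) ts)"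
proof -
  have "(PhiT ts :: _ \<Rightarrow>\<^sub>0 'k) = scalar (sg (int (length ts) + sxl ts)) (rho (ssum (\<lambda>x r. ssum (\<lambda>y z. if y = [] then 0
    else single (Vertex (x @ Vertex y # z)) (sg (pw susp x))) r) ts))"
    unfolding PhiT_def ssum_scalar lin_ssum[OF lin_rho]
  proof (intro ssum_cong, goal_cases)
    case (1 x r y z)
    have "sg (om x (length y)) = sg (int (length ts) + sxl ts) * (sg (sxl (x @ Vertex y # z)) * (sg (pw susp x) :: 'k))"
      using om_sign[of x y z, where ?'a = 'k] 1
      by simp (metis (no_types, lifting) mult.commute mult.left_commute sg_square(2))
    then show ?case by (simp add: rho_def mult.commute mult.left_commute)
  qed
  then have "scalar (sg (int (length ts) + sxl ts)) (PhiT ts :: _ \<Rightarrow>\<^sub>0 'k) = rho (ssum (\<lambda>x r. ssum (\<lambda>y z. if y = [] then 0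
    else single (Vertex (x @ Vertex y # z)) (sg (pw susp x))) r) ts)"
    by simp
  then show ?thesis
    unfolding ci_def using op_ideal.scalar[OF PhiT_ideal[OF assms]] by metis
qed

lemma lin_vert [simp]: "lin vert"
  by (simp add: vert_def)

lemma vert_slot: "vert (wd x * emb u * wd z) = slot x z u"
  by (rule lin_eqI[where p = u])
    (auto simp: vert_def slot_def wd_def mult_single plus_word_def intro!: lin_comp[OF lin_linext] lin_mult)

lemma tdiffs_eq: "tdiffs ts = ssum (\<lambda>x r. ssum (\<lambda>y z. if length y = 1
    then scalar (sg (pw susp x)) (wd x * emb (tdiff (hd y)) * wd z) else 0) r) ts"
proof -
  have "coder susp treeop ts = ssum (\<lambda>x r. ssum (\<lambda>y z. if length y = 1
    then scalar (sg (pw susp x)) (wd x * emb (tdiff (hd y)) * wd z) else 0) r) ts + brk ts"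
    unfolding coder_def brk_def ssum_plus[symmetric]
    by (intro ssum_cong) (auto simp: treeop_def lin_0[OF lin_emb] simp flip: wd_append)
  then show ?thesis by (simp add: coder_treeop)
qed

text \<open>
  By induction on the tree: the relation for \<open>ts\<close> expresses \<open>Vertex [Vertex ts]\<close> by trees whose root has several
  inputs, with a unary vertex at most below one of \<open>ts\<close>; this is how \<open>tdiff\<close> is defined. Two unary vertices on
  top of each other vanish by the relation of arity one.
\<close>

lemma ci_tdiff:
  assumes "valid m u" "1 \<le> m"
  shows "ci m (legs u) (tdiff u - single (Vertex [u]) (1 :: 'k::field_char_0))"
  using assms(1)
proof (induction u)
  case Triv
  show ?case by (simp add: ci_0)
next
  case (Vertex us)
  have *: "ci m (legs (Vertex us)) (ssum (\<lambda>x r. ssum (\<lambda>y z. if y = [] then 0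
    else single (Vertex (x @ Vertex y # z)) (sg (pw susp x) :: 'k)) r) us)"
    unfolding legs.simps by (rule ci_PhiT) (use Vertex.prems in auto)
  show ?case
  proof (cases "length us \<le> 1")
    case True
    then obtain t where t: "us = [t]" using Vertex.prems by (cases us) auto
    from * show ?thesis using ci_uminus unfolding t by fastforce
  next
    case False
    have brk: "vert (brk us :: _ \<Rightarrow>\<^sub>0 'k) = ssum (\<lambda>x r. ssum (\<lambda>y z. if 2 \<le> length y
        then single (Vertex (x @ Vertex y # z)) (sg (pw susp x)) else 0) r) us"
      unfolding brk_def lin_ssum[OF lin_vert]
      by (intro ssum_cong) (auto simp: vert_def)
    have tdiffs: "vert (tdiffs us :: _ \<Rightarrow>\<^sub>0 'k) = ssum (\<lambda>x r. ssum (\<lambda>y z. if length y = 1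
        then scalar (sg (pw susp x)) (slot x z (tdiff (hd y))) else 0) r) us"
      unfolding tdiffs_eq lin_ssum[OF lin_vert]
      by (intro ssum_cong) (auto simp: lin_scalarD[OF lin_vert] vert_slot lin_0[OF lin_vert])
    let ?E = "ssum (\<lambda>x r. ssum (\<lambda>y z. if length y = 1
        then scalar (sg (pw susp x)) (slot x z (tdiff (hd y) - single (Vertex y) (1 :: 'k))) else 0) r) us"
    have E: "ci m (legs (Vertex us)) ?E"
    proof (intro ci_ssum, goal_cases)
      case (1 x r y z)
      show ?case
      proof (cases "length y = 1")
        case True
        then obtain t where y: "y = [t]" by (cases y) auto
        have t: "t \<in> set us" "valid m t" using 1 y Vertex.prems by auto
        have "ci m (sum_list (map legs x) + legs t + sum_list (map legs z)) (slot x z (tdiff t - single (Vertex [t]) (1 :: 'k)))"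
          using Vertex.IH[OF t] legs_pos[OF t(2)] 1 y Vertex.prems by (intro ci_slot) auto
        then show ?thesis using 1 y by (simp add: ci_scalar add.assoc)
      qed (simp add: ci_0)
    qed
    have eq: "tdiff (Vertex us) - single (Vertex [Vertex us]) (1 :: 'k)
      = - (?E + ssum (\<lambda>x r. ssum (\<lambda>y z. if y = [] then 0
          else single (Vertex (x @ Vertex y # z)) (sg (pw susp x))) r) us)"
    proof -
      have "tdiff (Vertex us) - single (Vertex [Vertex us]) (1 :: 'k) = - (vert (tdiffs us) + vert (brk us))"
        using False by (simp add: vert_def)
      also have "vert (tdiffs us) + vert (brk us :: _ \<Rightarrow>\<^sub>0 'k) = ?E + ssum (\<lambda>x r. ssum (\<lambda>y z. if y = [] then 0
          else single (Vertex (x @ Vertex y # z)) (sg (pw susp x))) r) us"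
        unfolding brk tdiffs ssum_plus[symmetric]
      proof (intro ssum_cong, goal_cases)
        case (1 x r y z)
        consider "y = []" | t where "y = [t]" | "2 \<le> length y"
          by (cases y rule: remdups_adj.cases) auto
        then show ?case
          by cases (auto simp: slot_def scalar_minus)
      qed
      finally show ?thesis .
    qed
    show ?thesis
      unfolding eq by (intro ci_uminus ci_add E *)
  qed
qed

text \<open>
  The subtrees are replaced by their normal forms one after the other. The list \<open>xs\<close> holds those already done.
\<close>

lemma ci_snfs:
  assumes "\<And>t. t \<in> set ts \<Longrightarrow> ci m (legs t) (snf t - single t (1::'k::field_char_0))"
    and "1 \<le> m" "enat (length xs + length ts) \<le> m" "\<forall>t\<in>set xs \<union> set ts. valid m t"
  shows "ci m (sum_list (map legs xs) + sum_list (map legs ts))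
    (linext (\<lambda>w. single (Vertex (xs @ letters w)) 1) (snfs ts) - single (Vertex (xs @ ts)) (1::'k))"
  using assms
proof (induction ts arbitrary: xs)
  case Nil
  show ?case by (simp add: ci_0 flip: wd_Nil)
next
  case (Cons t ts)
  let ?n = "sum_list (map legs xs) + sum_list (map legs (t # ts))"
  have t: "valid m t" using Cons.prems by simp
  have "linext (\<lambda>w. single (Vertex (xs @ letters w)) 1) (snfs (t # ts)) - single (Vertex (xs @ t # ts)) (1::'k)
    = linext (\<lambda>a. linext (\<lambda>w. single (Vertex ((xs @ [a]) @ letters w)) 1) (snfs ts)
        - single (Vertex ((xs @ [a]) @ ts)) 1) (snf t)
    + slot xs ts (snf t - single t 1)"
    by (simp add: linext_emb_mult slot_def linext_minus_fun)
  moreover have "ci m ?n (linext (\<lambda>a. linext (\<lambda>w. single (Vertex ((xs @ [a]) @ letters w)) 1) (snfs ts)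
        - single (Vertex ((xs @ [a]) @ ts)) 1) (snf t :: _ \<Rightarrow>\<^sub>0 'k))"
  proof (rule ci_linext)
    fix a assume "a \<in> keys (snf t :: _ \<Rightarrow>\<^sub>0 'k)"
    then have "goodN m t a" using keys_snf[OF Cons.prems(2)] by auto
    then have a: "legs a = legs t" "valid m a" using t by (auto simp: goodN_def)
    have "ci m (sum_list (map legs (xs @ [a])) + sum_list (map legs ts))
      (linext (\<lambda>w. single (Vertex ((xs @ [a]) @ letters w)) 1) (snfs ts)
        - single (Vertex ((xs @ [a]) @ ts)) (1::'k))"
      using Cons.prems a by (intro Cons.IH) auto
    then show "ci m ?n (linext (\<lambda>w. single (Vertex ((xs @ [a]) @ letters w)) 1) (snfs ts)
        - single (Vertex ((xs @ [a]) @ ts)) (1::'k))"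
      using a by (simp add: add.assoc)
  qed
  moreover have "ci m ?n (slot xs ts (snf t - single t (1::'k)))"
    unfolding list.map sum_list.Cons add.assoc[symmetric]
    by (rule ci_slot) (use Cons.prems legs_pos[OF t] in auto)
  ultimately show ?case by (simp add: ci_add)
qed

lemma ci_snf:
  assumes "valid m T" "1 \<le> m"
  shows "ci m (legs T) (snf T - single T (1::'k::field_char_0))"
  using assms(1)
proof (induction T)
  case Triv
  show ?case by (simp add: ci_0)
next
  case (Vertex ts)
  have "ci m (sum_list (map legs []) + sum_list (map legs ts))
    (linext (\<lambda>w. single (Vertex ([] @ letters w)) 1) (snfs ts) - single (Vertex ([] @ ts)) (1::'k))"
    using Vertex assms(2) by (intro ci_snfs) auto
  then have 1: "ci m (legs (Vertex ts)) (vert (snfs ts) - single (Vertex ts) (1::'k))"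
    by (simp add: vert_def)
  have 2: "ci m (legs (Vertex ts)) (tops (snfs ts) - (vert (snfs ts) :: _ \<Rightarrow>\<^sub>0 'k))"
  proof (cases "length ts = 1")
    case True
    then obtain t where t: "ts = [t]" by (cases ts) auto
    have "tops (snfs ts) - vert (snfs ts) = linext (\<lambda>a. tdiff a - single (Vertex [a]) (1::'k)) (snf t)"
      unfolding t by (simp add: tops_emb vert_def linext_minus_fun) (simp add: emb_def linext_linext)
    moreover have "ci m (legs (Vertex ts)) \<dots>"
    proof (rule ci_linext)
      fix a assume "a \<in> keys (snf t :: _ \<Rightarrow>\<^sub>0 'k)"
      then have "goodN m t a" using keys_snf[OF assms(2)] by auto
      then show "ci m (legs (Vertex ts)) (tdiff a - single (Vertex [a]) (1::'k))"
        using ci_tdiff[of m a] assms(2) Vertex.prems unfolding t by (simp add: goodN_def)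
    qed
    ultimately show ?thesis by simp
  next
    case False
    then have "2 \<le> length ts" using Vertex.prems by auto
    have "tops (snfs ts) = (vert (snfs ts) :: _ \<Rightarrow>\<^sub>0 'k)"
      unfolding tops_def vert_def
    proof (rule linext_cong[OF refl])
      fix w assume "w \<in> keys (snfs ts :: _ \<Rightarrow>\<^sub>0 'k)"
      then have "list_all2 (goodN m) ts (letters w)"
        using keys_snfs[OF keys_snf[OF assms(2)]] by blast
      from list_all2_goodN(1)[OF this] \<open>2 \<le> length ts\<close>
      show "treeop (letters w) = single (Vertex (letters w)) (1 :: 'k)"
        by (simp add: treeop_simps)
    qed
    then show ?thesis by (simp add: ci_0)
  qed
  show ?case using ci_add[OF 1 2] by simp
qed

lemma nf_cong:
  assumes "valid m T" "1 \<le> m"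
  shows "(legs T, nf T - single T (1 :: 'k::field_char_0)) \<in> op_ideal m"
proof -
  have "nf T - single T (1 :: 'k) = scalar (sg (sx T)) (rho (snf T - single T 1))"
    by (simp add: nf_def rho_def scalar_minus)
  with ci_snf[OF assms, where ?'k = 'k] show ?thesis by (simp add: ci_def op_ideal.scalar)
qed


section \<open>Linear combinations in a module\<close>

lemma ring_of_type_algebra_simps [simp]:
  "carrier (ring_of_type_algebra :: 'k::field_char_0 ring) = UNIV"
  "add (ring_of_type_algebra :: 'k ring) = (+)"
  "monoid.mult (ring_of_type_algebra :: 'k ring) = (*)"
  "one (ring_of_type_algebra :: 'k ring) = 1"
  "ring.zero (ring_of_type_algebra :: 'k ring) = 0"
  by (simp_all add: ring_of_type_algebra_def fun_eq_iff)

text \<open>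
  The linear combination of the vectors \<open>\<phi> s\<close> with coefficients \<open>F\<close>. It extends \<open>linext\<close> to modules that are given by a carrier.
\<close>

definition lc :: "('k::field_char_0, 'v, 'e) module_scheme \<Rightarrow> ('s \<Rightarrow> 'v) \<Rightarrow> ('s \<Rightarrow>\<^sub>0 'k) \<Rightarrow> 'v"
  where "lc V \<phi> F = finsum V (\<lambda>s. lookup F s \<odot>\<^bsub>V\<^esub> \<phi> s) (keys F)"

definition vlin :: "('k::field_char_0, 'v, 'e) module_scheme \<Rightarrow> 's set \<Rightarrow> (('s \<Rightarrow>\<^sub>0 'k) \<Rightarrow> 'v) \<Rightarrow> bool"
  where "vlin V S h \<longleftrightarrow> (\<forall>F. keys F \<subseteq> S \<longrightarrow> h F \<in> carrier V \<and>
    (\<forall>c. h (scalar c F) = c \<odot>\<^bsub>V\<^esub> h F) \<and>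
    (\<forall>G. keys G \<subseteq> S \<longrightarrow> h (F + G) = h F \<oplus>\<^bsub>V\<^esub> h G))"

locale vspace =
  fixes V :: "('k::field_char_0, 'v, 'e) module_scheme" (structure)
  assumes module_V: "module (ring_of_type_algebra :: 'k ring) V"
begin

sublocale module "ring_of_type_algebra :: 'k ring" V
  by (rule module_V)

lemma smult_cl [simp, intro]: "x \<in> carrier V \<Longrightarrow> c \<odot> x \<in> carrier V"
  using smult_closed[of c x] by simp

lemma smult_add_left: "x \<in> carrier V \<Longrightarrow> (c + d) \<odot> x = c \<odot> x \<oplus> d \<odot> x"
  using smult_l_distr[of c d x] by simp

lemma smult_add_right: "x \<in> carrier V \<Longrightarrow> y \<in> carrier V \<Longrightarrow> c \<odot> (x \<oplus> y) = c \<odot> x \<oplus> c \<odot> y"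
  using smult_r_distr[of c x y] by simp

lemma smult_smult [simp]: "x \<in> carrier V \<Longrightarrow> c \<odot> (d \<odot> x) = (c * d) \<odot> x"
  using smult_assoc1[of c d x] by simp

lemma smult_1 [simp]: "x \<in> carrier V \<Longrightarrow> 1 \<odot> x = x"
  using smult_one[of x] by simp

lemma smult_0_left [simp]: "x \<in> carrier V \<Longrightarrow> 0 \<odot> x = \<zero>"
  using smult_l_null[of x] by simp

lemma smult_0_right [simp]: "c \<odot> \<zero> = \<zero>"
  using smult_r_null[of c] by simp

lemma smult_finsum:
  "finite A \<Longrightarrow> f \<in> A \<rightarrow> carrier V \<Longrightarrow> c \<odot> finsum V f A = finsum V (\<lambda>a. c \<odot> f a) A"
  using finsum_smult_ldistr[of A c f] by simp

lemma minus_eq_smult: "x \<in> carrier V \<Longrightarrow> \<ominus> x = (-1) \<odot> x"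
proof -
  assume x: "x \<in> carrier V"
  have "(-1) \<odot> x \<oplus> 1 \<odot> x = \<zero>"
    using x by (simp only: smult_add_left[symmetric]) simp
  then have "(-1) \<odot> x \<oplus> x = \<zero>" using x by simp
  from M.minus_equality[OF this x] x show ?thesis by auto
qed

lemma subspaceD:
  assumes "subspace_of V H"
  shows "H \<subseteq> carrier V" "\<zero> \<in> H" "x \<in> H \<Longrightarrow> y \<in> H \<Longrightarrow> x \<oplus> y \<in> H" "x \<in> H \<Longrightarrow> c \<odot> x \<in> H"
proof -
  note E = submoduleE[OF assms]
  show H: "H \<subseteq> carrier V" using E by blast
  show "x \<in> H \<Longrightarrow> y \<in> H \<Longrightarrow> x \<oplus> y \<in> H" using E by blast
  show sm: "x \<in> H \<Longrightarrow> c \<odot> x \<in> H" for x c using E by simp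
  obtain x where x: "x \<in> H" using E by blast
  then show "\<zero> \<in> H" using sm[OF x, of 0] H by auto
qed

lemma subspaceI:
  assumes "H \<subseteq> carrier V" "\<zero> \<in> H" "\<And>x y. x \<in> H \<Longrightarrow> y \<in> H \<Longrightarrow> x \<oplus> y \<in> H" "\<And>x c. x \<in> H \<Longrightarrow> c \<odot> x \<in> H"
  shows "subspace_of V H"
proof (rule submoduleI)
  show "\<ominus> a \<in> H" if "a \<in> H" for a
    using that assms(1,4) minus_eq_smult by auto
qed (use assms in auto)

lemma finsum_in_subspace:
  assumes "subspace_of V H" "\<And>a. a \<in> A \<Longrightarrow> f a \<in> H"
  shows "finsum V f A \<in> H"
  using assms(2)
proof (induction A rule: infinite_finite_induct)
  case (insert a A)
  then have "f \<in> A \<rightarrow> carrier V" "f a \<in> carrier V" using subspaceD(1)[OF assms(1)] by auto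
  then show ?case using insert subspaceD(3)[OF assms(1)] by (simp add: finsum_insert)
qed (simp_all add: subspaceD(2)[OF assms(1)])

lemma vlinD:
  assumes "vlin V S h" "keys F \<subseteq> S"
  shows "h F \<in> carrier V" "h (scalar c F) = c \<odot> h F" "keys G \<subseteq> S \<Longrightarrow> h (F + G) = h F \<oplus> h G"
  using assms unfolding vlin_def by blast+

lemma vlinI:
  assumes "\<And>F. keys F \<subseteq> S \<Longrightarrow> h F \<in> carrier V"
    "\<And>F c. keys F \<subseteq> S \<Longrightarrow> h (scalar c F) = c \<odot> h F"
    "\<And>F G. keys F \<subseteq> S \<Longrightarrow> keys G \<subseteq> S \<Longrightarrow> h (F + G) = h F \<oplus> h G"
  shows "vlin V S h"
  unfolding vlin_def by (intro allI impI conjI) (erule assms | erule (1) assms)+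

lemma vlin_0: assumes "vlin V S h" shows "h 0 = \<zero>"
  using vlinD(1)[OF assms, of 0] vlinD(2)[OF assms, of 0 0] by simp

lemma vlin_sum:
  assumes "vlin V S h" "finite I" "\<And>i. i \<in> I \<Longrightarrow> keys (F i) \<subseteq> S"
  shows "h (sum F I) = finsum V (\<lambda>i. h (F i)) I"
  using assms(2,3)
proof (induction I rule: finite_induct)
  case empty
  show ?case using vlin_0[OF assms(1)] by simp
next
  case (insert i I)
  have "h (sum F (insert i I)) = h (F i) \<oplus> h (sum F I)"
    using insert by (simp add: vlinD(3)[OF assms(1)] keys_sum_subset)
  also have "\<dots> = h (F i) \<oplus> finsum V (\<lambda>i. h (F i)) I" using insert by simp
  also have "\<dots> = finsum V (\<lambda>i. h (F i)) (insert i I)"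
    using insert vlinD(1)[OF assms(1)] by (simp add: finsum_insert)
  finally show ?case .
qed

lemma vlin_eq_lc:
  assumes "vlin V S h" "keys F \<subseteq> S"
  shows "h F = lc V (\<lambda>s. h (single s 1)) F"
proof -
  have S: "keys (single s (1::'k)) \<subseteq> S" if "s \<in> keys F" for s
    using that assms(2) by auto
  have "h F = h (\<Sum>s\<in>keys F. single s (lookup F s))"
    by (simp flip: poly_mapping_expansion)
  also have "\<dots> = finsum V (\<lambda>s. h (single s (lookup F s))) (keys F)"
    by (rule vlin_sum[OF assms(1)]) (use assms(2) in auto)
  also have "\<dots> = finsum V (\<lambda>s. lookup F s \<odot> h (single s 1)) (keys F)"
  proof (rule finsum_cong')
    fix s assume s: "s \<in> keys F"
    show "h (single s (lookup F s)) = lookup F s \<odot> h (single s 1)"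
      using vlinD(2)[OF assms(1) S[OF s], of "lookup F s"] by simp
  qed (use vlinD(1)[OF assms(1) S] in auto)
  finally show ?thesis by (simp add: lc_def)
qed

lemma lc_cong:
  assumes "F = G" "\<And>s. s \<in> keys G \<Longrightarrow> \<phi> s = \<psi> s" "\<And>s. s \<in> keys G \<Longrightarrow> \<psi> s \<in> carrier V"
  shows "lc V \<phi> F = lc V \<psi> G"
  unfolding lc_def assms(1) using assms(2,3) by (intro finsum_cong') auto

lemma vlin_eqI:
  assumes "vlin V S h" "vlin V S h'" "keys F \<subseteq> S"
    "\<And>s. s \<in> keys F \<Longrightarrow> h (single s 1) = h' (single s 1)"
  shows "h F = h' F"
  unfolding vlin_eq_lc[OF assms(1,3)] vlin_eq_lc[OF assms(2,3)]
proof (rule lc_cong[OF refl assms(4)])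
  fix s assume "s \<in> keys F"
  then have "keys (single s (1::'k)) \<subseteq> S" using assms(3) by auto
  then show "h' (single s 1) \<in> carrier V" by (rule vlinD(1)[OF assms(2)])
qed

lemma lc_superset:
  assumes "finite A" "keys F \<subseteq> A" "\<phi> \<in> A \<rightarrow> carrier V"
  shows "lc V \<phi> F = finsum V (\<lambda>s. lookup F s \<odot> \<phi> s) A"
  unfolding lc_def
  by (rule M.add.finprod_mono_neutral_cong_left) (use assms in \<open>auto simp: in_keys_iff Pi_iff\<close>)

lemma vlin_lc:
  assumes "\<phi> \<in> S \<rightarrow> carrier V"
  shows "vlin V S (lc V \<phi>)"
  unfolding vlin_def
proof (intro allI impI conjI)
  fix F G :: "'a \<Rightarrow>\<^sub>0 'k" and c
  assume F: "keys F \<subseteq> S"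
  then have cl: "\<phi> \<in> keys F \<rightarrow> carrier V" using assms by auto
  then show "lc V \<phi> F \<in> carrier V"
    unfolding lc_def by (intro finsum_closed) auto
  have "lc V \<phi> (scalar c F) = finsum V (\<lambda>s. lookup (scalar c F) s \<odot> \<phi> s) (keys F)"
    by (rule lc_superset) (use keys_scalar_subset[of c F] cl in auto)
  also have "\<dots> = finsum V (\<lambda>s. c \<odot> (lookup F s \<odot> \<phi> s)) (keys F)"
    by (rule finsum_cong') (use cl in \<open>auto simp: lookup_scalar Pi_iff\<close>)
  also have "\<dots> = c \<odot> lc V \<phi> F"
    unfolding lc_def by (rule smult_finsum[symmetric]) (use cl in auto)
  finally show "lc V \<phi> (scalar c F) = c \<odot> lc V \<phi> F" .
  assume G: "keys G \<subseteq> S"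
  let ?A = "keys F \<union> keys G"
  have clA: "\<phi> \<in> ?A \<rightarrow> carrier V" using assms F G by auto
  have "lc V \<phi> (F + G) = finsum V (\<lambda>s. lookup (F + G) s \<odot> \<phi> s) ?A"
    by (rule lc_superset) (use Poly_Mapping.keys_add[of F G] clA in auto)
  also have "\<dots> = finsum V (\<lambda>s. lookup F s \<odot> \<phi> s \<oplus> lookup G s \<odot> \<phi> s) ?A"
    by (rule finsum_cong') (use clA in \<open>auto simp: lookup_add smult_add_left Pi_iff\<close>)
  also have "\<dots> = finsum V (\<lambda>s. lookup F s \<odot> \<phi> s) ?A \<oplus> finsum V (\<lambda>s. lookup G s \<odot> \<phi> s) ?A"
    by (rule finsum_addf) (use clA in auto)
  also have "finsum V (\<lambda>s. lookup F s \<odot> \<phi> s) ?A = lc V \<phi> F"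
    by (rule lc_superset[symmetric]) (use clA in auto)
  also have "finsum V (\<lambda>s. lookup G s \<odot> \<phi> s) ?A = lc V \<phi> G"
    by (rule lc_superset[symmetric]) (use clA in auto)
  finally show "lc V \<phi> (F + G) = lc V \<phi> F \<oplus> lc V \<phi> G" .
qed

lemma lc_single [simp]: "\<phi> s \<in> carrier V \<Longrightarrow> lc V \<phi> (single s c) = c \<odot> \<phi> s"
  by (cases "c = 0") (simp_all add: lc_def)

lemma lc_0 [simp]: "lc V \<phi> 0 = \<zero>"
  by (simp add: lc_def)

lemma lc_closed: "\<phi> \<in> keys F \<rightarrow> carrier V \<Longrightarrow> lc V \<phi> F \<in> carrier V"
  by (rule vlinD(1)[OF vlin_lc]) auto

lemma vlin_smult: "vlin V S h \<Longrightarrow> vlin V S (\<lambda>F. c \<odot> h F)"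
  by (rule vlinI) (simp_all add: vlinD[of S h] smult_add_right, simp add: mult.commute)

lemma vlin_linext:
  assumes "vlin V S h" "\<And>a. a \<in> S' \<Longrightarrow> keys (\<psi> a) \<subseteq> S"
  shows "vlin V S' (\<lambda>F. h (linext \<psi> F))"
proof -
  have "keys (linext \<psi> F) \<subseteq> S" if "keys F \<subseteq> S'" for F
    using that assms(2) by (intro keys_linext_subset) auto
  then show ?thesis
    by (intro vlinI) (simp_all add: vlinD[OF assms(1)])
qed

lemma lc_linext:
  assumes "\<phi> \<in> S \<rightarrow> carrier V" "\<And>a. a \<in> keys F \<Longrightarrow> keys (\<psi> a) \<subseteq> S"
  shows "lc V \<phi> (linext \<psi> F) = lc V (\<lambda>a. lc V \<phi> (\<psi> a)) F"
proof -
  have "vlin V (keys F) (\<lambda>F. lc V \<phi> (linext \<psi> F))"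
    by (rule vlin_linext[OF vlin_lc[OF assms(1)] assms(2)])
  from vlin_eq_lc[OF this subset_refl] show ?thesis by simp
qed

lemma lc_linext2:
  assumes "\<phi> \<in> S \<rightarrow> carrier V"
    "\<And>a b. a \<in> keys F \<Longrightarrow> b \<in> keys G \<Longrightarrow> keys (h a b) \<subseteq> S"
  shows "lc V \<phi> (linext (\<lambda>a. linext (h a) G) F) = lc V (\<lambda>a. lc V (\<lambda>b. lc V \<phi> (h a b)) G) F"
proof -
  have "lc V \<phi> (linext (\<lambda>a. linext (h a) G) F) = lc V (\<lambda>a. lc V \<phi> (linext (h a) G)) F"
    by (rule lc_linext[OF assms(1)]) (intro keys_linext_subset assms(2))
  also have "\<dots> = lc V (\<lambda>a. lc V (\<lambda>b. lc V \<phi> (h a b)) G) F"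
  proof (rule lc_cong[OF refl])
    fix a assume a: "a \<in> keys F"
    show "lc V \<phi> (linext (h a) G) = lc V (\<lambda>b. lc V \<phi> (h a b)) G"
      by (rule lc_linext[OF assms(1)]) (rule assms(2)[OF a])
    show "lc V (\<lambda>b. lc V \<phi> (h a b)) G \<in> carrier V"
      by (intro lc_closed Pi_I vlinD(1)[OF vlin_lc[OF assms(1)]] assms(2)[OF a])
  qed
  finally show ?thesis .
qed

lemma lc_smult_fun:
  assumes "\<phi> \<in> keys F \<rightarrow> carrier V"
  shows "lc V (\<lambda>s. c \<odot> \<phi> s) F = c \<odot> lc V \<phi> F"
proof (rule vlin_eqI[where S = "keys F"])
  show "vlin V (keys F) (lc V (\<lambda>s. c \<odot> \<phi> s))"
    by (rule vlin_lc) (use assms in \<open>auto simp: Pi_iff\<close>)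
  show "vlin V (keys F) (\<lambda>F. c \<odot> lc V \<phi> F)"
    by (rule vlin_smult[OF vlin_lc[OF assms]])
  fix s assume "s \<in> keys F"
  then have "\<phi> s \<in> carrier V" using assms by auto
  then show "lc V (\<lambda>s. c \<odot> \<phi> s) (single s 1) = c \<odot> lc V \<phi> (single s 1)"
    by simp
qed simp

lemma lc_sum:
  assumes "\<phi> \<in> S \<rightarrow> carrier V" "finite I" "\<And>i. i \<in> I \<Longrightarrow> keys (F i) \<subseteq> S"
  shows "lc V \<phi> (sum F I) = finsum V (\<lambda>i. lc V \<phi> (F i)) I"
  by (rule vlin_sum[OF vlin_lc[OF assms(1)] assms(2,3)])

end

lemma multilinearD:
  assumes "multilinear k V W f"
  shows "length as = k \<Longrightarrow> set as \<subseteq> carrier V \<Longrightarrow> f as \<in> carrier W"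
    and "Suc (length xs + length zs) = k \<Longrightarrow> set xs \<union> set zs \<subseteq> carrier V \<Longrightarrow> x \<in> carrier V \<Longrightarrow> y \<in> carrier V \<Longrightarrow>
      f (xs @ (x \<oplus>\<^bsub>V\<^esub> y) # zs) = f (xs @ x # zs) \<oplus>\<^bsub>W\<^esub> f (xs @ y # zs)"
    and "Suc (length xs + length zs) = k \<Longrightarrow> set xs \<union> set zs \<subseteq> carrier V \<Longrightarrow> x \<in> carrier V \<Longrightarrow>
      f (xs @ (c \<odot>\<^bsub>V\<^esub> x) # zs) = c \<odot>\<^bsub>W\<^esub> f (xs @ x # zs)"
proof -
  show "length as = k \<Longrightarrow> set as \<subseteq> carrier V \<Longrightarrow> f as \<in> carrier W"
    using assms by (simp add: multilinear_def)
next
  assume *: "Suc (length xs + length zs) = k" "set xs \<union> set zs \<subseteq> carrier V" "x \<in> carrier V" "y \<in> carrier V"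
  then have "length (xs @ x # zs) = k \<and> set (xs @ x # zs) \<subseteq> carrier V" "length xs < k" by auto
  then have "f ((xs @ x # zs)[length xs := x \<oplus>\<^bsub>V\<^esub> y])
    = f ((xs @ x # zs)[length xs := x]) \<oplus>\<^bsub>W\<^esub> f ((xs @ x # zs)[length xs := y])"
    using assms * unfolding multilinear_def by blast
  then show "f (xs @ (x \<oplus>\<^bsub>V\<^esub> y) # zs) = f (xs @ x # zs) \<oplus>\<^bsub>W\<^esub> f (xs @ y # zs)" by simp
next
  assume *: "Suc (length xs + length zs) = k" "set xs \<union> set zs \<subseteq> carrier V" "x \<in> carrier V"
  then have "length (xs @ x # zs) = k \<and> set (xs @ x # zs) \<subseteq> carrier V" "length xs < k" by auto
  then have "f ((xs @ x # zs)[length xs := c \<odot>\<^bsub>V\<^esub> x]) = c \<odot>\<^bsub>W\<^esub> f ((xs @ x # zs)[length xs := x])"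
    using assms * unfolding multilinear_def by blast
  then show "f (xs @ (c \<odot>\<^bsub>V\<^esub> x) # zs) = c \<odot>\<^bsub>W\<^esub> f (xs @ x # zs)" by simp
qed

lemma multilinearI:
  assumes "\<And>as. length as = k \<Longrightarrow> set as \<subseteq> carrier V \<Longrightarrow> f as \<in> carrier W"
    and "\<And>xs zs x y. Suc (length xs + length zs) = k \<Longrightarrow> set xs \<union> set zs \<subseteq> carrier V \<Longrightarrow> x \<in> carrier V \<Longrightarrow> y \<in> carrier V \<Longrightarrow>
      f (xs @ (x \<oplus>\<^bsub>V\<^esub> y) # zs) = f (xs @ x # zs) \<oplus>\<^bsub>W\<^esub> f (xs @ y # zs)"
    and "\<And>xs zs x c. Suc (length xs + length zs) = k \<Longrightarrow> set xs \<union> set zs \<subseteq> carrier V \<Longrightarrow> x \<in> carrier V \<Longrightarrow>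
      f (xs @ (c \<odot>\<^bsub>V\<^esub> x) # zs) = c \<odot>\<^bsub>W\<^esub> f (xs @ x # zs)"
  shows "multilinear k V W f"
  unfolding multilinear_def
proof (intro allI impI ballI conjI)
  fix as i x assume as: "length as = k \<and> set as \<subseteq> carrier V" "i < k" and x: "x \<in> carrier V"
  have *: "as[i := u] = take i as @ u # drop (Suc i) as" for u
    using as by (simp add: upd_conv_take_nth_drop)
  have l: "Suc (length (take i as) + length (drop (Suc i) as)) = k"
    and s: "set (take i as) \<union> set (drop (Suc i) as) \<subseteq> carrier V"
    using as set_take_subset[of i as] set_drop_subset[of "Suc i" as] by auto
  show "f (as[i := x \<oplus>\<^bsub>V\<^esub> y]) = f (as[i := x]) \<oplus>\<^bsub>W\<^esub> f (as[i := y])" if "y \<in> carrier V" for y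
    unfolding * by (rule assms(2)[OF l s x that])
  show "f (as[i := c \<odot>\<^bsub>V\<^esub> x]) = c \<odot>\<^bsub>W\<^esub> f (as[i := x])" for c
    unfolding * by (rule assms(3)[OF l s x])
qed (use assms(1) in auto)


section \<open>Evaluation of trees in an algebra\<close>

abbreviation dsum :: "('b \<times> int) list \<Rightarrow> int"
  where "dsum as \<equiv> sum_list (map snd as)"

text \<open>
  The exponent of the Koszul sign for moving the trees \<open>ts\<close> past the arguments that are distributed among
  them. Each argument is given together with its degree.
\<close>

fun epsl :: "ptree list \<Rightarrow> ('b \<times> int) list \<Rightarrow> int"
  where
    "epsl [] as = 0"
  | "epsl (t # ts) as = dsum (take (legs t) as) * sum_list (map tdeg ts) + epsl ts (drop (legs t) as)"

text \<open>
  The sign is that of the evaluation of a tensor product of maps: the trees \<open>ts\<close> are moved to their arguments.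
\<close>

fun ev :: "('k::field_char_0, 'b) gr_module \<Rightarrow> (nat \<Rightarrow> 'b list \<Rightarrow> 'b) \<Rightarrow> ptree \<Rightarrow> ('b \<times> int) list \<Rightarrow> 'b"
  and evl :: "('k::field_char_0, 'b) gr_module \<Rightarrow> (nat \<Rightarrow> 'b list \<Rightarrow> 'b) \<Rightarrow> ptree list \<Rightarrow> ('b \<times> int) list \<Rightarrow> 'b list"
  where
    "ev B \<nu> Triv as = fst (hd as)"
  | "ev B \<nu> (Vertex ts) as = sg (epsl ts as) \<odot>\<^bsub>B\<^esub> \<nu> (length ts) (evl B \<nu> ts as)"
  | "evl B \<nu> [] as = []"
  | "evl B \<nu> (t # ts) as = ev B \<nu> t (take (legs t) as) # evl B \<nu> ts (drop (legs t) as)"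

lemma length_evl [simp]: "length (evl B \<nu> ts as) = length ts"
  by (induction ts arbitrary: as) auto

lemma image_take_drop:
  "f ` set as \<subseteq> C \<Longrightarrow> f ` set (take n as) \<subseteq> C" "f ` set as \<subseteq> C \<Longrightarrow> f ` set (drop n as) \<subseteq> C"
  by (meson image_mono order_trans set_take_subset set_drop_subset)+

locale Am_alg =
  fixes m :: enat and B :: "('k::field_char_0, 'b) gr_module" and \<nu> :: "nat \<Rightarrow> 'b list \<Rightarrow> 'b"
  assumes Am: "Am_algebra m B \<nu>"
begin

lemma graded_B: "graded_space B"
  using Am by (simp add: Am_algebra_def)

sublocale B: vspace B
  using graded_B by (intro vspace.intro) (simp add: graded_space_def)

lemma grade_sub: "subspace_of B (grade B d)"
  using graded_B by (simp add: graded_space_def)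

lemma grade_carrier: "x \<in> grade B d \<Longrightarrow> x \<in> carrier B"
  using B.subspaceD(1)[OF grade_sub] by blast

lemma ml: "1 \<le> k \<Longrightarrow> enat k \<le> m \<Longrightarrow> multilinear k B B (\<nu> k)"
  using Am by (simp add: Am_algebra_def)


lemma nu_grade:
  assumes "1 \<le> k" "enat k \<le> m" "length as = k" "length ds = k" "\<forall>i<k. as ! i \<in> grade B (ds ! i)"
  shows "\<nu> k as \<in> grade B (sum_list ds + int k - 2)"
  using Am assms unfolding Am_algebra_def by blast

lemma nu_relation:
  assumes "1 \<le> n" "enat n \<le> m" "length as = n" "length ds = n" "\<forall>i<n. as ! i \<in> grade B (ds ! i)"
  shows "(\<Oplus>\<^bsub>B\<^esub> l \<in> {0..<n}. \<Oplus>\<^bsub>B\<^esub> k \<in> {1..n - l}.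
          ((-1 :: 'k) powi (int k + int l + int k * int l + int k * sum_list (take l ds))) \<odot>\<^bsub>B\<^esub>
            \<nu> (n - k + 1) (take l as @ [\<nu> k (take k (drop l as))] @ drop (l + k) as)) = \<zero>\<^bsub>B\<^esub>"
  using Am assms unfolding Am_algebra_def by blast

lemma ev_closed:
  "valid m T \<Longrightarrow> length as = legs T \<Longrightarrow> fst ` set as \<subseteq> carrier B \<Longrightarrow> ev B \<nu> T as \<in> carrier B"
proof (induction T arbitrary: as)
  case Triv
  then show ?case by (cases as) auto
next
  case (Vertex ts)
  have "set (evl B \<nu> us as) \<subseteq> carrier B"
    if "set us \<subseteq> set ts" "length as = sum_list (map legs us)" "fst ` set as \<subseteq> carrier B" for us as
    using that
  proof (induction us arbitrary: as)
    case (Cons t us)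
    have "ev B \<nu> t (take (legs t) as) \<in> carrier B"
      using Cons.prems Vertex.prems by (intro Vertex.IH image_take_drop) auto
    moreover have "set (evl B \<nu> us (drop (legs t) as)) \<subseteq> carrier B"
      using Cons.prems by (intro Cons.IH image_take_drop) auto
    ultimately show ?case by simp
  qed simp
  from this[of ts as] have "set (evl B \<nu> ts as) \<subseteq> carrier B" using Vertex.prems by simp
  then have "\<nu> (length ts) (evl B \<nu> ts as) \<in> carrier B"
    using Vertex.prems by (intro multilinearD(1)[OF ml]) auto
  then show ?case by simp
qed

definition homog :: "('b \<times> int) list \<Rightarrow> bool"
  where "homog as \<longleftrightarrow> (\<forall>(a, d)\<in>set as. a \<in> grade B d)"

lemma homog_append [simp]: "homog (as @ bs) \<longleftrightarrow> homog as \<and> homog bs"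
  by (auto simp: homog_def)

lemma homog_carrier: "homog as \<Longrightarrow> fst ` set as \<subseteq> carrier B"
  unfolding homog_def using grade_carrier by fastforce

lemma ev_grade:
  "valid m T \<Longrightarrow> length as = legs T \<Longrightarrow> homog as \<Longrightarrow> ev B \<nu> T as \<in> grade B (tdeg T + dsum as)"
proof (induction T arbitrary: as)
  case Triv
  then show ?case by (cases as) (auto simp: homog_def)
next
  case (Vertex ts)
  have "\<exists>ds. length ds = length us \<and> (\<forall>i<length us. evl B \<nu> us as ! i \<in> grade B (ds ! i))
      \<and> sum_list ds = sum_list (map tdeg us) + dsum as"
    if "set us \<subseteq> set ts" "length as = sum_list (map legs us)" "homog as" for us as
    using that
  proof (induction us arbitrary: as)
    case (Cons t us)
    have h: "homog (take (legs t) as)" "homog (drop (legs t) as)"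
      using Cons.prems(3) homog_append[of "take (legs t) as" "drop (legs t) as"] by simp_all
    have e: "ev B \<nu> t (take (legs t) as) \<in> grade B (tdeg t + dsum (take (legs t) as))"
      using Cons.prems Vertex.prems h by (intro Vertex.IH) auto
    obtain ds where ds: "length ds = length us" "\<forall>i<length us. evl B \<nu> us (drop (legs t) as) ! i \<in> grade B (ds ! i)"
      "sum_list ds = sum_list (map tdeg us) + dsum (drop (legs t) as)"
      using Cons.IH[of "drop (legs t) as"] Cons.prems h by auto
    have "dsum as = dsum (take (legs t) as) + dsum (drop (legs t) as)"
      by (metis append_take_drop_id map_append sum_list_append)
    then show ?case
      using e ds by (intro exI[of _ "(tdeg t + dsum (take (legs t) as)) # ds"]) (auto simp: less_Suc_eq_0_disj)
  qed simp
  from this[of ts as] obtain ds where ds: "length ds = length ts"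
    "\<forall>i<length ts. evl B \<nu> ts as ! i \<in> grade B (ds ! i)" "sum_list ds = sum_list (map tdeg ts) + dsum as"
    using Vertex.prems by auto
  have "\<nu> (length ts) (evl B \<nu> ts as) \<in> grade B (sum_list ds + int (length ts) - 2)"
    using ds Vertex.prems by (intro nu_grade) auto
  also have "sum_list ds + int (length ts) - 2 = tdeg (Vertex ts) + dsum as"
    using ds by simp
  finally show ?case
    by (simp add: B.subspaceD(4)[OF grade_sub] del: tdeg_simps)
qed

definition lmap :: "('b \<Rightarrow> 'b) \<Rightarrow> bool"
  where "lmap L \<longleftrightarrow> (\<forall>x\<in>carrier B. L x \<in> carrier B \<and> (\<forall>c. L (c \<odot>\<^bsub>B\<^esub> x) = c \<odot>\<^bsub>B\<^esub> L x) \<and>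
    (\<forall>y\<in>carrier B. L (x \<oplus>\<^bsub>B\<^esub> y) = L x \<oplus>\<^bsub>B\<^esub> L y))"

lemma lmapD:
  assumes "lmap L" "x \<in> carrier B"
  shows "L x \<in> carrier B" "L (c \<odot>\<^bsub>B\<^esub> x) = c \<odot>\<^bsub>B\<^esub> L x" "y \<in> carrier B \<Longrightarrow> L (x \<oplus>\<^bsub>B\<^esub> y) = L x \<oplus>\<^bsub>B\<^esub> L y"
  using assms unfolding lmap_def by blast+

lemma lmap_ml:
  assumes "lmap L" "1 \<le> k" "enat k \<le> m" "Suc (length xs + length zs) = k" "set xs \<union> set zs \<subseteq> carrier B"
  shows "lmap (\<lambda>x. c \<odot>\<^bsub>B\<^esub> \<nu> k (xs @ L x # zs))"
proof -
  note M = multilinearD[OF ml[OF assms(2,3)]]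
  have cl: "\<nu> k (xs @ L x # zs) \<in> carrier B" if "x \<in> carrier B" for x
    using assms lmapD(1)[OF assms(1) that] by (intro M(1)) auto
  show ?thesis
    unfolding lmap_def
  proof (intro ballI conjI allI)
    fix x d assume x: "x \<in> carrier B"
    show "c \<odot>\<^bsub>B\<^esub> \<nu> k (xs @ L x # zs) \<in> carrier B" using cl[OF x] by simp
    show "c \<odot>\<^bsub>B\<^esub> \<nu> k (xs @ L (d \<odot>\<^bsub>B\<^esub> x) # zs) = d \<odot>\<^bsub>B\<^esub> (c \<odot>\<^bsub>B\<^esub> \<nu> k (xs @ L x # zs))"
      using cl[OF x] by (simp add: lmapD(2)[OF assms(1) x] M(3)[OF assms(4,5) lmapD(1)[OF assms(1) x]] mult.commute)
    fix y assume y: "y \<in> carrier B"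
    show "c \<odot>\<^bsub>B\<^esub> \<nu> k (xs @ L (x \<oplus>\<^bsub>B\<^esub> y) # zs)
      = c \<odot>\<^bsub>B\<^esub> \<nu> k (xs @ L x # zs) \<oplus>\<^bsub>B\<^esub> c \<odot>\<^bsub>B\<^esub> \<nu> k (xs @ L y # zs)"
      using cl[OF x] cl[OF y]
      by (simp add: lmapD(3)[OF assms(1) x y] M(2)[OF assms(4,5) lmapD(1)[OF assms(1) x] lmapD(1)[OF assms(1) y]]
          B.smult_add_right)
  qed
qed

lemma lmap_lc:
  assumes "lmap L" "\<phi> \<in> keys F \<rightarrow> carrier B"
  shows "L (lc B \<phi> F) = lc B (\<lambda>s. L (\<phi> s)) F"
proof (rule B.vlin_eqI[where S = "keys F"])
  have v: "vlin B (keys F) (lc B \<phi>)" by (rule B.vlin_lc[OF assms(2)])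
  show "vlin B (keys F) (\<lambda>F. L (lc B \<phi> F))"
    by (rule B.vlinI) (simp_all add: B.vlinD[OF v] lmapD[OF assms(1)])
  show "vlin B (keys F) (lc B (\<lambda>s. L (\<phi> s)))"
    by (rule B.vlin_lc) (use assms lmapD(1)[OF assms(1)] in \<open>auto simp: Pi_iff\<close>)
  fix s assume "s \<in> keys F"
  then have "\<phi> s \<in> carrier B" using assms(2) by auto
  then show "L (lc B \<phi> (single s 1)) = lc B (\<lambda>s. L (\<phi> s)) (single s 1)"
    by (simp add: lmapD(1)[OF assms(1)])
qed simp

text \<open>
  Evaluation turns grafting into composition. The tree and the arguments outside of the grafted part enter only
  through a linear map \<open>L\<close> and the parity of \<open>\<kappa>\<close>, which counts the trees past which the inserted element is moved.
\<close>

lemma ev_graft: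
  assumes "valid m T" "legs T = Suc (length a1 + length a3)" "fst ` (set a1 \<union> set a3) \<subseteq> carrier B"
  shows "\<exists>\<kappa> L. lmap L \<and> (\<forall>x\<in>carrier B. \<forall>d. ev B \<nu> T (a1 @ (x, d) # a3) = sg (\<kappa> * d) \<odot>\<^bsub>B\<^esub> L x) \<and>
    (\<forall>S a2. valid m S \<and> length a2 = legs S \<and> fst ` set a2 \<subseteq> carrier B \<longrightarrow>
      ev B \<nu> (graft (Suc (length a1)) T S) (a1 @ a2 @ a3)
        = sg (graft_sgn (Suc (length a1)) T (tdeg S) + tdeg S * dsum a1 + \<kappa> * (tdeg S + dsum a2)) \<odot>\<^bsub>B\<^esub> L (ev B \<nu> S a2))"
  using assms
proof (induction T arbitrary: a1 a3)
  case Triv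
  then show ?case
    by (intro exI[of _ 0] exI[of _ "\<lambda>x. x"]) (auto simp: lmap_def ev_closed)
next
  case (Vertex ts)
  have list: "\<exists>xs zs \<kappa> L e \<kappa>'. Suc (length xs + length zs) = length us \<and> set xs \<union> set zs \<subseteq> carrier B \<and> lmap L \<and>
     (\<forall>x\<in>carrier B. \<forall>d. evl B \<nu> us (a1 @ (x, d) # a3) = xs @ (sg (\<kappa> * d) \<odot>\<^bsub>B\<^esub> L x) # zs \<and>
        epsl us (a1 @ (x, d) # a3) = e + \<kappa>' * d) \<and>
     (\<forall>S a2. valid m S \<and> length a2 = legs S \<and> fst ` set a2 \<subseteq> carrier B \<longrightarrow>
        (\<exists>\<sigma>. evl B \<nu> (graft_list (Suc (length a1)) us S) (a1 @ a2 @ a3) = xs @ (sg \<sigma> \<odot>\<^bsub>B\<^esub> L (ev B \<nu> S a2)) # zs \<and>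
          even (\<sigma> + epsl (graft_list (Suc (length a1)) us S) (a1 @ a2 @ a3)
            - (graft_sgn_list (Suc (length a1)) us (tdeg S) + tdeg S * dsum a1 + (\<kappa> + \<kappa>') * (tdeg S + dsum a2) + e))))"
    if "set us \<subseteq> set ts" "sum_list (map legs us) = Suc (length a1 + length a3)" "fst ` (set a1 \<union> set a3) \<subseteq> carrier B"
    for us a1 a3
    using that
  proof (induction us arbitrary: a1)
    case (Cons t us)
    have vt: "valid m t" and vus: "\<forall>t\<in>set us. valid m t" using Cons.prems Vertex.prems by auto
    have evl_cl: "set (evl B \<nu> us as) \<subseteq> carrier B"
      if "\<forall>t\<in>set us. valid m t" "length as = sum_list (map legs us)" "fst ` set as \<subseteq> carrier B" for us as
      using that
    proof (induction us arbitrary: as)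
      case (Cons t us)
      have "ev B \<nu> t (take (legs t) as) \<in> carrier B"
        using Cons.prems by (intro ev_closed image_take_drop) auto
      moreover have "set (evl B \<nu> us (drop (legs t) as)) \<subseteq> carrier B"
        using Cons.prems by (intro Cons.IH image_take_drop) auto
      ultimately show ?case by simp
    qed simp
    show ?case
    proof (cases "length a1 < legs t")
      case True
      define b1 b2 where "b1 = take (legs t - Suc (length a1)) a3" and "b2 = drop (legs t - Suc (length a1)) a3"
      have a3: "a3 = b1 @ b2" by (simp add: b1_def b2_def)
      have lt: "legs t = Suc (length a1 + length b1)" and l2: "length b2 = sum_list (map legs us)"
        using True Cons.prems(2) by (auto simp: b1_def b2_def)
      obtain \<kappa> L where L: "lmap L"
        "\<And>x d. x \<in> carrier B \<Longrightarrow> ev B \<nu> t (a1 @ (x, d) # b1) = sg (\<kappa> * d) \<odot>\<^bsub>B\<^esub> L x"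
        "\<And>S a2. valid m S \<Longrightarrow> length a2 = legs S \<Longrightarrow> fst ` set a2 \<subseteq> carrier B \<Longrightarrow>
          ev B \<nu> (graft (Suc (length a1)) t S) (a1 @ a2 @ b1)
          = sg (graft_sgn (Suc (length a1)) t (tdeg S) + tdeg S * dsum a1 + \<kappa> * (tdeg S + dsum a2)) \<odot>\<^bsub>B\<^esub> L (ev B \<nu> S a2)"
        using Vertex.IH[of t a1 b1] Cons.prems vt lt a3 by (auto simp: image_Un)
      let ?\<tau> = "sum_list (map tdeg us)"
      let ?zs = "evl B \<nu> us b2"
      show ?thesis
      proof (rule exI[of _ "[]"], rule exI[of _ ?zs], rule exI[of _ \<kappa>], rule exI[of _ L],
          rule exI[of _ "(dsum a1 + dsum b1) * ?\<tau> + epsl us b2"], rule exI[of _ ?\<tau>], intro conjI ballI allI impI)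
        show "set [] \<union> set ?zs \<subseteq> carrier B"
          using evl_cl[OF vus l2] Cons.prems(3) a3 by auto
        fix x d assume x: "x \<in> carrier B"
        have td: "take (legs t) (a1 @ (x, d) # a3) = a1 @ (x, d) # b1" "drop (legs t) (a1 @ (x, d) # a3) = b2"
          by (simp_all add: lt a3)
        show "evl B \<nu> (t # us) (a1 @ (x, d) # a3) = [] @ (sg (\<kappa> * d) \<odot>\<^bsub>B\<^esub> L x) # ?zs"
          unfolding evl.simps td using L(2)[OF x] by simp
        show "epsl (t # us) (a1 @ (x, d) # a3) = (dsum a1 + dsum b1) * ?\<tau> + epsl us b2 + ?\<tau> * d"
          unfolding epsl.simps td by (simp add: algebra_simps)
      next
        fix S and a2 :: "('b \<times> int) list" assume S: "valid m S \<and> length a2 = legs S \<and> fst ` set a2 \<subseteq> carrier B"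
        let ?\<sigma> = "graft_sgn (Suc (length a1)) t (tdeg S) + tdeg S * dsum a1 + \<kappa> * (tdeg S + dsum a2)"
        have g: "graft_list (Suc (length a1)) (t # us) S = graft (Suc (length a1)) t S # us"
          "graft_sgn_list (Suc (length a1)) (t # us) (tdeg S) = graft_sgn (Suc (length a1)) t (tdeg S) + tdeg S * ?\<tau>"
          using True by simp_all
        have "legs (graft (Suc (length a1)) t S) = length (a1 @ a2 @ b1)"
          using graft_props(1)[of "Suc (length a1)" t S] True S lt by simp
        then have td: "take (legs (graft (Suc (length a1)) t S)) (a1 @ a2 @ a3) = a1 @ a2 @ b1"
            "drop (legs (graft (Suc (length a1)) t S)) (a1 @ a2 @ a3) = b2"
          by (simp_all add: a3)
        show "\<exists>\<sigma>. evl B \<nu> (graft_list (Suc (length a1)) (t # us) S) (a1 @ a2 @ a3) = [] @ (sg \<sigma> \<odot>\<^bsub>B\<^esub> L (ev B \<nu> S a2)) # ?zs \<and>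
          even (\<sigma> + epsl (graft_list (Suc (length a1)) (t # us) S) (a1 @ a2 @ a3)
            - (graft_sgn_list (Suc (length a1)) (t # us) (tdeg S) + tdeg S * dsum a1 + (\<kappa> + ?\<tau>) * (tdeg S + dsum a2)
              + ((dsum a1 + dsum b1) * ?\<tau> + epsl us b2)))"
        proof (intro exI[of _ ?\<sigma>] conjI)
          show "evl B \<nu> (graft_list (Suc (length a1)) (t # us) S) (a1 @ a2 @ a3) = [] @ (sg ?\<sigma> \<odot>\<^bsub>B\<^esub> L (ev B \<nu> S a2)) # ?zs"
            unfolding g evl.simps td using L(3)[of S a2] S by simp
          have "?\<sigma> + epsl (graft_list (Suc (length a1)) (t # us) S) (a1 @ a2 @ a3)
            - (graft_sgn_list (Suc (length a1)) (t # us) (tdeg S) + tdeg S * dsum a1 + (\<kappa> + ?\<tau>) * (tdeg S + dsum a2)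
              + ((dsum a1 + dsum b1) * ?\<tau> + epsl us b2)) = - 2 * (tdeg S * ?\<tau>)"
            unfolding g epsl.simps td by (simp add: algebra_simps)
          then show "even (?\<sigma> + epsl (graft_list (Suc (length a1)) (t # us) S) (a1 @ a2 @ a3)
            - (graft_sgn_list (Suc (length a1)) (t # us) (tdeg S) + tdeg S * dsum a1 + (\<kappa> + ?\<tau>) * (tdeg S + dsum a2)
              + ((dsum a1 + dsum b1) * ?\<tau> + epsl us b2)))" by simp
        qed
      qed (use L(1) in auto)
    next
      case False
      define c1 c2 where "c1 = take (legs t) a1" and "c2 = drop (legs t) a1"
      have a1: "a1 = c1 @ c2" and lt: "length c1 = legs t" using False by (auto simp: c1_def c2_def)
      obtain xs zs \<kappa> L e \<kappa>' where IH: "Suc (length xs + length zs) = length us" "set xs \<union> set zs \<subseteq> carrier B" "lmap L"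
       "\<And>x d. x \<in> carrier B \<Longrightarrow> evl B \<nu> us (c2 @ (x, d) # a3) = xs @ (sg (\<kappa> * d) \<odot>\<^bsub>B\<^esub> L x) # zs"
       "\<And>x d. x \<in> carrier B \<Longrightarrow> epsl us (c2 @ (x, d) # a3) = e + \<kappa>' * d"
       "\<And>S a2. valid m S \<and> length a2 = legs S \<and> fst ` set a2 \<subseteq> carrier B \<Longrightarrow>
        (\<exists>\<sigma>. evl B \<nu> (graft_list (Suc (length c2)) us S) (c2 @ a2 @ a3) = xs @ (sg \<sigma> \<odot>\<^bsub>B\<^esub> L (ev B \<nu> S a2)) # zs \<and>
          even (\<sigma> + epsl (graft_list (Suc (length c2)) us S) (c2 @ a2 @ a3)
            - (graft_sgn_list (Suc (length c2)) us (tdeg S) + tdeg S * dsum c2 + (\<kappa> + \<kappa>') * (tdeg S + dsum a2) + e)))"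
      proof -
        have "set us \<subseteq> set ts" "sum_list (map legs us) = Suc (length c2 + length a3)"
          "fst ` (set c2 \<union> set a3) \<subseteq> carrier B"
          using Cons.prems a1 lt by auto
        from Cons.IH[OF this] show ?thesis using that by blast
      qed
      let ?\<tau> = "sum_list (map tdeg us)"
      have et: "ev B \<nu> t c1 \<in> carrier B"
        using Cons.prems a1 lt vt by (intro ev_closed) auto
      show ?thesis
      proof (rule exI[of _ "ev B \<nu> t c1 # xs"], rule exI[of _ zs], rule exI[of _ \<kappa>], rule exI[of _ L],
          rule exI[of _ "dsum c1 * ?\<tau> + e"], rule exI[of _ \<kappa>'], intro conjI ballI allI impI)
        show "set (ev B \<nu> t c1 # xs) \<union> set zs \<subseteq> carrier B" using et IH(2) by auto
        show "Suc (length (ev B \<nu> t c1 # xs) + length zs) = length (t # us)" using IH(1) by simp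
        fix x d assume x: "x \<in> carrier B"
        show "evl B \<nu> (t # us) (a1 @ (x, d) # a3) = (ev B \<nu> t c1 # xs) @ (sg (\<kappa> * d) \<odot>\<^bsub>B\<^esub> L x) # zs"
          using IH(4)[OF x] lt a1 by simp
        show "epsl (t # us) (a1 @ (x, d) # a3) = dsum c1 * ?\<tau> + e + \<kappa>' * d"
          using IH(5)[OF x] lt a1 by simp
      next
        fix S and a2 :: "('b \<times> int) list" assume S: "valid m S \<and> length a2 = legs S \<and> fst ` set a2 \<subseteq> carrier B"
        from IH(6)[OF this] obtain \<sigma> where \<sigma>:
          "evl B \<nu> (graft_list (Suc (length c2)) us S) (c2 @ a2 @ a3) = xs @ (sg \<sigma> \<odot>\<^bsub>B\<^esub> L (ev B \<nu> S a2)) # zs"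
          "even (\<sigma> + epsl (graft_list (Suc (length c2)) us S) (c2 @ a2 @ a3)
            - (graft_sgn_list (Suc (length c2)) us (tdeg S) + tdeg S * dsum c2 + (\<kappa> + \<kappa>') * (tdeg S + dsum a2) + e))"
          by blast
        have g: "graft_list (Suc (length a1)) (t # us) S = t # graft_list (Suc (length c2)) us S"
          "graft_sgn_list (Suc (length a1)) (t # us) (tdeg S) = graft_sgn_list (Suc (length c2)) us (tdeg S)"
          using False lt by (simp_all add: a1 Suc_diff_le)
        have tg: "sum_list (map tdeg (graft_list (Suc (length c2)) us S)) = ?\<tau> + tdeg S"
          using graft_props(2)[of "Suc (length c2)" us S] Cons.prems(2) a1 lt by simp
        show "\<exists>\<sigma>. evl B \<nu> (graft_list (Suc (length a1)) (t # us) S) (a1 @ a2 @ a3)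
            = (ev B \<nu> t c1 # xs) @ (sg \<sigma> \<odot>\<^bsub>B\<^esub> L (ev B \<nu> S a2)) # zs \<and>
          even (\<sigma> + epsl (graft_list (Suc (length a1)) (t # us) S) (a1 @ a2 @ a3)
            - (graft_sgn_list (Suc (length a1)) (t # us) (tdeg S) + tdeg S * dsum a1 + (\<kappa> + \<kappa>') * (tdeg S + dsum a2)
              + (dsum c1 * ?\<tau> + e)))"
        proof (intro exI[of _ \<sigma>] conjI)
          show "evl B \<nu> (graft_list (Suc (length a1)) (t # us) S) (a1 @ a2 @ a3)
            = (ev B \<nu> t c1 # xs) @ (sg \<sigma> \<odot>\<^bsub>B\<^esub> L (ev B \<nu> S a2)) # zs"
            unfolding g using \<sigma>(1) lt by (simp add: a1)
          have "epsl (t # graft_list (Suc (length c2)) us S) (a1 @ a2 @ a3)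
            = dsum c1 * (?\<tau> + tdeg S) + epsl (graft_list (Suc (length c2)) us S) (c2 @ a2 @ a3)"
            using lt by (simp add: a1 tg)
          then show "even (\<sigma> + epsl (graft_list (Suc (length a1)) (t # us) S) (a1 @ a2 @ a3)
            - (graft_sgn_list (Suc (length a1)) (t # us) (tdeg S) + tdeg S * dsum a1 + (\<kappa> + \<kappa>') * (tdeg S + dsum a2)
              + (dsum c1 * ?\<tau> + e)))"
            unfolding g using \<sigma>(2) by (simp add: a1 algebra_simps)
        qed
      qed (use IH(3) in auto)
    qed
  qed simp
  have "set ts \<subseteq> set ts" "sum_list (map legs ts) = Suc (length a1 + length a3)" "fst ` (set a1 \<union> set a3) \<subseteq> carrier B"
    using Vertex.prems by auto
  from list[OF this] obtain xs zs \<kappa> L e \<kappa>' where H: "Suc (length xs + length zs) = length ts" "set xs \<union> set zs \<subseteq> carrier B" "lmap L"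
       "\<And>x d. x \<in> carrier B \<Longrightarrow> evl B \<nu> ts (a1 @ (x, d) # a3) = xs @ (sg (\<kappa> * d) \<odot>\<^bsub>B\<^esub> L x) # zs"
       "\<And>x d. x \<in> carrier B \<Longrightarrow> epsl ts (a1 @ (x, d) # a3) = e + \<kappa>' * d"
       "\<And>S a2. valid m S \<and> length a2 = legs S \<and> fst ` set a2 \<subseteq> carrier B \<Longrightarrow>
        (\<exists>\<sigma>. evl B \<nu> (graft_list (Suc (length a1)) ts S) (a1 @ a2 @ a3) = xs @ (sg \<sigma> \<odot>\<^bsub>B\<^esub> L (ev B \<nu> S a2)) # zs \<and>
          even (\<sigma> + epsl (graft_list (Suc (length a1)) ts S) (a1 @ a2 @ a3)
            - (graft_sgn_list (Suc (length a1)) ts (tdeg S) + tdeg S * dsum a1 + (\<kappa> + \<kappa>') * (tdeg S + dsum a2) + e)))"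
    by blast
  have k: "1 \<le> length ts" "enat (length ts) \<le> m" using Vertex.prems by auto
  note M = multilinearD[OF ml[OF k]]
  have cl: "\<nu> (length ts) (xs @ L x # zs) \<in> carrier B" if "x \<in> carrier B" for x
    using H(1,2) lmapD(1)[OF H(3) that] by (intro M(1)) auto
  have sm: "\<nu> (length ts) (xs @ (c \<odot>\<^bsub>B\<^esub> L x) # zs) = c \<odot>\<^bsub>B\<^esub> \<nu> (length ts) (xs @ L x # zs)" if "x \<in> carrier B" for x c
    by (rule M(3)[OF H(1,2) lmapD(1)[OF H(3) that]])
  show ?case
  proof (rule exI[of _ "\<kappa> + \<kappa>'"], rule exI[of _ "\<lambda>x. sg e \<odot>\<^bsub>B\<^esub> \<nu> (length ts) (xs @ L x # zs)"], intro conjI ballI allI impI)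
    show "lmap (\<lambda>x. sg e \<odot>\<^bsub>B\<^esub> \<nu> (length ts) (xs @ L x # zs))"
      by (rule lmap_ml[OF H(3) k H(1,2)])
    fix x d assume x: "x \<in> carrier B"
    show "ev B \<nu> (Vertex ts) (a1 @ (x, d) # a3)
      = sg ((\<kappa> + \<kappa>') * d) \<odot>\<^bsub>B\<^esub> (sg e \<odot>\<^bsub>B\<^esub> \<nu> (length ts) (xs @ L x # zs))"
    proof -
      have "sg (e + \<kappa>' * d) * sg (\<kappa> * d) = sg ((\<kappa> + \<kappa>') * d) * (sg e :: 'k)"
        unfolding sg_add[symmetric] by (rule sg_cong) (simp add: algebra_simps)
      then show ?thesis using cl[OF x] by (simp add: H(4,5)[OF x] sm[OF x])
    qed
  next
    fix S and a2 :: "('b \<times> int) list" assume S: "valid m S \<and> length a2 = legs S \<and> fst ` set a2 \<subseteq> carrier B"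
    have x: "ev B \<nu> S a2 \<in> carrier B" using S by (intro ev_closed) auto
    from H(6)[OF S] obtain \<sigma> where \<sigma>:
          "evl B \<nu> (graft_list (Suc (length a1)) ts S) (a1 @ a2 @ a3) = xs @ (sg \<sigma> \<odot>\<^bsub>B\<^esub> L (ev B \<nu> S a2)) # zs"
          "even (\<sigma> + epsl (graft_list (Suc (length a1)) ts S) (a1 @ a2 @ a3)
            - (graft_sgn_list (Suc (length a1)) ts (tdeg S) + tdeg S * dsum a1 + (\<kappa> + \<kappa>') * (tdeg S + dsum a2) + e))"
      by blast
    have "sg (epsl (graft_list (Suc (length a1)) ts S) (a1 @ a2 @ a3)) * sg \<sigma>
      = sg (graft_sgn_list (Suc (length a1)) ts (tdeg S) + tdeg S * dsum a1 + (\<kappa> + \<kappa>') * (tdeg S + dsum a2)) * (sg e :: 'k)"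
      unfolding sg_add[symmetric] by (rule sg_cong) (use \<sigma>(2) in \<open>simp add: algebra_simps\<close>)
    then show "ev B \<nu> (graft (Suc (length a1)) (Vertex ts) S) (a1 @ a2 @ a3)
      = sg (graft_sgn (Suc (length a1)) (Vertex ts) (tdeg S) + tdeg S * dsum a1 + (\<kappa> + \<kappa>') * (tdeg S + dsum a2))
        \<odot>\<^bsub>B\<^esub> (sg e \<odot>\<^bsub>B\<^esub> \<nu> (length ts) (xs @ L (ev B \<nu> S a2) # zs))"
      using cl[OF x] by (simp add: \<sigma>(1) sm[OF x])
  qed
qed

lemma evl_replicate:
  "l \<le> length as \<Longrightarrow> evl B \<nu> (replicate l Triv @ ts) as = map fst (take l as) @ evl B \<nu> ts (drop l as) \<and>
    epsl (replicate l Triv @ ts) as = dsum (take l as) * sum_list (map tdeg ts) + epsl ts (drop l as)"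
proof (induction l arbitrary: as)
  case (Suc l)
  then obtain a as' where "as = a # as'" by (cases as) auto
  with Suc show ?case by (simp add: algebra_simps)
qed simp

lemma ev_corolla:
  assumes "1 \<le> k" "enat k \<le> m" "length as = k" "fst ` set as \<subseteq> carrier B"
  shows "ev B \<nu> (corolla k) as = \<nu> k (map fst as)"
proof -
  have "\<nu> k (map fst as) \<in> carrier B"
    using assms by (intro multilinearD(1)[OF ml]) auto
  then show ?thesis
    using evl_replicate[of k as "[]"] assms(3) by (simp add: corolla_def)
qed

text \<open>
  The defining relation of an \<open>A(m)\<close>-algebra is the evaluation of \<open>Phi n\<close>: the signs in \<open>Phi n\<close> become \<open>\<omega>\<close>, because the
  inner operation, of degree \<open>k - 2\<close>, is moved past the first arguments.
\<close>

lemma ev_Phi: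
  assumes n: "1 \<le> n" "enat n \<le> m" and as: "homog as" "length as = n"
  shows "lc B (\<lambda>T. ev B \<nu> T as) (Phi n) = \<zero>\<^bsub>B\<^esub>"
proof -
  note cl = homog_carrier[OF as(1)]
  have ev_cl: "(\<lambda>T. ev B \<nu> T as) \<in> trees m n \<rightarrow> carrier B"
    using as(2) cl by (auto simp: trees_iff intro!: ev_closed)
  let ?T = "\<lambda>l k. Vertex (replicate l Triv @ corolla k # replicate (n - k - l) Triv)"
  have T: "?T l k \<in> trees m n" if "l \<in> {0..<n}" "k \<in> {1..n - l}" for l k
  proof -
    have "enat (Suc (l + (n - k - l))) \<le> enat n" "enat k \<le> enat n" using that by auto
    then have "enat (Suc (l + (n - k - l))) \<le> m" "enat k \<le> m" using n(2) order_trans by blast+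
    then show ?thesis using that by (auto simp: trees_iff corolla_def)
  qed
  have s: "keys (single (?T l k) (sg (int (l * (k + 1) + k)) :: 'k)) \<subseteq> trees m n"
    if "l \<in> {0..<n}" "k \<in> {1..n - l}" for l k
    using T[OF that] by auto
  have "lc B (\<lambda>T. ev B \<nu> T as) (Phi n)
    = (\<Oplus>\<^bsub>B\<^esub> l \<in> {0..<n}. lc B (\<lambda>T. ev B \<nu> T as)
        (\<Sum>k\<in>{1..n - l}. single (?T l k) (sg (int (l * (k + 1) + k)))))"
    unfolding Phi_eq by (rule B.lc_sum[OF ev_cl finite_atLeastLessThan keys_sum_subset[OF s]])
  also have "\<dots> = (\<Oplus>\<^bsub>B\<^esub> l \<in> {0..<n}. \<Oplus>\<^bsub>B\<^esub> k \<in> {1..n - l}.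
      lc B (\<lambda>T. ev B \<nu> T as) (single (?T l k) (sg (int (l * (k + 1) + k)))))"
  proof (rule B.finsum_cong'[OF refl])
    show "lc B (\<lambda>T. ev B \<nu> T as) (\<Sum>k\<in>{1..n - l}. single (?T l k) (sg (int (l * (k + 1) + k))))
      = (\<Oplus>\<^bsub>B\<^esub> k \<in> {1..n - l}. lc B (\<lambda>T. ev B \<nu> T as) (single (?T l k) (sg (int (l * (k + 1) + k)))))"
      if "l \<in> {0..<n}" for l
      by (rule B.lc_sum[OF ev_cl]) (use s[OF that] in auto)
    show "(\<lambda>l. \<Oplus>\<^bsub>B\<^esub> k \<in> {1..n - l}.
      lc B (\<lambda>T. ev B \<nu> T as) (single (?T l k) (sg (int (l * (k + 1) + k))))) \<in> {0..<n} \<rightarrow> carrier B"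
      using s by (intro Pi_I B.finsum_closed B.vlinD(1)[OF B.vlin_lc[OF ev_cl]]) auto
  qed
  also have "\<dots> = (\<Oplus>\<^bsub>B\<^esub> l \<in> {0..<n}. \<Oplus>\<^bsub>B\<^esub> k \<in> {1..n - l}.
          ((-1 :: 'k) powi (int k + int l + int k * int l + int k * sum_list (take l (map snd as)))) \<odot>\<^bsub>B\<^esub>
            \<nu> (n - k + 1) (take l (map fst as) @ [\<nu> k (take k (drop l (map fst as)))] @ drop (l + k) (map fst as)))"
  proof -
    have *: "lc B (\<lambda>T. ev B \<nu> T as) (single (?T l k) (sg (int (l * (k + 1) + k))))
      = ((-1 :: 'k) powi (int k + int l + int k * int l + int k * sum_list (take l (map snd as)))) \<odot>\<^bsub>B\<^esub>
            \<nu> (n - k + 1) (take l (map fst as) @ [\<nu> k (take k (drop l (map fst as)))] @ drop (l + k) (map fst as)) \<and>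
        \<nu> (n - k + 1) (take l (map fst as) @ [\<nu> k (take k (drop l (map fst as)))] @ drop (l + k) (map fst as)) \<in> carrier B"
      if lk: "l \<in> {0..<n}" "k \<in> {1..n - l}" for l k
    proof -
      let ?a2 = "take k (drop l as)"
      have km: "1 \<le> k" "enat k \<le> m"
        using lk n(2) order_trans[of "enat k" "enat n" m] by auto
      have nkm: "1 \<le> n - k + 1" "enat (n - k + 1) \<le> m"
        using lk n(2) order_trans[of "enat (n - k + 1)" "enat n" m] by auto
      have l2: "length ?a2 = k" using lk as by auto
      have c2: "fst ` set ?a2 \<subseteq> carrier B" by (intro image_take_drop cl)
      have cor: "ev B \<nu> (corolla k) ?a2 = \<nu> k (map fst ?a2)"
        by (rule ev_corolla[OF km l2 c2])
      have ccl: "\<nu> k (map fst ?a2) \<in> carrier B"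
        using c2 l2 by (intro multilinearD(1)[OF ml[OF km]]) auto
      have legs: "legs (corolla k) = k" "tdeg (corolla k) = int k - 2" by (simp_all add: corolla_def)
      have "evl B \<nu> (replicate (n - k - l) Triv @ []) (drop k (drop l as)) = map fst (drop k (drop l as)) \<and>
        epsl (replicate (n - k - l) Triv @ []) (drop k (drop l as)) = 0"
        using evl_replicate[of "n - k - l" "drop k (drop l as)" "[]"] as(2) by simp
      moreover have "l \<le> length as" using lk as by auto
      ultimately have evl: "evl B \<nu> (replicate l Triv @ corolla k # replicate (n - k - l) Triv) as
         = map fst (take l as) @ \<nu> k (map fst ?a2) # map fst (drop k (drop l as))"
        and epsl: "epsl (replicate l Triv @ corolla k # replicate (n - k - l) Triv) as = dsum (take l as) * (int k - 2)"
        using evl_replicate[of l as "corolla k # replicate (n - k - l) Triv"] by (simp_all add: legs cor)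
      have len: "length (replicate l Triv @ corolla k # replicate (n - k - l) Triv) = n - k + 1" using lk by auto
      have c: "\<nu> (n - k + 1) (map fst (take l as) @ \<nu> k (map fst ?a2) # map fst (drop k (drop l as))) \<in> carrier B"
      proof (rule multilinearD(1)[OF ml[OF nkm]])
        show "set (map fst (take l as) @ \<nu> k (map fst ?a2) # map fst (drop k (drop l as))) \<subseteq> carrier B"
          using ccl image_take_drop[OF cl] image_take_drop(2)[OF image_take_drop(2)[OF cl]] by simp
      qed (use lk as in auto)
      have sgn: "sg (int (l * (k + 1) + k)) * (sg (dsum (take l as) * (int k - 2)) :: 'k)
        = (-1) powi (int k + int l + int k * int l + int k * sum_list (take l (map snd as)))"
        unfolding sg_add[symmetric] powi_eq_sg by (rule sg_cong) (simp add: take_map algebra_simps)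
      have X: "map fst (take l as) @ \<nu> k (map fst ?a2) # map fst (drop k (drop l as))
        = take l (map fst as) @ [\<nu> k (take k (drop l (map fst as)))] @ drop (l + k) (map fst as)"
        by (simp add: take_map drop_map add.commute)
      have ev: "ev B \<nu> (?T l k) as = sg (dsum (take l as) * (int k - 2)) \<odot>\<^bsub>B\<^esub>
          \<nu> (n - k + 1) (map fst (take l as) @ \<nu> k (map fst ?a2) # map fst (drop k (drop l as)))"
        by (simp only: ev.simps evl epsl len)
      have lc1: "lc B (\<lambda>T. ev B \<nu> T as) (single (?T l k) (sg (int (l * (k + 1) + k))))
        = sg (int (l * (k + 1) + k)) \<odot>\<^bsub>B\<^esub> ev B \<nu> (?T l k) as"
        by (rule B.lc_single) (rule funcset_mem[OF ev_cl T[OF lk]])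
      show ?thesis
        unfolding lc1 ev B.smult_smult[OF c] sgn X[symmetric] using c by blast
    qed
    show ?thesis
      by (intro B.finsum_cong'[OF refl] Pi_I B.finsum_closed) (use * in auto)
  qed
  also have "\<dots> = \<zero>\<^bsub>B\<^esub>"
  proof (rule nu_relation[OF n])
    show "\<forall>i<n. map fst as ! i \<in> grade B (map snd as ! i)"
      using as unfolding homog_def by (metis case_prodD nth_map nth_mem prod.collapse)
  qed (use as in auto)
  finally show ?thesis .
qed

lemma lc_tw:
  assumes "\<phi> \<in> keys f \<rightarrow> carrier B"
  shows "lc B \<phi> (tw c f) = lc B (\<lambda>S. sg (c * tdeg S) \<odot>\<^bsub>B\<^esub> \<phi> S) f"
proof -
  have "lc B \<phi> (tw c f) = lc B (\<lambda>S. lc B \<phi> (single S (sg (c * tdeg S)))) f"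
    unfolding tw_def by (rule B.lc_linext[OF assms]) auto
  also have "\<dots> = lc B (\<lambda>S. sg (c * tdeg S) \<odot>\<^bsub>B\<^esub> \<phi> S) f"
    by (rule B.lc_cong[OF refl]) (use assms in \<open>auto simp: Pi_iff\<close>)
  finally show ?thesis .
qed

lemma lc_zero_fun: "(\<And>s. s \<in> keys F \<Longrightarrow> \<phi> s = \<zero>\<^bsub>B\<^esub>) \<Longrightarrow> lc B \<phi> F = \<zero>\<^bsub>B\<^esub>"
proof -
  assume "\<And>s. s \<in> keys F \<Longrightarrow> \<phi> s = \<zero>\<^bsub>B\<^esub>"
  then have "lc B \<phi> F = lc B (\<lambda>s. \<zero>\<^bsub>B\<^esub>) F"
    by (intro B.lc_cong) auto
  then show ?thesis by (simp add: lc_def)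
qed

text \<open>
  The twist is there for the induction. By \<open>ev_graft\<close>, the
  evaluation of a composite differs from the composite of the evaluations by signs that depend on the parity of the inserted
  tree, that is, by a twist of the factor that belongs to the ideal.
\<close>

lemma ev_tw_ideal:
  "(n, f) \<in> op_ideal m \<Longrightarrow> homog as \<Longrightarrow> length as = n \<Longrightarrow> lc B (\<lambda>T. ev B \<nu> T as) (tw c f) = \<zero>\<^bsub>B\<^esub>"
proof (induction arbitrary: c as rule: op_ideal.induct)
  case (generator n)
  have v: "vlin B (trees m n) (lc B (\<lambda>T. ev B \<nu> T as))"
    using generator homog_carrier by (intro B.vlin_lc) (auto simp: trees_iff intro!: ev_closed)
  have "keys (Phi n :: _ \<Rightarrow>\<^sub>0 'k) \<subseteq> trees m n" using Phi_keys[OF generator(1,2)] by auto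
  then show ?case
    using generator by (simp add: tw_Phi B.vlinD(2)[OF v] ev_Phi)
next
  case (zero n)
  show ?case by (simp add: tw_def)
next
  case (add n f g)
  have v: "vlin B (trees m n) (lc B (\<lambda>T. ev B \<nu> T as))"
    using add.prems homog_carrier by (intro B.vlin_lc) (auto simp: trees_iff intro!: ev_closed)
  have "tw c (f + g) = tw c f + tw c g" by (simp add: tw_def)
  then show ?case
    using add B.vlinD(3)[OF v keys_tw[OF op_ideal_keys[OF add.hyps(1)]] keys_tw[OF op_ideal_keys[OF add.hyps(2)]]]
    by simp
next
  case (scalar n f d)
  have v: "vlin B (trees m n) (lc B (\<lambda>T. ev B \<nu> T as))"
    using scalar.prems homog_carrier by (intro B.vlin_lc) (auto simp: trees_iff intro!: ev_closed)
  have "tw c (scalar d f) = scalar d (tw c f)" by (simp add: tw_def)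
  then show ?case
    using scalar B.vlinD(2)[OF v keys_tw[OF op_ideal_keys[OF scalar.hyps(1)]]] by simp
next
  case (comp_left n f g p i)
  define a1 a2 a3 where "a1 = take (i - 1) as" and "a2 = take p (drop (i - 1) as)" and "a3 = drop p (drop (i - 1) as)"
  have as: "as = a1 @ a2 @ a3" by (simp add: a1_def a2_def a3_def del: drop_drop)
  have len: "i = Suc (length a1)" "length a2 = p" "n = Suc (length a1 + length a3)"
    using comp_left by (auto simp: a1_def a2_def a3_def)
  have hom: "homog a1" "homog a2" "homog a3" using comp_left.prems as by auto
  note kf = keys_tw[OF op_ideal_keys[OF comp_left.hyps(1)], of c]
  have kg: "keys (tw c g) \<subseteq> trees m p"
    using comp_left.hyps(2) by (simp add: carrier_opF keys_tw)
  have cl: "(\<lambda>T. ev B \<nu> T as) \<in> trees m (n + p - 1) \<rightarrow> carrier B"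
    using comp_left.prems homog_carrier by (auto simp: trees_iff intro!: ev_closed)
  have gr: "graft i T S \<in> trees m (n + p - 1)" if "T \<in> keys (tw c f)" "S \<in> keys (tw c g)" for T S
    using that kf kg graft_props(1)[of i T S m] comp_left.hyps(3,4) by (fastforce simp: trees_iff)
  have "lc B (\<lambda>T. ev B \<nu> T as) (tw c (pcomp i f g)) = lc B (\<lambda>S. lc B (\<lambda>T. lc B (\<lambda>T. ev B \<nu> T as)
      (single (graft i T S) (sg (graft_sgn i T (tdeg S))))) (tw c f)) (tw c g)"
    unfolding tw_pcomp[OF op_ideal_keys[OF comp_left.hyps(1)] comp_left.hyps(3,4)]
    unfolding pcomp_eq
    unfolding linext_swap[of _ "tw c g"]
    by (rule B.lc_linext2[OF cl]) (use gr in auto)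
  also have "\<dots> = \<zero>\<^bsub>B\<^esub>"
  proof (rule lc_zero_fun)
    fix S assume "S \<in> keys (tw c g)"
    then have S: "valid m S" "length a2 = legs S" and Sk: "S \<in> keys (tw c g)" using kg len by (auto simp: trees_iff)
    let ?b = "a1 @ (ev B \<nu> S a2, tdeg S + dsum a2) # a3"
    have hb: "homog ?b" using hom ev_grade[OF S hom(2)] by (auto simp: homog_def)
    have lb: "length ?b = n" using len by simp
    have evb: "ev B \<nu> T ?b \<in> carrier B" if "T \<in> keys (tw c f)" for T
      using that kf lb homog_carrier[OF hb] by (intro ev_closed) (auto simp: trees_iff)
    have "lc B (\<lambda>T. lc B (\<lambda>T. ev B \<nu> T as) (single (graft i T S) (sg (graft_sgn i T (tdeg S))))) (tw c f)
      = lc B (\<lambda>T. sg (tdeg S * dsum a1) \<odot>\<^bsub>B\<^esub> ev B \<nu> T ?b) (tw c f)"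
    proof (rule B.lc_cong[OF refl])
      fix T assume Tk: "T \<in> keys (tw c f)"
      then have T: "valid m T" "legs T = Suc (length a1 + length a3)" using kf len by (auto simp: trees_iff)
      have x: "ev B \<nu> S a2 \<in> carrier B" using S homog_carrier[OF hom(2)] by (intro ev_closed) auto
      obtain \<kappa> L where L: "lmap L" "ev B \<nu> T ?b = sg (\<kappa> * (tdeg S + dsum a2)) \<odot>\<^bsub>B\<^esub> L (ev B \<nu> S a2)"
        "ev B \<nu> (graft i T S) as
          = sg (graft_sgn i T (tdeg S) + tdeg S * dsum a1 + \<kappa> * (tdeg S + dsum a2)) \<odot>\<^bsub>B\<^esub> L (ev B \<nu> S a2)"
        using ev_graft[OF T] homog_carrier hom x S unfolding as len(1) by (fastforce simp: image_Un)
      have "sg (graft_sgn i T (tdeg S)) * sg (graft_sgn i T (tdeg S) + tdeg S * dsum a1 + \<kappa> * (tdeg S + dsum a2))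
        = sg (tdeg S * dsum a1) * (sg (\<kappa> * (tdeg S + dsum a2)) :: 'k)"
        unfolding sg_add[symmetric] by (rule sg_cong) simp
      then show "lc B (\<lambda>T. ev B \<nu> T as) (single (graft i T S) (sg (graft_sgn i T (tdeg S))))
        = sg (tdeg S * dsum a1) \<odot>\<^bsub>B\<^esub> ev B \<nu> T ?b"
        using L lmapD(1)[OF L(1) x] by simp
      show "sg (tdeg S * dsum a1) \<odot>\<^bsub>B\<^esub> ev B \<nu> T ?b \<in> carrier B" using evb[OF Tk] by simp
    qed
    also have "\<dots> = sg (tdeg S * dsum a1) \<odot>\<^bsub>B\<^esub> lc B (\<lambda>T. ev B \<nu> T ?b) (tw c f)"
      using evb by (intro B.lc_smult_fun) auto
    also have "\<dots> = \<zero>\<^bsub>B\<^esub>" using comp_left.IH[OF hb lb] by simp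
    finally show "lc B (\<lambda>T. lc B (\<lambda>T. ev B \<nu> T as)
      (single (graft i T S) (sg (graft_sgn i T (tdeg S))))) (tw c f) = \<zero>\<^bsub>B\<^esub>" .
  qed
  finally show ?case .
next
  case (comp_right f n p g i)
  define a1 a2 a3 where "a1 = take (i - 1) as" and "a2 = take p (drop (i - 1) as)" and "a3 = drop p (drop (i - 1) as)"
  have as: "as = a1 @ a2 @ a3" by (simp add: a1_def a2_def a3_def del: drop_drop)
  have len: "i = Suc (length a1)" "length a2 = p" "n = Suc (length a1 + length a3)"
    using comp_right by (auto simp: a1_def a2_def a3_def)
  have hom: "homog a1" "homog a2" "homog a3" using comp_right.prems as by auto
  note kg = keys_tw[OF op_ideal_keys[OF comp_right.hyps(2)], of c]
  have f: "keys f \<subseteq> trees m n" using comp_right.hyps(1) by (simp add: carrier_opF)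
  note kf = keys_tw[OF f, of c]
  have cl: "(\<lambda>T. ev B \<nu> T as) \<in> trees m (n + p - 1) \<rightarrow> carrier B"
    using comp_right.prems homog_carrier by (auto simp: trees_iff intro!: ev_closed)
  have gr: "graft i T S \<in> trees m (n + p - 1)" if "T \<in> keys (tw c f)" "S \<in> keys (tw c g)" for T S
    using that kf kg graft_props(1)[of i T S m] comp_right.hyps(3,4) by (fastforce simp: trees_iff)
  have "lc B (\<lambda>T. ev B \<nu> T as) (tw c (pcomp i f g)) = lc B (\<lambda>T. lc B (\<lambda>S. lc B (\<lambda>T. ev B \<nu> T as)
      (single (graft i T S) (sg (graft_sgn i T (tdeg S))))) (tw c g)) (tw c f)"
    unfolding tw_pcomp[OF f comp_right.hyps(3,4)]
    unfolding pcomp_eq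
    by (rule B.lc_linext2[OF cl]) (use gr in auto)
  also have "\<dots> = \<zero>\<^bsub>B\<^esub>"
  proof (rule lc_zero_fun)
    fix T assume "T \<in> keys (tw c f)"
    then have T: "valid m T" "legs T = Suc (length a1 + length a3)" using kf len by (auto simp: trees_iff)
    obtain \<kappa> L where L: "lmap L"
      "\<And>S. valid m S \<Longrightarrow> length a2 = legs S \<Longrightarrow> ev B \<nu> (graft i T S) as
          = sg (graft_sgn i T (tdeg S) + tdeg S * dsum a1 + \<kappa> * (tdeg S + dsum a2)) \<odot>\<^bsub>B\<^esub> L (ev B \<nu> S a2)"
      using ev_graft[OF T] homog_carrier[OF hom(1)] homog_carrier[OF hom(2)] homog_carrier[OF hom(3)]
      unfolding as len(1) image_Un by (metis (no_types, lifting) Un_least)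
    have ev2: "ev B \<nu> S a2 \<in> carrier B" if "S \<in> keys (tw c g)" for S
      using that kg len homog_carrier[OF hom(2)] by (intro ev_closed) (auto simp: trees_iff)
    let ?c = "dsum a1 + \<kappa>"
    have "lc B (\<lambda>S. lc B (\<lambda>T. ev B \<nu> T as) (single (graft i T S) (sg (graft_sgn i T (tdeg S))))) (tw c g)
      = lc B (\<lambda>S. sg (\<kappa> * dsum a2) \<odot>\<^bsub>B\<^esub> (sg (?c * tdeg S) \<odot>\<^bsub>B\<^esub> L (ev B \<nu> S a2))) (tw c g)"
    proof (rule B.lc_cong[OF refl])
      fix S assume Sk: "S \<in> keys (tw c g)"
      then have S: "valid m S" "length a2 = legs S" using kg len by (auto simp: trees_iff)
      have "sg (graft_sgn i T (tdeg S)) * sg (graft_sgn i T (tdeg S) + tdeg S * dsum a1 + \<kappa> * (tdeg S + dsum a2))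
        = sg (\<kappa> * dsum a2) * (sg (?c * tdeg S) :: 'k)"
        unfolding sg_add[symmetric] by (rule sg_cong) (simp add: algebra_simps)
      then show "lc B (\<lambda>T. ev B \<nu> T as) (single (graft i T S) (sg (graft_sgn i T (tdeg S))))
        = sg (\<kappa> * dsum a2) \<odot>\<^bsub>B\<^esub> (sg (?c * tdeg S) \<odot>\<^bsub>B\<^esub> L (ev B \<nu> S a2))"
        using L(2)[OF S] lmapD(1)[OF L(1) ev2[OF Sk]] by simp
      show "sg (\<kappa> * dsum a2) \<odot>\<^bsub>B\<^esub> (sg (?c * tdeg S) \<odot>\<^bsub>B\<^esub> L (ev B \<nu> S a2)) \<in> carrier B"
        using lmapD(1)[OF L(1) ev2[OF Sk]] by simp
    qed
    also have "\<dots> = sg (\<kappa> * dsum a2) \<odot>\<^bsub>B\<^esub> lc B (\<lambda>S. sg (?c * tdeg S) \<odot>\<^bsub>B\<^esub> L (ev B \<nu> S a2)) (tw c g)"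
      using lmapD(1)[OF L(1) ev2] by (intro B.lc_smult_fun) auto
    also have "lc B (\<lambda>S. sg (?c * tdeg S) \<odot>\<^bsub>B\<^esub> L (ev B \<nu> S a2)) (tw c g) = lc B (\<lambda>S. L (ev B \<nu> S a2)) (tw ?c (tw c g))"
      using lmapD(1)[OF L(1) ev2] by (intro lc_tw[symmetric]) auto
    also have "\<dots> = L (lc B (\<lambda>S. ev B \<nu> S a2) (tw ?c (tw c g)))"
      using ev2 keys_tw[of "tw c g" "keys (tw c g)" ?c] by (intro lmap_lc[OF L(1), symmetric]) auto
    also have "lc B (\<lambda>S. ev B \<nu> S a2) (tw ?c (tw c g)) = \<zero>\<^bsub>B\<^esub>"
      unfolding tw_tw by (rule comp_right.IH[OF hom(2) len(2)])
    also have "L \<zero>\<^bsub>B\<^esub> = \<zero>\<^bsub>B\<^esub>"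
      using lmapD(1,2)[OF L(1), of "\<zero>\<^bsub>B\<^esub>"] by (metis B.smult_0_left B.zero_closed)
    finally show "lc B (\<lambda>S. lc B (\<lambda>T. ev B \<nu> T as)
      (single (graft i T S) (sg (graft_sgn i T (tdeg S))))) (tw c g) = \<zero>\<^bsub>B\<^esub>"
      by simp
  qed
  finally show ?case .
qed

lemma ev_ideal:
  assumes "(n, f) \<in> op_ideal m" "homog as" "length as = n"
  shows "lc B (\<lambda>T. ev B \<nu> T as) f = \<zero>\<^bsub>B\<^esub>"
proof -
  have "tw 0 f = f" by (simp add: tw_def)
  then show ?thesis using ev_tw_ideal[OF assms, of 0] by simp
qed

lemma ev_nf:
  assumes "valid m T" "1 \<le> m" "homog as" "length as = legs T"
  shows "lc B (\<lambda>T. ev B \<nu> T as) (nf T) = ev B \<nu> T as"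
proof -
  have cl: "(\<lambda>T. ev B \<nu> T as) \<in> trees m (legs T) \<rightarrow> carrier B"
    using assms homog_carrier by (auto simp: trees_iff intro!: ev_closed)
  let ?d = "nf T - single T 1 :: _ \<Rightarrow>\<^sub>0 'k"
  have d: "(legs T, ?d) \<in> op_ideal m" by (rule nf_cong[OF assms(1,2)])
  have T: "keys (single T (1 :: 'k)) \<subseteq> trees m (legs T)" "T \<in> trees m (legs T)"
    using assms(1) by (auto simp: trees_iff)
  have "lc B (\<lambda>T. ev B \<nu> T as) (?d + single T 1)
    = lc B (\<lambda>T. ev B \<nu> T as) ?d \<oplus>\<^bsub>B\<^esub> lc B (\<lambda>T. ev B \<nu> T as) (single T 1)"
    by (rule B.vlinD(3)[OF B.vlin_lc[OF cl] op_ideal_keys[OF d] T(1)])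
  moreover have "ev B \<nu> T as \<in> carrier B" using cl T(2) by auto
  ultimately show ?thesis
    using ev_ideal[OF d assms(3,4)] by simp
qed

end


section \<open>Free graded vector spaces\<close>

lemma free_gr_space_simps [simp]:
  "carrier (free_gr_space dg S) = {F. keys F \<subseteq> S}"
  "F \<oplus>\<^bsub>free_gr_space dg S\<^esub> G = F + G"
  "c \<odot>\<^bsub>free_gr_space dg S\<^esub> F = scalar c F"
  "\<zero>\<^bsub>free_gr_space dg S\<^esub> = 0"
  "grade (free_gr_space dg S) d = {F. keys F \<subseteq> {s \<in> S. dg s = d}}"
  by (simp_all add: free_gr_space_def with_grading_def free_space_def mk_module_def
     gr_module.defs module.defs)

lemma vspace_poly_mapping:
  fixes V :: "('k::field_char_0, 'a \<Rightarrow>\<^sub>0 'k, 'e) module_scheme"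
  assumes V: "carrier V = {F. keys F \<subseteq> S}" "\<And>F G. F \<oplus>\<^bsub>V\<^esub> G = F + G"
    "\<And>c F. c \<odot>\<^bsub>V\<^esub> F = scalar c F" "\<zero>\<^bsub>V\<^esub> = 0"
  shows "vspace V"
proof (intro vspace.intro moduleI)
  show "abelian_group V"
  proof (rule abelian_groupI)
    fix F :: "'a \<Rightarrow>\<^sub>0 'k" assume "F \<in> carrier V"
    then show "\<exists>G\<in>carrier V. G \<oplus>\<^bsub>V\<^esub> F = \<zero>\<^bsub>V\<^esub>"
      by (intro bexI[of _ "- F"]) (auto simp: V)
  qed (auto simp: V add.assoc add.commute dest: subsetD[OF Poly_Mapping.keys_add])
qed (auto simp: V cring_from_type_algebra scalar_add scalar_add_left dest: subsetD[OF keys_scalar_subset])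

lemma vspace_free: "vspace (free_gr_space dg S :: ('k::field_char_0, _) gr_module)"
  by (rule vspace_poly_mapping[of _ S]) simp_all

lemma finsum_free:
  "f \<in> A \<rightarrow> {F. keys F \<subseteq> S} \<Longrightarrow> finsum (free_gr_space dg S :: ('k::field_char_0, _) gr_module) f A = sum f A"
proof -
  interpret vspace "free_gr_space dg S :: ('k, _) gr_module" by (rule vspace_free)
  show "f \<in> A \<rightarrow> {F. keys F \<subseteq> S} \<Longrightarrow> finsum (free_gr_space dg S :: ('k, _) gr_module) f A = sum f A"
  proof (induction A rule: infinite_finite_induct)
    case (insert a A)
    then show ?case by (subst finsum_insert) auto
  qed simp_all
qed

lemma lc_free:
  assumes "\<And>s. s \<in> keys F \<Longrightarrow> keys (\<phi> s) \<subseteq> S"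
  shows "lc (free_gr_space dg S :: ('k::field_char_0, _) gr_module) \<phi> F = linext \<phi> F"
  unfolding lc_def linext_def
  by (subst finsum_free) (use assms in \<open>auto dest: subsetD[OF keys_scalar_subset]\<close>)

text \<open>
  The component of degree \<open>d\<close>. The index type is arbitrary since the same projection serves for the summands of a direct sum.
\<close>

definition part :: "('a \<Rightarrow> 'd) \<Rightarrow> 'd \<Rightarrow> ('a \<Rightarrow>\<^sub>0 'k::field_char_0) \<Rightarrow> ('a \<Rightarrow>\<^sub>0 'k)"
  where "part dg d = linext (\<lambda>s. if dg s = d then single s 1 else 0)"

lemma lookup_part: "lookup (part dg d F) s = (if dg s = d then lookup F s else 0)"
proof -
  have "lookup (part dg d F) s
    = (\<Sum>a\<in>keys F. if s = a then (if dg s = d then lookup F s else 0) else 0)"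
    unfolding part_def linext_def lookup_sum
    by (rule sum.cong[OF refl]) (simp add: lookup_scalar lookup_single when_def)
  also have "\<dots> = (if dg s = d then lookup F s else 0)"
    by (simp add: in_keys_iff)
  finally show ?thesis .
qed

lemma part_decomposition:
  "finite {d. part dg d v \<noteq> 0}" "(\<Sum>d\<in>{d. part dg d v \<noteq> 0}. part dg d v) = v"
proof -
  have "{d. part dg d v \<noteq> 0} \<subseteq> dg ` keys v"
  proof
    fix d assume "d \<in> {d. part dg d v \<noteq> 0}"
    then have ne: "part dg d v \<noteq> 0" by simp
    have "\<exists>s. lookup (part dg d v) s \<noteq> 0"
    proof (rule ccontr)
      assume "\<nexists>s. lookup (part dg d v) s \<noteq> 0"
      then have "part dg d v = 0" by (intro poly_mapping_eqI) simp
      with ne show False by contradiction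
    qed
    then show "d \<in> dg ` keys v"
      by (auto simp: lookup_part in_keys_iff split: if_splits)
  qed
  then show fin: "finite {d. part dg d v \<noteq> 0}" by (rule finite_subset) simp
  show "(\<Sum>d\<in>{d. part dg d v \<noteq> 0}. part dg d v) = v"
  proof (rule poly_mapping_eqI)
    fix s
    have "(\<Sum>d\<in>{d. part dg d v \<noteq> 0}. if dg s = d then lookup v s else 0) = lookup v s"
    proof (cases "lookup v s = 0")
      case False
      then have "lookup (part dg (dg s) v) s \<noteq> 0" by (simp add: lookup_part)
      then have "dg s \<in> {d. part dg d v \<noteq> 0}" by auto
      then show ?thesis using fin by simp
    qed (simp cong: if_cong)
    then show "lookup (\<Sum>d\<in>{d. part dg d v \<noteq> 0}. part dg d v) s = lookup v s"
      by (simp add: lookup_sum lookup_part)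
  qed
qed

lemma graded_free: "graded_space (free_gr_space dg S :: ('k::field_char_0, _) gr_module)"
proof -
  let ?V = "free_gr_space dg S :: ('k, _) gr_module"
  interpret vspace ?V by (rule vspace_free)
  have "\<exists>!c. (\<forall>d. c d \<in> grade ?V d) \<and> finite {d. c d \<noteq> \<zero>\<^bsub>?V\<^esub>} \<and> v = finsum ?V c {d. c d \<noteq> \<zero>\<^bsub>?V\<^esub>}"
    if v: "v \<in> carrier ?V" for v
  proof (rule ex1I[of _ "\<lambda>d. part dg d v"], intro conjI allI)
    show gr: "part dg d v \<in> grade ?V d" for d
      using v by (auto simp: in_keys_iff lookup_part split: if_splits)
    show "finite {d. part dg d v \<noteq> \<zero>\<^bsub>?V\<^esub>}" using part_decomposition(1) by simp
    have "v = (\<Sum>d\<in>{d. part dg d v \<noteq> 0}. part dg d v)" by (rule part_decomposition(2)[symmetric])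
    also have "\<dots> = finsum ?V (\<lambda>d. part dg d v) {d. part dg d v \<noteq> \<zero>\<^bsub>?V\<^esub>}"
      using gr by (subst finsum_free) auto
    finally show "v = finsum ?V (\<lambda>d. part dg d v) {d. part dg d v \<noteq> \<zero>\<^bsub>?V\<^esub>}" .
  next
    fix c assume c: "(\<forall>d. c d \<in> grade ?V d) \<and> finite {d. c d \<noteq> \<zero>\<^bsub>?V\<^esub>} \<and> v = finsum ?V c {d. c d \<noteq> \<zero>\<^bsub>?V\<^esub>}"
    then have v': "v = sum c {d. c d \<noteq> 0}" and fin: "finite {d. c d \<noteq> 0}"
      by (auto simp: finsum_free subset_iff)
    have z: "lookup (c d) s = 0" if "dg s \<noteq> d" for d s
      using c that by (auto simp: in_keys_iff subset_iff)
    show "c = (\<lambda>d. part dg d v)"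
    proof (rule ext, rule poly_mapping_eqI)
      fix d s
      have "lookup v s = (\<Sum>e\<in>{d. c d \<noteq> 0}. lookup (c e) s)"
        by (subst v') (simp add: lookup_sum)
      also have "\<dots> = (\<Sum>e\<in>{d. c d \<noteq> 0}. if e = dg s then lookup (c (dg s)) s else 0)"
        by (rule sum.cong) (auto simp: z)
      also have "\<dots> = lookup (c (dg s)) s"
        using fin by (auto simp: sum.delta)
      finally show "lookup (c d) s = lookup (part dg d v) s"
        using z[of s d] by (auto simp: lookup_part)
    qed
  qed
  moreover have "subspace_of ?V (grade ?V d)" for d
    by (rule subspaceI)
      (auto dest!: subsetD[OF Poly_Mapping.keys_add] subsetD[OF keys_scalar_subset])
  ultimately show ?thesis
    unfolding graded_space_def using module_V by blast
qed


section \<open>Multilinear extension\<close>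

text \<open>
  The multilinear extension of \<open>\<phi>\<close> from basis elements, obtained as a linear map on the tensor algebra.
\<close>

definition mex :: "('a list \<Rightarrow> 'b \<Rightarrow>\<^sub>0 'k::field_char_0) \<Rightarrow> ('a \<Rightarrow>\<^sub>0 'k) list \<Rightarrow> ('b \<Rightarrow>\<^sub>0 'k)"
  where "mex \<phi> ps = linext (\<lambda>w. \<phi> (letters w)) (prod_list (map emb ps))"

lemma mex_Nil [simp]: "mex \<phi> [] = \<phi> []"
  by (simp add: mex_def flip: wd_Nil)

lemma mex_Cons: "mex \<phi> (p # ps) = linext (\<lambda>a. mex (\<lambda>as. \<phi> (a # as)) ps) p"
  by (simp add: mex_def linext_emb_mult)

lemma mex_append: "mex \<phi> (ps @ qs) = mex (\<lambda>as. mex (\<lambda>bs. \<phi> (as @ bs)) qs) ps"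
  by (induction ps arbitrary: \<phi>) (simp_all add: mex_Cons)

lemma mex_cong:
  assumes "\<And>as. list_all2 (\<lambda>a p. a \<in> keys p) as ps \<Longrightarrow> \<phi> as = \<psi> as"
  shows "mex \<phi> ps = mex \<psi> ps"
  using assms
proof (induction ps arbitrary: \<phi> \<psi>)
  case (Cons p ps)
  show ?case
    unfolding mex_Cons by (rule linext_cong[OF refl], rule Cons.IH) (auto intro: Cons.prems)
qed simp

lemma keys_mex:
  assumes "\<And>as. list_all2 (\<lambda>a p. a \<in> keys p) as ps \<Longrightarrow> keys (\<phi> as) \<subseteq> S"
  shows "keys (mex \<phi> ps) \<subseteq> S"
  using assms
proof (induction ps arbitrary: \<phi>)
  case (Cons p ps)
  show ?case
    unfolding mex_Cons by (rule keys_linext_subset, rule Cons.IH, rule Cons.prems) simp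
qed simp

lemma mex_lin: "lin f \<Longrightarrow> f (mex \<phi> ps) = mex (\<lambda>as. f (\<phi> as)) ps"
  unfolding mex_def by (rule lin_linext_apply)

lemma mex_linext: "mex (\<lambda>as. linext (\<lambda>b. \<phi> as b) q) ps = linext (\<lambda>b. mex (\<lambda>as. \<phi> as b) ps) q"
  unfolding mex_def by (rule linext_swap)

lemma mex_sum: "mex (\<lambda>as. \<Sum>i\<in>I. \<phi> i as) ps = (\<Sum>i\<in>I. mex (\<phi> i) ps)"
  unfolding mex_def by (rule linext_sum_fun)

lemma mex_scalar: "mex (\<lambda>as. scalar c (\<phi> as)) ps = scalar c (mex \<phi> ps)"
  unfolding mex_def by (rule linext_scalar_fun)

lemma mex_singles: "mex \<phi> (map (\<lambda>a. single a 1) as) = \<phi> as"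
  by (induction as arbitrary: \<phi>) (simp_all add: mex_Cons)

lemma lin_mex: "lin (\<lambda>p. mex \<phi> (xs @ p # zs))"
  unfolding mex_append mex_Cons mex_linext by (rule lin_linext)

lemma mex_zero [simp]: "mex (\<lambda>as. 0) ps = 0"
  by (simp add: mex_def)

lemma mex_nested:
  "mex \<phi> (as @ mex \<psi> bs # cs) = mex (\<lambda>ws. linext (\<lambda>z. \<phi> (take (length as) ws @ z # drop (length as + length bs) ws))
      (\<psi> (take (length bs) (drop (length as) ws)))) (as @ bs @ cs)"
proof -
  have "mex \<phi> (as @ mex \<psi> bs # cs)
    = mex (\<lambda>us. mex (\<lambda>b. mex (\<lambda>vs. linext (\<lambda>z. \<phi> (us @ z # vs)) (\<psi> b)) cs) bs) as"
    unfolding mex_append mex_Cons mex_lin[OF lin_linext] mex_linext by (rule refl)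
  also have "\<dots> = mex (\<lambda>us. mex (\<lambda>b. mex (\<lambda>vs. linext (\<lambda>z. \<phi> (take (length as) (us @ b @ vs) @ z # drop (length as + length bs) (us @ b @ vs)))
      (\<psi> (take (length bs) (drop (length as) (us @ b @ vs))))) cs) bs) as"
    by (intro mex_cong) (auto dest!: list_all2_lengthD)
  finally show ?thesis unfolding mex_append .
qed

lemma multilinear_mex:
  assumes "\<And>bs. length bs = k \<Longrightarrow> set bs \<subseteq> S \<Longrightarrow> keys (\<phi> bs) \<subseteq> S'"
  shows "multilinear k (free_gr_space dg S) (free_gr_space dg' S' :: ('k::field_char_0, _) gr_module) (mex \<phi>)"
proof (rule multilinearI)
  fix as :: "('a \<Rightarrow>\<^sub>0 'k) list" assume as: "length as = k" "set as \<subseteq> carrier (free_gr_space dg S)"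
  have "keys (mex \<phi> as) \<subseteq> S'"
  proof (rule keys_mex)
    fix bs assume bs: "list_all2 (\<lambda>a p. a \<in> keys p) bs as"
    have "set bs \<subseteq> S"
    proof
      fix b assume "b \<in> set bs"
      then obtain i where "i < length bs" "b = bs ! i" by (auto simp: in_set_conv_nth)
      then have "b \<in> keys (as ! i)" "as ! i \<in> set as"
        using bs list_all2_lengthD[OF bs] by (auto simp: list_all2_conv_all_nth)
      then show "b \<in> S" using as(2) by auto
    qed
    then show "keys (\<phi> bs) \<subseteq> S'"
      using assms as(1) list_all2_lengthD[OF bs] by simp
  qed
  then show "mex \<phi> as \<in> carrier (free_gr_space dg' S')" by simp
qed (simp_all add: lin_addD[OF lin_mex] lin_scalarD[OF lin_mex])

definition lhom :: "('k::field_char_0, 'v) gr_module \<Rightarrow> ('k, 'w) gr_module \<Rightarrow> ('v \<Rightarrow> 'w) \<Rightarrow> bool"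
  where "lhom V W h \<longleftrightarrow> (\<forall>x\<in>carrier V. h x \<in> carrier W \<and> (\<forall>c. h (c \<odot>\<^bsub>V\<^esub> x) = c \<odot>\<^bsub>W\<^esub> h x) \<and>
    (\<forall>y\<in>carrier V. h (x \<oplus>\<^bsub>V\<^esub> y) = h x \<oplus>\<^bsub>W\<^esub> h y))"

lemma lhomD:
  assumes "lhom V W h" "x \<in> carrier V"
  shows "h x \<in> carrier W" "h (c \<odot>\<^bsub>V\<^esub> x) = c \<odot>\<^bsub>W\<^esub> h x" "y \<in> carrier V \<Longrightarrow> h (x \<oplus>\<^bsub>V\<^esub> y) = h x \<oplus>\<^bsub>W\<^esub> h y"
  using assms unfolding lhom_def by blast+

lemma lhomI:
  assumes "\<And>x. x \<in> carrier V \<Longrightarrow> h x \<in> carrier W" "\<And>x c. x \<in> carrier V \<Longrightarrow> h (c \<odot>\<^bsub>V\<^esub> x) = c \<odot>\<^bsub>W\<^esub> h x"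
    "\<And>x y. x \<in> carrier V \<Longrightarrow> y \<in> carrier V \<Longrightarrow> h (x \<oplus>\<^bsub>V\<^esub> y) = h x \<oplus>\<^bsub>W\<^esub> h y"
  shows "lhom V W h"
  unfolding lhom_def using assms by blast

lemma multilinear_lhom_out:
  assumes f: "multilinear k V W f" and h: "lhom W Z h"
  shows "multilinear k V Z (\<lambda>as. h (f as))"
proof (rule multilinearI)
  note M = multilinearD[OF f]
  show "h (f as) \<in> carrier Z" if "length as = k" "set as \<subseteq> carrier V" for as
    by (rule lhomD(1)[OF h M(1)[OF that]])
  fix xs zs x assume a: "Suc (length xs + length zs) = k" "set xs \<union> set zs \<subseteq> carrier V" and x: "x \<in> carrier V"
  have cl: "f (xs @ x # zs) \<in> carrier W" if "x \<in> carrier V" for x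
    using a that by (intro M(1)) auto
  show "h (f (xs @ (x \<oplus>\<^bsub>V\<^esub> y) # zs)) = h (f (xs @ x # zs)) \<oplus>\<^bsub>Z\<^esub> h (f (xs @ y # zs))" if y: "y \<in> carrier V" for y
    unfolding M(2)[OF a x y] by (rule lhomD(3)[OF h cl[OF x] cl[OF y]])
  show "h (f (xs @ (c \<odot>\<^bsub>V\<^esub> x) # zs)) = c \<odot>\<^bsub>Z\<^esub> h (f (xs @ x # zs))" for c
    unfolding M(3)[OF a x] by (rule lhomD(2)[OF h cl[OF x]])
qed

lemma multilinear_lhom_in:
  assumes h: "lhom V W h" and f: "multilinear k W Z f"
  shows "multilinear k V Z (\<lambda>as. f (map h as))"
proof (rule multilinearI)
  note M = multilinearD[OF f]
  show "f (map h as) \<in> carrier Z" if "length as = k" "set as \<subseteq> carrier V" for as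
    using that lhomD(1)[OF h] by (intro M(1)) auto
  fix xs zs x assume a: "Suc (length xs + length zs) = k" "set xs \<union> set zs \<subseteq> carrier V" and x: "x \<in> carrier V"
  have a': "Suc (length (map h xs) + length (map h zs)) = k" "set (map h xs) \<union> set (map h zs) \<subseteq> carrier W"
    using a lhomD(1)[OF h] by auto
  show "f (map h (xs @ (x \<oplus>\<^bsub>V\<^esub> y) # zs)) = f (map h (xs @ x # zs)) \<oplus>\<^bsub>Z\<^esub> f (map h (xs @ y # zs))" if y: "y \<in> carrier V" for y
    using M(2)[OF a' lhomD(1)[OF h x] lhomD(1)[OF h y]] by (simp add: lhomD(3)[OF h x y])
  show "f (map h (xs @ (c \<odot>\<^bsub>V\<^esub> x) # zs)) = c \<odot>\<^bsub>Z\<^esub> f (map h (xs @ x # zs))" for c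
    using M(3)[OF a' lhomD(1)[OF h x]] by (simp add: lhomD(2)[OF h x])
qed

lemma multilinear_eqI:
  assumes f: "multilinear k (free_gr_space dg S) W f" and g: "multilinear k (free_gr_space dg S) W g"
    and W: "vspace (W :: ('k::field_char_0, 'w) gr_module)"
    and eq: "\<And>bs. length bs = k \<Longrightarrow> set bs \<subseteq> S \<Longrightarrow>
      f (map (\<lambda>b. single b 1) bs) = g (map (\<lambda>b. single b 1) bs)"
    and as: "length as = k" "\<And>a. a \<in> set as \<Longrightarrow> keys a \<subseteq> S"
  shows "f as = g as"
proof -
  interpret W: vspace W by (rule W)
  let ?s = "map (\<lambda>b. single b (1 :: 'k))"
  have "f (?s bs @ as) = g (?s bs @ as)"
    if "length bs + length as = k" "set bs \<subseteq> S" "\<And>a. a \<in> set as \<Longrightarrow> keys a \<subseteq> S" for bs as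
    using that
  proof (induction as arbitrary: bs)
    case Nil
    then show ?case using eq by simp
  next
    case (Cons a as)
    have l: "Suc (length (?s bs) + length as) = k" using Cons.prems(1) by simp
    have c: "set (?s bs) \<union> set as \<subseteq> carrier (free_gr_space dg S)"
      using Cons.prems(2,3) by (auto simp: subset_iff)
    have v: "vlin W S (\<lambda>F. f' (?s bs @ F # as))" if f': "multilinear k (free_gr_space dg S) W f'" for f'
    proof (rule W.vlinI)
      note M = multilinearD[OF f']
      fix F :: "'a \<Rightarrow>\<^sub>0 'k" assume F: "keys F \<subseteq> S"
      show "f' (?s bs @ F # as) \<in> carrier W"
        using l c F by (intro M(1)) auto
      show "f' (?s bs @ scalar d F # as) = d \<odot>\<^bsub>W\<^esub> f' (?s bs @ F # as)" for d
        using M(3)[OF l c, of F d] F by simp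
      show "f' (?s bs @ (F + G) # as) = f' (?s bs @ F # as) \<oplus>\<^bsub>W\<^esub> f' (?s bs @ G # as)"
        if "keys G \<subseteq> S" for G
        using M(2)[OF l c, of F G] F that by simp
    qed
    show ?case
    proof (rule W.vlin_eqI[OF v[OF f] v[OF g]])
      show "keys a \<subseteq> S" using Cons.prems(3) by simp
      fix s assume "s \<in> keys a"
      then have "s \<in> S" using Cons.prems(3)[of a] by auto
      then show "f (?s bs @ single s 1 # as) = g (?s bs @ single s 1 # as)"
        using Cons.IH[of "bs @ [s]"] Cons.prems by simp
    qed
  qed
  from this[of "[]" as] show ?thesis using as by simp
qed


section \<open>The algebra of decorated admissible trees\<close>

definition basis :: "enat \<Rightarrow> 'e set \<Rightarrow> (ptree \<times> 'e list) set"
  where "basis m E = {(T, es). valid m T \<and> adm T \<and> length es = legs T \<and> set es \<subseteq> E}"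

definition bdeg :: "('e \<Rightarrow> int) \<Rightarrow> ptree \<times> 'e list \<Rightarrow> int"
  where "bdeg dg b = tdeg (fst b) + sum_list (map dg (snd b))"

definition tag :: "'e list \<Rightarrow> (ptree \<Rightarrow>\<^sub>0 'k::field_char_0) \<Rightarrow> (ptree \<times> 'e list \<Rightarrow>\<^sub>0 'k)"
  where "tag es = linext (\<lambda>T. single (T, es) 1)"

text \<open>
  The exponent of the Koszul sign \<open>\<epsilon>\<close>: the decorations of each factor are moved past the trees of all later ones.
\<close>

fun epsb :: "('e \<Rightarrow> int) \<Rightarrow> (ptree \<times> 'e list) list \<Rightarrow> int"
  where
    "epsb dg [] = 0"
  | "epsb dg (b # bs) = sum_list (map dg (snd b)) * sum_list (map (tdeg \<circ> fst) bs) + epsb dg bs"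

definition mu0 :: "('e \<Rightarrow> int) \<Rightarrow> (ptree \<times> 'e list) list \<Rightarrow> (ptree \<times> 'e list \<Rightarrow>\<^sub>0 'k::field_char_0)"
  where "mu0 dg bs = scalar (sg (epsb dg bs)) (tag (concat (map snd bs)) (nf (Vertex (map fst bs))))"

definition muP :: "('e \<Rightarrow> int) \<Rightarrow> nat \<Rightarrow> (ptree \<times> 'e list \<Rightarrow>\<^sub>0 'k::field_char_0) list \<Rightarrow> (ptree \<times> 'e list \<Rightarrow>\<^sub>0 'k)"
  where "muP dg k = mex (mu0 dg)"

abbreviation freeP :: "enat \<Rightarrow> 'e set \<Rightarrow> ('e \<Rightarrow> int) \<Rightarrow> ('k::field_char_0, ptree \<times> 'e list \<Rightarrow>\<^sub>0 'k) gr_module"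
  where "freeP m E dg \<equiv> free_gr_space (bdeg dg) (basis m E)"

lemma lin_tag [simp]: "lin (tag es)"
  by (simp add: tag_def)

lemma linext_tag: "linext \<phi> (tag es f) = linext (\<lambda>T. \<phi> (T, es)) f"
  by (simp add: tag_def linext_linext)

lemma epsb_append: "epsb dg (bs @ cs) = epsb dg bs
    + sum_list (map (\<lambda>b. sum_list (map dg (snd b))) bs) * sum_list (map (tdeg \<circ> fst) cs) + epsb dg cs"
  by (induction bs) (simp_all add: algebra_simps o_def)

lemma sum_list_concat_snd: "sum_list (map dg (concat (map snd bs))) = sum_list (map (\<lambda>b. sum_list (map dg (snd b))) bs)"
  by (induction bs) simp_all

lemma sum_list_bdeg: "sum_list (map (bdeg dg) x)
    = sum_list (map tdeg (map fst x)) + sum_list (map (\<lambda>b. sum_list (map dg (snd b))) x)"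
  by (induction x) (simp_all add: bdeg_def)

lemma keys_mu0:
  assumes "1 \<le> m" "bs \<noteq> []" "enat (length bs) \<le> m" "set bs \<subseteq> basis m E"
  shows "keys (mu0 dg bs :: _ \<Rightarrow>\<^sub>0 'k::field_char_0)
    \<subseteq> {b \<in> basis m E. bdeg dg b = sum_list (map (bdeg dg) bs) + int (length bs) - 2}"
  unfolding mu0_def tag_def
proof (intro keys_le keys_linext_subset)
  fix T' assume T': "T' \<in> keys (nf (Vertex (map fst bs)) :: _ \<Rightarrow>\<^sub>0 'k)"
  have g: "goodN m (Vertex (map fst bs)) T'" by (rule keys_nf[OF assms(1) T'])
  have v: "valid m (Vertex (map fst bs))" using assms by (auto simp: basis_def Suc_le_eq)
  have l: "length (concat (map snd bs)) = sum_list (map (legs \<circ> fst) bs)" "set (concat (map snd bs)) \<subseteq> E"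
    using assms(4) by (induction bs) (auto simp: basis_def)
  have d: "sum_list (map (bdeg dg) bs) = sum_list (map (tdeg \<circ> fst) bs) + sum_list (map dg (concat (map snd bs)))"
    by (induction bs) (simp_all add: bdeg_def)
  have "(T', concat (map snd bs)) \<in> {b \<in> basis m E. bdeg dg b = sum_list (map (bdeg dg) bs) + int (length bs) - 2}"
    using g v l d by (auto simp: basis_def goodN_def bdeg_def o_def)
  then show "keys (single (T', concat (map snd bs)) (1 :: 'k))
    \<subseteq> {b \<in> basis m E. bdeg dg b = sum_list (map (bdeg dg) bs) + int (length bs) - 2}"
    by simp
qed

lemma nf_Nil: "nf (Vertex (x @ Vertex [] # z)) = 0"
  by (simp add: nf_def rho_def snfs_append tops_def treeop_simps lin_0[OF lin_emb] flip: wd_Nil)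

lemma nf_relation_sum:
  "(\<Sum>l\<in>{0..<length Ts}. \<Sum>k\<in>{1..length Ts - l}. scalar (sg (om (take l Ts) k))
      (nf (Vertex (take l Ts @ Vertex (take k (drop l Ts)) # drop (l + k) Ts)))) = (0 :: _ \<Rightarrow>\<^sub>0 'k::field_char_0)"
proof -
  let ?f = "\<lambda>l k. scalar (sg (om (take l Ts) k))
      (nf (Vertex (take l Ts @ Vertex (take k (drop l Ts)) # drop (l + k) Ts))) :: _ \<Rightarrow>\<^sub>0 'k"
  have "(\<Sum>l\<in>{0..<length Ts}. \<Sum>k\<in>{1..length Ts - l}. ?f l k) = (\<Sum>l\<in>{0..<length Ts}. \<Sum>k\<le>length Ts - l. ?f l k)"
    by (intro sum.cong[OF refl] sum.mono_neutral_left) (auto simp: nf_Nil not_less_eq_eq)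
  also have "\<dots> = (\<Sum>l\<le>length Ts. \<Sum>k\<le>length Ts - l. ?f l k)"
    by (rule sum.mono_neutral_left) (auto simp: nf_Nil)
  also have "\<dots> = (\<Sum>l\<le>length Ts. \<Sum>k\<le>length Ts - l. scalar (sg (om (take l Ts) (length (take k (drop l Ts)))))
      (nf (Vertex (take l Ts @ Vertex (take k (drop l Ts)) # drop k (drop l Ts)))))"
    by (intro sum.cong refl) (auto simp: min_def add.commute)
  also have "\<dots> = 0"
    using nf_relation[of Ts, where ?'k = 'k] unfolding ssum_eq_sum by simp
  finally show ?thesis .
qed

text \<open>
  The Koszul signs of the two operations combine to the sign for the whole list, which is common to all terms of the relation, and
  to a sign from moving the inner operation past the decorations of \<open>x\<close>. Together with the sign in the relation
  of trees, the latter makes up \<open>\<omega>\<close> for the decorated trees.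
\<close>

lemma nested_mu0:
  assumes m: "1 \<le> m" and w: "set (x @ y @ z) \<subseteq> basis m E" "y \<noteq> []" "enat (length y) \<le> m"
  shows "linext (\<lambda>b. mu0 dg (x @ b # z)) (mu0 dg y)
    = scalar (sg (epsb dg (x @ y @ z) + int (length y) * sum_list (map (\<lambda>b. sum_list (map dg (snd b))) x)))
      (tag (concat (map snd (x @ y @ z))) (nf (Vertex (map fst x @ Vertex (map fst y) # map fst z)) :: _ \<Rightarrow>\<^sub>0 'k::field_char_0))"
proof -
  let ?dx = "sum_list (map (\<lambda>b. sum_list (map dg (snd b))) x)"
  let ?c = "concat (map snd (x @ y @ z))"
  let ?e = "epsb dg (x @ y @ z) + int (length y) * ?dx"
  have v: "valid m (Vertex (map fst y))" using w by (auto simp: basis_def Suc_le_eq)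
  have "linext (\<lambda>b. mu0 dg (x @ b # z)) (mu0 dg y)
    = scalar (sg (epsb dg y)) (linext (\<lambda>T. mu0 dg (x @ (T, concat (map snd y)) # z)) (nf (Vertex (map fst y)) :: _ \<Rightarrow>\<^sub>0 'k))"
    unfolding mu0_def[of dg y] linext_scalar linext_tag by (rule refl)
  also have "linext (\<lambda>T. mu0 dg (x @ (T, concat (map snd y)) # z)) (nf (Vertex (map fst y)) :: _ \<Rightarrow>\<^sub>0 'k)
    = linext (\<lambda>T. scalar (sg (epsb dg y + ?e)) (tag ?c (nf (Vertex (map fst x @ T # map fst z))))) (nf (Vertex (map fst y)))"
  proof (rule linext_cong[OF refl])
    fix T assume "T \<in> keys (nf (Vertex (map fst y)) :: _ \<Rightarrow>\<^sub>0 'k)"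
    then have "goodN m (Vertex (map fst y)) T" by (rule keys_nf[OF m])
    then have t: "tdeg T = int (length y) - 2 + sum_list (map (tdeg \<circ> fst) y)"
      by (simp add: goodN_def)
    have "sg (epsb dg (x @ (T, concat (map snd y)) # z)) = (sg (epsb dg y + ?e) :: 'k)"
      by (rule sg_cong) (simp add: epsb_append t sum_list_concat_snd algebra_simps)
    then show "mu0 dg (x @ (T, concat (map snd y)) # z)
      = scalar (sg (epsb dg y + ?e)) (tag ?c (nf (Vertex (map fst x @ T # map fst z)) :: _ \<Rightarrow>\<^sub>0 'k))"
      by (simp add: mu0_def)
  qed
  also have "\<dots> = scalar (sg (epsb dg y + ?e)) (tag ?c (linext (\<lambda>T. nf (Vertex (map fst x @ T # map fst z))) (nf (Vertex (map fst y)))))"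
    unfolding linext_scalar_fun lin_linext_apply[OF lin_tag] by (rule refl)
  also have "linext (\<lambda>T. nf (Vertex (map fst x @ T # map fst z))) (nf (Vertex (map fst y)))
    = (nf (Vertex (map fst x @ Vertex (map fst y) # map fst z)) :: _ \<Rightarrow>\<^sub>0 'k)"
    by (rule nf_slot[OF m v])
  finally show ?thesis by (simp add: sg_add)
qed

text \<open>
  By multilinearity, the relations need to be verified on basis elements only, where \<open>nested_mu0\<close> reduces them to the
  relations between normal forms.
\<close>

theorem Am_algebra_freeP:
  assumes m: "1 \<le> m"
  shows "Am_algebra m (freeP m E dg :: ('k::field_char_0, _) gr_module) (muP dg)"
proof -
  let ?V = "freeP m E dg :: ('k, _) gr_module"
  have ml: "multilinear k ?V ?V (muP dg k)" if "1 \<le> k" "enat k \<le> m" for k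
    unfolding muP_def
  proof (rule multilinear_mex)
    fix bs assume bs: "length bs = k" "set bs \<subseteq> basis m E"
    then have "bs \<noteq> []" using that by auto
    from keys_mu0[OF m this _ bs(2), of dg] bs(1) that
    show "keys (mu0 dg bs :: _ \<Rightarrow>\<^sub>0 'k) \<subseteq> basis m E" by blast
  qed
  have key: "set bs \<subseteq> basis m E \<and> map (bdeg dg) bs = ds"
    if "list_all2 (\<lambda>a p. a \<in> keys p) bs as" "length ds = length as" "\<forall>i<length as. as ! i \<in> grade ?V (ds ! i)"
    for bs as ds
  proof -
    have len: "length bs = length as" using that(1) by (rule list_all2_lengthD)
    have nth: "bs ! i \<in> basis m E \<and> bdeg dg (bs ! i) = ds ! i" if "i < length as" for i
      using list_all2_nthD2[OF \<open>list_all2 _ bs as\<close> that] \<open>\<forall>i<length as. _\<close> that by auto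
    have "set bs \<subseteq> basis m E" by (metis in_set_conv_nth len nth subsetI)
    moreover have "map (bdeg dg) bs = ds" by (rule nth_equalityI) (use len that(2) nth in auto)
    ultimately show ?thesis by blast
  qed
  have gr: "muP dg k as \<in> grade ?V (sum_list ds + int k - 2)"
    if k: "1 \<le> k" "enat k \<le> m" "length as = k" "length ds = k" "\<forall>i<k. as ! i \<in> grade ?V (ds ! i)" for k as ds
  proof -
    have "keys (muP dg k as) \<subseteq> {s \<in> basis m E. bdeg dg s = sum_list ds + int k - 2}"
      unfolding muP_def
    proof (rule keys_mex)
      fix bs assume bs: "list_all2 (\<lambda>a p. a \<in> keys p) bs as"
      have "length bs = k" using list_all2_lengthD[OF bs] k by simp
      moreover have "set bs \<subseteq> basis m E \<and> map (bdeg dg) bs = ds" using key[OF bs] k by simp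
      moreover from this have "bs \<noteq> []" using k by auto
      ultimately show "keys (mu0 dg bs :: _ \<Rightarrow>\<^sub>0 'k) \<subseteq> {s \<in> basis m E. bdeg dg s = sum_list ds + int k - 2}"
        using keys_mu0[OF m, of bs E dg, where ?'k = 'k] k by simp
    qed
    then show ?thesis by simp
  qed
  have rel: "(\<Oplus>\<^bsub>?V\<^esub> l \<in> {0..<n}. \<Oplus>\<^bsub>?V\<^esub> k \<in> {1..n - l}.
          ((-1 :: 'k) powi (int k + int l + int k * int l + int k * sum_list (take l ds))) \<odot>\<^bsub>?V\<^esub>
            muP dg (n - k + 1) (take l as @ [muP dg k (take k (drop l as))] @ drop (l + k) as)) = \<zero>\<^bsub>?V\<^esub>"
    if n: "1 \<le> n" "enat n \<le> m" "length as = n" "length ds = n" "\<forall>i<n. as ! i \<in> grade ?V (ds ! i)" for n as ds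
  proof -
    let ?s = "\<lambda>l k. sg (int k + int l + int k * int l + int k * sum_list (take l ds)) :: 'k"
    let ?t = "\<lambda>l k. scalar (?s l k) (muP dg (n - k + 1) (take l as @ [muP dg k (take k (drop l as))] @ drop (l + k) as))"
    have asc: "set as \<subseteq> carrier ?V"
    proof
      fix a assume "a \<in> set as"
      then obtain i where "i < n" "a = as ! i" using n(3) by (auto simp: in_set_conv_nth)
      then show "a \<in> carrier ?V" using n(5) by auto
    qed
    have cl: "keys (?t l k) \<subseteq> basis m E" if lk: "l \<in> {0..<n}" "k \<in> {1..n - l}" for l k
    proof (rule keys_scalar_le)
      have "enat k \<le> enat n" "enat (n - k + 1) \<le> enat n" using lk by auto
      then have k: "1 \<le> k" "enat k \<le> m" "1 \<le> n - k + 1" "enat (n - k + 1) \<le> m"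
        using lk n(2) order_trans[of "enat k" "enat n" m] order_trans[of "enat (n - k + 1)" "enat n" m] by auto
      have "muP dg k (take k (drop l as)) \<in> carrier ?V"
        using asc lk n(3) by (intro multilinearD(1)[OF ml[OF k(1,2)]]) (auto dest: in_set_takeD in_set_dropD)
      then have "set (take l as @ [muP dg k (take k (drop l as))] @ drop (l + k) as) \<subseteq> carrier ?V"
        using asc by (auto dest: in_set_takeD in_set_dropD)
      then have "muP dg (n - k + 1) (take l as @ [muP dg k (take k (drop l as))] @ drop (l + k) as) \<in> carrier ?V"
        using lk n(3) by (intro multilinearD(1)[OF ml[OF k(3,4)]]) auto
      then show "keys (muP dg (n - k + 1) (take l as @ [muP dg k (take k (drop l as))] @ drop (l + k) as)) \<subseteq> basis m E"
        by simp
    qed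
    have "(\<Oplus>\<^bsub>?V\<^esub> l \<in> {0..<n}. \<Oplus>\<^bsub>?V\<^esub> k \<in> {1..n - l}.
          ((-1 :: 'k) powi (int k + int l + int k * int l + int k * sum_list (take l ds))) \<odot>\<^bsub>?V\<^esub>
            muP dg (n - k + 1) (take l as @ [muP dg k (take k (drop l as))] @ drop (l + k) as))
       = (\<Oplus>\<^bsub>?V\<^esub> l \<in> {0..<n}. \<Oplus>\<^bsub>?V\<^esub> k \<in> {1..n - l}. ?t l k)"
      by (simp only: powi_eq_sg free_gr_space_simps)
    also have "\<dots> = (\<Sum>l\<in>{0..<n}. \<Sum>k\<in>{1..n - l}. ?t l k)"
    proof -
      have *: "(\<Oplus>\<^bsub>?V\<^esub> k \<in> {1..n - l}. ?t l k) = (\<Sum>k\<in>{1..n - l}. ?t l k)" if "l \<in> {0..<n}" for l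
        by (rule finsum_free) (use cl[OF that] in auto)
      interpret V: vspace ?V by (rule vspace_free)
      have "(\<Oplus>\<^bsub>?V\<^esub> l \<in> {0..<n}. \<Oplus>\<^bsub>?V\<^esub> k \<in> {1..n - l}. ?t l k) = (\<Oplus>\<^bsub>?V\<^esub> l \<in> {0..<n}. \<Sum>k\<in>{1..n - l}. ?t l k)"
        by (rule V.finsum_cong'[OF refl _ *]) (auto intro!: keys_sum_subset[OF cl, THEN subsetD])
      also have "\<dots> = (\<Sum>l\<in>{0..<n}. \<Sum>k\<in>{1..n - l}. ?t l k)"
        by (rule finsum_free) (auto intro!: keys_sum_subset[OF cl, THEN subsetD])
      finally show ?thesis .
    qed
    also have "\<dots> = (\<Sum>l\<in>{0..<n}. \<Sum>k\<in>{1..n - l}. scalar (?s l k)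
        (mex (\<lambda>ws. linext (\<lambda>z. mu0 dg (take l ws @ z # drop (l + k) ws)) (mu0 dg (take k (drop l ws)))) as))"
    proof (intro sum.cong refl arg_cong[where f = "scalar _"])
      fix l k assume lk: "l \<in> {0..<n}" "k \<in> {1..n - l}"
      have "length (take l as) = l" "length (take k (drop l as)) = k" using lk n by auto
      moreover have "take l as @ take k (drop l as) @ drop (l + k) as = as"
        by (metis add.commute append_take_drop_id drop_drop)
      ultimately show "muP dg (n - k + 1) (take l as @ [muP dg k (take k (drop l as))] @ drop (l + k) as)
        = mex (\<lambda>ws. linext (\<lambda>z. mu0 dg (take l ws @ z # drop (l + k) ws)) (mu0 dg (take k (drop l ws)))) as"
        unfolding muP_def using mex_nested[of "mu0 dg" "take l as" "mu0 dg" "take k (drop l as)" "drop (l + k) as"]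
        by simp
    qed
    also have "\<dots> = mex (\<lambda>ws. \<Sum>l\<in>{0..<n}. \<Sum>k\<in>{1..n - l}. scalar (?s l k)
        (linext (\<lambda>z. mu0 dg (take l ws @ z # drop (l + k) ws)) (mu0 dg (take k (drop l ws))))) as"
      unfolding mex_sum mex_scalar by (rule refl)
    also have "\<dots> = mex (\<lambda>ws. 0) as"
    proof (rule mex_cong)
      fix ws assume ws: "list_all2 (\<lambda>a p. a \<in> keys p) ws as"
      have lw: "length ws = n" using list_all2_lengthD[OF ws] n by simp
      have wb: "set ws \<subseteq> basis m E" "map (bdeg dg) ws = ds" using key[OF ws] n by auto
      have "(\<Sum>l\<in>{0..<n}. \<Sum>k\<in>{1..n - l}. scalar (?s l k)
          (linext (\<lambda>z. mu0 dg (take l ws @ z # drop (l + k) ws)) (mu0 dg (take k (drop l ws)))))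
        = (\<Sum>l\<in>{0..<n}. \<Sum>k\<in>{1..n - l}. scalar (sg (epsb dg ws)) (tag (concat (map snd ws))
           (scalar (sg (om (take l (map fst ws)) k))
             (nf (Vertex (take l (map fst ws) @ Vertex (take k (drop l (map fst ws))) # drop (l + k) (map fst ws)))))))"
      proof (intro sum.cong refl)
        fix l k assume lk: "l \<in> {0..<n}" "k \<in> {1..n - l}"
        let ?x = "take l ws" and ?y = "take k (drop l ws)" and ?z = "drop (l + k) ws"
        have xyz: "?x @ ?y @ ?z = ws" by (metis add.commute append_take_drop_id drop_drop)
        have len: "length ?x = l" "length ?y = k" "?y \<noteq> []" using lk lw by auto
        have "enat k \<le> enat n" using lk by auto
        then have "enat (length ?y) \<le> m" unfolding len using n(2) order_trans by blast
        note N = nested_mu0[OF m, of ?x ?y ?z E dg, unfolded xyz, OF wb(1) len(3) this, unfolded len]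
        have ds: "sum_list (take l ds) = sum_list (map tdeg (map fst ?x)) + sum_list (map (\<lambda>b. sum_list (map dg (snd b))) ?x)"
          unfolding wb(2)[symmetric] take_map by (rule sum_list_bdeg)
        have "?s l k * sg (epsb dg ws + int k * sum_list (map (\<lambda>b. sum_list (map dg (snd b))) ?x))
          = sg (epsb dg ws) * (sg (om (take l (map fst ws)) k) :: 'k)"
          unfolding sg_add[symmetric]
          by (rule sg_cong) (use len in \<open>simp add: ds om_def take_map algebra_simps\<close>)
        then show "scalar (?s l k) (linext (\<lambda>z. mu0 dg (take l ws @ z # drop (l + k) ws)) (mu0 dg (take k (drop l ws))))
          = scalar (sg (epsb dg ws)) (tag (concat (map snd ws)) (scalar (sg (om (take l (map fst ws)) k))
             (nf (Vertex (take l (map fst ws) @ Vertex (take k (drop l (map fst ws))) # drop (l + k) (map fst ws))))))"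
          unfolding N lin_scalarD[OF lin_tag] scalar_scalar by (simp add: take_map drop_map)
      qed
      also have "\<dots> = scalar (sg (epsb dg ws)) (tag (concat (map snd ws)) 0)"
        unfolding nf_relation_sum[of "map fst ws", symmetric]
        by (simp add: lw lin_sum[OF lin_tag] scalar_sum)
      finally show "(\<Sum>l\<in>{0..<n}. \<Sum>k\<in>{1..n - l}. scalar (?s l k)
          (linext (\<lambda>z. mu0 dg (take l ws @ z # drop (l + k) ws)) (mu0 dg (take k (drop l ws))))) = 0"
        by (simp add: lin_0[OF lin_tag])
    qed
    finally show ?thesis by simp
  qed
  show ?thesis
    unfolding Am_algebra_def
  proof (intro conjI allI impI; (elim conjE)?)
    show "graded_space ?V" by (rule graded_free)
  qed (fact ml, fact gr, fact rel)
qed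

lemma mex_nf:
  assumes "1 \<le> m" "\<forall>t\<in>set ts. valid m t"
  shows "mex (\<lambda>Ts. nf (Vertex (xs @ Ts))) (map nf ts) = (nf (Vertex (xs @ ts)) :: _ \<Rightarrow>\<^sub>0 'k::field_char_0)"
  using assms(2)
proof (induction ts arbitrary: xs)
  case (Cons t ts)
  have IH: "mex (\<lambda>Ts. nf (Vertex (xs @ T # Ts))) (map nf ts) = (nf (Vertex (xs @ T # ts)) :: _ \<Rightarrow>\<^sub>0 'k)" for T
    using Cons.IH[of "xs @ [T]"] Cons.prems by simp
  have "mex (\<lambda>Ts. nf (Vertex (xs @ Ts))) (map nf (t # ts))
    = linext (\<lambda>T. mex (\<lambda>Ts. nf (Vertex (xs @ T # Ts))) (map nf ts)) (nf t :: _ \<Rightarrow>\<^sub>0 'k)"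
    by (simp add: mex_Cons)
  also have "\<dots> = nf (Vertex (xs @ t # ts))"
    unfolding IH using Cons.prems by (intro nf_slot[OF assms(1)]) simp
  finally show ?case .
qed simp

lemma mex_tag:
  "length ts = length ss \<Longrightarrow> mex \<phi> (map2 (\<lambda>t es. tag es (nf t)) ts ss) = mex (\<lambda>Ts. \<phi> (zip Ts ss)) (map nf ts)"
proof (induction ts ss arbitrary: \<phi> rule: list_induct2)
  case (Cons t ts s ss)
  show ?case
    by (simp add: mex_Cons linext_tag Cons.IH)
qed simp

text \<open>
  The decorations of a tree, distributed among the subtrees \<open>ts\<close>.
\<close>

fun segs :: "ptree list \<Rightarrow> 'a list \<Rightarrow> 'a list list"
  where
    "segs [] es = []"
  | "segs (t # ts) es = take (legs t) es # segs ts (drop (legs t) es)"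

lemma length_segs [simp]: "length (segs ts es) = length ts"
  by (induction ts arbitrary: es) auto

lemma concat_segs: "length es = sum_list (map legs ts) \<Longrightarrow> concat (segs ts es) = es"
  by (induction ts arbitrary: es) auto

lemma epsb_segs:
  "map tdeg Ts = map tdeg ts \<Longrightarrow> epsb dg (zip Ts (segs ts es)) = epsl ts (map (\<lambda>e. (g e, dg e)) es)"
proof (induction ts arbitrary: Ts es)
  case (Cons t ts)
  then obtain T Ts' where Ts: "Ts = T # Ts'" "map tdeg Ts' = map tdeg ts" by (cases Ts) auto
  then have len: "length Ts' = length ts" by (metis length_map)
  have "sum_list (map (tdeg \<circ> fst) (zip Ts' (segs ts es'))) = sum_list (map tdeg ts)" for es' :: "'a list"
    unfolding map_map[symmetric] using len Ts(2) by simp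
  then show ?case
    unfolding Ts(1) using Cons.IH[OF Ts(2), of "drop (legs t) es"]
    by (simp add: take_map drop_map o_def)
qed simp

definition gens :: "('e \<Rightarrow> int) \<Rightarrow> 'e list \<Rightarrow> ((ptree \<times> 'e list \<Rightarrow>\<^sub>0 'k::field_char_0) \<times> int) list"
  where "gens dg es = map (\<lambda>e. (single (Triv, [e]) 1, dg e)) es"

lemma nf_Triv [simp]: "nf Triv = single Triv 1"
  by (rule nf_adm[of \<infinity>]) simp_all

text \<open>
  By induction on the tree: the subtrees evaluate to their normal forms, and grafting these and taking the normal form again
  yields the normal form of the whole tree. The Koszul signs of the evaluation and of the product agree because generators
  carry the trivial tree, of degree \<open>0\<close>.
\<close>

lemma ev_gens:
  assumes "1 \<le> m" "valid m T" "length es = legs T"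
  shows "ev (freeP m E dg) (muP dg) T (gens dg es) = (tag es (nf T) :: _ \<Rightarrow>\<^sub>0 'k::field_char_0)"
  using assms(2,3)
proof (induction T arbitrary: es)
  case Triv
  then obtain e where "es = [e]" by (cases es) auto
  then show ?case by (simp add: gens_def tag_def)
next
  case (Vertex ts)
  let ?V = "freeP m E dg :: ('k, _) gr_module"
  let ?G = "gens dg es :: ((_ \<Rightarrow>\<^sub>0 'k) \<times> int) list"
  have "evl ?V (muP dg) us (gens dg es) = map2 (\<lambda>t es. tag es (nf t)) us (segs us es)"
    if "set us \<subseteq> set ts" "length es = sum_list (map legs us)" for us es
    using that
  proof (induction us arbitrary: es)
    case (Cons t us)
    have "ev ?V (muP dg) t (gens dg (take (legs t) es)) = tag (take (legs t) es) (nf t)"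
      using Vertex.IH[of t "take (legs t) es"] Vertex.prems Cons.prems by auto
    moreover have "evl ?V (muP dg) us (gens dg (drop (legs t) es)) = map2 (\<lambda>t es. tag es (nf t)) us (segs us (drop (legs t) es))"
      using Cons.IH[of "drop (legs t) es"] Cons.prems by auto
    ultimately show ?case by (simp add: gens_def take_map drop_map)
  qed (simp add: gens_def)
  from this[of ts es] have evl: "evl ?V (muP dg) ts ?G = map2 (\<lambda>t es. tag es (nf t)) ts (segs ts es)"
    using Vertex.prems by simp
  have "muP dg (length ts) (evl ?V (muP dg) ts ?G) = mex (\<lambda>Ts. mu0 dg (zip Ts (segs ts es))) (map nf ts)"
    unfolding evl muP_def by (rule mex_tag) simp
  also have "\<dots> = mex (\<lambda>Ts. scalar (sg (epsl ts ?G)) (tag es (nf (Vertex Ts)))) (map nf ts)"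
  proof (rule mex_cong)
    fix Ts assume Ts: "list_all2 (\<lambda>a p. a \<in> keys p) Ts (map nf ts :: (ptree \<Rightarrow>\<^sub>0 'k) list)"
    then have len: "length Ts = length ts" by (auto dest: list_all2_lengthD)
    have "map tdeg Ts = map tdeg ts"
    proof (rule nth_equalityI)
      fix i assume "i < length (map tdeg Ts)"
      then have i: "i < length Ts" by simp
      have "Ts ! i \<in> keys (nf (ts ! i) :: _ \<Rightarrow>\<^sub>0 'k)"
        using list_all2_nthD[OF Ts i] i len by simp
      from keys_nf[OF assms(1) this] show "map tdeg Ts ! i = map tdeg ts ! i"
        using i len by (simp add: goodN_def)
    qed (use len in simp)
    then have "epsb dg (zip Ts (segs ts es)) = epsl ts ?G"
      unfolding gens_def by (rule epsb_segs)
    then show "mu0 dg (zip Ts (segs ts es)) = scalar (sg (epsl ts ?G)) (tag es (nf (Vertex Ts)) :: _ \<Rightarrow>\<^sub>0 'k)"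
      using Vertex.prems len by (simp add: mu0_def concat_segs)
  qed
  also have "\<dots> = scalar (sg (epsl ts ?G)) (tag es (nf (Vertex ts)))"
    using mex_nf[OF assms(1), of ts "[]", where ?'k = 'k] Vertex.prems
    by (simp add: mex_scalar flip: mex_lin[OF lin_tag])
  finally show ?case by simp
qed

lemma homog_gens:
  assumes "Am_alg m (freeP m E dg :: ('k::field_char_0, _) gr_module) (muP dg)" "set es \<subseteq> E"
  shows "Am_alg.homog (freeP m E dg :: ('k, _) gr_module) (gens dg es)"
proof -
  interpret P: Am_alg m "freeP m E dg :: ('k, _) gr_module" "muP dg" by (rule assms(1))
  show ?thesis
    unfolding P.homog_def using assms(2) by (auto simp: gens_def basis_def bdeg_def)
qed

lemma tag_eq_0: "tag es f = 0 \<longleftrightarrow> f = 0"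
proof
  assume *: "tag es f = 0"
  have "linext (\<lambda>b. single (fst b) 1) (tag es f) = f"
    unfolding linext_tag by simp
  with * show "f = 0" by simp
qed (simp add: lin_0[OF lin_tag])

text \<open>
  The ideal is killed by the evaluation in the algebra of trees decorated with a single letter of degree zero, and there a tree
  evaluates to its normal form.
\<close>

theorem nf_op_ideal:
  assumes "1 \<le> m" "(n, f :: ptree \<Rightarrow>\<^sub>0 'k::field_char_0) \<in> op_ideal m"
  shows "linext nf f = 0"
proof -
  let ?V = "freeP m UNIV (\<lambda>_. 0) :: ('k, ptree \<times> unit list \<Rightarrow>\<^sub>0 'k) gr_module"
  let ?es = "replicate n ()"
  interpret P: Am_alg m ?V "muP (\<lambda>_. 0)"
    using Am_algebra_freeP[OF assms(1)] by (intro Am_alg.intro)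
  have keys: "keys f \<subseteq> trees m n" by (rule op_ideal_keys[OF assms(2)])
  have h: "P.homog (gens (\<lambda>_. 0) ?es)" by (intro homog_gens P.Am_alg_axioms) simp
  have ev: "ev ?V (muP (\<lambda>_. 0)) T (gens (\<lambda>_. 0) ?es) = tag ?es (nf T)" if "T \<in> keys f" for T
    using that keys by (intro ev_gens[OF assms(1)]) (auto simp: trees_iff)
  have c: "keys (tag ?es (nf T :: _ \<Rightarrow>\<^sub>0 'k)) \<subseteq> basis m UNIV" if "T \<in> keys f" for T
    unfolding tag_def
  proof (rule keys_linext_subset)
    fix T' assume "T' \<in> keys (nf T :: _ \<Rightarrow>\<^sub>0 'k)"
    then have "goodN m T T'" by (rule keys_nf[OF assms(1)])
    then show "keys (single (T', ?es) (1 :: 'k)) \<subseteq> basis m UNIV"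
      using that keys by (auto simp: goodN_def basis_def trees_iff)
  qed
  have "0 = lc ?V (\<lambda>T. ev ?V (muP (\<lambda>_. 0)) T (gens (\<lambda>_. 0) ?es)) f"
    using P.ev_ideal[OF assms(2) h] by (simp add: gens_def)
  also have "\<dots> = lc ?V (\<lambda>T. tag ?es (nf T)) f"
    by (rule P.B.lc_cong[OF refl ev]) (use c in auto)
  also have "\<dots> = linext (\<lambda>T. tag ?es (nf T)) f"
    by (rule lc_free[OF c])
  also have "\<dots> = tag ?es (linext nf f)"
    by (rule lin_linext_apply[OF lin_tag, symmetric])
  finally show ?thesis by (simp add: tag_eq_0)
qed


section \<open>The universal property of the algebra of decorated trees\<close>

text \<open>
  The homomorphism that extends \<open>f\<close> sends a decorated tree to its evaluation at the images of its decorations.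
\<close>

definition Hm :: "('k::field_char_0, 'b) gr_module \<Rightarrow> (nat \<Rightarrow> 'b list \<Rightarrow> 'b) \<Rightarrow> ('e \<Rightarrow> int) \<Rightarrow> ('e \<Rightarrow> 'b) \<Rightarrow>
    (ptree \<times> 'e list \<Rightarrow>\<^sub>0 'k) \<Rightarrow> 'b"
  where "Hm B \<nu> dg f = lc B (\<lambda>b. ev B \<nu> (fst b) (map (\<lambda>e. (f e, dg e)) (snd b)))"

context Am_alg
begin

context
  fixes E :: "'e set" and dg :: "'e \<Rightarrow> int" and f :: "'e \<Rightarrow> 'b"
  assumes m: "1 \<le> m" and f: "\<And>e. e \<in> E \<Longrightarrow> f e \<in> grade B (dg e)"
begin

lemma homog_f: "set es \<subseteq> E \<Longrightarrow> homog (map (\<lambda>e. (f e, dg e)) es)"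
  using f by (auto simp: homog_def)

lemma ev_f_grade:
  assumes "b \<in> basis m E"
  shows "ev B \<nu> (fst b) (map (\<lambda>e. (f e, dg e)) (snd b)) \<in> grade B (bdeg dg b)"
proof -
  have "ev B \<nu> (fst b) (map (\<lambda>e. (f e, dg e)) (snd b))
    \<in> grade B (tdeg (fst b) + dsum (map (\<lambda>e. (f e, dg e)) (snd b)))"
    using assms by (intro ev_grade homog_f) (auto simp: basis_def)
  then show ?thesis by (simp add: bdeg_def o_def)
qed

lemma ev_f_closed: "b \<in> basis m E \<Longrightarrow> ev B \<nu> (fst b) (map (\<lambda>e. (f e, dg e)) (snd b)) \<in> carrier B"
  using ev_f_grade grade_carrier by blast

lemma vlin_Hm: "vlin B (basis m E) (Hm B \<nu> dg f)"
  unfolding Hm_def by (rule B.vlin_lc) (auto intro!: ev_f_closed)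

lemma lhom_Hm: "lhom (freeP m E dg) B (Hm B \<nu> dg f)"
  by (rule lhomI) (simp_all add: B.vlinD[OF vlin_Hm])

lemma Hm_single: "b \<in> basis m E \<Longrightarrow> Hm B \<nu> dg f (single b 1) = ev B \<nu> (fst b) (map (\<lambda>e. (f e, dg e)) (snd b))"
  using ev_f_closed by (simp add: Hm_def)

lemma Hm_grade: "F \<in> grade (freeP m E dg) d \<Longrightarrow> Hm B \<nu> dg f F \<in> grade B d"
  unfolding Hm_def lc_def
  by (rule B.finsum_in_subspace[OF grade_sub])
    (use ev_f_grade in \<open>auto intro!: B.subspaceD(4)[OF grade_sub]\<close>)

text \<open>
  The product of decorated trees is the normal form of a tree, which can be replaced by the tree itself because the
  evaluation is compatible with normal forms.
\<close>

lemma Hm_mu0: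
  assumes "bs \<noteq> []" "enat (length bs) \<le> m" "set bs \<subseteq> basis m E"
  shows "Hm B \<nu> dg f (mu0 dg bs) = \<nu> (length bs) (map (\<lambda>b. Hm B \<nu> dg f (single b 1)) bs)"
proof -
  let ?g = "map (\<lambda>e. (f e, dg e))"
  let ?T = "Vertex (map fst bs)" and ?es = "concat (map snd bs)"
  have v: "valid m ?T" using assms by (auto simp: basis_def Suc_le_eq)
  have les: "length ?es = legs ?T" "set ?es \<subseteq> E"
    using assms(3) by (induction bs) (auto simp: basis_def)
  have key: "keys (mu0 dg bs :: _ \<Rightarrow>\<^sub>0 'k) \<subseteq> basis m E"
    using keys_mu0[OF m assms(1,2,3), of dg] by blast
  have evl: "evl B \<nu> (map fst bs) (?g ?es) = map (\<lambda>b. Hm B \<nu> dg f (single b 1)) bs \<and>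
    epsl (map fst bs) (?g ?es) = epsb dg bs"
    using assms(3) by (induction bs) (auto simp: basis_def Hm_single o_def)
  have cl: "\<nu> (length bs) (map (\<lambda>b. Hm B \<nu> dg f (single b 1)) bs) \<in> carrier B"
    using assms B.vlinD(1)[OF vlin_Hm]
    by (intro multilinearD(1)[OF ml]) (auto simp: Suc_le_eq)
  have nfk: "T' \<in> trees m (legs ?T)" "(T', ?es) \<in> basis m E" if "T' \<in> keys (nf ?T :: _ \<Rightarrow>\<^sub>0 'k)" for T'
    using keys_nf[OF m that] v les by (auto simp: goodN_def trees_iff basis_def)
  have "Hm B \<nu> dg f (mu0 dg bs) = sg (epsb dg bs) \<odot>\<^bsub>B\<^esub> Hm B \<nu> dg f (tag ?es (nf ?T))"
    unfolding mu0_def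
  proof (rule B.vlinD(2)[OF vlin_Hm])
    show "keys (tag ?es (nf ?T :: _ \<Rightarrow>\<^sub>0 'k)) \<subseteq> basis m E"
      unfolding tag_def by (rule keys_linext_subset) (use nfk(2) in auto)
  qed
  also have "Hm B \<nu> dg f (tag ?es (nf ?T)) = lc B (\<lambda>T'. Hm B \<nu> dg f (single (T', ?es) 1)) (nf ?T)"
    unfolding tag_def Hm_def
    by (rule B.lc_linext[where S = "basis m E"]) (use nfk(2) ev_f_closed in auto)
  also have "\<dots> = lc B (\<lambda>T'. ev B \<nu> T' (?g ?es)) (nf ?T)"
    by (rule B.lc_cong[OF refl]) (use nfk(2) ev_f_closed Hm_single in force)+
  also have "\<dots> = ev B \<nu> ?T (?g ?es)"
    by (rule ev_nf[OF v m homog_f[OF les(2)]]) (use les in simp)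
  also have "sg (epsb dg bs) \<odot>\<^bsub>B\<^esub> ev B \<nu> ?T (?g ?es) = \<nu> (length bs) (map (\<lambda>b. Hm B \<nu> dg f (single b 1)) bs)"
    using evl cl by simp
  finally show ?thesis .
qed

lemma Hm_strict:
  assumes "1 \<le> k" "enat k \<le> m" "length as = k" "set as \<subseteq> carrier (freeP m E dg)"
  shows "Hm B \<nu> dg f (muP dg k as) = \<nu> k (map (Hm B \<nu> dg f) as)"
proof -
  let ?V = "freeP m E dg :: ('k, _) gr_module"
  interpret P: Am_alg m ?V "muP dg"
    using Am_algebra_freeP[OF m] by (intro Am_alg.intro)
  show ?thesis
  proof (rule multilinear_eqI)
    show "multilinear k ?V B (\<lambda>as. Hm B \<nu> dg f (muP dg k as))"
      by (rule multilinear_lhom_out[OF P.ml[OF assms(1,2)] lhom_Hm])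
    show "multilinear k ?V B (\<lambda>as. \<nu> k (map (Hm B \<nu> dg f) as))"
      by (rule multilinear_lhom_in[OF lhom_Hm ml[OF assms(1,2)]])
    show "vspace B" by (rule B.vspace_axioms)
    fix bs assume bs: "length bs = k" "set bs \<subseteq> basis m E"
    then have "bs \<noteq> []" using assms(1) by auto
    from Hm_mu0[OF this _ bs(2)] bs(1) assms(2)
    show "Hm B \<nu> dg f (muP dg k (map (\<lambda>b. single b 1) bs))
      = \<nu> k (map (Hm B \<nu> dg f) (map (\<lambda>b. single b 1) bs))"
      by (simp add: muP_def mex_singles o_def)
  qed (use assms in auto)
qed

end

end


section \<open>Coordinates on graded vector spaces\<close>

text \<open>
  An isomorphism of graded spaces onto the span of \<open>S\<close>, where \<open>s \<in> S\<close> has degree \<open>dg s\<close>. In these terms the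
  coset-based constructions are compared with the algebra of decorated trees.
\<close>

definition coords :: "('k::field_char_0, 'v) gr_module \<Rightarrow> 's set \<Rightarrow> ('s \<Rightarrow> int) \<Rightarrow> ('v \<Rightarrow> ('s \<Rightarrow>\<^sub>0 'k)) \<Rightarrow> bool"
  where "coords V S dg \<kappa> \<longleftrightarrow> bij_betw \<kappa> (carrier V) {F. keys F \<subseteq> S} \<and>
    \<zero>\<^bsub>V\<^esub> \<in> carrier V \<and> \<kappa> \<zero>\<^bsub>V\<^esub> = 0 \<and>
    (\<forall>x\<in>carrier V. \<forall>y\<in>carrier V. x \<oplus>\<^bsub>V\<^esub> y \<in> carrier V \<and> \<kappa> (x \<oplus>\<^bsub>V\<^esub> y) = \<kappa> x + \<kappa> y) \<and>
    (\<forall>c. \<forall>x\<in>carrier V. c \<odot>\<^bsub>V\<^esub> x \<in> carrier V \<and> \<kappa> (c \<odot>\<^bsub>V\<^esub> x) = scalar c (\<kappa> x)) \<and>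
    (\<forall>d. grade V d = {x \<in> carrier V. keys (\<kappa> x) \<subseteq> {s \<in> S. dg s = d}})"

lemma coordsD:
  assumes "coords V S dg \<kappa>"
  shows "bij_betw \<kappa> (carrier V) {F. keys F \<subseteq> S}"
    "\<zero>\<^bsub>V\<^esub> \<in> carrier V" "\<kappa> \<zero>\<^bsub>V\<^esub> = 0"
    "x \<in> carrier V \<Longrightarrow> keys (\<kappa> x) \<subseteq> S"
    "x \<in> carrier V \<Longrightarrow> y \<in> carrier V \<Longrightarrow> x \<oplus>\<^bsub>V\<^esub> y \<in> carrier V"
    "x \<in> carrier V \<Longrightarrow> y \<in> carrier V \<Longrightarrow> \<kappa> (x \<oplus>\<^bsub>V\<^esub> y) = \<kappa> x + \<kappa> y"
    "x \<in> carrier V \<Longrightarrow> c \<odot>\<^bsub>V\<^esub> x \<in> carrier V"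
    "x \<in> carrier V \<Longrightarrow> \<kappa> (c \<odot>\<^bsub>V\<^esub> x) = scalar c (\<kappa> x)"
    "grade V d = {x \<in> carrier V. keys (\<kappa> x) \<subseteq> {s \<in> S. dg s = d}}"
    "x \<in> carrier V \<Longrightarrow> y \<in> carrier V \<Longrightarrow> \<kappa> x = \<kappa> y \<Longrightarrow> x = y"
proof -
  show b: "bij_betw \<kappa> (carrier V) {F. keys F \<subseteq> S}" using assms unfolding coords_def by blast
  show "\<zero>\<^bsub>V\<^esub> \<in> carrier V" "\<kappa> \<zero>\<^bsub>V\<^esub> = 0"
    "x \<in> carrier V \<Longrightarrow> y \<in> carrier V \<Longrightarrow> x \<oplus>\<^bsub>V\<^esub> y \<in> carrier V"
    "x \<in> carrier V \<Longrightarrow> y \<in> carrier V \<Longrightarrow> \<kappa> (x \<oplus>\<^bsub>V\<^esub> y) = \<kappa> x + \<kappa> y"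
    "x \<in> carrier V \<Longrightarrow> c \<odot>\<^bsub>V\<^esub> x \<in> carrier V"
    "x \<in> carrier V \<Longrightarrow> \<kappa> (c \<odot>\<^bsub>V\<^esub> x) = scalar c (\<kappa> x)"
    "grade V d = {x \<in> carrier V. keys (\<kappa> x) \<subseteq> {s \<in> S. dg s = d}}"
    using assms unfolding coords_def by blast+
  show "x \<in> carrier V \<Longrightarrow> keys (\<kappa> x) \<subseteq> S"
    using b bij_betwE by blast
  show "x \<in> carrier V \<Longrightarrow> y \<in> carrier V \<Longrightarrow> \<kappa> x = \<kappa> y \<Longrightarrow> x = y"
    using b unfolding bij_betw_def by (blast dest: inj_onD)
qed

definition uncoord :: "('k::field_char_0, 'v) gr_module \<Rightarrow> ('v \<Rightarrow> ('s \<Rightarrow>\<^sub>0 'k)) \<Rightarrow> ('s \<Rightarrow>\<^sub>0 'k) \<Rightarrow> 'v"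
  where "uncoord V \<kappa> = inv_into (carrier V) \<kappa>"

lemma uncoord:
  assumes "coords V S dg \<kappa>"
  shows "keys F \<subseteq> S \<Longrightarrow> uncoord V \<kappa> F \<in> carrier V"
    "keys F \<subseteq> S \<Longrightarrow> \<kappa> (uncoord V \<kappa> F) = F"
    "x \<in> carrier V \<Longrightarrow> uncoord V \<kappa> (\<kappa> x) = x"
proof -
  note b = coordsD(1)[OF assms]
  have im: "\<kappa> ` carrier V = {F. keys F \<subseteq> S}" using b by (simp add: bij_betw_def)
  show "keys F \<subseteq> S \<Longrightarrow> uncoord V \<kappa> F \<in> carrier V"
    unfolding uncoord_def by (rule inv_into_into) (simp add: im)
  show "keys F \<subseteq> S \<Longrightarrow> \<kappa> (uncoord V \<kappa> F) = F"
    unfolding uncoord_def by (rule f_inv_into_f) (simp add: im)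
  show "x \<in> carrier V \<Longrightarrow> uncoord V \<kappa> (\<kappa> x) = x"
    unfolding uncoord_def using b by (intro inv_into_f_f) (simp add: bij_betw_def)
qed

lemma coords_vspace:
  fixes V :: "('k::field_char_0, 'v) gr_module"
  assumes "coords V S dg \<kappa>"
  shows "vspace V"
proof -
  note C = coordsD[OF assms]
  have neg: "(-1) \<odot>\<^bsub>V\<^esub> x \<oplus>\<^bsub>V\<^esub> x = \<zero>\<^bsub>V\<^esub>" if x: "x \<in> carrier V" for x
  proof (rule C(10))
    show "\<kappa> ((-1) \<odot>\<^bsub>V\<^esub> x \<oplus>\<^bsub>V\<^esub> x) = \<kappa> \<zero>\<^bsub>V\<^esub>"
      by (simp add: C(3) C(6)[OF C(7)[OF x] x] C(8)[OF x] scalar_uminus)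
  qed (simp_all add: C(2,5,7) x)
  have "abelian_group V"
  proof (rule abelian_groupI)
    fix x y z assume x: "x \<in> carrier V" and y: "y \<in> carrier V" and z: "z \<in> carrier V"
    show "x \<oplus>\<^bsub>V\<^esub> y \<oplus>\<^bsub>V\<^esub> z = x \<oplus>\<^bsub>V\<^esub> (y \<oplus>\<^bsub>V\<^esub> z)"
      by (rule C(10)) (simp_all add: C(5,6) x y z add.assoc)
  next
    fix x y assume x: "x \<in> carrier V" and y: "y \<in> carrier V"
    show "x \<oplus>\<^bsub>V\<^esub> y = y \<oplus>\<^bsub>V\<^esub> x"
      by (rule C(10)) (simp_all add: C(5,6) x y add.commute)
    show "x \<oplus>\<^bsub>V\<^esub> y \<in> carrier V" by (rule C(5)[OF x y])
  next
    fix x assume x: "x \<in> carrier V"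
    show "\<zero>\<^bsub>V\<^esub> \<oplus>\<^bsub>V\<^esub> x = x"
      by (rule C(10)) (simp_all add: C(2,3,5,6) x)
    show "\<exists>y\<in>carrier V. y \<oplus>\<^bsub>V\<^esub> x = \<zero>\<^bsub>V\<^esub>"
      using neg[OF x] C(7)[OF x] by blast
  qed (rule C(2))
  then show ?thesis
  proof (intro vspace.intro moduleI)
    show "cring (ring_of_type_algebra :: 'k ring)" by (rule cring_from_type_algebra)
  next
    fix a b :: 'k and x assume x: "x \<in> carrier V"
    show "(a \<oplus>\<^bsub>ring_of_type_algebra\<^esub> b) \<odot>\<^bsub>V\<^esub> x = a \<odot>\<^bsub>V\<^esub> x \<oplus>\<^bsub>V\<^esub> b \<odot>\<^bsub>V\<^esub> x"
      by (rule C(10)) (simp_all add: C(5-8) x scalar_add_left)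
    show "(a \<otimes>\<^bsub>ring_of_type_algebra\<^esub> b) \<odot>\<^bsub>V\<^esub> x = a \<odot>\<^bsub>V\<^esub> (b \<odot>\<^bsub>V\<^esub> x)"
      by (rule C(10)) (simp_all add: C(7,8) x)
  next
    fix a :: 'k and x y assume x: "x \<in> carrier V" and y: "y \<in> carrier V"
    show "a \<odot>\<^bsub>V\<^esub> (x \<oplus>\<^bsub>V\<^esub> y) = a \<odot>\<^bsub>V\<^esub> x \<oplus>\<^bsub>V\<^esub> a \<odot>\<^bsub>V\<^esub> y"
      by (rule C(10)) (simp_all add: C(5-8) x y scalar_add)
  next
    fix x assume x: "x \<in> carrier V"
    show "\<one>\<^bsub>ring_of_type_algebra\<^esub> \<odot>\<^bsub>V\<^esub> x = x"
      by (rule C(10)) (simp_all add: C(7,8) x)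
  qed (simp_all add: C(7))
qed

lemma coords_lhom:
  assumes "coords V S dg \<kappa>"
  shows "lhom V (free_gr_space dg S) \<kappa>" "lhom (free_gr_space dg S) V (uncoord V \<kappa>)"
proof -
  note C = coordsD[OF assms] and U = uncoord[OF assms]
  show "lhom V (free_gr_space dg S) \<kappa>"
    by (rule lhomI) (simp_all add: C(4,6,8))
  show "lhom (free_gr_space dg S) V (uncoord V \<kappa>)"
  proof (rule lhomI, goal_cases)
    case (1 F)
    then show ?case by (simp add: U(1))
  next
    case (2 F c)
    then have F: "keys F \<subseteq> S" by simp
    show ?case
      by (rule C(10)) (simp_all add: C(7,8) U F keys_scalar_le)
  next
    case (3 F G)
    then have F: "keys F \<subseteq> S" "keys G \<subseteq> S" by simp_all
    show ?case
      by (rule C(10)) (simp_all add: C(5,6) U F keys_add_subset)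
  qed
qed

lemma finsum_lhom:
  assumes "vspace V" "vspace W" "lhom V W h" "f \<in> A \<rightarrow> carrier V"
  shows "h (finsum V f A) = finsum W (\<lambda>a. h (f a)) A"
proof -
  interpret V: vspace V by (rule assms(1))
  interpret W: vspace W by (rule assms(2))
  note h = lhomD[OF assms(3)]
  have h0: "h \<zero>\<^bsub>V\<^esub> = \<zero>\<^bsub>W\<^esub>"
    using h(2)[of "\<zero>\<^bsub>V\<^esub>" 0] h(1)[of "\<zero>\<^bsub>V\<^esub>"] by simp
  show ?thesis
    using assms(4)
  proof (induction A rule: infinite_finite_induct)
    case (insert a A)
    have "finsum V f A \<in> carrier V" using insert.prems by (intro V.finsum_closed) auto
    then show ?case
      using insert h by (simp add: V.finsum_insert W.finsum_insert Pi_iff)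
  qed (simp_all add: h0)
qed

lemma coords_graded:
  fixes V :: "('k::field_char_0, 'v) gr_module"
  assumes c: "coords V S dg \<kappa>"
  shows "graded_space V"
proof -
  let ?P = "free_gr_space dg S :: ('k, _) gr_module"
  note C = coordsD[OF c] and U = uncoord[OF c]
  interpret V: vspace V by (rule coords_vspace[OF c])
  have P: "graded_space ?P" by (rule graded_free)
  have sub: "subspace_of V (grade V d)" for d
    unfolding C(9)
  proof (rule V.subspaceI)
    show "x \<oplus>\<^bsub>V\<^esub> y \<in> {x \<in> carrier V. keys (\<kappa> x) \<subseteq> {s \<in> S. dg s = d}}"
      if "x \<in> {x \<in> carrier V. keys (\<kappa> x) \<subseteq> {s \<in> S. dg s = d}}"
        "y \<in> {x \<in> carrier V. keys (\<kappa> x) \<subseteq> {s \<in> S. dg s = d}}" for x y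
      using that by (simp add: C(5,6) keys_add_subset)
    show "c \<odot>\<^bsub>V\<^esub> x \<in> {x \<in> carrier V. keys (\<kappa> x) \<subseteq> {s \<in> S. dg s = d}}"
      if "x \<in> {x \<in> carrier V. keys (\<kappa> x) \<subseteq> {s \<in> S. dg s = d}}" for x c
      using that by (simp add: C(7,8) keys_scalar_le)
  qed (auto simp: C(2,3))
  have gr: "x \<in> grade V d \<longleftrightarrow> x \<in> carrier V \<and> \<kappa> x \<in> grade ?P d" for x d
    by (simp add: C(9))
  have dec: "\<exists>!e. (\<forall>d. e d \<in> grade V d) \<and> finite {d. e d \<noteq> \<zero>\<^bsub>V\<^esub>} \<and> v = finsum V e {d. e d \<noteq> \<zero>\<^bsub>V\<^esub>}"
    if v: "v \<in> carrier V" for v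
  proof -
    have "\<kappa> v \<in> carrier ?P" using C(4)[OF v] by simp
    note ex = P[unfolded graded_space_def, THEN conjunct2, THEN conjunct2, THEN bspec, OF this]
    define e where "e = (THE e. (\<forall>d. e d \<in> grade ?P d) \<and> finite {d. e d \<noteq> \<zero>\<^bsub>?P\<^esub>} \<and> \<kappa> v = finsum ?P e {d. e d \<noteq> \<zero>\<^bsub>?P\<^esub>})"
    note e' = theI'[OF ex, folded e_def]
    have e: "\<forall>d. e d \<in> grade ?P d" "finite {d. e d \<noteq> 0}" "\<kappa> v = finsum ?P e {d. e d \<noteq> 0}"
      using e'[THEN conjunct1] e'[THEN conjunct2, THEN conjunct1] e'[THEN conjunct2, THEN conjunct2]
      unfolding free_gr_space_simps(4) by - assumption+
    have uniq: "e' = e" if "\<forall>d. e' d \<in> grade ?P d" "finite {d. e' d \<noteq> 0}" "\<kappa> v = finsum ?P e' {d. e' d \<noteq> 0}" for e'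
      unfolding e_def by (rule the1_equality[OF ex, symmetric], intro conjI) (unfold free_gr_space_simps(4), (fact that)+)
    have ek: "keys (e d) \<subseteq> S" for d using e(1) by auto
    show ?thesis
    proof (rule ex1I[of _ "\<lambda>d. uncoord V \<kappa> (e d)"], intro conjI allI)
      show "uncoord V \<kappa> (e d) \<in> grade V d" for d
        unfolding gr using e(1) ek by (simp add: U)
      have nz: "{d. uncoord V \<kappa> (e d) \<noteq> \<zero>\<^bsub>V\<^esub>} = {d. e d \<noteq> 0}"
      proof -
        have "uncoord V \<kappa> (e d) = \<zero>\<^bsub>V\<^esub> \<longleftrightarrow> e d = 0" for d
          using C(3) U(2)[OF ek] U(3)[OF C(2)] by metis
        then show ?thesis by simp
      qed
      show "finite {d. uncoord V \<kappa> (e d) \<noteq> \<zero>\<^bsub>V\<^esub>}" unfolding nz by (rule e(2))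
      have "v = uncoord V \<kappa> (finsum ?P e {d. e d \<noteq> 0})" using U(3)[OF v] e(3) by simp
      also have "\<dots> = finsum V (\<lambda>d. uncoord V \<kappa> (e d)) {d. e d \<noteq> 0}"
        by (rule finsum_lhom[OF vspace_free V.vspace_axioms coords_lhom(2)[OF c]]) (use ek in auto)
      finally show "v = finsum V (\<lambda>d. uncoord V \<kappa> (e d)) {d. uncoord V \<kappa> (e d) \<noteq> \<zero>\<^bsub>V\<^esub>}" unfolding nz .
    next
      fix e' assume e': "(\<forall>d. e' d \<in> grade V d) \<and> finite {d. e' d \<noteq> \<zero>\<^bsub>V\<^esub>} \<and> v = finsum V e' {d. e' d \<noteq> \<zero>\<^bsub>V\<^esub>}"
      then have cl: "e' d \<in> carrier V" for d by (simp add: gr)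
      have nz: "{d. \<kappa> (e' d) \<noteq> 0} = {d. e' d \<noteq> \<zero>\<^bsub>V\<^esub>}"
        using C(3) C(10)[OF cl C(2)] by auto
      have "(\<lambda>d. \<kappa> (e' d)) = e"
      proof (rule uniq)
        show "\<forall>d. \<kappa> (e' d) \<in> grade ?P d" using e' by (simp add: gr)
        show "finite {d. \<kappa> (e' d) \<noteq> 0}" unfolding nz using e' by blast
        have "\<kappa> v = \<kappa> (finsum V e' {d. e' d \<noteq> \<zero>\<^bsub>V\<^esub>})" using e' by simp
        also have "\<dots> = finsum ?P (\<lambda>d. \<kappa> (e' d)) {d. e' d \<noteq> \<zero>\<^bsub>V\<^esub>}"
          by (rule finsum_lhom[OF V.vspace_axioms vspace_free coords_lhom(1)[OF c]]) (use cl in auto)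
        finally show "\<kappa> v = finsum ?P (\<lambda>d. \<kappa> (e' d)) {d. \<kappa> (e' d) \<noteq> 0}" unfolding nz .
      qed
      then show "e' = (\<lambda>d. uncoord V \<kappa> (e d))"
        using U(3)[OF cl] by auto
    qed
  qed
  show ?thesis
    unfolding graded_space_def by (intro conjI allI ballI V.module_V sub dec)
qed

lemma pm_induct [consumes 1, case_names zero add]:
  fixes F :: "'a \<Rightarrow>\<^sub>0 'k::field_char_0"
  assumes "keys F \<subseteq> S" "P 0"
    "\<And>F s c. keys F \<subseteq> S \<Longrightarrow> s \<in> S \<Longrightarrow> P F \<Longrightarrow> P (single s c + F)"
  shows "P F"
proof -
  have "A \<subseteq> S \<Longrightarrow> P (\<Sum>a\<in>A. single a (lookup F a))" if "finite A" for A
    using that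
  proof (induction A rule: finite_induct)
    case (insert a A)
    have "keys (\<Sum>a\<in>A. single a (lookup F a)) \<subseteq> S"
      by (rule keys_sum_subset) (use insert.prems in auto)
    from assms(3)[OF this, of a] insert show ?case by simp
  qed (simp add: assms(2))
  from this[of "keys F"] assms(1) show ?thesis
    by (simp flip: poly_mapping_expansion)
qed


section \<open>Homogeneous bases\<close>

lemma ex1_eq: "\<exists>!x. P x \<Longrightarrow> P a \<Longrightarrow> P b \<Longrightarrow> a = b"
  by blast

text \<open>
  A maximal linearly independent set of homogeneous elements spans every homogeneous component, and thus the space.
\<close>

lemma homogeneous_basis:
  fixes U :: "('k::field_char_0, 'x) gr_module"
  assumes U: "graded_space U"
  obtains E dg \<kappa> where "coords U E dg \<kappa>" "E \<subseteq> carrier U" "\<And>e. e \<in> E \<Longrightarrow> \<kappa> e = single e 1"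
proof -
  interpret vspace U using U by (intro vspace.intro) (simp add: graded_space_def)
  have gs: "subspace_of U (grade U d)" for d using U by (simp add: graded_space_def)
  note G = subspaceD[OF gs]
  let ?lc = "lc U (\<lambda>x. x)"
  define indep where "indep E \<longleftrightarrow> (\<forall>F. keys F \<subseteq> E \<and> ?lc F = \<zero>\<^bsub>U\<^esub> \<longrightarrow> F = 0)" for E
  let ?A = "{E. E \<subseteq> (\<Union>d. grade U d) \<and> indep E}"
  have "\<exists>M\<in>?A. \<forall>Y\<in>?A. M \<subseteq> Y \<longrightarrow> Y = M"
  proof (rule subset_Zorn_nonempty)
    have "{} \<in> ?A" by (auto simp: indep_def)
    then show "?A \<noteq> {}" by blast
    fix C assume C: "C \<noteq> {}" "subset.chain ?A C"
    have "indep (\<Union>C)"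
      unfolding indep_def
    proof (intro allI impI)
      fix F assume F: "keys F \<subseteq> \<Union>C \<and> ?lc F = \<zero>\<^bsub>U\<^esub>"
      then obtain E where "E \<in> C" "keys F \<subseteq> E"
        using finite_subset_Union_chain[OF finite_keys _ C(1) C(2)] by metis
      then show "F = 0" using F C(2) by (auto simp: subset.chain_def indep_def)
    qed
    then show "\<Union>C \<in> ?A" using C(2) by (auto simp: subset.chain_def)
  qed
  then obtain E where EA: "E \<in> ?A" and maxA: "\<forall>Y\<in>?A. E \<subseteq> Y \<longrightarrow> Y = E" by (elim bexE)
  have E: "E \<subseteq> (\<Union>d. grade U d)" "indep E" using EA by simp_all
  have max: "Y = E" if "Y \<subseteq> (\<Union>d. grade U d)" "indep Y" "E \<subseteq> Y" for Y
    using maxA[THEN bspec, of Y] that by simp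
  have Ec: "E \<subseteq> carrier U" using E(1) G(1) by blast
  have v: "vlin U E ?lc" by (rule vlin_lc) (use Ec in auto)
  note V = vlinD[OF v]
  have inj: "F = G" if "keys F \<subseteq> E" "keys G \<subseteq> E" "?lc F = ?lc G" for F G
  proof -
    have n: "keys (scalar (-1) G) \<subseteq> E" using that(2) by (rule keys_scalar_le)
    have "?lc (F + scalar (-1) G) = 1 \<odot>\<^bsub>U\<^esub> ?lc F \<oplus>\<^bsub>U\<^esub> (-1) \<odot>\<^bsub>U\<^esub> ?lc G"
      using V(3)[OF that(1) n] V(2)[OF that(2)] V(1)[OF that(1)] by simp
    also have "\<dots> = \<zero>\<^bsub>U\<^esub>"
      unfolding that(3) using V(1)[OF that(2)] by (simp only: smult_add_left[symmetric]) simp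
    finally have "F + scalar (-1) G = 0"
      using E(2) keys_add_subset[OF that(1) n] unfolding indep_def by blast
    then show ?thesis by (simp add: scalar_uminus)
  qed
  let ?R = "?lc ` {F. keys F \<subseteq> E}"
  have R: "subspace_of U ?R"
  proof (rule subspaceI)
    show "?R \<subseteq> carrier U" using V(1) by auto
    show "\<zero>\<^bsub>U\<^esub> \<in> ?R" by (rule image_eqI[of _ _ 0]) simp_all
    show "x \<oplus>\<^bsub>U\<^esub> y \<in> ?R" if "x \<in> ?R" "y \<in> ?R" for x y
    proof -
      from that obtain F G where FG: "keys F \<subseteq> E" "keys G \<subseteq> E" "x = ?lc F" "y = ?lc G" by auto
      show ?thesis
        unfolding FG(3,4) V(3)[OF FG(1,2), symmetric] by (rule imageI) (simp add: keys_add_subset FG(1,2))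
    qed
    show "c \<odot>\<^bsub>U\<^esub> x \<in> ?R" if "x \<in> ?R" for x c
    proof -
      from that obtain F where F: "keys F \<subseteq> E" "x = ?lc F" by auto
      show ?thesis
        unfolding F(2) V(2)[OF F(1), symmetric] by (rule imageI) (simp add: keys_scalar_le F(1))
    qed
  qed
  have hom: "x \<in> ?R" if x: "x \<in> grade U d" for x d
  proof (rule ccontr)
    assume nx: "x \<notin> ?R"
    have xc: "x \<in> carrier U" using G(1) x by blast
    have "indep (insert x E)"
      unfolding indep_def
    proof (intro allI impI, elim conjE)
      fix F assume F: "keys F \<subseteq> insert x E" "?lc F = \<zero>\<^bsub>U\<^esub>"
      define c where "c = lookup F x"
      define H where "H = F - single x c"
      have H: "keys H \<subseteq> E"
        using F(1) by (auto simp: H_def c_def in_keys_iff lookup_minus lookup_single when_def split: if_splits)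
      have FH: "F = single x c + H" by (simp add: H_def)
      have v': "vlin U (insert x E) ?lc" by (rule vlin_lc) (use Ec xc in auto)
      have "\<zero>\<^bsub>U\<^esub> = c \<odot>\<^bsub>U\<^esub> x \<oplus>\<^bsub>U\<^esub> ?lc H"
      proof -
        have "?lc (single x c + H) = ?lc (single x c) \<oplus>\<^bsub>U\<^esub> ?lc H"
          by (rule vlinD(3)[OF v']) (use H in auto)
        then show ?thesis using F(2) xc unfolding FH by simp
      qed
      show "F = 0"
      proof (cases "c = 0")
        case True
        then have "F = H" by (simp add: FH)
        then show ?thesis using F(2) H E(2) unfolding indep_def by blast
      next
        case False
        have "?lc (scalar (- 1 / c) H) = (- 1 / c) \<odot>\<^bsub>U\<^esub> ?lc H" by (rule V(2)[OF H])
        also have "\<dots> = (- 1 / c) \<odot>\<^bsub>U\<^esub> ?lc H \<oplus>\<^bsub>U\<^esub> ((-1) \<odot>\<^bsub>U\<^esub> x \<oplus>\<^bsub>U\<^esub> 1 \<odot>\<^bsub>U\<^esub> x)"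
          using xc V(1)[OF H] by (simp only: smult_add_left[symmetric]) simp
        also have "\<dots> = (- 1 / c) \<odot>\<^bsub>U\<^esub> (c \<odot>\<^bsub>U\<^esub> x \<oplus>\<^bsub>U\<^esub> ?lc H) \<oplus>\<^bsub>U\<^esub> x"
          using xc V(1)[OF H] False by (simp add: smult_add_right a_ac)
        also have "\<dots> = x" using \<open>\<zero>\<^bsub>U\<^esub> = _\<close>[symmetric] xc by simp
        finally have *: "?lc (scalar (- 1 / c) H) = x" .
        have "x \<in> ?R" by (subst *[symmetric], rule imageI) (simp add: keys_scalar_le H)
        with nx show ?thesis by contradiction
      qed
    qed
    then have "insert x E = E" using E(1) x by (intro max) auto
    then have "x \<in> E" by blast
    then have "x \<in> ?R" using xc by (intro image_eqI[of _ _ "single x 1"]) auto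
    with nx show False by contradiction
  qed
  have dec: "\<exists>!c. (\<forall>d. c d \<in> grade U d) \<and> finite {d. c d \<noteq> \<zero>\<^bsub>U\<^esub>} \<and> v = finsum U c {d. c d \<noteq> \<zero>\<^bsub>U\<^esub>}"
    if "v \<in> carrier U" for v
    by (rule U[unfolded graded_space_def, THEN conjunct2, THEN conjunct2, THEN bspec, OF that])
  have surj: "x \<in> ?R" if x: "x \<in> carrier U" for x
  proof -
    obtain c where c: "\<forall>d. c d \<in> grade U d" "x = finsum U c {d. c d \<noteq> \<zero>\<^bsub>U\<^esub>}"
      using theI'[OF dec[OF x]] by (elim conjE) (rule that)
    show ?thesis unfolding c(2) by (rule finsum_in_subspace[OF R]) (use c(1) hom in blast)
  qed
  have bij: "bij_betw ?lc {F. keys F \<subseteq> E} (carrier U)"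
    unfolding bij_betw_def using inj surj V(1) by (auto intro!: inj_onI)
  define dg where "dg e = (SOME d. e \<in> grade U d)" for e
  have dg: "e \<in> grade U (dg e)" if "e \<in> E" for e
    using E(1) that unfolding dg_def by (auto intro: someI)
  define \<kappa> where "\<kappa> = inv_into {F. keys F \<subseteq> E} ?lc"
  have \<kappa>lc: "\<kappa> (?lc F) = F" if "keys F \<subseteq> E" for F
    unfolding \<kappa>_def using bij that by (intro inv_into_f_f) (auto simp: bij_betw_def)
  have k: "keys (\<kappa> x) \<subseteq> E" "?lc (\<kappa> x) = x" if "x \<in> carrier U" for x
    using surj[OF that] \<kappa>lc by auto
  have gradeE: "x \<in> grade U d \<longleftrightarrow> keys (\<kappa> x) \<subseteq> {s \<in> E. dg s = d}" if x: "x \<in> carrier U" for x d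
  proof
    assume a: "keys (\<kappa> x) \<subseteq> {s \<in> E. dg s = d}"
    have "?lc (\<kappa> x) \<in> grade U d"
      unfolding lc_def by (rule finsum_in_subspace[OF gs]) (use a dg in \<open>auto intro!: G(4)\<close>)
    then show "x \<in> grade U d" using k(2)[OF x] by simp
  next
    assume a: "x \<in> grade U d"
    let ?p = "\<lambda>d. part dg d (\<kappa> x)"
    have pk: "keys (?p d') \<subseteq> {s \<in> E. dg s = d'}" for d'
      using k(1)[OF x] by (auto simp: in_keys_iff lookup_part split: if_splits)
    then have pE: "keys (?p d') \<subseteq> E" for d' by blast
    have nz: "{d'. ?lc (?p d') \<noteq> \<zero>\<^bsub>U\<^esub>} = {d'. ?p d' \<noteq> 0}"
      using E(2) pE unfolding indep_def by auto
    have 1: "(\<forall>d'. ?lc (?p d') \<in> grade U d') \<and> finite {d'. ?lc (?p d') \<noteq> \<zero>\<^bsub>U\<^esub>} \<and>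
      x = finsum U (\<lambda>d'. ?lc (?p d')) {d'. ?lc (?p d') \<noteq> \<zero>\<^bsub>U\<^esub>}"
    proof (intro conjI allI)
      show "?lc (?p d') \<in> grade U d'" for d'
        unfolding lc_def by (rule finsum_in_subspace[OF gs]) (use pk dg in \<open>auto intro!: G(4)\<close>)
      show "finite {d'. ?lc (?p d') \<noteq> \<zero>\<^bsub>U\<^esub>}" unfolding nz by (rule part_decomposition)
      have "x = ?lc (\<Sum>d'\<in>{d'. ?p d' \<noteq> 0}. ?p d')" using k(2)[OF x] by (simp add: part_decomposition(2))
      also have "\<dots> = finsum U (\<lambda>d'. ?lc (?p d')) {d'. ?p d' \<noteq> 0}"
        by (rule vlin_sum[OF v part_decomposition(1)]) (rule pE)
      finally show "x = finsum U (\<lambda>d'. ?lc (?p d')) {d'. ?lc (?p d') \<noteq> \<zero>\<^bsub>U\<^esub>}" unfolding nz .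
    qed
    let ?c = "\<lambda>d'. if d' = d then x else \<zero>\<^bsub>U\<^esub>"
    have 2: "(\<forall>d'. ?c d' \<in> grade U d') \<and> finite {d'. ?c d' \<noteq> \<zero>\<^bsub>U\<^esub>} \<and> x = finsum U ?c {d'. ?c d' \<noteq> \<zero>\<^bsub>U\<^esub>}"
    proof (cases "x = \<zero>\<^bsub>U\<^esub>")
      case False
      then have "{d'. ?c d' \<noteq> \<zero>\<^bsub>U\<^esub>} = {d}" by auto
      then show ?thesis using a x G(2) by (simp add: finsum_insert[of "{}"])
    qed (use G(2) in simp)
    have eq: "(\<lambda>d'. ?lc (?p d')) = ?c"
      by (rule ex1_eq[OF dec[OF x]]) (rule 1, rule 2)
    have "?p d' = 0" if "d' \<noteq> d" for d'
    proof -
      have "?lc (?p d') = \<zero>\<^bsub>U\<^esub>" using fun_cong[OF eq, of d'] that by simp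
      then show ?thesis using E(2) pE unfolding indep_def by blast
    qed
    then have "lookup (\<kappa> x) s = 0" if "dg s \<noteq> d" for s
      using lookup_part[of dg "dg s" "\<kappa> x" s] that by auto
    then show "keys (\<kappa> x) \<subseteq> {s \<in> E. dg s = d}"
      using k(1)[OF x] by (auto simp: in_keys_iff)
  qed
  have "coords U E dg \<kappa>"
    unfolding coords_def
  proof (intro conjI allI ballI)
    show "bij_betw \<kappa> (carrier U) {F. keys F \<subseteq> E}"
      unfolding \<kappa>_def by (rule bij_betw_inv_into[OF bij])
    show "\<kappa> \<zero>\<^bsub>U\<^esub> = 0" using \<kappa>lc[of 0] by simp
    fix x assume x: "x \<in> carrier U"
    show "\<kappa> (c \<odot>\<^bsub>U\<^esub> x) = scalar c (\<kappa> x)" for c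
      using \<kappa>lc[OF keys_scalar_le[OF k(1)[OF x]], of c] V(2)[OF k(1)[OF x], of c] k(2)[OF x] by simp
    fix y assume y: "y \<in> carrier U"
    show "\<kappa> (x \<oplus>\<^bsub>U\<^esub> y) = \<kappa> x + \<kappa> y"
      using \<kappa>lc[OF keys_add_subset[OF k(1)[OF x] k(1)[OF y]]] V(3)[OF k(1)[OF x] k(1)[OF y]] k(2)[OF x] k(2)[OF y] by simp
  next
    show "grade U d = {x \<in> carrier U. keys (\<kappa> x) \<subseteq> {s \<in> E. dg s = d}}" for d
      using gradeE G(1) by blast
  qed auto
  moreover have "\<kappa> e = single e 1" if "e \<in> E" for e
    using \<kappa>lc[of "single e 1"] Ec that by auto
  ultimately show ?thesis using that Ec by blast
qed


section \<open>Quotients in coordinates\<close>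

text \<open>
  Each quotient that occurs divides a space of finitely supported functions by the kernel \<open>N\<close> of a linear map \<open>k0\<close> with a section \<open>p\<close>. Its
  cosets are the fibres of \<open>k0\<close>, and the value of \<open>k0\<close> on a coset is its coordinate.
\<close>

locale quotient_coords =
  fixes V :: "('k::field_char_0, 'a \<Rightarrow>\<^sub>0 'k, 'e) module_scheme" and Y :: "'a set" and N :: "('a \<Rightarrow>\<^sub>0 'k) set"
    and k0 :: "('a \<Rightarrow>\<^sub>0 'k) \<Rightarrow> ('s \<Rightarrow>\<^sub>0 'k)" and S :: "'s set" and p :: "'s \<Rightarrow> ('a \<Rightarrow>\<^sub>0 'k)"
  assumes V: "carrier V = {f. keys f \<subseteq> Y}"
      "\<And>f g. f \<oplus>\<^bsub>V\<^esub> g = f + g" "\<And>c f. c \<odot>\<^bsub>V\<^esub> f = scalar c f"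
    and lin_k0: "lin k0" and k0_keys: "keys f \<subseteq> Y \<Longrightarrow> keys (k0 f) \<subseteq> S"
    and p: "s \<in> S \<Longrightarrow> keys (p s) \<subseteq> Y" "s \<in> S \<Longrightarrow> k0 (p s) = single s 1"
    and N: "N = {f. keys f \<subseteq> Y \<and> k0 f = 0}"
begin

definition fib :: "('s \<Rightarrow>\<^sub>0 'k) \<Rightarrow> ('a \<Rightarrow>\<^sub>0 'k) set"
  where "fib F = {g. keys g \<subseteq> Y \<and> k0 g = F}"

definition kap :: "('a \<Rightarrow>\<^sub>0 'k) set \<Rightarrow> ('s \<Rightarrow>\<^sub>0 'k)"
  where "kap A = k0 (SOME f. f \<in> A)"

lemma coset_eq:
  assumes "keys f \<subseteq> Y"
  shows "N +>\<^bsub>V\<^esub> f = fib (k0 f)"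
proof -
  have "g \<in> fib (k0 f) \<longleftrightarrow> (\<exists>h\<in>N. g = h + f)" for g
  proof
    assume g: "g \<in> fib (k0 f)"
    then have "g - f \<in> N"
      using assms by (simp add: fib_def N lin_diff[OF lin_k0] keys_diff_subset)
    then show "\<exists>h\<in>N. g = h + f" by (intro bexI[of _ "g - f"]) simp_all
  next
    assume "\<exists>h\<in>N. g = h + f"
    then obtain h where "keys h \<subseteq> Y" "k0 h = 0" "g = h + f" unfolding N by blast
    then show "g \<in> fib (k0 f)"
      unfolding fib_def using assms by (simp add: lin_addD[OF lin_k0] keys_add_subset)
  qed
  then show ?thesis
    unfolding set_eq_iff by (simp add: a_r_coset_def' V(2))
qed

lemma lift: "keys F \<subseteq> S \<Longrightarrow> keys (linext p F) \<subseteq> Y \<and> k0 (linext p F) = F"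
proof -
  assume F: "keys F \<subseteq> S"
  have "k0 (linext p F) = linext (\<lambda>s. k0 (p s)) F" by (rule lin_linext_apply[OF lin_k0])
  also have "\<dots> = linext (\<lambda>s. single s 1) F"
    by (rule linext_cong[OF refl], rule p(2)) (use F in blast)
  finally have "k0 (linext p F) = F" by simp
  moreover have "keys (linext p F) \<subseteq> Y"
    by (rule keys_linext_subset, rule p(1)) (use F in blast)
  ultimately show ?thesis by blast
qed

lemma kap_fib [simp]: "keys F \<subseteq> S \<Longrightarrow> kap (fib F) = F"
proof -
  assume F: "keys F \<subseteq> S"
  have "linext p F \<in> fib F" using lift[OF F] by (simp add: fib_def)
  then have "(SOME f. f \<in> fib F) \<in> fib F" by (rule someI)
  then show "kap (fib F) = F" by (simp add: kap_def fib_def)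
qed

lemma carrier_quot: "carrier (quot_space V N) = fib ` {F. keys F \<subseteq> S}"
proof -
  have "carrier (quot_space V N) = (\<Union>f\<in>{f. keys f \<subseteq> Y}. {N +>\<^bsub>V\<^esub> f})"
    by (simp add: quot_space_def mk_module_def A_RCOSETS_def' V(1))
  also have "\<dots> = (\<Union>f\<in>{f. keys f \<subseteq> Y}. {fib (k0 f)})"
    by (intro SUP_cong refl) (simp add: coset_eq)
  also have "\<dots> = fib ` k0 ` {f. keys f \<subseteq> Y}"
    by blast
  also have "k0 ` {f. keys f \<subseteq> Y} = {F. keys F \<subseteq> S}"
  proof (intro subset_antisym subsetI)
    fix F :: "'s \<Rightarrow>\<^sub>0 'k" assume "F \<in> {F. keys F \<subseteq> S}"
    then have "keys (linext p F) \<subseteq> Y \<and> k0 (linext p F) = F" using lift by simp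
    then show "F \<in> k0 ` {f. keys f \<subseteq> Y}" by (intro image_eqI[of _ _ "linext p F"]) simp_all
  qed (use k0_keys in blast)
  finally show ?thesis .
qed

lemma add_quot:
  assumes "keys F \<subseteq> S" "keys G \<subseteq> S"
  shows "fib F \<oplus>\<^bsub>quot_space V N\<^esub> fib G = fib (F + G)"
proof -
  have "h \<in> fib (F + G) \<longleftrightarrow> (\<exists>f\<in>fib F. \<exists>g\<in>fib G. h = f + g)" for h
  proof
    assume h: "h \<in> fib (F + G)"
    let ?f = "linext p F"
    have "?f \<in> fib F" using lift[OF assms(1)] by (simp add: fib_def)
    moreover have "h - ?f \<in> fib G"
      using h lift[OF assms(1)] by (simp add: fib_def lin_diff[OF lin_k0] keys_diff_subset)
    moreover have "h = ?f + (h - ?f)" by simp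
    ultimately show "\<exists>f\<in>fib F. \<exists>g\<in>fib G. h = f + g" by blast
  next
    assume "\<exists>f\<in>fib F. \<exists>g\<in>fib G. h = f + g"
    then obtain f g where "keys f \<subseteq> Y" "k0 f = F" "keys g \<subseteq> Y" "k0 g = G" "h = f + g"
      unfolding fib_def by blast
    then show "h \<in> fib (F + G)"
      by (simp add: fib_def lin_addD[OF lin_k0] keys_add_subset)
  qed
  moreover have "fib F \<oplus>\<^bsub>quot_space V N\<^esub> fib G = fib F <+>\<^bsub>V\<^esub> fib G"
    by (simp add: quot_space_def mk_module_def)
  ultimately show ?thesis
    unfolding set_eq_iff by (simp add: set_add_def' V(2))
qed

lemma smult_quot:
  assumes "keys F \<subseteq> S"
  shows "c \<odot>\<^bsub>quot_space V N\<^esub> fib F = fib (scalar c F)"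
proof -
  have "N +>\<^bsub>V\<^esub> (c \<odot>\<^bsub>V\<^esub> a) = fib (scalar c F)" if "a \<in> fib F" for a
    using that coset_eq[of "scalar c a"] by (simp add: fib_def V lin_scalarD[OF lin_k0] keys_scalar_le)
  then have "(\<Union>a\<in>fib F. N +>\<^bsub>V\<^esub> (c \<odot>\<^bsub>V\<^esub> a)) = (\<Union>a\<in>fib F. fib (scalar c F))"
    by (intro SUP_cong refl)
  moreover have "linext p F \<in> fib F" using lift[OF assms] by (simp add: fib_def)
  ultimately show ?thesis
    by (auto simp: quot_space_def mk_module_def)
qed

lemma zero_quot: "\<zero>\<^bsub>quot_space V N\<^esub> = fib 0"
  by (auto simp: quot_space_def mk_module_def fib_def N)

lemma kap_carrier: "A \<in> carrier (quot_space V N) \<Longrightarrow> keys (kap A) \<subseteq> S \<and> fib (kap A) = A"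
  by (auto simp: carrier_quot)

lemma coords_quot:
  assumes "\<And>d. g d = {A \<in> carrier (quot_space V N). keys (kap A) \<subseteq> {s \<in> S. dg s = d}}"
  shows "coords (with_grading (quot_space V N) g) S dg kap"
proof -
  let ?Q = "with_grading (quot_space V N) g"
  have q: "carrier ?Q = carrier (quot_space V N)" "add ?Q = add (quot_space V N)"
    "module.smult ?Q = module.smult (quot_space V N)" "ring.zero ?Q = ring.zero (quot_space V N)" "grade ?Q = g"
    by (simp_all add: with_grading_def gr_module.defs module.defs)
  show ?thesis
    unfolding coords_def q
  proof (intro conjI allI ballI)
    show "bij_betw kap (carrier (quot_space V N)) {F. keys F \<subseteq> S}"
      by (rule bij_betw_byWitness[of _ fib]) (auto simp: carrier_quot)
    show "\<zero>\<^bsub>quot_space V N\<^esub> \<in> carrier (quot_space V N)" "kap \<zero>\<^bsub>quot_space V N\<^esub> = 0"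
      by (auto simp: zero_quot carrier_quot)
    fix A assume "A \<in> carrier (quot_space V N)"
    then obtain F where F: "keys F \<subseteq> S" "A = fib F" by (auto simp: carrier_quot)
    show "c \<odot>\<^bsub>quot_space V N\<^esub> A \<in> carrier (quot_space V N)" "kap (c \<odot>\<^bsub>quot_space V N\<^esub> A) = scalar c (kap A)" for c
      using F keys_scalar_le[OF F(1), of c] by (auto simp: smult_quot carrier_quot)
    fix B assume "B \<in> carrier (quot_space V N)"
    then obtain G where G: "keys G \<subseteq> S" "B = fib G" by (auto simp: carrier_quot)
    show "A \<oplus>\<^bsub>quot_space V N\<^esub> B \<in> carrier (quot_space V N)" "kap (A \<oplus>\<^bsub>quot_space V N\<^esub> B) = kap A + kap B"
      using F G keys_add_subset[OF F(1) G(1)] by (auto simp: add_quot carrier_quot)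
  qed (use assms in blast)
qed

text \<open>
  The homogeneous components of tensor products are spans of classes, which are identified by exhibiting the
  classes of basis elements among the generators.
\<close>

lemma span_eq:
  assumes gen: "\<And>A. A \<in> Gen \<Longrightarrow> A \<in> carrier (quot_space V N) \<and> keys (kap A) \<subseteq> S'"
    and "S' \<subseteq> S" and gen': "\<And>s. s \<in> S' \<Longrightarrow> fib (single s 1) \<in> Gen"
  shows "span_in (quot_space V N) Gen = {A \<in> carrier (quot_space V N). keys (kap A) \<subseteq> S'}"
proof -
  let ?Q = "quot_space V N"
  have co: "coords (with_grading ?Q (\<lambda>d. {A \<in> carrier ?Q. keys (kap A) \<subseteq> {s \<in> S. 0 = d}})) S (\<lambda>_. 0) kap"
    (is "coords ?W _ _ _")
    by (rule coords_quot) simp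
  have q: "carrier ?W = carrier ?Q" "add ?W = add ?Q" "module.smult ?W = module.smult ?Q" "ring.zero ?W = ring.zero ?Q"
    by (simp_all add: with_grading_def gr_module.defs module.defs)
  interpret W: vspace ?W by (rule coords_vspace[OF co])
  interpret Q: vspace ?Q
  proof (intro vspace.intro moduleI)
    show "cring (ring_of_type_algebra :: 'k ring)" by (rule cring_from_type_algebra)
    show "abelian_group ?Q"
    proof (rule abelian_groupI)
      show "\<exists>y\<in>carrier ?Q. y \<oplus>\<^bsub>?Q\<^esub> x = \<zero>\<^bsub>?Q\<^esub>" if "x \<in> carrier ?Q" for x
        using W.l_neg[unfolded q, OF that] W.a_inv_closed[unfolded q, OF that] by blast
    qed (use W.a_closed[unfolded q] W.zero_closed[unfolded q] W.a_assoc[unfolded q] W.a_comm[unfolded q]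
        W.l_zero[unfolded q] in blast)+
  qed (simp_all add: W.smult_cl[unfolded q] W.smult_add_left[unfolded q] W.smult_add_right[unfolded q]
      W.smult_smult[unfolded q] W.smult_1[unfolded q])
  let ?R = "{A \<in> carrier ?Q. keys (kap A) \<subseteq> S'}"
  note C = coordsD[OF co, unfolded q]
  have R: "subspace_of ?Q ?R"
  proof (rule Q.subspaceI)
    show "A \<oplus>\<^bsub>?Q\<^esub> B \<in> ?R" if "A \<in> ?R" "B \<in> ?R" for A B
      using that by (simp add: C(5,6) keys_add_subset)
    show "c \<odot>\<^bsub>?Q\<^esub> A \<in> ?R" if "A \<in> ?R" for A c
      using that by (simp add: C(7,8) keys_scalar_le)
  qed (auto simp: C(2,3))
  show ?thesis
  proof
    show "span_in ?Q Gen \<subseteq> ?R"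
      unfolding span_in_def by (rule hull_minimal) (use R gen in auto)
    show "?R \<subseteq> span_in ?Q Gen"
    proof
      fix A assume "A \<in> ?R"
      then have A: "A \<in> carrier ?Q" "keys (kap A) \<subseteq> S'" by auto
      show "A \<in> span_in ?Q Gen"
        unfolding span_in_def hull_def
      proof (rule InterI, elim CollectE conjE)
        fix t assume t: "subspace_of ?Q t" "Gen \<subseteq> t"
        note T = Q.subspaceD[OF t(1)]
        have "fib F \<in> t \<and> keys F \<subseteq> S" if "keys F \<subseteq> S'" for F
          using that
        proof (induction rule: pm_induct)
          case zero
          show ?case using T(2) by (simp add: zero_quot)
        next
          case (add F s c)
          have s: "keys (single s (1::'k)) \<subseteq> S" "keys (single s c) \<subseteq> S"
            using add assms(2) by auto
          have "fib (single s 1) \<in> t" using gen' add t(2) by blast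
          from T(4)[OF this, of c] have "fib (single s c) \<in> t"
            using smult_quot[OF s(1), of c] by simp
          from T(3)[OF this, of "fib F"] add add_quot[OF s(2), of F] keys_add_subset[OF s(2), of F]
          show ?case by auto
        qed
        from this[OF A(2)] kap_carrier[OF A(1)] show "A \<in> t" by simp
      qed
    qed
  qed
qed

end


section \<open>Subspaces of spaces of finitely supported functions\<close>

definition psub :: "('a \<Rightarrow>\<^sub>0 'k::field_char_0) set \<Rightarrow> bool"
  where "psub Z \<longleftrightarrow> 0 \<in> Z \<and> (\<forall>f\<in>Z. \<forall>g\<in>Z. f + g \<in> Z) \<and> (\<forall>c. \<forall>f\<in>Z. scalar c f \<in> Z)"

lemma psubD:
  assumes "psub Z"
  shows "0 \<in> Z" "f \<in> Z \<Longrightarrow> g \<in> Z \<Longrightarrow> f + g \<in> Z" "f \<in> Z \<Longrightarrow> scalar c f \<in> Z" "f \<in> Z \<Longrightarrow> g \<in> Z \<Longrightarrow> f - g \<in> Z"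
proof -
  show "0 \<in> Z" and add: "f \<in> Z \<Longrightarrow> g \<in> Z \<Longrightarrow> f + g \<in> Z" and sc: "f \<in> Z \<Longrightarrow> scalar c f \<in> Z" for f g c
    using assms unfolding psub_def by blast+
  show "f \<in> Z \<Longrightarrow> g \<in> Z \<Longrightarrow> f - g \<in> Z"
    using add[of f "scalar (-1) g"] sc[of g "-1"] by (simp add: scalar_uminus)
qed

lemma psub_sum: "psub Z \<Longrightarrow> (\<And>i. i \<in> I \<Longrightarrow> f i \<in> Z) \<Longrightarrow> sum f I \<in> Z"
  by (induction I rule: infinite_finite_induct) (auto simp: psubD)

lemma psub_linext: "psub Z \<Longrightarrow> (\<And>a. a \<in> keys p \<Longrightarrow> \<psi> a \<in> Z) \<Longrightarrow> linext \<psi> p \<in> Z"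
  unfolding linext_def by (rule psub_sum) (auto intro: psubD)

lemma free_space_simps [simp]:
  "carrier (free_space S) = {F. keys F \<subseteq> S}"
  "F \<oplus>\<^bsub>free_space S\<^esub> G = F + G"
  "c \<odot>\<^bsub>free_space S\<^esub> F = scalar c F"
  "\<zero>\<^bsub>free_space S\<^esub> = 0"
  by (simp_all add: free_space_def mk_module_def)

lemma vspace_free_space: "vspace (free_space S :: ('k::field_char_0, _) module)"
  by (rule vspace_poly_mapping[of _ S]) simp_all

lemma subspace_free_space:
  "subspace_of (free_space S :: ('k::field_char_0, _) module) H \<longleftrightarrow> (\<forall>f\<in>H. keys f \<subseteq> S) \<and> psub H"
proof -
  interpret vspace "free_space S :: ('k, _) module" by (rule vspace_free_space)
  show ?thesis
  proof
    assume "subspace_of (free_space S :: ('k, _) module) H"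
    note D = subspaceD[OF this]
    show "(\<forall>f\<in>H. keys f \<subseteq> S) \<and> psub H"
      using D(1) D(2) D(3) D(4) unfolding psub_def by auto
  next
    assume *: "(\<forall>f\<in>H. keys f \<subseteq> S) \<and> psub H"
    show "subspace_of (free_space S :: ('k, _) module) H"
      by (rule subspaceI) (use * in \<open>auto simp: psubD\<close>)
  qed
qed

lemma span_free_space:
  assumes "\<And>f. f \<in> Gen \<Longrightarrow> keys f \<subseteq> S"
  shows "psub (span_in (free_space S :: ('k::field_char_0, _) module) Gen)"
    and "f \<in> Gen \<Longrightarrow> f \<in> span_in (free_space S :: ('k, _) module) Gen"
    and "f \<in> span_in (free_space S :: ('k, _) module) Gen \<Longrightarrow> psub M \<Longrightarrow> Gen \<subseteq> M \<Longrightarrow> f \<in> M \<and> keys f \<subseteq> S"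
proof -
  show "psub (span_in (free_space S :: ('k, _) module) Gen)"
    unfolding psub_def span_in_def hull_def subspace_free_space by (auto simp: psubD)
  show "f \<in> Gen \<Longrightarrow> f \<in> span_in (free_space S :: ('k, _) module) Gen"
    unfolding span_in_def hull_def by blast
  assume f: "f \<in> span_in (free_space S :: ('k, _) module) Gen" and M: "psub M" "Gen \<subseteq> M"
  have "subspace_of (free_space S :: ('k, _) module) (M \<inter> {f. keys f \<subseteq> S})"
    unfolding subspace_free_space psub_def using psubD(1-3)[OF M(1)] by (auto simp: keys_add_subset keys_scalar_le)
  moreover have "Gen \<subseteq> M \<inter> {f. keys f \<subseteq> S}" using M(2) assms by blast
  ultimately have "f \<in> M \<inter> {f. keys f \<subseteq> S}"
    using f unfolding span_in_def hull_def by blast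
  then show "f \<in> M \<and> keys f \<subseteq> S" by simp
qed

text \<open>Modulo the relations of linearity in one argument, that argument can be expanded in coordinates.\<close>

lemma expand_slot:
  assumes c: "coords V S dg \<kappa>" and Z: "psub Z"
    and add: "\<And>x y. x \<in> carrier V \<Longrightarrow> y \<in> carrier V \<Longrightarrow>
      single (\<phi> (x \<oplus>\<^bsub>V\<^esub> y)) 1 - single (\<phi> x) 1 - single (\<phi> y) (1::'k::field_char_0) \<in> Z"
    and smult: "\<And>c x. x \<in> carrier V \<Longrightarrow> single (\<phi> (c \<odot>\<^bsub>V\<^esub> x)) 1 - single (\<phi> x) c \<in> Z"
    and v: "v \<in> carrier V"
  shows "single (\<phi> v) 1
    - linext (\<lambda>s. single (\<phi> (uncoord V \<kappa> (single s 1))) 1) (\<kappa> v) \<in> Z"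
proof -
  note C = coordsD[OF c] and U = uncoord[OF c]
  let ?u = "uncoord V \<kappa>"
  let ?l = "linext (\<lambda>s. single (\<phi> (?u (single s 1))) 1)"
  have "single (\<phi> (?u F)) 1 - ?l F \<in> Z" if "keys F \<subseteq> S" for F
    using that
  proof (induction rule: pm_induct)
    case zero
    have z: "?u 0 = \<zero>\<^bsub>V\<^esub>" using U(3)[OF C(2)] C(3) by simp
    have "0 \<odot>\<^bsub>V\<^esub> \<zero>\<^bsub>V\<^esub> = \<zero>\<^bsub>V\<^esub>"
      by (rule C(10)) (simp_all add: C(2,3,7,8))
    then show ?case using smult[OF C(2), of 0] by (simp add: z)
  next
    case (add F s d)
    let ?x = "?u (single s 1)"
    have s: "keys (single s (1::'k)) \<subseteq> S" "keys (single s d) \<subseteq> S"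
      using add by auto
    have x: "?x \<in> carrier V" by (rule U(1)[OF s(1)])
    have dx: "?u (single s d) = d \<odot>\<^bsub>V\<^esub> ?x"
      by (rule C(10)) (simp_all add: U(1)[OF s(2)] U(2)[OF s(2)] U(2)[OF s(1)] C(7)[OF x] C(8)[OF x])
    have F: "?u F \<in> carrier V" by (rule U(1)[OF add.hyps(1)])
    have sum: "?u (single s d + F) = (d \<odot>\<^bsub>V\<^esub> ?x) \<oplus>\<^bsub>V\<^esub> ?u F"
    proof (rule C(10))
      have "\<kappa> (d \<odot>\<^bsub>V\<^esub> ?x) = single s d" using U(2)[OF s(2)] dx by simp
      then show "\<kappa> (?u (single s d + F)) = \<kappa> ((d \<odot>\<^bsub>V\<^esub> ?x) \<oplus>\<^bsub>V\<^esub> ?u F)"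
        by (simp only: U(2)[OF keys_add_subset[OF s(2) add.hyps(1)]] U(2)[OF add.hyps(1)] C(6)[OF C(7)[OF x] F])
    qed (use U(1) keys_add_subset[OF s(2) add.hyps(1)] C(5)[OF C(7)[OF x] F] in auto)
    let ?S = "\<lambda>x. single (\<phi> x) (1::'k)"
    have "?S ((d \<odot>\<^bsub>V\<^esub> ?x) \<oplus>\<^bsub>V\<^esub> ?u F) - ?l (single s d + F)
      = (?S ((d \<odot>\<^bsub>V\<^esub> ?x) \<oplus>\<^bsub>V\<^esub> ?u F) - ?S (d \<odot>\<^bsub>V\<^esub> ?x) - ?S (?u F))
        + ((?S (d \<odot>\<^bsub>V\<^esub> ?x) - single (\<phi> ?x) d) + (?S (?u F) - ?l F))"
      by simp
    also have "\<dots> \<in> Z"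
      by (intro psubD(2)[OF Z] assms(3)[OF C(7)[OF x] F] smult[OF x] add.IH)
    finally show ?case unfolding sum .
  qed
  from this[OF C(4)[OF v]] show ?thesis by (simp add: U(3)[OF v])
qed


section \<open>Coordinates on the operad\<close>

abbreviation kA :: "(ptree \<Rightarrow>\<^sub>0 'k::field_char_0) set \<Rightarrow> (ptree \<Rightarrow>\<^sub>0 'k)"
  where "kA \<equiv> quotient_coords.kap (linext nf)"

lemma opF_simps [simp]:
  "carrier (opF m n) = {F. keys F \<subseteq> trees m n}"
  "F \<oplus>\<^bsub>opF m n\<^esub> G = F + G"
  "c \<odot>\<^bsub>opF m n\<^esub> F = scalar c F"
  "grade (opF m n) d = {F. keys F \<subseteq> {T \<in> trees m n. tdeg T = d}}"
  unfolding opF_def by simp_all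

lemma linext_nf_keys:
  assumes "1 \<le> m" "keys f \<subseteq> {T \<in> trees m n. P (tdeg T)}"
  shows "keys (linext nf f :: _ \<Rightarrow>\<^sub>0 'k::field_char_0) \<subseteq> {T \<in> Adm m n. P (tdeg T)}"
proof (rule keys_linext_subset, rule subsetI)
  fix T T' assume T: "T \<in> keys f" and T': "T' \<in> keys (nf T :: _ \<Rightarrow>\<^sub>0 'k)"
  have "goodN m T T'" by (rule keys_nf[OF assms(1) T'])
  moreover have "T \<in> {T \<in> trees m n. P (tdeg T)}" using T assms(2) by blast
  ultimately show "T' \<in> {T \<in> Adm m n. P (tdeg T)}"
    by (simp add: goodN_def trees_iff Adm_iff)
qed

lemma linext_nf_Adm: "keys f \<subseteq> Adm m n \<Longrightarrow> linext nf f = f"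
proof -
  assume f: "keys f \<subseteq> Adm m n"
  have "linext nf f = linext (\<lambda>T. single T 1) f"
  proof (rule linext_cong[OF refl])
    fix T assume "T \<in> keys f"
    then have "T \<in> Adm m n" using f by blast
    then show "nf T = single T 1" by (intro nf_adm[of m]) (simp_all add: Adm_iff)
  qed
  then show ?thesis by simp
qed

lemma quotient_opA:
  assumes m: "1 \<le> m"
  shows "quotient_coords (opF m n :: ('k::field_char_0, _) gr_module) (trees m n) (opI m n) (linext nf) (Adm m n)
    (\<lambda>T. single T 1)"
proof
  show "keys f \<subseteq> trees m n \<Longrightarrow> keys (linext nf f :: _ \<Rightarrow>\<^sub>0 'k) \<subseteq> Adm m n" for f
    using linext_nf_keys[OF m, of f n "\<lambda>_. True"] by simp
  show "linext nf (single T 1) = single T (1::'k)" if "T \<in> Adm m n" for T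
    using that nf_adm[of m T] by (simp add: Adm_iff)
  show "opI m n = {f. keys f \<subseteq> trees m n \<and> linext nf f = (0 :: _ \<Rightarrow>\<^sub>0 'k)}"
  proof (intro Set.set_eqI iffI)
    fix f :: "ptree \<Rightarrow>\<^sub>0 'k" assume "f \<in> opI m n"
    then have "(n, f) \<in> op_ideal m" by (simp add: opI_def)
    then show "f \<in> {f. keys f \<subseteq> trees m n \<and> linext nf f = 0}"
      using op_ideal_keys nf_op_ideal[OF m] by blast
  next
    fix f :: "ptree \<Rightarrow>\<^sub>0 'k" assume f: "f \<in> {f. keys f \<subseteq> trees m n \<and> linext nf f = 0}"
    have "(n, linext (\<lambda>T. nf T - single T 1) f) \<in> op_ideal m"
    proof (rule op_ideal_linext)
      fix T assume "T \<in> keys f"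
      then have "valid m T" "legs T = n" using f by (auto simp: trees_iff)
      then show "(n, nf T - single T (1::'k)) \<in> op_ideal m" using nf_cong[OF _ m, of T] by simp
    qed
    also have "linext (\<lambda>T. nf T - single T 1) f = - f"
      using f by (simp add: linext_minus_fun)
    finally show "f \<in> opI m n" using op_ideal_uminus[of n "- f" m] by (simp add: opI_def)
  qed
qed (auto simp: Adm_def split: if_splits)

lemma op_class_coords:
  assumes m: "1 \<le> m" and f: "keys f \<subseteq> trees m n"
  shows "op_class m n f \<in> carrier (opA m n)" "kA (op_class m n f) = (linext nf f :: _ \<Rightarrow>\<^sub>0 'k::field_char_0)"
proof -
  interpret q: quotient_coords "opF m n :: ('k, _) gr_module" "trees m n" "opI m n" "linext nf" "Adm m n"
    "\<lambda>T. single T 1"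
    by (rule quotient_opA[OF m])
  have e: "op_class m n f = q.fib (linext nf f)" unfolding op_class_def by (rule q.coset_eq[OF f])
  have k: "keys (linext nf f :: _ \<Rightarrow>\<^sub>0 'k) \<subseteq> Adm m n" by (rule q.k0_keys[OF f])
  show "op_class m n f \<in> carrier (opA m n)"
    unfolding e opA_def quot_gr_space_def using k q.carrier_quot
    by (simp add: with_grading_def gr_module.defs module.defs)
  show "kA (op_class m n f) = linext nf f" unfolding e by (rule q.kap_fib[OF k])
qed

lemma coords_opA:
  assumes m: "1 \<le> m"
  shows "coords (opA m n :: ('k::field_char_0, _) gr_module) (Adm m n) tdeg kA"
  unfolding opA_def quot_gr_space_def
proof -
  interpret q: quotient_coords "opF m n :: ('k, _) gr_module" "trees m n" "opI m n" "linext nf" "Adm m n"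
    "\<lambda>T. single T 1"
    by (rule quotient_opA[OF m])
  show "coords (with_grading (quot_space (opF m n) (opI m n))
      (\<lambda>d. (+>\<^bsub>opF m n\<^esub>) (opI m n) ` grade (opF m n :: ('k, _) gr_module) d)) (Adm m n) tdeg kA"
  proof (rule q.coords_quot, intro Set.set_eqI iffI)
    fix d A assume "A \<in> (+>\<^bsub>opF m n\<^esub>) (opI m n) ` grade (opF m n :: ('k, _) gr_module) d"
    then obtain v :: "ptree \<Rightarrow>\<^sub>0 'k" where v: "keys v \<subseteq> {T \<in> trees m n. tdeg T = d}"
      and A: "A = opI m n +>\<^bsub>opF m n :: ('k, _) gr_module\<^esub> v"
      by auto
    have vt: "keys v \<subseteq> trees m n" using v by blast
    have k: "keys (linext nf v :: _ \<Rightarrow>\<^sub>0 'k) \<subseteq> {T \<in> Adm m n. tdeg T = d}"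
      by (rule linext_nf_keys[OF m v])
    then have k': "keys (linext nf v :: _ \<Rightarrow>\<^sub>0 'k) \<subseteq> Adm m n" by blast
    have "A = q.fib (linext nf v)" unfolding A by (rule q.coset_eq[OF vt])
    then show "A \<in> {A \<in> carrier (quot_space (opF m n) (opI m n)). keys (q.kap A) \<subseteq> {T \<in> Adm m n. tdeg T = d}}"
      using k k' by (simp add: q.carrier_quot)
  next
    fix d A assume A: "A \<in> {A \<in> carrier (quot_space (opF m n) (opI m n)). keys (q.kap A) \<subseteq> {T \<in> Adm m n. tdeg T = d}}"
    let ?F = "q.kap A"
    have F: "keys ?F \<subseteq> Adm m n" "q.fib ?F = A" using A q.kap_carrier by auto
    have Ft: "keys ?F \<subseteq> trees m n" using F(1) by (auto simp: Adm_def)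
    have "opI m n +>\<^bsub>opF m n :: ('k, _) gr_module\<^esub> ?F = A"
      unfolding q.coset_eq[OF Ft] linext_nf_Adm[OF F(1)] by (rule F(2))
    moreover have "?F \<in> grade (opF m n) d" using A by (auto simp: Adm_def)
    ultimately show "A \<in> (+>\<^bsub>opF m n\<^esub>) (opI m n) ` grade (opF m n :: ('k, _) gr_module) d" by blast
  qed
qed

lemma Adm_basis:
  assumes m: "1 \<le> m"
  shows "(\<lambda>w\<in>carrier (span_Adm m n). op_class m n w) \<in> gr_hom (span_Adm m n :: ('k::field_char_0, _) gr_module) (opA m n)"
    and "bij_betw (op_class m n) (carrier (span_Adm m n :: ('k, _) gr_module)) (carrier (opA m n))"
proof -
  let ?A = "opA m n :: ('k, _) gr_module"
  note C = coordsD[OF coords_opA[OF m, of n, where ?'k = 'k]]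
  note op = op_class_coords[OF m, of _ n, where ?'k = 'k]
  have t: "keys w \<subseteq> trees m n" if "keys w \<subseteq> Adm m n" for w :: "ptree \<Rightarrow>\<^sub>0 'k"
    using that by (auto simp: Adm_def)
  have k: "kA (op_class m n w) = w" if "keys w \<subseteq> Adm m n" for w :: "ptree \<Rightarrow>\<^sub>0 'k"
    using op(2)[OF t[OF that]] linext_nf_Adm[OF that] by simp
  show "bij_betw (op_class m n) (carrier (span_Adm m n :: ('k, _) gr_module)) (carrier ?A)"
  proof (rule bij_betw_byWitness[of _ kA])
    show "\<forall>A\<in>carrier ?A. op_class m n (kA A) = A"
    proof
      fix A assume A: "A \<in> carrier ?A"
      show "op_class m n (kA A) = A"
        by (rule C(10)) (use A op(1)[OF t[OF C(4)[OF A]]] k[OF C(4)[OF A]] in auto)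
    qed
  qed (use k op(1)[OF t] C(4) in \<open>auto simp: span_Adm_def\<close>)
  show "(\<lambda>w\<in>carrier (span_Adm m n). op_class m n w) \<in> gr_hom (span_Adm m n :: ('k, _) gr_module) ?A"
    unfolding gr_hom_def
  proof (intro CollectI conjI ballI allI)
    show "(\<lambda>w\<in>carrier (span_Adm m n). op_class m n w) \<in> carrier (span_Adm m n :: ('k, _) gr_module) \<rightarrow>\<^sub>E carrier ?A"
      using op(1)[OF t] by (auto simp: span_Adm_def)
    fix v assume "v \<in> carrier (span_Adm m n :: ('k, _) gr_module)"
    then have v: "keys v \<subseteq> Adm m n" by (simp add: span_Adm_def)
    note ov = op(1)[OF t[OF v]]
    show "(\<lambda>w\<in>carrier (span_Adm m n). op_class m n w) (c \<odot>\<^bsub>span_Adm m n\<^esub> v)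
      = c \<odot>\<^bsub>?A\<^esub> (\<lambda>w\<in>carrier (span_Adm m n). op_class m n w) v" for c
    proof -
      have cv: "keys (scalar c v) \<subseteq> Adm m n" by (rule keys_scalar_le[OF v])
      have "op_class m n (scalar c v) = c \<odot>\<^bsub>?A\<^esub> op_class m n v"
        by (rule C(10)) (simp_all add: op(1)[OF t[OF cv]] C(7,8) ov k v cv)
      then show ?thesis using v cv by (simp add: span_Adm_def)
    qed
    fix w assume "w \<in> carrier (span_Adm m n :: ('k, _) gr_module)"
    then have w: "keys w \<subseteq> Adm m n" by (simp add: span_Adm_def)
    have vw: "keys (v + w) \<subseteq> Adm m n" by (rule keys_add_subset[OF v w])
    have "op_class m n (v + w) = op_class m n v \<oplus>\<^bsub>?A\<^esub> op_class m n w"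
      by (rule C(10)) (simp_all add: op(1)[OF t[OF vw]] C(5,6) ov op(1)[OF t[OF w]] k v w vw)
    then show "(\<lambda>w\<in>carrier (span_Adm m n). op_class m n w) (v \<oplus>\<^bsub>span_Adm m n\<^esub> w)
      = (\<lambda>w\<in>carrier (span_Adm m n). op_class m n w) v \<oplus>\<^bsub>?A\<^esub> (\<lambda>w\<in>carrier (span_Adm m n). op_class m n w) w"
      using v w vw by (simp add: span_Adm_def)
  next
    fix d
    show "(\<lambda>w\<in>carrier (span_Adm m n). op_class m n w) ` grade (span_Adm m n :: ('k, _) gr_module) d \<subseteq> grade ?A d"
    proof
      fix A assume "A \<in> (\<lambda>w\<in>carrier (span_Adm m n). op_class m n w) ` grade (span_Adm m n :: ('k, _) gr_module) d"
      then obtain w :: "ptree \<Rightarrow>\<^sub>0 'k" where w: "keys w \<subseteq> {T \<in> Adm m n. tdeg T = d}"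
        and A: "A = (\<lambda>w\<in>carrier (span_Adm m n). op_class m n w) w"
        by (auto simp: span_Adm_def)
      have wA: "keys w \<subseteq> Adm m n" using w by blast
      have "A = op_class m n w" unfolding A using wA by (simp add: span_Adm_def)
      then show "A \<in> grade ?A d" using w k[OF wA] op(1)[OF t[OF wA]] by (simp add: C(9))
    qed
  qed
qed

text \<open>
  The normal form is an admissible representative, and it is the only one because \<open>nf\<close> vanishes on the ideal and fixes
  admissible trees.
\<close>

lemma Omega_eq_nf:
  assumes m: "1 \<le> m" and T: "valid m T"
  shows "Omega m T = (nf T :: _ \<Rightarrow>\<^sub>0 'k::field_char_0)"
  unfolding Omega_def
proof (rule the_equality)
  have T1: "keys (single T (1::'k)) \<subseteq> {T' \<in> trees m (legs T). True}"
    using T by (auto simp: trees_iff)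
  have k: "keys (nf T :: _ \<Rightarrow>\<^sub>0 'k) \<subseteq> Adm m (legs T)"
    using linext_nf_keys[OF m T1] by simp
  then show "nf T \<in> carrier (span_Adm m (legs T) :: ('k, _) gr_module) \<and> nf T - single T (1::'k) \<in> opI m (legs T)"
    using nf_cong[OF T m] by (simp add: span_Adm_def opI_def)
  fix w :: "ptree \<Rightarrow>\<^sub>0 'k"
  assume "w \<in> carrier (span_Adm m (legs T) :: ('k, _) gr_module) \<and> w - single T 1 \<in> opI m (legs T)"
  then have w: "keys w \<subseteq> Adm m (legs T)" "(legs T, w - single T 1) \<in> op_ideal m"
    by (simp_all add: span_Adm_def opI_def)
  have "linext nf (w - single T 1) = 0" by (rule nf_op_ideal[OF m w(2)])
  then show "w = nf T" using linext_nf_Adm[OF w(1)] by simp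
qed


section \<open>Coordinates on tensor products\<close>

definition outer :: "('s \<Rightarrow>\<^sub>0 'k::field_char_0) \<Rightarrow> ('t \<Rightarrow>\<^sub>0 'k) \<Rightarrow> ('s \<times> 't \<Rightarrow>\<^sub>0 'k)"
  where "outer F G = linext (\<lambda>s. linext (\<lambda>t. single (s, t) 1) G) F"

lemma outer_lin:
  "outer (F + F') G = outer F G + outer F' G" "outer F (G + G') = outer F G + outer F G'"
  "outer (scalar c F) G = scalar c (outer F G)" "outer F (scalar c G) = scalar c (outer F G)"
  by (simp_all add: outer_def linext_plus_fun linext_scalar_fun)

lemma outer_single: "outer (single s 1) (single t 1) = single (s, t) 1"
  by (simp add: outer_def)

lemma keys_outer: "keys F \<subseteq> A \<Longrightarrow> keys G \<subseteq> B \<Longrightarrow> keys (outer F G) \<subseteq> A \<times> B"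
  unfolding outer_def by (intro keys_linext_subset) auto

text \<open>
  A tensor \<open>v \<otimes> w\<close> has as coordinates the products of the coordinates of \<open>v\<close> and \<open>w\<close>.
\<close>

definition tensor_coord :: "('v \<Rightarrow> ('s \<Rightarrow>\<^sub>0 'k::field_char_0)) \<Rightarrow> ('w \<Rightarrow> ('t \<Rightarrow>\<^sub>0 'k)) \<Rightarrow> ('v \<times> 'w \<Rightarrow>\<^sub>0 'k) \<Rightarrow> ('s \<times> 't \<Rightarrow>\<^sub>0 'k)"
  where "tensor_coord \<kappa>V \<kappa>W = linext (\<lambda>(v, w). outer (\<kappa>V v) (\<kappa>W w))"

abbreviation kT where "kT \<kappa>V \<kappa>W \<equiv> quotient_coords.kap (tensor_coord \<kappa>V \<kappa>W)"

text \<open>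
  The coordinate map kills the relations. Conversely, modulo the relations every
  pair can be expanded in basis elements, first in the left and then in the right factor, so an element with vanishing coordinates is a
  combination of relations.
\<close>

lemma quotient_tensor:
  fixes V :: "('k::field_char_0, 'v) gr_module" and W :: "('k, 'w) gr_module"
  assumes cV: "coords V SV dV \<kappa>V" and cW: "coords W SW dW \<kappa>W"
  shows "quotient_coords (free_space (carrier V \<times> carrier W) :: ('k, _) module) (carrier V \<times> carrier W) (tensor_rels V W)
    (tensor_coord \<kappa>V \<kappa>W) (SV \<times> SW)
    (\<lambda>(s, t). single (uncoord V \<kappa>V (single s 1), uncoord W \<kappa>W (single t 1)) 1)"
proof
  let ?X = "carrier V \<times> carrier W"
  let ?k = "tensor_coord \<kappa>V \<kappa>W"
  let ?bV = "\<lambda>s. uncoord V \<kappa>V (single s 1)" and ?bW = "\<lambda>t. uncoord W \<kappa>W (single t 1)"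
  note CV = coordsD[OF cV] and CW = coordsD[OF cW] and UV = uncoord[OF cV] and UW = uncoord[OF cW]
  have k1: "?k (single (v, w) c) = scalar c (outer (\<kappa>V v) (\<kappa>W w))" for v w c
    by (simp add: tensor_coord_def)
  show lin: "lin ?k" by (simp add: tensor_coord_def)
  show "keys (?k f) \<subseteq> SV \<times> SW" if "keys f \<subseteq> ?X" for f
    unfolding tensor_coord_def
  proof (rule keys_linext_subset)
    fix a assume "a \<in> keys f"
    then obtain v w where "a = (v, w)" "v \<in> carrier V" "w \<in> carrier W" using \<open>keys f \<subseteq> ?X\<close> by auto
    then show "keys (case a of (v, w) \<Rightarrow> outer (\<kappa>V v) (\<kappa>W w)) \<subseteq> SV \<times> SW"
      using keys_outer[OF CV(4) CW(4)] by simp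
  qed
  have b: "?bV s \<in> carrier V" "\<kappa>V (?bV s) = single s 1" if "s \<in> SV" for s
    using that by (auto intro!: UV)
  have b': "?bW t \<in> carrier W" "\<kappa>W (?bW t) = single t 1" if "t \<in> SW" for t
    using that by (auto intro!: UW)
  show "keys (case st of (s, t) \<Rightarrow> single (?bV s, ?bW t) (1::'k)) \<subseteq> ?X" if "st \<in> SV \<times> SW" for st
    using that b b' by auto
  show "?k (case st of (s, t) \<Rightarrow> single (?bV s, ?bW t) 1) = single st 1" if "st \<in> SV \<times> SW" for st
    using that by (auto simp: k1 b b' outer_single)
  let ?G1 = "{single (x \<oplus>\<^bsub>V\<^esub> x', y) 1 - single (x, y) 1 - single (x', y) (1::'k)
       | x x' y. x \<in> carrier V \<and> x' \<in> carrier V \<and> y \<in> carrier W}"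
  let ?G2 = "{single (x, y \<oplus>\<^bsub>W\<^esub> y') 1 - single (x, y) 1 - single (x, y') (1::'k)
       | x y y'. x \<in> carrier V \<and> y \<in> carrier W \<and> y' \<in> carrier W}"
  let ?G3 = "{single (c \<odot>\<^bsub>V\<^esub> x, y) 1 - single (x, y) (c::'k)
       | c x y. x \<in> carrier V \<and> y \<in> carrier W}"
  let ?G4 = "{single (x, c \<odot>\<^bsub>W\<^esub> y) 1 - single (x, y) (c::'k)
       | c x y. x \<in> carrier V \<and> y \<in> carrier W}"
  let ?Gen = "?G1 \<union> ?G2 \<union> ?G3 \<union> ?G4"
  have Z: "tensor_rels V W = span_in (free_space ?X) ?Gen" by (simp only: tensor_rels_def)
  have s: "keys (single (v, w) (c::'k)) \<subseteq> ?X" if "v \<in> carrier V" "w \<in> carrier W" for v w c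
    using that by auto
  have Gsub: "?Gen \<subseteq> {f. keys f \<subseteq> ?X}"
  proof (intro Un_least subsetI; elim CollectE exE conjE; intro CollectI)
    fix f x x' y assume f: "f = single (x \<oplus>\<^bsub>V\<^esub> x', y) 1 - single (x, y) 1 - single (x', y) (1::'k)"
      and "x \<in> carrier V" "x' \<in> carrier V" "y \<in> carrier W"
    then show "keys f \<subseteq> ?X" unfolding f by (intro keys_diff_subset s CV(5))
  next
    fix f x y y' assume f: "f = single (x, y \<oplus>\<^bsub>W\<^esub> y') 1 - single (x, y) 1 - single (x, y') (1::'k)"
      and "x \<in> carrier V" "y \<in> carrier W" "y' \<in> carrier W"
    then show "keys f \<subseteq> ?X" unfolding f by (intro keys_diff_subset s CW(5))
  next
    fix f c x y assume f: "f = single (c \<odot>\<^bsub>V\<^esub> x, y) 1 - single (x, y) (c::'k)"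
      and "x \<in> carrier V" "y \<in> carrier W"
    then show "keys f \<subseteq> ?X" unfolding f by (intro keys_diff_subset s CV(7))
  next
    fix f c x y assume f: "f = single (x, c \<odot>\<^bsub>W\<^esub> y) 1 - single (x, y) (c::'k)"
      and "x \<in> carrier V" "y \<in> carrier W"
    then show "keys f \<subseteq> ?X" unfolding f by (intro keys_diff_subset s CW(7))
  qed
  have Gk: "keys f \<subseteq> ?X" if "f \<in> ?Gen" for f by (rule CollectD[OF subsetD[OF Gsub that]])
  have ker: "psub {f. ?k f = 0}"
    unfolding psub_def using lin_addD[OF lin] lin_scalarD[OF lin] lin_0[OF lin] by auto
  have Gker: "?Gen \<subseteq> {f. ?k f = 0}"
  proof (intro Un_least subsetI; elim CollectE exE conjE; intro CollectI)
    fix f x x' and y :: 'w assume "f = single (x \<oplus>\<^bsub>V\<^esub> x', y) 1 - single (x, y) 1 - single (x', y) (1::'k)"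
      "x \<in> carrier V" "x' \<in> carrier V"
    then show "?k f = 0" by (simp add: lin_diff[OF lin] k1 CV(6) outer_lin)
  next
    fix f y y' and x :: 'v assume "f = single (x, y \<oplus>\<^bsub>W\<^esub> y') 1 - single (x, y) 1 - single (x, y') (1::'k)"
      "y \<in> carrier W" "y' \<in> carrier W"
    then show "?k f = 0" by (simp add: lin_diff[OF lin] k1 CW(6) outer_lin)
  next
    fix f c x and y :: 'w assume "f = single (c \<odot>\<^bsub>V\<^esub> x, y) 1 - single (x, y) (c::'k)" "x \<in> carrier V"
    then show "?k f = 0" by (simp add: lin_diff[OF lin] k1 CV(8) outer_lin)
  next
    fix f c y and x :: 'v assume "f = single (x, c \<odot>\<^bsub>W\<^esub> y) 1 - single (x, y) (c::'k)" "y \<in> carrier W"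
    then show "?k f = 0" by (simp add: lin_diff[OF lin] k1 CW(8) outer_lin)
  qed
  have P: "psub (tensor_rels V W)" unfolding Z by (rule span_free_space(1)[OF Gk])
  have gen: "f \<in> tensor_rels V W" if "f \<in> ?Gen" for f unfolding Z by (rule span_free_space(2)[OF Gk that])
  have left: "single (v, w) 1 - linext (\<lambda>s. single (?bV s, w) (1::'k)) (\<kappa>V v) \<in> tensor_rels V W"
    if "v \<in> carrier V" "w \<in> carrier W" for v w
    by (rule expand_slot[where \<phi> = "\<lambda>v. (v, w)", OF cV P _ _ that(1)]; rule gen; use that(2) in blast)
  have right: "single (v, w) 1 - linext (\<lambda>t. single (v, ?bW t) (1::'k)) (\<kappa>W w) \<in> tensor_rels V W"
    if "v \<in> carrier V" "w \<in> carrier W" for v w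
    by (rule expand_slot[where \<phi> = "\<lambda>w. (v, w)", OF cW P _ _ that(2)]; rule gen; use that(1) in blast)
  let ?p = "\<lambda>(s, t). single (?bV s, ?bW t) (1::'k)"
  have expand: "single (v, w) 1 - linext ?p (outer (\<kappa>V v) (\<kappa>W w)) \<in> tensor_rels V W"
    if v: "v \<in> carrier V" and w: "w \<in> carrier W" for v w
  proof -
    have "linext (\<lambda>s. single (?bV s, w) 1 - linext (\<lambda>t. single (?bV s, ?bW t) (1::'k)) (\<kappa>W w)) (\<kappa>V v) \<in> tensor_rels V W"
      by (rule psub_linext[OF P], rule right[OF _ w], rule b(1)) (use CV(4)[OF v] in blast)
    from psubD(2)[OF P left[OF v w] this]
    show ?thesis by (simp add: outer_def linext_linext linext_minus_fun)
  qed
  show "tensor_rels V W = {f. keys f \<subseteq> ?X \<and> ?k f = 0}"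
  proof (intro Set.set_eqI iffI)
    fix f assume "f \<in> tensor_rels V W"
    then show "f \<in> {f. keys f \<subseteq> ?X \<and> ?k f = 0}"
      using span_free_space(3)[OF Gk _ ker Gker, of f] unfolding Z by blast
  next
    fix f assume f: "f \<in> {f. keys f \<subseteq> ?X \<and> ?k f = 0}"
    have "linext (\<lambda>a. single a 1 - linext ?p (case a of (v, w) \<Rightarrow> outer (\<kappa>V v) (\<kappa>W w))) f \<in> tensor_rels V W"
    proof (rule psub_linext[OF P])
      fix a assume "a \<in> keys f"
      then obtain v w where "a = (v, w)" "v \<in> carrier V" "w \<in> carrier W" using f by auto
      then show "single a 1 - linext ?p (case a of (v, w) \<Rightarrow> outer (\<kappa>V v) (\<kappa>W w)) \<in> tensor_rels V W"
        using expand by simp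
    qed
    also have "linext (\<lambda>a. single a 1 - linext ?p (case a of (v, w) \<Rightarrow> outer (\<kappa>V v) (\<kappa>W w))) f
      = f - linext ?p (?k f)"
      unfolding tensor_coord_def linext_minus_fun linext_linext by simp
    finally show "f \<in> tensor_rels V W" using f by simp
  qed
qed (simp_all add: split_beta)

lemma tensor_coords:
  fixes V :: "('k::field_char_0, 'v) gr_module" and W :: "('k, 'w) gr_module"
  assumes cV: "coords V SV dV \<kappa>V" and cW: "coords W SW dW \<kappa>W"
  shows "coords (tensor V W) (SV \<times> SW) (\<lambda>(s, t). dV s + dW t) (kT \<kappa>V \<kappa>W)"
    and "v \<in> carrier V \<Longrightarrow> w \<in> carrier W \<Longrightarrow> tens V W v w \<in> carrier (tensor V W)"
    and "v \<in> carrier V \<Longrightarrow> w \<in> carrier W \<Longrightarrow> kT \<kappa>V \<kappa>W (tens V W v w) = outer (\<kappa>V v) (\<kappa>W w)"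
proof -
  let ?V = "free_space (carrier V \<times> carrier W) :: ('k, _) module"
  interpret q: quotient_coords ?V "carrier V \<times> carrier W" "tensor_rels V W"
    "tensor_coord \<kappa>V \<kappa>W" "SV \<times> SW"
    "\<lambda>(s, t). single (uncoord V \<kappa>V (single s 1), uncoord W \<kappa>W (single t 1)) 1"
    by (rule quotient_tensor[OF cV cW])
  note CV = coordsD[OF cV] and CW = coordsD[OF cW] and UV = uncoord[OF cV] and UW = uncoord[OF cW]
  have ko: "keys (outer (\<kappa>V v) (\<kappa>W w)) \<subseteq> SV \<times> SW" if "v \<in> carrier V" "w \<in> carrier W" for v w
    by (rule keys_outer[OF CV(4)[OF that(1)] CW(4)[OF that(2)]])
  have fib: "tens V W v w = q.fib (outer (\<kappa>V v) (\<kappa>W w))" if "v \<in> carrier V" "w \<in> carrier W" for v w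
    unfolding tens_def using that by (subst q.coset_eq) (auto simp: tensor_coord_def)
  have car: "carrier (tensor V W) = carrier (quot_space ?V (tensor_rels V W))"
    by (simp add: tensor_def with_grading_def gr_module.defs module.defs Let_def)
  show "v \<in> carrier V \<Longrightarrow> w \<in> carrier W \<Longrightarrow> tens V W v w \<in> carrier (tensor V W)"
    unfolding car using fib ko by (auto simp: q.carrier_quot)
  show "v \<in> carrier V \<Longrightarrow> w \<in> carrier W \<Longrightarrow> kT \<kappa>V \<kappa>W (tens V W v w) = outer (\<kappa>V v) (\<kappa>W w)"
    using fib ko by simp
  show "coords (tensor V W) (SV \<times> SW) (\<lambda>(s, t). dV s + dW t) (kT \<kappa>V \<kappa>W)"
    unfolding tensor_def Let_def
  proof (rule q.coords_quot, rule q.span_eq)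
    fix d A assume "A \<in> {tens V W v w |v w. \<exists>i j. v \<in> grade V i \<and> w \<in> grade W j \<and> i + j = d}"
    then obtain v w i j where vw: "v \<in> grade V i" "w \<in> grade W j" "i + j = d" and A: "A = tens V W v w" by blast
    have c: "v \<in> carrier V" "w \<in> carrier W" using vw by (simp_all add: CV(9) CW(9))
    have "keys (outer (\<kappa>V v) (\<kappa>W w)) \<subseteq> {s \<in> SV. dV s = i} \<times> {t \<in> SW. dW t = j}"
      by (rule keys_outer) (use vw in \<open>simp_all add: CV(9) CW(9)\<close>)
    also have "\<dots> \<subseteq> {s \<in> SV \<times> SW. (case s of (s, t) \<Rightarrow> dV s + dW t) = d}" using vw(3) by auto
    finally show "A \<in> carrier (quot_space ?V (tensor_rels V W)) \<and>
        keys (q.kap A) \<subseteq> {s \<in> SV \<times> SW. (case s of (s, t) \<Rightarrow> dV s + dW t) = d}"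
      using c ko[OF c] unfolding A by (simp add: fib q.carrier_quot)
  next
    fix d st assume "st \<in> {s \<in> SV \<times> SW. (case s of (s, t) \<Rightarrow> dV s + dW t) = d}"
    then obtain s t where st: "st = (s, t)" "s \<in> SV" "t \<in> SW" "dV s + dW t = d" by auto
    let ?v = "uncoord V \<kappa>V (single s 1)" and ?w = "uncoord W \<kappa>W (single t 1)"
    have v: "?v \<in> carrier V" "\<kappa>V ?v = single s 1" and w: "?w \<in> carrier W" "\<kappa>W ?w = single t 1"
      using st by (auto intro!: UV UW)
    have "q.fib (single st 1) = tens V W ?v ?w"
      unfolding fib[OF v(1) w(1)] v(2) w(2) outer_single st(1) by (rule refl)
    moreover have "?v \<in> grade V (dV s)" "?w \<in> grade W (dW t)" using v w st by (simp_all add: CV(9) CW(9))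
    ultimately show "q.fib (single st 1) \<in> {tens V W v w |v w. \<exists>i j. v \<in> grade V i \<and> w \<in> grade W j \<and> i + j = d}"
      using st(4) by blast
  qed blast
qed


section \<open>Coordinates on tensor powers\<close>

definition tprod :: "('x \<Rightarrow> ('e \<Rightarrow>\<^sub>0 'k::field_char_0)) \<Rightarrow> 'x list \<Rightarrow> ('e list \<Rightarrow>\<^sub>0 'k)"
  where "tprod \<kappa> vs = mex (\<lambda>es. single es 1) (map \<kappa> vs)"

abbreviation kP where "kP \<kappa> \<equiv> quotient_coords.kap (linext (tprod \<kappa>))"

abbreviation words :: "'e set \<Rightarrow> nat \<Rightarrow> 'e list set"
  where "words E n \<equiv> {es. length es = n \<and> set es \<subseteq> E}"

text \<open>
  A graded space with a homogeneous basis \<open>E\<close> of elements of the space itself, so that words in \<open>E\<close> are elementary tensors.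
\<close>

locale based_space =
  fixes U :: "('k::field_char_0, 'x) gr_module" and E :: "'x set" and dg :: "'x \<Rightarrow> int" and \<kappa> :: "'x \<Rightarrow> ('x \<Rightarrow>\<^sub>0 'k)"
  assumes coords_U: "coords U E dg \<kappa>" and E: "E \<subseteq> carrier U" and \<kappa>_E: "e \<in> E \<Longrightarrow> \<kappa> e = single e 1"
begin

lemmas CU = coordsD[OF coords_U]

lemma uncoord_E: "e \<in> E \<Longrightarrow> uncoord U \<kappa> (single e 1) = e"
  using uncoord(3)[OF coords_U, of e] E \<kappa>_E by auto

lemma tprod_E: "set es \<subseteq> E \<Longrightarrow> tprod \<kappa> es = single es 1"
proof -
  assume es: "set es \<subseteq> E"
  then have "map \<kappa> es = map (\<lambda>e. single e 1) es" using \<kappa>_E by auto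
  then show ?thesis unfolding tprod_def by (simp only: mex_singles)
qed

lemma keys_tprod:
  assumes "set vs \<subseteq> carrier U" "length vs = length ds" "\<forall>i<length vs. keys (\<kappa> (vs ! i)) \<subseteq> {e \<in> E. P (ds ! i) e}"
  shows "keys (tprod \<kappa> vs) \<subseteq> {es \<in> words E (length vs). \<forall>i<length vs. P (ds ! i) (es ! i)}"
  unfolding tprod_def
proof (rule keys_mex)
  fix es assume es: "list_all2 (\<lambda>a p. a \<in> keys p) es (map \<kappa> vs)"
  then have len: "length es = length vs" by (auto dest: list_all2_lengthD)
  have "es ! i \<in> E \<and> P (ds ! i) (es ! i)" if "i < length vs" for i
  proof -
    have "es ! i \<in> keys (\<kappa> (vs ! i))" using list_all2_nthD2[OF es, of i] that by simp
    then show ?thesis using assms(3) that by blast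
  qed
  then have "es \<in> {es \<in> words E (length vs). \<forall>i<length vs. P (ds ! i) (es ! i)}"
    using len by (auto simp: in_set_conv_nth)
  then show "keys (single es (1::'k)) \<subseteq> {es \<in> words E (length vs). \<forall>i<length vs. P (ds ! i) (es ! i)}"
    by simp
qed

lemma keys_tprod': "vs \<in> tuples U n \<Longrightarrow> keys (tprod \<kappa> vs) \<subseteq> words E n"
proof -
  assume vs: "vs \<in> tuples U n"
  have "keys (tprod \<kappa> vs) \<subseteq> {es \<in> words E (length vs). \<forall>i<length vs. True}"
    by (rule keys_tprod[where ds = vs and P = "\<lambda>_ _. True"]) (use vs CU(4) in \<open>force simp: tuples_def\<close>)+
  then show ?thesis using vs by (simp add: tuples_def)
qed

text \<open>
  As for the tensor product of two spaces, with the entries of a tuple expanded one after the other; \<open>us\<close> holds the basis elements that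
  have been chosen for the first entries.
\<close>

lemma quotient_power:
  "quotient_coords (free_space (tuples U n) :: ('k, _) module) (tuples U n) (power_rels U n) (linext (tprod \<kappa>)) (words E n)
    (\<lambda>es. single es 1)"
proof
  let ?X = "tuples U n"
  show "keys f \<subseteq> ?X \<Longrightarrow> keys (linext (tprod \<kappa>) f) \<subseteq> words E n" for f
    by (rule keys_linext_subset, rule keys_tprod') blast
  show "es \<in> words E n \<Longrightarrow> keys (single es (1::'k)) \<subseteq> ?X" for es
    using E by (auto simp: tuples_def)
  show "es \<in> words E n \<Longrightarrow> linext (tprod \<kappa>) (single es 1) = single es 1" for es
    by (simp add: tprod_E)
  let ?G1 = "{single (vs[i := x \<oplus>\<^bsub>U\<^esub> y]) 1 - single (vs[i := x]) 1
       - single (vs[i := y]) (1::'k)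
       | vs i x y. vs \<in> tuples U n \<and> i < n \<and> x \<in> carrier U \<and> y \<in> carrier U}"
  let ?G2 = "{single (vs[i := c \<odot>\<^bsub>U\<^esub> x]) 1 - single (vs[i := x]) (c::'k)
       | vs i c x. vs \<in> tuples U n \<and> i < n \<and> x \<in> carrier U}"
  have Z: "power_rels U n = span_in (free_space ?X) (?G1 \<union> ?G2)" by (simp only: power_rels_def)
  have s: "keys (single (vs[i := x]) (c::'k)) \<subseteq> ?X" if "vs \<in> tuples U n" "x \<in> carrier U" for vs i x c
    using that set_update_subset_insert[of vs i x] by (auto simp: tuples_def)
  have Gsub: "?G1 \<union> ?G2 \<subseteq> {f. keys f \<subseteq> ?X}"
  proof (intro Un_least subsetI; elim CollectE exE conjE; intro CollectI)
    fix f vs i x y assume f: "f = single (vs[i := x \<oplus>\<^bsub>U\<^esub> y]) 1 - single (vs[i := x]) 1 - single (vs[i := y]) (1::'k)"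
      and "vs \<in> tuples U n" "x \<in> carrier U" "y \<in> carrier U"
    then show "keys f \<subseteq> ?X" unfolding f by (intro keys_diff_subset s CU(5))
  next
    fix f vs i c x assume f: "f = single (vs[i := c \<odot>\<^bsub>U\<^esub> x]) 1 - single (vs[i := x]) (c::'k)"
      and "vs \<in> tuples U n" "x \<in> carrier U"
    then show "keys f \<subseteq> ?X" unfolding f by (intro keys_diff_subset s CU(7))
  qed
  have Gk: "keys f \<subseteq> ?X" if "f \<in> ?G1 \<union> ?G2" for f by (rule CollectD[OF subsetD[OF Gsub that]])
  have ker: "psub {f. linext (tprod \<kappa>) f = (0 :: _ \<Rightarrow>\<^sub>0 'k)}"
    unfolding psub_def by auto
  have upd: "tprod \<kappa> (vs[i := x]) = mex (\<lambda>es. single es 1) (map \<kappa> (take i vs) @ \<kappa> x # map \<kappa> (drop (Suc i) vs))"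
    if "vs \<in> tuples U n" "i < n" for vs i x
    using that by (simp add: tprod_def upd_conv_take_nth_drop tuples_def)
  have Gker: "?G1 \<union> ?G2 \<subseteq> {f. linext (tprod \<kappa>) f = (0 :: _ \<Rightarrow>\<^sub>0 'k)}"
  proof (intro Un_least subsetI; elim CollectE exE conjE; intro CollectI)
    fix f vs i x y assume "f = single (vs[i := x \<oplus>\<^bsub>U\<^esub> y]) 1 - single (vs[i := x]) 1
       - single (vs[i := y]) (1::'k)" "vs \<in> tuples U n" "i < n" "x \<in> carrier U" "y \<in> carrier U"
    then show "linext (tprod \<kappa>) f = (0 :: _ \<Rightarrow>\<^sub>0 'k)"
      by (simp add: upd CU(6) lin_addD[OF lin_mex])
  next
    fix f vs i c x assume "f = single (vs[i := c \<odot>\<^bsub>U\<^esub> x]) 1 - single (vs[i := x]) (c::'k)"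
       "vs \<in> tuples U n" "i < n" "x \<in> carrier U"
    then show "linext (tprod \<kappa>) f = (0 :: _ \<Rightarrow>\<^sub>0 'k)"
      by (simp add: upd CU(8) lin_scalarD[OF lin_mex])
  qed
  have P: "psub (power_rels U n)" unfolding Z by (rule span_free_space(1)[OF Gk])
  have gen: "f \<in> power_rels U n" if "f \<in> ?G1 \<union> ?G2" for f unfolding Z by (rule span_free_space(2)[OF Gk that])
  have slot: "single (us @ v # vs) 1 - linext (\<lambda>e. single (us @ e # vs) (1::'k)) (\<kappa> v) \<in> power_rels U n"
    if t: "us @ v # vs \<in> tuples U n" for us v vs
  proof -
    have v: "v \<in> carrier U" and l: "length us < n" using t by (auto simp: tuples_def)
    have "single (us @ v # vs) 1
      - linext (\<lambda>s. single (us @ uncoord U \<kappa> (single s 1) # vs) (1::'k)) (\<kappa> v) \<in> power_rels U n"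
    proof (rule expand_slot[where \<phi> = "\<lambda>v. us @ v # vs", OF coords_U P _ _ v])
      fix x y assume xy: "x \<in> carrier U" "y \<in> carrier U"
      have "single ((us @ v # vs)[length us := x \<oplus>\<^bsub>U\<^esub> y]) 1 - single ((us @ v # vs)[length us := x]) 1
       - single ((us @ v # vs)[length us := y]) (1::'k) \<in> power_rels U n"
        by (rule gen) (use t l xy in blast)
      then show "single (us @ (x \<oplus>\<^bsub>U\<^esub> y) # vs) 1 - single (us @ x # vs) 1
        - single (us @ y # vs) (1::'k) \<in> power_rels U n" by simp
    next
      fix c x assume x: "x \<in> carrier U"
      have "single ((us @ v # vs)[length us := c \<odot>\<^bsub>U\<^esub> x]) 1
       - single ((us @ v # vs)[length us := x]) (c::'k) \<in> power_rels U n"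
        by (rule gen) (use t l x in blast)
      then show "single (us @ (c \<odot>\<^bsub>U\<^esub> x) # vs) 1 - single (us @ x # vs) (c::'k) \<in> power_rels U n" by simp
    qed
    also have "linext (\<lambda>s. single (us @ uncoord U \<kappa> (single s 1) # vs) (1::'k)) (\<kappa> v)
      = linext (\<lambda>e. single (us @ e # vs) 1) (\<kappa> v)"
      by (rule linext_cong[OF refl]) (use CU(4)[OF v] uncoord_E in auto)
    finally show ?thesis .
  qed
  have expand: "single (us @ vs) 1 - mex (\<lambda>es. single (us @ es) (1::'k)) (map \<kappa> vs) \<in> power_rels U n"
    if "us @ vs \<in> tuples U n" for us vs
    using that
  proof (induction vs arbitrary: us)
    case Nil
    show ?case using psubD(1)[OF P] by simp
  next
    case (Cons v vs)
    have v: "v \<in> carrier U" using Cons.prems by (simp add: tuples_def)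
    have "linext (\<lambda>e. single (us @ e # vs) 1 - mex (\<lambda>es. single (us @ e # es) (1::'k)) (map \<kappa> vs)) (\<kappa> v)
      \<in> power_rels U n"
    proof (rule psub_linext[OF P])
      fix e assume "e \<in> keys (\<kappa> v)"
      then have "e \<in> carrier U" using CU(4)[OF v] E by blast
      then have "(us @ [e]) @ vs \<in> tuples U n" using Cons.prems by (simp add: tuples_def)
      from Cons.IH[OF this]
      show "single (us @ e # vs) 1 - mex (\<lambda>es. single (us @ e # es) (1::'k)) (map \<kappa> vs) \<in> power_rels U n"
        by simp
    qed
    from psubD(2)[OF P slot[OF Cons.prems] this] show ?case by (simp add: mex_Cons linext_minus_fun)
  qed
  show "power_rels U n = {f. keys f \<subseteq> ?X \<and> linext (tprod \<kappa>) f = 0}"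
  proof (intro Set.set_eqI iffI)
    fix f assume "f \<in> power_rels U n"
    then show "f \<in> {f. keys f \<subseteq> ?X \<and> linext (tprod \<kappa>) f = 0}"
      using span_free_space(3)[OF Gk _ ker Gker, of f] unfolding Z by blast
  next
    fix f assume f: "f \<in> {f. keys f \<subseteq> ?X \<and> linext (tprod \<kappa>) f = 0}"
    have "linext (\<lambda>vs. single vs 1 - tprod \<kappa> vs) f \<in> power_rels U n"
    proof (rule psub_linext[OF P])
      fix vs assume "vs \<in> keys f"
      then show "single vs 1 - tprod \<kappa> vs \<in> power_rels U n"
        using f expand[of "[]" vs] by (auto simp: tprod_def)
    qed
    then show "f \<in> power_rels U n" using f by (simp add: linext_minus_fun)
  qed
qed simp_all

lemma power_class_coords:
  assumes f: "keys f \<subseteq> tuples U n"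
  shows "power_class U n f \<in> carrier (tensor_power U n)" "kP \<kappa> (power_class U n f) = linext (tprod \<kappa>) f"
proof -
  interpret q: quotient_coords "free_space (tuples U n) :: ('k, _) module" "tuples U n" "power_rels U n" "linext (tprod \<kappa>)"
    "words E n" "\<lambda>es. single es 1"
    by (rule quotient_power)
  have e: "power_class U n f = q.fib (linext (tprod \<kappa>) f)" unfolding power_class_def by (rule q.coset_eq[OF f])
  show "power_class U n f \<in> carrier (tensor_power U n)"
    unfolding e tensor_power_def Let_def using q.k0_keys[OF f] q.carrier_quot
    by (simp add: with_grading_def gr_module.defs module.defs)
  show "kP \<kappa> (power_class U n f) = linext (tprod \<kappa>) f" unfolding e by (rule q.kap_fib[OF q.k0_keys[OF f]])
qed

lemma coords_power: "coords (tensor_power U n) (words E n) (\<lambda>es. sum_list (map dg es)) (kP \<kappa>)"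
proof -
  let ?V = "free_space (tuples U n) :: ('k, _) module"
  interpret q: quotient_coords ?V "tuples U n" "power_rels U n" "linext (tprod \<kappa>)"
    "words E n" "\<lambda>es. single es 1"
    by (rule quotient_power)
  have fib: "power_class U n (single vs 1) = q.fib (tprod \<kappa> vs)" if "vs \<in> tuples U n" for vs
    unfolding power_class_def using that by (subst q.coset_eq) auto
  show ?thesis
    unfolding tensor_power_def Let_def
  proof (rule q.coords_quot, rule q.span_eq)
    fix d A assume "A \<in> {power_class U n (single vs 1) | vs.
          \<exists>ds. length vs = n \<and> length ds = n \<and> (\<forall>i<n. vs ! i \<in> grade U (ds ! i)) \<and> sum_list ds = d}"
    then obtain vs ds where A: "A = power_class U n (single vs 1)" and l: "length vs = n" "length ds = n"
      and g: "\<forall>i<n. vs ! i \<in> grade U (ds ! i)" and d: "sum_list ds = d" by blast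
    have vs: "set vs \<subseteq> carrier U" using g l by (auto simp: in_set_conv_nth CU(9))
    then have t: "vs \<in> tuples U n" using l by (simp add: tuples_def)
    have "keys (tprod \<kappa> vs) \<subseteq> {es \<in> words E (length vs). \<forall>i<length vs. dg (es ! i) = ds ! i}"
      by (rule keys_tprod[OF vs, of ds "\<lambda>d e. dg e = d"]) (use l g in \<open>auto simp: CU(9)\<close>)
    also have "\<dots> \<subseteq> {es \<in> words E n. sum_list (map dg es) = d}"
    proof (intro subsetI, elim CollectE conjE, intro CollectI conjI)
      fix es assume es: "length es = length vs" "\<forall>i<length vs. dg (es ! i) = ds ! i"
      then have "map dg es = ds" using l by (intro nth_equalityI) auto
      then show "sum_list (map dg es) = d" using d by simp
    qed (use l in auto)
    finally show "A \<in> carrier (quot_space ?V (power_rels U n)) \<and>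
       keys (q.kap A) \<subseteq> {es \<in> words E n. sum_list (map dg es) = d}"
      using keys_tprod'[OF t] unfolding A fib[OF t] by (simp add: q.carrier_quot)
  next
    fix d es assume es: "es \<in> {es \<in> words E n. sum_list (map dg es) = d}"
    then have t: "es \<in> tuples U n" using E by (auto simp: tuples_def)
    have "q.fib (single es 1) = power_class U n (single es 1)"
      using fib[OF t] tprod_E[of es] es by simp
    moreover have "es ! i \<in> grade U (map dg es ! i)" if "i < n" for i
    proof -
      have "es ! i \<in> E" using es that by auto
      then show ?thesis using es that E \<kappa>_E by (auto simp: CU(9))
    qed
    ultimately show "q.fib (single es 1) \<in> {power_class U n (single vs 1) | vs.
          \<exists>ds. length vs = n \<and> length ds = n \<and> (\<forall>i<n. vs ! i \<in> grade U (ds ! i)) \<and> sum_list ds = d}"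
      using es by (intro CollectI exI[of _ es] conjI exI[of _ "map dg es"]) auto
  qed blast
qed

definition cat :: "('e list \<Rightarrow>\<^sub>0 'k) \<Rightarrow> ('e list \<Rightarrow>\<^sub>0 'k) \<Rightarrow> ('e list \<Rightarrow>\<^sub>0 'k)"
  where "cat F G = linext (\<lambda>es. linext (\<lambda>fs. single (es @ fs) 1) G) F"

lemma tprod_append: "tprod \<kappa> (vs @ ws) = cat (tprod \<kappa> vs) (tprod \<kappa> ws)"
proof -
  have "tprod \<kappa> (vs @ ws) = mex (\<lambda>es. linext (\<lambda>fs. single (es @ fs) 1) (tprod \<kappa> ws)) (map \<kappa> vs)"
    unfolding tprod_def map_append mex_append mex_lin[OF lin_linext] by simp
  also have "\<dots> = mex (\<lambda>es. linext (\<lambda>es. linext (\<lambda>fs. single (es @ fs) 1) (tprod \<kappa> ws)) (single es 1)) (map \<kappa> vs)"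
    by simp
  also have "\<dots> = cat (tprod \<kappa> vs) (tprod \<kappa> ws)"
    unfolding cat_def tprod_def[of \<kappa> vs] mex_lin[OF lin_linext] by (rule refl)
  finally show ?thesis .
qed

lemma concat_tensor_coords:
  assumes A: "A \<in> carrier (tensor_power U p)" and B: "B \<in> carrier (tensor_power U q)"
  shows "concat_tensor U p q A B \<in> carrier (tensor_power U (p + q))"
    "kP \<kappa> (concat_tensor U p q A B) = cat (kP \<kappa> A) (kP \<kappa> B)"
proof -
  interpret P: quotient_coords "free_space (tuples U p) :: ('k, _) module" "tuples U p" "power_rels U p" "linext (tprod \<kappa>)"
    "words E p" "\<lambda>es. single es 1"
    by (rule quotient_power)
  interpret Q: quotient_coords "free_space (tuples U q) :: ('k, _) module" "tuples U q" "power_rels U q" "linext (tprod \<kappa>)"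
    "words E q" "\<lambda>es. single es 1"
    by (rule quotient_power)
  have car: "carrier (tensor_power U n) = carrier (quot_space (free_space (tuples U n) :: ('k, _) module) (power_rels U n))" for n
    by (simp add: tensor_power_def with_grading_def gr_module.defs module.defs Let_def)
  let ?F = "kP \<kappa> A" and ?G = "kP \<kappa> B"
  have F: "P.fib ?F = A" and G: "Q.fib ?G = B"
    using P.kap_carrier[of A] Q.kap_carrier[of B] A B car by auto
  obtain f g where fg: "f \<in> A" "g \<in> B"
    using P.lift[of ?F] Q.lift[of ?G] P.kap_carrier[of A] Q.kap_carrier[of B] A B car F G
    unfolding P.fib_def Q.fib_def by blast
  have key: "keys (bilinear_ext (\<lambda>vs ws. single (vs @ ws) 1) f g) \<subseteq> tuples U (p + q) \<and>
      linext (tprod \<kappa>) (bilinear_ext (\<lambda>vs ws. single (vs @ ws) 1) f g) = cat ?F ?G"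
    if "f \<in> A" "g \<in> B" for f g
  proof
    have f: "keys f \<subseteq> tuples U p" "linext (tprod \<kappa>) f = ?F" using that(1) F unfolding P.fib_def by auto
    have g: "keys g \<subseteq> tuples U q" "linext (tprod \<kappa>) g = ?G" using that(2) G unfolding Q.fib_def by auto
    show "keys (bilinear_ext (\<lambda>vs ws. single (vs @ ws) 1) f g) \<subseteq> tuples U (p + q)"
      unfolding bilinear_ext_eq
    proof (intro keys_linext_subset)
      fix vs ws assume "vs \<in> keys f" "ws \<in> keys g"
      then have "vs \<in> tuples U p" "ws \<in> tuples U q" using f(1) g(1) by auto
      then show "keys (single (vs @ ws) (1::'k)) \<subseteq> tuples U (p + q)"
        by (simp add: tuples_def)
    qed
    have "linext (tprod \<kappa>) (bilinear_ext (\<lambda>vs ws. single (vs @ ws) 1) f g)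
      = linext (\<lambda>vs. linext (\<lambda>ws. cat (tprod \<kappa> vs) (tprod \<kappa> ws)) g) f"
      unfolding bilinear_ext_eq linext_linext by (simp add: tprod_append)
    also have "\<dots> = linext (\<lambda>vs. cat (tprod \<kappa> vs) ?G) f"
    proof -
      have "linext (\<lambda>ws. cat H (tprod \<kappa> ws)) g = cat H ?G" for H
      proof -
        have "lin (\<lambda>G. cat H G)" unfolding cat_def by (rule lin_linext_fun) simp
        from lin_linext_apply[OF this, of "tprod \<kappa>" g] show ?thesis unfolding g(2) by simp
      qed
      then show ?thesis by simp
    qed
    also have "\<dots> = cat ?F ?G"
      unfolding cat_def f(2)[symmetric] linext_linext by (rule refl)
    finally show "linext (tprod \<kappa>) (bilinear_ext (\<lambda>vs ws. single (vs @ ws) 1) f g) = cat ?F ?G" .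
  qed
  have same: "power_class U (p + q) (bilinear_ext (\<lambda>vs ws. single (vs @ ws) 1) f' g')
    = power_class U (p + q) (bilinear_ext (\<lambda>vs ws. single (vs @ ws) 1) f g)" if "f' \<in> A" "g' \<in> B" for f' g'
    by (rule coordsD(10)[OF coords_power[of "p + q"]])
      (use power_class_coords key[OF that] key[OF fg] in simp_all)
  have "concat_tensor U p q A B = power_class U (p + q) (bilinear_ext (\<lambda>vs ws. single (vs @ ws) 1) f g)"
    unfolding concat_tensor_def using fg same by blast
  then show "concat_tensor U p q A B \<in> carrier (tensor_power U (p + q))"
    "kP \<kappa> (concat_tensor U p q A B) = cat ?F ?G"
    using power_class_coords key[OF fg] by simp_all
qed

lemma concat_tensors_coords:
  assumes "list_all2 (\<lambda>n A. A \<in> carrier (tensor_power U n)) ns As"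
  shows "concat_tensors U ns As \<in> carrier (tensor_power U (sum_list ns)) \<and>
    kP \<kappa> (concat_tensors U ns As) = mex (\<lambda>ess. single (concat ess) 1) (map (kP \<kappa>) As)"
  using assms
proof (induction rule: list_all2_induct)
  case Nil
  have "keys (single ([] :: 'x list) (1::'k)) \<subseteq> tuples U 0" by (simp add: tuples_def)
  moreover have "tprod \<kappa> [] = single [] 1" by (simp add: tprod_def)
  ultimately show ?case using power_class_coords[of "single [] 1" 0] by simp
next
  case (Cons n ns A As)
  note c = concat_tensor_coords[OF Cons.hyps(1) conjunct1[OF Cons.IH]]
  have "cat F (mex (\<lambda>ess. single (concat ess) 1) ps) = mex (\<lambda>ess. single (concat ess) 1) (F # ps)" for F ps
    unfolding cat_def mex_Cons mex_lin[OF lin_linext] by simp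
  with c Cons.IH show ?case by simp
qed

end


section \<open>Coordinates on direct sums\<close>

lemma direct_sum_simps:
  fixes V :: "'i \<Rightarrow> ('k::field_char_0, 'v) gr_module"
  shows "carrier (direct_sum I V) = {f \<in> \<Pi>\<^sub>E i\<in>I. carrier (V i). finite {i \<in> I. f i \<noteq> \<zero>\<^bsub>V i\<^esub>}}"
    "\<zero>\<^bsub>direct_sum I V\<^esub> = (\<lambda>i\<in>I. \<zero>\<^bsub>V i\<^esub>)"
    "f \<oplus>\<^bsub>direct_sum I V\<^esub> g = (\<lambda>i\<in>I. f i \<oplus>\<^bsub>V i\<^esub> g i)"
    "c \<odot>\<^bsub>direct_sum I V\<^esub> f = (\<lambda>i\<in>I. c \<odot>\<^bsub>V i\<^esub> f i)"
    "grade (direct_sum I V) d = {f \<in> carrier (direct_sum I V). \<forall>i\<in>I. f i \<in> grade (V i) d}"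
  by (simp_all add: direct_sum_def Let_def with_grading_def mk_module_def gr_module.defs module.defs)

definition sum_coord :: "'i set \<Rightarrow> ('i \<Rightarrow> ('k::field_char_0, 'v) gr_module) \<Rightarrow> ('i \<Rightarrow> 'v \<Rightarrow> ('s \<Rightarrow>\<^sub>0 'k)) \<Rightarrow> ('i \<Rightarrow> 'v) \<Rightarrow> ('s \<Rightarrow>\<^sub>0 'k)"
  where "sum_coord I V \<kappa> f = (\<Sum>i\<in>{i \<in> I. f i \<noteq> \<zero>\<^bsub>V i\<^esub>}. \<kappa> i (f i))"

context
  fixes V :: "'i \<Rightarrow> ('k::field_char_0, 'v) gr_module" and I :: "'i set" and S :: "'s set" and ix :: "'s \<Rightarrow> 'i"
    and dg :: "'s \<Rightarrow> int" and \<kappa> :: "'i \<Rightarrow> 'v \<Rightarrow> ('s \<Rightarrow>\<^sub>0 'k)"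
  assumes c: "\<And>i. i \<in> I \<Longrightarrow> coords (V i) {s \<in> S. ix s = i} dg (\<kappa> i)" and ix: "\<And>s. s \<in> S \<Longrightarrow> ix s \<in> I"
begin

text \<open>
  The basis of a direct sum is the disjoint union of the bases of the summands, where \<open>ix s\<close> is the summand to which \<open>s\<close> belongs.
\<close>

lemma lookup_sum_coord:
  assumes f: "f \<in> carrier (direct_sum I V)"
  shows "lookup (sum_coord I V \<kappa> f) s = (if s \<in> S then lookup (\<kappa> (ix s) (f (ix s))) s else 0)"
proof -
  let ?A = "{i \<in> I. f i \<noteq> \<zero>\<^bsub>V i\<^esub>}"
  have fin: "finite ?A" and fI: "\<And>i. i \<in> I \<Longrightarrow> f i \<in> carrier (V i)" using f by (auto simp: direct_sum_simps(1))
  have z: "lookup (\<kappa> i (f i)) s = 0" if "i \<in> I" "s \<notin> S \<or> ix s \<noteq> i" for i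
    using coordsD(4)[OF c[OF that(1)] fI[OF that(1)]] that(2) by (auto simp: in_keys_iff)
  have "lookup (sum_coord I V \<kappa> f) s = (\<Sum>i\<in>?A. lookup (\<kappa> i (f i)) s)"
    by (simp add: sum_coord_def lookup_sum)
  also have "\<dots> = (\<Sum>i\<in>?A. if i = ix s then (if s \<in> S then lookup (\<kappa> i (f i)) s else 0) else 0)"
    by (intro sum.cong refl) (auto intro: z)
  also have "\<dots> = (if ix s \<in> ?A then (if s \<in> S then lookup (\<kappa> (ix s) (f (ix s))) s else 0) else 0)"
    by (rule sum.delta[OF fin])
  also have "\<dots> = (if s \<in> S then lookup (\<kappa> (ix s) (f (ix s))) s else 0)"
  proof -
    have "lookup (\<kappa> (ix s) (f (ix s))) s = 0" if "s \<in> S" "ix s \<notin> ?A"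
    proof -
      have "f (ix s) = \<zero>\<^bsub>V (ix s)\<^esub>" using ix that by blast
      then show ?thesis using coordsD(3)[OF c[OF ix[OF that(1)]]] by simp
    qed
    then show ?thesis by auto
  qed
  finally show ?thesis .
qed

lemma coords_direct_sum: "coords (direct_sum I V) S dg (sum_coord I V \<kappa>)"
proof -
  let ?D = "direct_sum I V" and ?K = "sum_coord I V \<kappa>"
  let ?inv = "\<lambda>F. \<lambda>i\<in>I. uncoord (V i) (\<kappa> i) (part ix i F)"
  have fI: "f i \<in> carrier (V i)" if "f \<in> carrier ?D" "i \<in> I" for f i
    using that by (auto simp: direct_sum_simps(1))
  have zero: "\<zero>\<^bsub>?D\<^esub> \<in> carrier ?D"
    using coordsD(2)[OF c] by (auto simp: direct_sum_simps(1,2))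
  have cl: "f \<oplus>\<^bsub>?D\<^esub> g \<in> carrier ?D" if f: "f \<in> carrier ?D" and g: "g \<in> carrier ?D" for f g
  proof -
    have z: "\<zero>\<^bsub>V i\<^esub> \<oplus>\<^bsub>V i\<^esub> \<zero>\<^bsub>V i\<^esub> = \<zero>\<^bsub>V i\<^esub>" if "i \<in> I" for i
    proof -
      note C = coordsD[OF c[OF that]]
      show ?thesis by (rule C(10)) (simp_all add: C(2,3) C(5)[OF C(2) C(2)] C(6)[OF C(2) C(2)])
    qed
    have "finite ({i \<in> I. f i \<noteq> \<zero>\<^bsub>V i\<^esub>} \<union> {i \<in> I. g i \<noteq> \<zero>\<^bsub>V i\<^esub>})" using f g by (simp add: direct_sum_simps(1))
    moreover have "{i \<in> I. (f \<oplus>\<^bsub>?D\<^esub> g) i \<noteq> \<zero>\<^bsub>V i\<^esub>} \<subseteq> {i \<in> I. f i \<noteq> \<zero>\<^bsub>V i\<^esub>} \<union> {i \<in> I. g i \<noteq> \<zero>\<^bsub>V i\<^esub>}"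
      using z by (auto simp: direct_sum_simps(3))
    ultimately have "finite {i \<in> I. (f \<oplus>\<^bsub>?D\<^esub> g) i \<noteq> \<zero>\<^bsub>V i\<^esub>}" by (rule rev_finite_subset)
    moreover have "f \<oplus>\<^bsub>?D\<^esub> g \<in> (\<Pi>\<^sub>E i\<in>I. carrier (V i))"
      unfolding direct_sum_simps(3) using coordsD(5)[OF c fI[OF f] fI[OF g]] by (intro restrict_PiE_iff[THEN iffD2] ballI)
    ultimately show ?thesis by (simp add: direct_sum_simps(1))
  qed
  have sc: "a \<odot>\<^bsub>?D\<^esub> f \<in> carrier ?D" if f: "f \<in> carrier ?D" for a f
  proof -
    have z: "a \<odot>\<^bsub>V i\<^esub> \<zero>\<^bsub>V i\<^esub> = \<zero>\<^bsub>V i\<^esub>" if "i \<in> I" for i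
    proof -
      note C = coordsD[OF c[OF that]]
      show ?thesis by (rule C(10)) (simp_all add: C(2,3) C(7)[OF C(2)] C(8)[OF C(2)])
    qed
    have "finite {i \<in> I. f i \<noteq> \<zero>\<^bsub>V i\<^esub>}" using f by (simp add: direct_sum_simps(1))
    moreover have "{i \<in> I. (a \<odot>\<^bsub>?D\<^esub> f) i \<noteq> \<zero>\<^bsub>V i\<^esub>} \<subseteq> {i \<in> I. f i \<noteq> \<zero>\<^bsub>V i\<^esub>}"
      using z by (auto simp: direct_sum_simps(4))
    ultimately have "finite {i \<in> I. (a \<odot>\<^bsub>?D\<^esub> f) i \<noteq> \<zero>\<^bsub>V i\<^esub>}" by (rule rev_finite_subset)
    moreover have "a \<odot>\<^bsub>?D\<^esub> f \<in> (\<Pi>\<^sub>E i\<in>I. carrier (V i))"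
      unfolding direct_sum_simps(4) using coordsD(7)[OF c fI[OF f]] by (intro restrict_PiE_iff[THEN iffD2] ballI)
    ultimately show ?thesis by (simp add: direct_sum_simps(1))
  qed
  have keys: "keys (?K f) \<subseteq> S" if "f \<in> carrier ?D" for f
    using lookup_sum_coord[OF that] by (auto simp: in_keys_iff split: if_splits)
  have pk: "keys (part ix i F) \<subseteq> {s \<in> S. ix s = i}" if "keys F \<subseteq> S" for i F
    using that by (auto simp: in_keys_iff lookup_part split: if_splits)
  have unc: "?inv F i \<in> carrier (V i)" "\<kappa> i (?inv F i) = part ix i F" if "keys F \<subseteq> S" "i \<in> I" for F i
    using uncoord(1,2)[OF c[OF that(2)] pk[OF that(1)]] that(2) by simp_all
  have inv: "?inv F \<in> carrier ?D" if F: "keys F \<subseteq> S" for F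
  proof -
    have "{i \<in> I. ?inv F i \<noteq> \<zero>\<^bsub>V i\<^esub>} \<subseteq> {i. part ix i F \<noteq> 0}"
    proof
      fix i assume i: "i \<in> {i \<in> I. ?inv F i \<noteq> \<zero>\<^bsub>V i\<^esub>}"
      note C = coordsD[OF c[of i]]
      have "part ix i F \<noteq> 0"
      proof
        assume "part ix i F = 0"
        then have "?inv F i = \<zero>\<^bsub>V i\<^esub>" using i unc[OF F, of i] C(2,3) by (intro C(10)) auto
        then show False using i by simp
      qed
      then show "i \<in> {i. part ix i F \<noteq> 0}" by simp
    qed
    then have "finite {i \<in> I. ?inv F i \<noteq> \<zero>\<^bsub>V i\<^esub>}" by (rule finite_subset) (rule part_decomposition(1))
    moreover have "?inv F \<in> (\<Pi>\<^sub>E i\<in>I. carrier (V i))" using uncoord(1)[OF c pk[OF F]] by (intro restrict_PiE_iff[THEN iffD2] ballI)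
    ultimately show ?thesis by (simp add: direct_sum_simps(1))
  qed
  have comp: "\<kappa> i (f i) = part ix i (?K f)" if f: "f \<in> carrier ?D" and i: "i \<in> I" for f i
  proof (rule poly_mapping_eqI)
    fix s
    show "lookup (\<kappa> i (f i)) s = lookup (part ix i (?K f)) s"
      using coordsD(4)[OF c[OF i] fI[OF f i]] by (auto simp: lookup_part lookup_sum_coord[OF f] in_keys_iff)
  qed
  have bij: "bij_betw ?K (carrier ?D) {F. keys F \<subseteq> S}"
  proof (rule bij_betw_byWitness[of _ ?inv])
    show "\<forall>f\<in>carrier ?D. ?inv (?K f) = f"
    proof
      fix f assume f: "f \<in> carrier ?D"
      have "f \<in> (\<Pi>\<^sub>E i\<in>I. carrier (V i))" using f by (simp add: direct_sum_simps(1))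
      moreover have "?inv (?K f) i = f i" if "i \<in> I" for i
        using uncoord(3)[OF c[OF that] fI[OF f that]] that by (simp add: comp[OF f that])
      ultimately show "?inv (?K f) = f" by (intro ext) (auto simp: PiE_iff extensional_def)
    qed
    show "\<forall>F\<in>{F. keys F \<subseteq> S}. ?K (?inv F) = F"
    proof
      fix F assume "F \<in> {F :: 's \<Rightarrow>\<^sub>0 'k. keys F \<subseteq> S}"
      then have F: "keys F \<subseteq> S" by simp
      show "?K (?inv F) = F"
      proof (rule poly_mapping_eqI)
        fix s show "lookup (?K (?inv F)) s = lookup F s"
        proof (cases "s \<in> S")
          case True
          then show ?thesis using unc(2)[OF F ix[OF True]] ix[OF True] by (simp add: lookup_sum_coord[OF inv[OF F]] lookup_part del: restrict_apply)
        next
          case False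
          then show ?thesis using F by (auto simp: lookup_sum_coord[OF inv[OF F]] in_keys_iff)
        qed
      qed
    qed
  qed (use keys inv in auto)
  have k0: "?K \<zero>\<^bsub>?D\<^esub> = 0" by (auto simp: sum_coord_def direct_sum_simps(2) intro!: sum.neutral)
  have kadd: "?K (f \<oplus>\<^bsub>?D\<^esub> g) = ?K f + ?K g" if "f \<in> carrier ?D" "g \<in> carrier ?D" for f g
  proof (rule poly_mapping_eqI)
    fix s show "lookup (?K (f \<oplus>\<^bsub>?D\<^esub> g)) s = lookup (?K f + ?K g) s"
      unfolding lookup_add lookup_sum_coord[OF cl[OF that]] lookup_sum_coord[OF that(1)] lookup_sum_coord[OF that(2)]
      using ix[of s] by (simp add: direct_sum_simps(3) coordsD(6)[OF c fI[OF that(1)] fI[OF that(2)]] lookup_add)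
  qed
  have ksc: "?K (a \<odot>\<^bsub>?D\<^esub> f) = scalar a (?K f)" if "f \<in> carrier ?D" for f a
  proof (rule poly_mapping_eqI)
    fix s show "lookup (?K (a \<odot>\<^bsub>?D\<^esub> f)) s = lookup (scalar a (?K f)) s"
      unfolding Poly_Mapping.map.rep_eq lookup_sum_coord[OF sc[OF that]] lookup_sum_coord[OF that]
      using ix[of s] by (simp add: direct_sum_simps(4) coordsD(8)[OF c fI[OF that]] Poly_Mapping.map.rep_eq when_def)
  qed
  have gr: "grade ?D d = {x \<in> carrier ?D. keys (?K x) \<subseteq> {s \<in> S. dg s = d}}" for d
  proof -
    have "(\<forall>i\<in>I. f i \<in> grade (V i) d) \<longleftrightarrow> keys (?K f) \<subseteq> {s \<in> S. dg s = d}" if f: "f \<in> carrier ?D" for f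
    proof -
      have "f i \<in> grade (V i) d \<longleftrightarrow> (\<forall>s\<in>keys (?K f). ix s = i \<longrightarrow> dg s = d)" if i: "i \<in> I" for i
        using keys[OF f] fI[OF f i] by (auto simp: coordsD(9)[OF c[OF i]] comp[OF f i] in_keys_iff lookup_part subset_iff split: if_splits)
      then show ?thesis using keys[OF f] ix by (auto simp: subset_iff)
    qed
    then show ?thesis unfolding direct_sum_simps(5) by blast
  qed
  show ?thesis
    unfolding coords_def by (intro conjI ballI allI) (rule bij zero k0 cl kadd sc ksc gr; assumption)+
qed

lemma sum_inj_coord:
  assumes n: "n \<in> I" and v: "v \<in> carrier (V n)"
  shows "sum_inj I V n v \<in> carrier (direct_sum I V)" "sum_coord I V \<kappa> (sum_inj I V n v) = \<kappa> n v"
proof -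
  have "{i \<in> I. sum_inj I V n v i \<noteq> \<zero>\<^bsub>V i\<^esub>} \<subseteq> {n}" by (auto simp: sum_inj_def)
  then have "finite {i \<in> I. sum_inj I V n v i \<noteq> \<zero>\<^bsub>V i\<^esub>}" by (rule finite_subset) simp
  moreover have "sum_inj I V n v \<in> (\<Pi>\<^sub>E i\<in>I. carrier (V i))"
    unfolding sum_inj_def using v coordsD(2)[OF c] by (intro restrict_PiE_iff[THEN iffD2] ballI) auto
  ultimately show f: "sum_inj I V n v \<in> carrier (direct_sum I V)" by (simp add: direct_sum_simps(1))
  show "sum_coord I V \<kappa> (sum_inj I V n v) = \<kappa> n v"
  proof (rule poly_mapping_eqI)
    fix s
    have "lookup (\<kappa> n v) s = 0" if "s \<notin> S \<or> ix s \<noteq> n"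
      using coordsD(4)[OF c[OF n] v] that by (auto simp: in_keys_iff)
    then show "lookup (sum_coord I V \<kappa> (sum_inj I V n v)) s = lookup (\<kappa> n v) s"
      unfolding lookup_sum_coord[OF f] using ix[of s] coordsD(3)[OF c[of "ix s"]] by (auto simp: sum_inj_def)
  qed
qed

end


section \<open>Transport of structure along coordinates\<close>

lemma Am_algebra_transport:
  fixes V :: "('k::field_char_0, 'v) gr_module"
  assumes c: "coords V S dg \<kappa>" and P: "Am_algebra m (free_gr_space dg S :: ('k, _) gr_module) \<mu>"
  shows "Am_algebra m V (\<lambda>k as. uncoord V \<kappa> (\<mu> k (map \<kappa> as)))"
proof -
  let ?P = "free_gr_space dg S :: ('k, _) gr_module"
  let ?\<nu> = "\<lambda>k as. uncoord V \<kappa> (\<mu> k (map \<kappa> as))"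
  interpret P: Am_alg m ?P \<mu> by (rule Am_alg.intro[OF P])
  interpret V: vspace V by (rule coords_vspace[OF c])
  note C = coordsD[OF c] and U = uncoord[OF c]
  have ml: "multilinear k V V (?\<nu> k)" if "1 \<le> k" "enat k \<le> m" for k
    by (rule multilinear_lhom_out[OF multilinear_lhom_in[OF coords_lhom(1)[OF c] P.ml[OF that]] coords_lhom(2)[OF c]])
  have in_P: "keys (\<mu> k (map \<kappa> as)) \<subseteq> S" if "1 \<le> k" "enat k \<le> m" "length as = k" "set as \<subseteq> carrier V" for k as
    using multilinearD(1)[OF P.ml[OF that(1,2)], of "map \<kappa> as"] that(3,4) C(4) by auto
  have gr: "map \<kappa> as ! i \<in> grade ?P (ds ! i)" if "i < length as" "as ! i \<in> grade V (ds ! i)" for as i and ds :: "int list"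
    using that by (simp add: C(9))
  have "(\<Oplus>\<^bsub>V\<^esub> l \<in> {0..<n}. \<Oplus>\<^bsub>V\<^esub> k \<in> {1..n - l}.
          ((-1 :: 'k) powi (int k + int l + int k * int l + int k * sum_list (take l ds))) \<odot>\<^bsub>V\<^esub>
            ?\<nu> (n - k + 1) (take l as @ [?\<nu> k (take k (drop l as))] @ drop (l + k) as)) = \<zero>\<^bsub>V\<^esub>"
    if n: "1 \<le> n" "enat n \<le> m" "length as = n" "length ds = n" and as: "\<forall>i<n. as ! i \<in> grade V (ds ! i)" for n as ds
  proof -
    let ?c = "\<lambda>l k. (-1 :: 'k) powi (int k + int l + int k * int l + int k * sum_list (take l ds))"
    define t where "t l k = ?c l k \<odot>\<^bsub>V\<^esub> ?\<nu> (n - k + 1) (take l as @ [?\<nu> k (take k (drop l as))] @ drop (l + k) as)" for l k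
    define u where "u l k = ?c l k \<odot>\<^bsub>?P\<^esub> \<mu> (n - k + 1) (take l (map \<kappa> as) @ [\<mu> k (take k (drop l (map \<kappa> as)))] @ drop (l + k) (map \<kappa> as))" for l k
    have asV: "set as \<subseteq> carrier V" using as n(3) by (auto simp: C(9) in_set_conv_nth)
    have enat: "enat k \<le> m" if "k \<le> n" for k using that n(2) by (meson enat_ord_simps(1) order_trans)
    have tu: "t l k \<in> carrier V \<and> \<kappa> (t l k) = u l k" if l: "l \<in> {0..<n}" and k: "k \<in> {1..n - l}" for l k
    proof -
      have sub: "set (take k (drop l as)) \<subseteq> carrier V" "set (take l as) \<subseteq> carrier V" "set (drop (l + k) as) \<subseteq> carrier V"
        using asV by (auto dest: in_set_takeD in_set_dropD)
      have kk: "1 \<le> k" "enat k \<le> m" "length (take k (drop l as)) = k" using l k n enat[of k] by auto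
      note i1 = in_P[OF kk sub(1)]
      let ?as = "take l as @ [?\<nu> k (take k (drop l as))] @ drop (l + k) as"
      have nn: "1 \<le> n - k + 1" "enat (n - k + 1) \<le> m" "length ?as = n - k + 1" using l k n enat[of "n - k + 1"] by auto
      have as': "set ?as \<subseteq> carrier V" using sub U(1)[OF i1] by auto
      note i2 = in_P[OF nn as']
      have m: "map \<kappa> ?as = take l (map \<kappa> as) @ [\<mu> k (take k (drop l (map \<kappa> as)))] @ drop (l + k) (map \<kappa> as)"
        using U(2)[OF i1] by (simp add: take_map drop_map)
      show ?thesis unfolding t_def u_def m[symmetric]
        by (simp only: C(7)[OF U(1)[OF i2]] C(8)[OF U(1)[OF i2]] U(2)[OF i2] free_gr_space_simps simp_thms)
    qed
    have tk: "t l \<in> {1..n - l} \<rightarrow> carrier V" if "l \<in> {0..<n}" for l using tu that by blast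
    have uk: "u l \<in> {1..n - l} \<rightarrow> carrier ?P" if "l \<in> {0..<n}" for l
      using tu[OF that] C(4) by (auto simp: Pi_iff) (metis subsetD)
    have "\<kappa> (\<Oplus>\<^bsub>V\<^esub>l\<in>{0..<n}. \<Oplus>\<^bsub>V\<^esub>k\<in>{1..n - l}. t l k) = (\<Oplus>\<^bsub>?P\<^esub>l\<in>{0..<n}. \<kappa> (\<Oplus>\<^bsub>V\<^esub>k\<in>{1..n - l}. t l k))"
      by (rule finsum_lhom[OF V.vspace_axioms P.B.vspace_axioms coords_lhom(1)[OF c]]) (use tk in \<open>auto intro: V.finsum_closed\<close>)
    also have "\<dots> = (\<Oplus>\<^bsub>?P\<^esub>l\<in>{0..<n}. \<Oplus>\<^bsub>?P\<^esub>k\<in>{1..n - l}. u l k)"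
    proof (rule P.B.finsum_cong'[OF refl])
      show "(\<lambda>l. \<Oplus>\<^bsub>?P\<^esub>k\<in>{1..n - l}. u l k) \<in> {0..<n} \<rightarrow> carrier ?P"
        by (rule Pi_I, rule P.B.finsum_closed, rule uk)
      fix l assume l: "l \<in> {0..<n}"
      have "\<kappa> (\<Oplus>\<^bsub>V\<^esub>k\<in>{1..n - l}. t l k) = (\<Oplus>\<^bsub>?P\<^esub>k\<in>{1..n - l}. \<kappa> (t l k))"
        by (rule finsum_lhom[OF V.vspace_axioms P.B.vspace_axioms coords_lhom(1)[OF c] tk[OF l]])
      also have "\<dots> = (\<Oplus>\<^bsub>?P\<^esub>k\<in>{1..n - l}. u l k)"
        by (rule P.B.finsum_cong'[OF refl uk[OF l]]) (use tu[OF l] in blast)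
      finally show "\<kappa> (\<Oplus>\<^bsub>V\<^esub>k\<in>{1..n - l}. t l k) = (\<Oplus>\<^bsub>?P\<^esub>k\<in>{1..n - l}. u l k)" .
    qed
    also have "\<dots> = \<zero>\<^bsub>?P\<^esub>"
      unfolding u_def by (rule P.nu_relation) (use n as gr in \<open>auto simp del: nth_map\<close>)
    finally have "\<kappa> (\<Oplus>\<^bsub>V\<^esub>l\<in>{0..<n}. \<Oplus>\<^bsub>V\<^esub>k\<in>{1..n - l}. t l k) = \<kappa> \<zero>\<^bsub>V\<^esub>" by (simp add: C(3))
    then have "(\<Oplus>\<^bsub>V\<^esub>l\<in>{0..<n}. \<Oplus>\<^bsub>V\<^esub>k\<in>{1..n - l}. t l k) = \<zero>\<^bsub>V\<^esub>"
      by (intro C(10)) (use tk in \<open>auto intro!: V.finsum_closed\<close>)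
    then show ?thesis unfolding t_def .
  qed
  moreover have "?\<nu> k as \<in> grade V (sum_list ds + int k - 2)"
    if n: "1 \<le> k" "enat k \<le> m" "length as = k" "length ds = k" and as: "\<forall>i<k. as ! i \<in> grade V (ds ! i)" for k as ds
  proof -
    have "\<mu> k (map \<kappa> as) \<in> grade ?P (sum_list ds + int k - 2)"
      by (rule P.nu_grade) (use n as gr in \<open>auto simp del: nth_map\<close>)
    then have "keys (\<mu> k (map \<kappa> as)) \<subseteq> {s \<in> S. dg s = sum_list ds + int k - 2}" by simp
    moreover from this have "keys (\<mu> k (map \<kappa> as)) \<subseteq> S" by blast
    ultimately show ?thesis using U(1,2) by (simp add: C(9))
  qed
  ultimately show ?thesis
    unfolding Am_algebra_def using coords_graded[OF c] ml by blast
qed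


section \<open>Strict homomorphisms and the evaluation of trees\<close>

lemma epsl_apfst: "epsl ts (map (apfst g) as) = epsl ts as"
  by (induction ts arbitrary: as) (simp_all add: take_map drop_map o_def)

text \<open>
  An operation on trees is a composite of the operations \<open>\<mu> k\<close>, so strict homomorphisms commute with it.
\<close>

lemma ev_strict:
  fixes V :: "('k::field_char_0, 'v) gr_module" and W :: "('k, 'w) gr_module"
  assumes V: "Am_alg m V \<mu>" and g: "lhom V W g"
    and strict: "\<And>k as. 1 \<le> k \<Longrightarrow> enat k \<le> m \<Longrightarrow> length as = k \<Longrightarrow> set as \<subseteq> carrier V \<Longrightarrow> g (\<mu> k as) = \<nu> k (map g as)"
  shows "valid m T \<Longrightarrow> length as = legs T \<Longrightarrow> fst ` set as \<subseteq> carrier V \<Longrightarrow>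
    g (ev V \<mu> T as) = ev W \<nu> T (map (apfst g) as)"
proof (induction T arbitrary: as)
  case Triv
  then show ?case by (cases as) auto
next
  case (Vertex ts)
  interpret V: Am_alg m V \<mu> by (rule V)
  have "map g (evl V \<mu> us as) = evl W \<nu> us (map (apfst g) as) \<and> set (evl V \<mu> us as) \<subseteq> carrier V"
    if "set us \<subseteq> set ts" "length as = sum_list (map legs us)" "fst ` set as \<subseteq> carrier V" for us as
    using that
  proof (induction us arbitrary: as)
    case (Cons t us)
    have t: "t \<in> set ts" "valid m t" "length (take (legs t) as) = legs t" "fst ` set (take (legs t) as) \<subseteq> carrier V"
      using Cons.prems Vertex.prems by (auto intro!: image_take_drop)
    have "length (drop (legs t) as) = sum_list (map legs us)" "fst ` set (drop (legs t) as) \<subseteq> carrier V"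
      using Cons.prems by (auto intro!: image_take_drop)
    with Cons show ?case
      using Vertex.IH[OF t] V.ev_closed[OF t(2-4)] by (simp add: take_map drop_map)
  qed simp
  from this[of ts as] have e: "map g (evl V \<mu> ts as) = evl W \<nu> ts (map (apfst g) as)" "set (evl V \<mu> ts as) \<subseteq> carrier V"
    using Vertex.prems by simp_all
  have k: "1 \<le> length ts" "enat (length ts) \<le> m" using Vertex.prems(1) by auto
  have "\<mu> (length ts) (evl V \<mu> ts as) \<in> carrier V"
    using e(2) by (intro multilinearD(1)[OF V.ml[OF k]]) auto
  then show ?case
    using strict[OF k _ e(2)] lhomD(2)[OF g] by (simp add: epsl_apfst e(1))
qed

lemma vlin_lhom: "vspace V \<Longrightarrow> lhom (free_gr_space dg S) V h \<Longrightarrow> vlin V S h"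
  by (rule vspace.vlinI) (simp_all add: lhomD lhomD(2)[of "free_gr_space dg S", simplified] lhomD(3)[of "free_gr_space dg S", simplified])

lemma lhom_comp: "lhom V W f \<Longrightarrow> lhom W Z g \<Longrightarrow> lhom V Z (\<lambda>x. g (f x))"
  by (rule lhomI) (simp_all add: lhomD)

lemma gr_hom_lhom: "h \<in> gr_hom V W \<Longrightarrow> lhom V W h"
  by (rule lhomI) (auto simp: gr_hom_def)

lemma gr_hom_grade: "h \<in> gr_hom V W \<Longrightarrow> x \<in> grade V d \<Longrightarrow> h x \<in> grade W d"
  unfolding gr_hom_def by blast

lemma gr_homI:
  assumes "lhom V W h" "\<And>d x. x \<in> grade V d \<Longrightarrow> h x \<in> grade W d" "\<And>x. x \<notin> carrier V \<Longrightarrow> h x = undefined"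
  shows "h \<in> gr_hom V W"
  unfolding gr_hom_def
proof (intro CollectI conjI ballI allI PiE_I subsetI)
  fix d y assume "y \<in> h ` grade V d" then show "y \<in> grade W d" using assms(2) by blast
qed (use assms(3) lhomD[OF assms(1)] in simp_all)


section \<open>The free algebra in coordinates\<close>

text \<open>
  The recursion for the Koszul sign collects the pairs \<open>i < j\<close> by the first index \<open>i\<close>.
\<close>

lemma epsb_zip:
  "length Ts = length ess \<Longrightarrow> epsb dg (zip Ts ess)
    = (\<Sum>j<length Ts. \<Sum>i<j. sum_list (map dg (ess ! i)) * tdeg (Ts ! j))"
proof (induction Ts ess rule: list_induct2)
  case (Cons T Ts es ess)
  have "map (tdeg \<circ> fst) (zip Ts ess) = map tdeg Ts"
    using Cons.hyps by (simp add: map_map[symmetric] del: map_map)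
  then have "sum_list (map (tdeg \<circ> fst) (zip Ts ess)) = (\<Sum>j<length Ts. tdeg (Ts ! j))"
    by (simp add: sum_list_sum_nth atLeast0LessThan)
  with Cons.IH show ?case
    by (simp add: sum.lessThan_Suc_shift sum.distrib sum_distrib_left del: sum.lessThan_Suc)
qed simp

lemma outer_tag: "outer F (single es 1) = tag es F"
  by (simp add: outer_def tag_def)

lemma outer_single_left: "outer (single T 1) p = linext (\<lambda>es. single (T, es) 1) p"
  by (simp add: outer_def)

lemma lin_outer: "lin (outer F)"
  by (simp add: lin_def outer_lin)

lemma mex_outer:
  "length Ts = length ps \<Longrightarrow> mex \<phi> (map2 (\<lambda>T p. outer (single T 1) p) Ts ps) = mex (\<lambda>ess. \<phi> (zip Ts ess)) ps"
proof (induction Ts ps arbitrary: \<phi> rule: list_induct2)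
  case (Cons T Ts p ps)
  then show ?case by (simp add: mex_Cons outer_single_left linext_linext)
qed simp

text \<open>
  The generators are kept together with a homogeneous basis, and \<open>kQ\<close> below gives coordinates of the free algebra with respect to the
  decorated admissible trees.
\<close>

locale free_algebra = based_space U E dg \<kappa>
  for U :: "('k::field_char_0, 'x) gr_module" and E dg \<kappa> +
  fixes m :: enat
  assumes m: "1 \<le> m"
begin

abbreviation "Q \<equiv> free_Am m U"

definition kQ :: "(nat \<Rightarrow> ((ptree \<Rightarrow>\<^sub>0 'k) set \<times> ('x list \<Rightarrow>\<^sub>0 'k) set \<Rightarrow>\<^sub>0 'k) set) \<Rightarrow> (ptree \<times> 'x list \<Rightarrow>\<^sub>0 'k)"
  where "kQ = sum_coord {1..} (free_Am_part m U) (\<lambda>n. kT kA (kP \<kappa>))"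

lemma coords_part:
  "coords (free_Am_part m U n) {b \<in> basis m E. legs (fst b) = n} (bdeg dg) (kT kA (kP \<kappa>))"
proof -
  have "Adm m n \<times> words E n = {b \<in> basis m E. legs (fst b) = n}"
    by (auto simp: basis_def Adm_iff)
  moreover have "(\<lambda>(T, es). tdeg T + sum_list (map dg es)) = bdeg dg" by (auto simp: bdeg_def)
  ultimately show ?thesis
    using tensor_coords(1)[OF coords_opA[OF m, of n, where ?'k = 'k] coords_power[of n]]
    by (simp add: free_Am_part_def)
qed

lemma legs_basis: "b \<in> basis m E \<Longrightarrow> legs (fst b) \<in> {1..}"
  using legs_pos by (auto simp: basis_def)

lemma coords_Q: "coords Q (basis m E) (bdeg dg) kQ"
  unfolding free_Am_def kQ_def by (rule coords_direct_sum[OF coords_part legs_basis])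

lemmas CQ = coordsD[OF coords_Q] and UQ = uncoord[OF coords_Q]

lemma free_elem_coords:
  assumes n: "1 \<le> n" and w: "keys w \<subseteq> trees m n" and v: "v \<in> carrier (tensor_power U n)"
  shows "free_elem m U n w v \<in> carrier Q" "kQ (free_elem m U n w v) = outer (linext nf w) (kP \<kappa> v)"
proof -
  note op = op_class_coords[OF m w]
  note t = tensor_coords(2,3)[OF coords_opA[OF m, of n, where ?'k = 'k] coords_power[of n] op(1) v]
  have t1: "tens (opA m n) (tensor_power U n) (op_class m n w) v \<in> carrier (free_Am_part m U n)"
    using t(1) by (simp add: free_Am_part_def)
  have n': "n \<in> {1..}" using n by simp
  note s = sum_inj_coord[where V = "free_Am_part m U" and \<kappa> = "\<lambda>n. kT kA (kP \<kappa>)", OF coords_part legs_basis n' t1]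
  show "free_elem m U n w v \<in> carrier Q" unfolding free_elem_def free_Am_def by (rule s(1))
  show "kQ (free_elem m U n w v) = outer (linext nf w) (kP \<kappa> v)"
    using s(2) t(2) op(2) by (simp only: free_elem_def kQ_def)
qed

definition op :: "nat \<Rightarrow> (nat \<Rightarrow> ((ptree \<Rightarrow>\<^sub>0 'k) set \<times> ('x list \<Rightarrow>\<^sub>0 'k) set \<Rightarrow>\<^sub>0 'k) set) list \<Rightarrow>
    (nat \<Rightarrow> ((ptree \<Rightarrow>\<^sub>0 'k) set \<times> ('x list \<Rightarrow>\<^sub>0 'k) set \<Rightarrow>\<^sub>0 'k) set)"
  where "op k as = uncoord Q kQ (muP dg k (map kQ as))"

lemma Am_algebra_op: "Am_algebra m Q op"
  using Am_algebra_transport[OF coords_Q Am_algebra_freeP[OF m]] by (simp add: op_def[abs_def])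

sublocale Q: Am_alg m Q op
  by (rule Am_alg.intro[OF Am_algebra_op])

sublocale P: Am_alg m "freeP m E dg :: ('k, _) gr_module" "muP dg"
  by (rule Am_alg.intro[OF Am_algebra_freeP[OF m]])

lemma muP_closed:
  assumes "1 \<le> k" "enat k \<le> m" "length ps = k" "\<And>p. p \<in> set ps \<Longrightarrow> keys p \<subseteq> basis m E"
  shows "keys (muP dg k ps :: _ \<Rightarrow>\<^sub>0 'k) \<subseteq> basis m E"
  using multilinearD(1)[OF P.ml[OF assms(1,2)], of ps] assms(3,4) by auto

lemma kQ_op:
  assumes "1 \<le> k" "enat k \<le> m" "length as = k" "set as \<subseteq> carrier Q"
  shows "kQ (op k as) = muP dg k (map kQ as)"
  unfolding op_def by (rule UQ(2), rule muP_closed) (use assms CQ(4) in auto)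

text \<open>
  Both sides have the same coordinates. The tensors \<open>vs\<close> are combinations of words, and since each is homogeneous, all words
  that occur give the same Koszul sign, which can be taken out of the sum.
\<close>

lemma op_free_elem:
  assumes k: "1 \<le> k" "enat k \<le> m" and len: "length Ts = k" "length vs = k" "length ds = k"
    and Tv: "\<And>j. j < k \<Longrightarrow> Ts ! j \<in> Adm m (legs (Ts ! j)) \<and> vs ! j \<in> grade (tensor_power U (legs (Ts ! j))) (ds ! j)"
  shows "op k (map2 (\<lambda>T v. free_elem m U (legs T) (single T 1) v) Ts vs) =
    ((-1 :: 'k) powi (\<Sum>j<k. \<Sum>i<j. ds ! i * tdeg (Ts ! j))) \<odot>\<^bsub>Q\<^esub>
      free_elem m U (legs (Vertex Ts)) (Omega m (Vertex Ts)) (concat_tensors U (map legs Ts) vs)"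
proof -
  let ?as = "map2 (\<lambda>T v. free_elem m U (legs T) (single T 1) v) Ts vs"
  let ?e = "\<Sum>j<k. \<Sum>i<j. ds ! i * tdeg (Ts ! j)"
  let ?ps = "map (kP \<kappa>) vs"
  have valid: "valid m T" "adm T" if "T \<in> set Ts" for T
    using Tv that len(1) by (auto simp: Adm_iff in_set_conv_nth)
  have v: "vs ! j \<in> carrier (tensor_power U (legs (Ts ! j)))"
    and kv: "keys (kP \<kappa> (vs ! j)) \<subseteq> {es \<in> words E (legs (Ts ! j)). sum_list (map dg es) = ds ! j}" if "j < k" for j
    using Tv[OF that] by (auto simp: coordsD(9)[OF coords_power])
  have elem: "free_elem m U (legs T) (single T 1) v \<in> carrier Q \<and>
    kQ (free_elem m U (legs T) (single T 1) v) = outer (single T 1) (kP \<kappa> v)"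
    if "(T, v) \<in> set (zip Ts vs)" for T v
  proof -
    from that obtain j where j: "j < k" "T = Ts ! j" "v = vs ! j" using len by (auto simp: in_set_zip)
    then have T: "valid m T" "adm T" using valid len by auto
    have nf1: "nf T = single T (1::'k)" by (rule nf_adm[OF T])
    have *: "keys (single T (1::'k)) \<subseteq> trees m (legs T)" using T by (simp add: trees_iff)
    show ?thesis
      using free_elem_coords[OF legs_pos[OF T(1)] *, of v] v[OF j(1)] j nf1 by simp
  qed
  have as: "set ?as \<subseteq> carrier Q" "length ?as = k" using elem len by auto
  have "map kQ ?as = map2 (\<lambda>T v. outer (single T 1) (kP \<kappa> v)) Ts vs"
    using elem by auto
  also have "\<dots> = map2 (\<lambda>T p. outer (single T 1) p) Ts ?ps"
    by (simp add: zip_map2 split_beta)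
  finally have "kQ (op k ?as) = mex (\<lambda>ess. mu0 dg (zip Ts ess)) ?ps"
    using kQ_op[OF k as(2,1)] len by (simp add: muP_def mex_outer)
  also have "\<dots> = mex (\<lambda>ess. scalar (sg ?e) (outer (nf (Vertex Ts)) (single (concat ess) 1))) ?ps"
  proof (rule mex_cong)
    fix ess assume ess: "list_all2 (\<lambda>es p. es \<in> keys p) ess ?ps"
    then have l: "length ess = k" using len by (auto dest: list_all2_lengthD)
    have "sum_list (map dg (ess ! j)) = ds ! j" if "j < k" for j
      using list_all2_nthD[OF ess, of j] kv[OF that] that l len by auto
    then have "epsb dg (zip Ts ess) = ?e"
      using l len by (subst epsb_zip) (auto intro!: sum.cong)
    then show "mu0 dg (zip Ts ess) = scalar (sg ?e) (outer (nf (Vertex Ts)) (single (concat ess) 1))"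
      using l len by (simp add: mu0_def outer_tag)
  qed
  also have "\<dots> = scalar (sg ?e) (outer (nf (Vertex Ts)) (mex (\<lambda>ess. single (concat ess) 1) ?ps))"
    by (simp add: mex_scalar mex_lin[OF lin_outer])
  finally have L: "kQ (op k ?as) = scalar (sg ?e) (outer (nf (Vertex Ts)) (mex (\<lambda>ess. single (concat ess) 1) ?ps))" .
  have "list_all2 (\<lambda>n A. A \<in> carrier (tensor_power U n)) (map legs Ts) vs"
    using v len by (simp add: list_all2_conv_all_nth)
  note ct = concat_tensors_coords[OF this]
  have V: "valid m (Vertex Ts)" using k len valid by auto
  have nf: "keys (nf (Vertex Ts) :: _ \<Rightarrow>\<^sub>0 'k) \<subseteq> Adm m (legs (Vertex Ts))"
  proof
    fix T assume "T \<in> keys (nf (Vertex Ts) :: _ \<Rightarrow>\<^sub>0 'k)"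
    then have "goodN m (Vertex Ts) T" by (rule keys_nf[OF m])
    then show "T \<in> Adm m (legs (Vertex Ts))" using V by (simp add: goodN_def Adm_iff)
  qed
  then have tr: "keys (nf (Vertex Ts) :: _ \<Rightarrow>\<^sub>0 'k) \<subseteq> trees m (legs (Vertex Ts))"
    by (auto simp: Adm_def)
  let ?r = "free_elem m U (legs (Vertex Ts)) (nf (Vertex Ts)) (concat_tensors U (map legs Ts) vs)"
  have cc: "concat_tensors U (map legs Ts) vs \<in> carrier (tensor_power U (legs (Vertex Ts)))" using ct by simp
  note r = free_elem_coords[OF legs_pos[OF V] tr cc]
  have "kQ (op k ?as) = kQ (sg ?e \<odot>\<^bsub>Q\<^esub> ?r)"
    unfolding L CQ(8)[OF r(1)] r(2) linext_nf_Adm[OF nf] using ct by simp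
  then have "op k ?as = sg ?e \<odot>\<^bsub>Q\<^esub> ?r"
    using multilinearD(1)[OF Q.ml[OF k] as(2,1)] CQ(7)[OF r(1)] by (intro CQ(10))
  then show ?thesis by (simp only: powi_eq_sg Omega_eq_nf[OF m V])
qed

lemma free_structure_op: "free_structure m U op"
  unfolding free_structure_def
proof (intro allI impI conjI)
  fix k assume k: "1 \<le> k \<and> enat k \<le> m"
  then show "multilinear k Q Q (op k)" using Q.ml by blast
  fix Ts vs ds
  assume "length Ts = k \<and> length vs = k \<and> length ds = k \<and>
        (\<forall>j<k. Ts ! j \<in> Adm m (legs (Ts ! j)) \<and>
           vs ! j \<in> grade (tensor_power U (legs (Ts ! j))) (ds ! j))"
  then show "op k (map2 (\<lambda>T v. free_elem m U (legs T) (single T 1) v) Ts vs) =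
    ((-1 :: 'k) powi (\<Sum>j<k. \<Sum>i<j. ds ! i * tdeg (Ts ! j))) \<odot>\<^bsub>Q\<^esub>
      free_elem m U (legs (Vertex Ts)) (Omega m (Vertex Ts)) (concat_tensors U (map legs Ts) vs)"
    using k by (intro op_free_elem) auto
qed

lemma basis_free_elem:
  assumes b: "b \<in> basis m E"
  shows "power_class U (legs (fst b)) (single (snd b) 1) \<in> grade (tensor_power U (legs (fst b))) (sum_list (map dg (snd b)))"
    and "uncoord Q kQ (single b 1)
    = free_elem m U (legs (fst b)) (single (fst b) 1) (power_class U (legs (fst b)) (single (snd b) 1))"
proof -
  obtain T es where [simp]: "b = (T, es)" by (cases b)
  have T: "valid m T" "adm T" "length es = legs T" "set es \<subseteq> E" using b by (auto simp: basis_def)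
  have "es \<in> tuples U (legs T)" using T E by (auto simp: tuples_def)
  then have t: "keys (single es (1::'k)) \<subseteq> tuples U (legs T)" by simp
  note p = power_class_coords[OF t]
  have p2: "kP \<kappa> (power_class U (legs T) (single es 1)) = single es 1"
    using p(2) tprod_E[OF T(4)] by simp
  show "power_class U (legs (fst b)) (single (snd b) 1) \<in> grade (tensor_power U (legs (fst b))) (sum_list (map dg (snd b)))"
    using p(1) p2 T by (simp add: coordsD(9)[OF coords_power])
  have *: "keys (single T (1::'k)) \<subseteq> trees m (legs T)" using T by (simp add: trees_iff)
  note f = free_elem_coords[OF legs_pos[OF T(1)] * p(1)]
  have "kQ (free_elem m U (legs T) (single T 1) (power_class U (legs T) (single es 1))) = single b 1"
    unfolding f(2) p2 by (simp add: nf_adm[OF T(1,2)] outer_single)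
  with UQ(3)[OF f(1)] show "uncoord Q kQ (single b 1)
    = free_elem m U (legs (fst b)) (single (fst b) 1) (power_class U (legs (fst b)) (single (snd b) 1))"
    by simp
qed

text \<open>
  The elements \<open>T \<otimes> v\<close> with \<open>T\<close> admissible and \<open>v\<close> a word in the basis span the algebra, so their products determine a
  multilinear structure.
\<close>

lemma free_structure_unique:
  assumes s: "free_structure m U \<mu>" and s': "free_structure m U \<mu>'"
    and k: "1 \<le> k" "enat k \<le> m" and as: "length as = k" "set as \<subseteq> carrier Q"
  shows "\<mu>' k as = \<mu> k as"
proof -
  let ?u = "uncoord Q kQ"
  have ml: "multilinear k (freeP m E dg) Q (\<lambda>ps. \<mu> k (map ?u ps))" if "free_structure m U \<mu>" for \<mu>
    by (rule multilinear_lhom_in[OF coords_lhom(2)[OF coords_Q]])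
      (use that k in \<open>simp add: free_structure_def\<close>)
  have val: "\<mu> k (map ?u (map (\<lambda>b. single b 1) bs)) =
      ((-1 :: 'k) powi (\<Sum>j<k. \<Sum>i<j. map (\<lambda>b. sum_list (map dg (snd b))) bs ! i * tdeg (map fst bs ! j))) \<odot>\<^bsub>Q\<^esub>
      free_elem m U (legs (Vertex (map fst bs))) (Omega m (Vertex (map fst bs)))
        (concat_tensors U (map legs (map fst bs)) (map (\<lambda>b. power_class U (legs (fst b)) (single (snd b) 1)) bs))"
    if \<mu>: "free_structure m U \<mu>" and bs: "length bs = k" "set bs \<subseteq> basis m E" for \<mu> bs
  proof -
    have "map ?u (map (\<lambda>b. single b 1) bs) = map2 (\<lambda>T v. free_elem m U (legs T) (single T 1) v)
      (map fst bs) (map (\<lambda>b. power_class U (legs (fst b)) (single (snd b) 1)) bs)"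
      using basis_free_elem(2) bs(2) by (induction bs) auto
    moreover have "bs ! j \<in> basis m E" if "j < k" for j using that bs by auto
    then have "map fst bs ! j \<in> Adm m (legs (map fst bs ! j)) \<and>
      map (\<lambda>b. power_class U (legs (fst b)) (single (snd b) 1)) bs ! j
        \<in> grade (tensor_power U (legs (map fst bs ! j))) (map (\<lambda>b. sum_list (map dg (snd b))) bs ! j)" if "j < k" for j
      using basis_free_elem(1)[of "bs ! j"] that bs(1) by (force simp: basis_def Adm_iff)
    ultimately show ?thesis
      using \<mu>[unfolded free_structure_def, rule_format, OF conjI[OF k], THEN conjunct2, rule_format,
        of "map fst bs" "map (\<lambda>b. power_class U (legs (fst b)) (single (snd b) 1)) bs"
           "map (\<lambda>b. sum_list (map dg (snd b))) bs"] bs(1)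
      by simp
  qed
  have "\<mu>' k (map ?u (map kQ as)) = \<mu> k (map ?u (map kQ as))"
    by (rule multilinear_eqI[OF ml[OF s'] ml[OF s] Q.B.vspace_axioms])
      (use as CQ(4) in \<open>auto simp only: val[OF s] val[OF s'] length_map set_map\<close>)
  moreover have "map ?u (map kQ as) = as" using as(2) UQ(3) by (simp add: map_idI subset_iff)
  ultimately show ?thesis by simp
qed

end


section \<open>The inclusion of generators and the universal property\<close>

context free_algebra
begin

lemma free_incl_coords:
  assumes x: "x \<in> carrier U"
  shows "free_incl m U x \<in> carrier Q"
    "kQ (free_incl m U x) = linext (\<lambda>e. single (Triv, [e]) 1) (\<kappa> x)"
proof -
  have "[x] \<in> tuples U 1" using x by (simp add: tuples_def)
  then have t: "keys (single [x] (1::'k)) \<subseteq> tuples U 1" by simp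
  note p = power_class_coords[OF t]
  have T: "keys (single Triv (1::'k)) \<subseteq> trees m 1" by (simp add: trees_iff)
  note f = free_elem_coords[OF order_refl T p(1)]
  have i: "free_incl m U x = free_elem m U 1 (single Triv 1) (power_class U 1 (single [x] 1))"
    using x by (simp add: free_incl_def)
  show "free_incl m U x \<in> carrier Q" unfolding i by (rule f(1))
  have k: "kP \<kappa> (power_class U 1 (single [x] 1)) = linext (\<lambda>e. single [e] 1) (\<kappa> x)"
    unfolding p(2) by (simp add: tprod_def mex_Cons)
  have "kQ (free_incl m U x) = outer (single Triv 1) (kP \<kappa> (power_class U 1 (single [x] 1)))"
    unfolding i f(2) by simp
  also have "\<dots> = linext (\<lambda>e. single (Triv, [e]) 1) (\<kappa> x)"
    unfolding k outer_single_left linext_linext by simp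
  finally show "kQ (free_incl m U x) = linext (\<lambda>e. single (Triv, [e]) 1) (\<kappa> x)" .
qed

lemma free_incl_gr_hom: "free_incl m U \<in> gr_hom U Q"
proof (rule gr_homI)
  show "lhom U Q (free_incl m U)"
  proof (rule lhomI)
    fix x assume x: "x \<in> carrier U"
    note i = free_incl_coords[OF x]
    show "free_incl m U x \<in> carrier Q" by (rule i(1))
    show "free_incl m U (c \<odot>\<^bsub>U\<^esub> x) = c \<odot>\<^bsub>Q\<^esub> free_incl m U x" for c
      using free_incl_coords[OF CU(7)[OF x, of c]] CQ(7)[OF i(1), of c]
      by (intro CQ(10)) (simp_all add: CQ(8)[OF i(1)] i(2) CU(8)[OF x])
    fix y assume y: "y \<in> carrier U"
    note j = free_incl_coords[OF y]
    show "free_incl m U (x \<oplus>\<^bsub>U\<^esub> y) = free_incl m U x \<oplus>\<^bsub>Q\<^esub> free_incl m U y"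
      using free_incl_coords[OF CU(5)[OF x y]] CQ(5)[OF i(1) j(1)]
      by (intro CQ(10)) (simp_all add: CQ(6)[OF i(1) j(1)] i(2) j(2) CU(6)[OF x y])
  qed
  show "free_incl m U x \<in> grade Q d" if "x \<in> grade U d" for d x
  proof -
    have x: "x \<in> carrier U" "keys (\<kappa> x) \<subseteq> {e \<in> E. dg e = d}" using that by (simp_all add: CU(9))
    have "keys (linext (\<lambda>e. single (Triv, [e]) (1::'k)) (\<kappa> x)) \<subseteq> {b \<in> basis m E. bdeg dg b = d}"
      by (rule keys_linext_subset) (use x(2) in \<open>auto simp: basis_def bdeg_def adm_def\<close>)
    then show ?thesis using free_incl_coords[OF x(1)] by (simp add: CQ(9))
  qed
  show "x \<notin> carrier U \<Longrightarrow> free_incl m U x = undefined" for x by (simp add: free_incl_def)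
qed

lemma Hm_cong:
  assumes "\<And>e. e \<in> E \<Longrightarrow> f e = g e" "keys F \<subseteq> basis m E" and B: "Am_alg m B \<nu>" "\<And>e. e \<in> E \<Longrightarrow> g e \<in> grade B (dg e)"
  shows "Hm B \<nu> dg f F = Hm B \<nu> dg g F"
proof -
  interpret B: Am_alg m B \<nu> by (rule B)
  show ?thesis
    unfolding Hm_def
  proof (rule B.B.lc_cong[OF refl])
    fix b assume "b \<in> keys F"
    then have b: "b \<in> basis m E" using assms(2) by blast
    then have "set (snd b) \<subseteq> E" by (auto simp: basis_def)
    then have "map (\<lambda>e. (f e, dg e)) (snd b) = map (\<lambda>e. (g e, dg e)) (snd b)" using assms(1) by auto
    then show "ev B \<nu> (fst b) (map (\<lambda>e. (f e, dg e)) (snd b)) = ev B \<nu> (fst b) (map (\<lambda>e. (g e, dg e)) (snd b))" by (rule arg_cong)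
    show "ev B \<nu> (fst b) (map (\<lambda>e. (g e, dg e)) (snd b)) \<in> carrier B"
      by (rule B.ev_f_closed[OF m B(2) b])
  qed
qed

text \<open>
  A strict homomorphism is forced on the admissible tree \<open>T\<close> with leaves \<open>es\<close>, because this basis
  element is the evaluation of \<open>T\<close> on the generators \<open>es\<close>.
\<close>

lemma strict_hom_determined:
  assumes B: "Am_alg m B \<nu>" and h: "h \<in> strict_hom m Q op B \<nu>" and q: "q \<in> carrier Q"
  shows "h q = Hm B \<nu> dg (\<lambda>e. h (free_incl m U e)) (kQ q)"
proof -
  interpret B: Am_alg m B \<nu> by (rule B)
  let ?u = "uncoord Q kQ" and ?f = "\<lambda>e. h (free_incl m U e)"
  have hg: "h \<in> gr_hom Q B" using h by (simp add: strict_hom_def)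
  have hs: "h (op k as) = \<nu> k (map h as)" if "1 \<le> k" "enat k \<le> m" "length as = k" "set as \<subseteq> carrier Q" for k as
    using h that unfolding strict_hom_def by blast
  have e: "?f e \<in> grade B (dg e)" if "e \<in> E" for e
  proof -
    have "e \<in> grade U (dg e)" using that E \<kappa>_E by (auto simp: CU(9))
    then show ?thesis by (intro gr_hom_grade[OF hg] gr_hom_grade[OF free_incl_gr_hom])
  qed
  let ?g = "\<lambda>p. h (?u p)"
  have gl: "lhom (freeP m E dg) B ?g" by (rule lhom_comp[OF coords_lhom(2)[OF coords_Q] gr_hom_lhom[OF hg]])
  have gs: "?g (muP dg k ps) = \<nu> k (map ?g ps)"
    if "1 \<le> k" "enat k \<le> m" "length ps = k" "set ps \<subseteq> carrier (freeP m E dg :: ('k, _) gr_module)" for k ps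
  proof -
    have ps: "map kQ (map ?u ps) = ps" "set (map ?u ps) \<subseteq> carrier Q"
      using that(4) UQ(1,2) by (auto simp: subset_iff intro!: map_idI)
    have "?u (muP dg k ps) = op k (map ?u ps)" unfolding op_def ps(1) by (rule refl)
    then show ?thesis using hs[OF that(1,2) _ ps(2)] that(3) by (simp add: o_def)
  qed
  have gen: "?g (single (Triv, [e]) 1) = ?f e" if "e \<in> E" for e
  proof -
    have "kQ (free_incl m U e) = single (Triv, [e]) 1"
      using free_incl_coords(2)[of e] that E \<kappa>_E[OF that] by auto
    then show ?thesis using UQ(3)[OF free_incl_coords(1), of e] that E by auto
  qed
  have "?g (kQ q) = Hm B \<nu> dg ?f (kQ q)"
  proof (rule B.B.vlin_eqI[OF vlin_lhom[OF B.B.vspace_axioms gl] B.vlin_Hm[OF m e] CQ(4)[OF q]])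
    fix b assume "b \<in> keys (kQ q)"
    then have b: "b \<in> basis m E" using CQ(4)[OF q] by blast
    obtain T es where [simp]: "b = (T, es)" by (cases b)
    have T: "valid m T" "adm T" "length es = legs T" "set es \<subseteq> E" using b by (auto simp: basis_def)
    have "single b 1 = (tag es (nf T) :: _ \<Rightarrow>\<^sub>0 'k)" by (simp add: tag_def nf_adm[OF T(1,2)])
    also have "\<dots> = ev (freeP m E dg) (muP dg) T (gens dg es)" by (rule ev_gens[OF m T(1,3), symmetric])
    finally have "?g (single b 1) = ?g (ev (freeP m E dg) (muP dg) T (gens dg es))" by simp
    also have "\<dots> = ev B \<nu> T (map (apfst ?g) (gens dg es))"
    proof (rule ev_strict[OF P.Am_alg_axioms gl gs T(1)])
      show "fst ` set (gens dg es) \<subseteq> carrier (freeP m E dg :: ('k, _) gr_module)"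
        by (rule P.homog_carrier[OF homog_gens[OF P.Am_alg_axioms T(4)]])
    qed (simp_all add: gens_def T(3))
    also have "map (apfst ?g) (gens dg es) = map (\<lambda>e. (?f e, dg e)) es"
      using gen T(4) by (auto simp: gens_def)
    also have "ev B \<nu> T (map (\<lambda>e. (?f e, dg e)) es) = Hm B \<nu> dg ?f (single b 1)"
      using B.Hm_single[OF m e b] by simp
    finally show "?g (single b 1) = Hm B \<nu> dg ?f (single b 1)" .
  qed
  then show ?thesis by (simp add: UQ(3)[OF q])
qed

text \<open>
  The evaluation of decorated trees extends \<open>f\<close> because the generators are the trivial trees, on which the evaluation is
  \<open>f\<close> itself.
\<close>

lemma Hm_strict_hom:
  assumes B: "Am_alg m B \<nu>" and f: "f \<in> gr_hom U B"
  shows "(\<lambda>q\<in>carrier Q. Hm B \<nu> dg f (kQ q)) \<in> strict_hom m Q op B \<nu>"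
    and "compose (carrier U) (\<lambda>q\<in>carrier Q. Hm B \<nu> dg f (kQ q)) (free_incl m U) = f"
proof -
  interpret B: Am_alg m B \<nu> by (rule B)
  let ?h = "\<lambda>q\<in>carrier Q. Hm B \<nu> dg f (kQ q)"
  have e: "f e \<in> grade B (dg e)" if "e \<in> E" for e
  proof -
    have "e \<in> grade U (dg e)" using that E \<kappa>_E by (auto simp: CU(9))
    then show ?thesis by (rule gr_hom_grade[OF f])
  qed
  have l: "lhom Q B (\<lambda>q. Hm B \<nu> dg f (kQ q))"
    by (rule lhom_comp[OF coords_lhom(1)[OF coords_Q] B.lhom_Hm[OF m e]])
  have "lhom Q B ?h"
    by (rule lhomI) (simp_all add: lhomD[OF l] CQ(5,7))
  then have "?h \<in> gr_hom Q B"
  proof (rule gr_homI)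
    fix d x assume "x \<in> grade Q d"
    then have "x \<in> carrier Q" "kQ x \<in> grade (freeP m E dg) d" by (simp_all add: CQ(9))
    then show "?h x \<in> grade B d" using B.Hm_grade[OF m e] by simp
  qed simp
  moreover have "?h (op k as) = \<nu> k (map ?h as)"
    if k: "1 \<le> k" "enat k \<le> m" "length as = k" "set as \<subseteq> carrier Q" for k as
  proof -
    have "?h (op k as) = Hm B \<nu> dg f (muP dg k (map kQ as))"
      using multilinearD(1)[OF Q.ml[OF k(1,2)] k(3,4)] kQ_op[OF k] by simp
    also have "\<dots> = \<nu> k (map (Hm B \<nu> dg f) (map kQ as))"
      by (rule B.Hm_strict[OF m e k(1,2)]) (use k CQ(4) in auto)
    also have "map (Hm B \<nu> dg f) (map kQ as) = map ?h as" using k(4) by auto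
    finally show ?thesis .
  qed
  ultimately show "?h \<in> strict_hom m Q op B \<nu>" by (simp add: strict_hom_def)
  show "compose (carrier U) ?h (free_incl m U) = f"
  proof
    fix x
    show "compose (carrier U) ?h (free_incl m U) x = f x"
    proof (cases "x \<in> carrier U")
      case True
      let ?i = "linext (\<lambda>e. single (Triv, [e]) (1::'k))"
      have "Hm B \<nu> dg f (?i (\<kappa> x)) = f (uncoord U \<kappa> (\<kappa> x))"
      proof (rule B.B.vlin_eqI[OF B.B.vlin_linext[OF B.vlin_Hm[OF m e]] vlin_lhom[OF B.B.vspace_axioms] CU(4)[OF True]])
        show "lhom (free_gr_space dg E) B (\<lambda>F. f (uncoord U \<kappa> F))"
          by (rule lhom_comp[OF coords_lhom(2)[OF coords_U] gr_hom_lhom[OF f]])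
        show "keys (single (Triv, [a]) (1::'k)) \<subseteq> basis m E" if "a \<in> E" for a
          using that by (simp add: basis_def adm_def)
        fix s assume "s \<in> keys (\<kappa> x)"
        then have s: "s \<in> E" using CU(4)[OF True] by blast
        have b: "(Triv, [s]) \<in> basis m E" using s by (simp add: basis_def adm_def)
        show "Hm B \<nu> dg f (?i (single s 1)) = f (uncoord U \<kappa> (single s 1))"
          using B.Hm_single[OF m e b] by (simp add: uncoord_E[OF s])
      qed
      then show ?thesis
        using free_incl_coords[OF True] uncoord(3)[OF coords_U True] True by (simp add: compose_def)
    next
      case False
      then show ?thesis using f by (auto simp: compose_def gr_hom_def PiE_def extensional_def)
    qed
  qed
qed

theorem free_algebra_universal:
  fixes B :: "('k, 'b) gr_module"
  assumes Bm: "Am_algebra m B \<nu>"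
  shows "bij_betw (\<lambda>h. compose (carrier U) h (free_incl m U)) (strict_hom m Q op B \<nu>) (gr_hom U B)"
proof -
  have B: "Am_alg m B \<nu>" by (rule Am_alg.intro[OF Bm])
  let ?c = "\<lambda>h. compose (carrier U) h (free_incl m U)"
  have into: "?c h \<in> gr_hom U B" if "h \<in> strict_hom m Q op B \<nu>" for h
  proof (rule gr_homI)
    have h: "h \<in> gr_hom Q B" using that by (simp add: strict_hom_def)
    have l: "lhom U B (\<lambda>x. h (free_incl m U x))"
      by (rule lhom_comp[OF gr_hom_lhom[OF free_incl_gr_hom] gr_hom_lhom[OF h]])
    show "lhom U B (?c h)"
      by (rule lhomI) (simp_all add: compose_def lhomD[OF l] CU(5,7))
    fix d x assume x: "x \<in> grade U d"
    then have "x \<in> carrier U" by (simp add: CU(9))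
    then show "?c h x \<in> grade B d"
      using gr_hom_grade[OF h gr_hom_grade[OF free_incl_gr_hom x]] by (simp add: compose_def)
  qed (simp add: compose_def)
  have gen_grade: "h (free_incl m U e) \<in> grade B (dg e)" if "h \<in> strict_hom m Q op B \<nu>" "e \<in> E" for h e
  proof -
    have "e \<in> grade U (dg e)" using that E \<kappa>_E by (auto simp: CU(9))
    moreover have "h \<in> gr_hom Q B" using that by (simp add: strict_hom_def)
    ultimately show ?thesis by (intro gr_hom_grade[of h Q B] gr_hom_grade[OF free_incl_gr_hom])
  qed
  have inj: "h = h'" if h: "h \<in> strict_hom m Q op B \<nu>" and h': "h' \<in> strict_hom m Q op B \<nu>" and eq: "?c h = ?c h'" for h h'
  proof
    fix q
    show "h q = h' q"
    proof (cases "q \<in> carrier Q")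
      case True
      have "h (free_incl m U x) = h' (free_incl m U x)" if "x \<in> E" for x
        using fun_cong[OF eq, of x] that E by (auto simp: compose_def)
      then have "Hm B \<nu> dg (\<lambda>e. h (free_incl m U e)) (kQ q) = Hm B \<nu> dg (\<lambda>e. h' (free_incl m U e)) (kQ q)"
        by (rule Hm_cong[OF _ CQ(4)[OF True] B gen_grade[OF h']])
      then show ?thesis
        using strict_hom_determined[OF B h True] strict_hom_determined[OF B h' True] by simp
    next
      case False
      then show ?thesis using h h' by (auto simp: strict_hom_def gr_hom_def PiE_def extensional_def)
    qed
  qed
  show ?thesis
    unfolding bij_betw_def
  proof (intro conjI subset_antisym subsetI)
    show "inj_on ?c (strict_hom m Q op B \<nu>)" by (rule inj_onI) (rule inj)
    show "f \<in> gr_hom U B" if "f \<in> ?c ` strict_hom m Q op B \<nu>" for f using that into by blast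
    show "f \<in> ?c ` strict_hom m Q op B \<nu>" if "f \<in> gr_hom U B" for f
      using Hm_strict_hom[OF B that] by (intro image_eqI[of _ ?c "\<lambda>q\<in>carrier Q. Hm B \<nu> dg f (kQ q)"]) simp_all
  qed
qed

end

section \<open>The free algebra\<close>

theorem theorem2p1:
  fixes m :: enat and U :: "('k::field_char_0, 'x) gr_module"
  assumes "1 \<le> m" and "graded_space U"
  shows "(\<forall>n\<ge>1.
            (\<lambda>w\<in>carrier (span_Adm m n). op_class m n w) \<in>
              gr_hom (span_Adm m n :: ('k, _) gr_module) (opA m n) \<and>
            bij_betw (op_class m n) (carrier (span_Adm m n :: ('k, _) gr_module))
              (carrier (opA m n)))
       \<and> (\<exists>\<mu>. free_structure m U \<mu> \<and>
            (\<forall>\<mu>'. free_structure m U \<mu>' \<longrightarrow>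
               (\<forall>k as. 1 \<le> k \<and> enat k \<le> m \<and> length as = k \<and> set as \<subseteq> carrier (free_Am m U) \<longrightarrow>
                  \<mu>' k as = \<mu> k as)) \<and>
            Am_algebra m (free_Am m U) \<mu> \<and>
            free_incl m U \<in> gr_hom U (free_Am m U) \<and>
            (\<forall>(B :: ('k, 'b) gr_module) \<nu>. Am_algebra m B \<nu> \<longrightarrow>
               bij_betw (\<lambda>h. compose (carrier U) h (free_incl m U))
                 (strict_hom m (free_Am m U) \<mu> B \<nu>) (gr_hom U B)))"
proof -
  \<comment> \<open>The free algebra does not depend on a basis of \<open>U\<close>; a choice is needed to describe it by decorated trees.\<close>
  obtain E dg \<kappa> where b: "coords U E dg \<kappa>" "E \<subseteq> carrier U" "\<And>e. e \<in> E \<Longrightarrow> \<kappa> e = single e 1"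
    using homogeneous_basis[OF assms(2)] by metis
  interpret free_algebra U E dg \<kappa> m
    by unfold_locales (rule b assms(1); assumption?)+
  show ?thesis
  proof (intro conjI allI impI exI[of _ op])
    fix n :: nat
    show "(\<lambda>w\<in>carrier (span_Adm m n). op_class m n w) \<in> gr_hom (span_Adm m n :: ('k, _) gr_module) (opA m n)"
      by (rule Adm_basis(1)[OF assms(1)])
    show "bij_betw (op_class m n) (carrier (span_Adm m n :: ('k, _) gr_module)) (carrier (opA m n))"
      by (rule Adm_basis(2)[OF assms(1)])
  next
    fix \<mu>' k as
    assume "free_structure m U \<mu>'" "1 \<le> k \<and> enat k \<le> m \<and> length as = k \<and> set as \<subseteq> carrier (free_Am m U)"
    then show "\<mu>' k as = op k as" by (intro free_structure_unique[OF free_structure_op]) (elim conjE; assumption)+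
  next
    fix B :: "('k, 'b) gr_module" and \<nu> assume "Am_algebra m B \<nu>"
    then show "bij_betw (\<lambda>h. compose (carrier U) h (free_incl m U)) (strict_hom m (free_Am m U) op B \<nu>) (gr_hom U B)"
      by (rule free_algebra_universal)
  qed (rule free_structure_op Am_algebra_op free_incl_gr_hom)+
qed

end
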